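(* Let $n \geq 2$, let $\mathfrak{g}_\mathbb{R} = \mathfrak{so}(1,n)$, and let $\mathfrak{g} = \mathfrak{so}_{n+1}(\mathbb{C})$ be its complexification, of rank $r = \lfloor \frac{n+1}{2} \rfloor$. Let $\lambda = \sum_{i=1}^r \lambda_i \varepsilon_i \in \mathfrak{h}^*$ be a dominant integral weight of $\mathfrak{g}$, let $V_\lambda$ be the irreducible complex representation of $\mathfrak{g}$ with highest weight $\lambda$, and let $V_\lambda^{\mathfrak{l}}$ be its subspace of $\mathfrak{l}$-invariant vectors, where $\mathfrak{l}$ is the centralizer in $\mathfrak{g}$ of (the complexification of) a Cartan subspace $\mathfrak{a}_\mathbb{R}$ of $\mathfrak{g}_\mathbb{R}$. Let $( * )$ denote the following condition on $\lambda$: - if $n \geq 3$: $\lambda = \lambda_1 \varepsilon_1 + \lambda_2 \varepsilon_2$ for some $\lambda_1, \lambda_2 \in \mathbb{Z}$ with $\lambda_1 + \lambda_2 \equiv 0 \pmod 2$; - if $n = 2$: $\lambda = \lambda_1 \varepsilon_1$ for some $\lambda_1 \in \mathbb{Z}$. Then: (i) $V_\lambda^{\mathfrak{l}} \neq 0$ if and only if $\lambda$ satisfies $( * )$. (ii) If $\lambda$ satisfies $( * )$, then $\dim V_\lambda^{\mathfrak{l}} = 1$. (iii) If $\lambda$ satisfies $( * )$, then the longest element $w_0$ of the restricted Weyl group of $\mathfrak{g}_\mathbb{R}$ acts on $V_\lambda^{\mathfrak{l}}$ by $$w_0|_{V_\lambda^{\mathfrak{l}}} = (-1)^{\lambda_1}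 \operatorname{Id}.$$
   Context: All representations are finite-dimensional and complex. Setting. Let $\mathfrak{g}_\mathbb{R}$ be a semisimple real Lie algebra with complexification $\mathfrak{g}$. A Cartan subspace $\mathfrak{a}_\mathbb{R} \subset \mathfrak{g}_\mathbb{R}$ is an abelian subalgebra whose elements are ($\operatorname{ad}$-)diagonalizable over $\mathbb{R}$ and which is maximal for these properties; $\mathfrak{a}$ is its complexification. Choose a Cartan subalgebra $\mathfrak{h}$ of $\mathfrak{g}$ containing $\mathfrak{a}$. Let $\mathfrak{l}$ be the centralizer of $\mathfrak{a}$ in $\mathfrak{g}$. Identify $\mathfrak{h}^*$ with $\mathfrak{h}$ via the Killing form, and let $\mathfrak{h}_{(\mathbb{R})}$ be the real span of the roots of $\mathfrak{g}$; one has $\mathfrak{h}_{(\mathbb{R})} = \mathfrak{a}_\mathbb{R} \oplus i\mathfrak{t}_\mathbb{R}$, where $\mathfrak{t}_\mathbb{R}$ is the orthogonal complement of $\mathfrak{a}_\mathbb{R}$ in $\mathfrak{h} \cap \mathfrak{g}_\mathbb{R}$. Positive roots are taken with respect to a lexicographical ordering on $\mathfrak{h}_{(\mathbb{R})}$ that puts $\mathfrak{a}_\mathbb{R}$ first, i.e. every vector whose orthogonal projection onto $\mathfrak{a}_\mathbb{R}$ is positive is itself positive. Let $\mathfrak{h}^+ = \{X \in \mathfrak{h}_{(\mathbb{R})} : \alpha(X) \geq 0 \text{ for all simple roots } \alpha\}$ be the dominant Weyl chamber. Dominant integral weights are the elements of the weight lattice lying in $\mathfrak{h}^+$. For a representation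 $V$ of $\mathfrak{g}$, $V^{\mathfrak{l}} = \{v \in V : l \cdot v = 0 \text{ for all } l \in \mathfrak{l}\}$. Restricted Weyl group. For a connected Lie group $G_\mathbb{R}$ with Lie algebra $\mathfrak{g}_\mathbb{R}$, the restricted Weyl group is $W = N_{G_\mathbb{R}}(\mathfrak{a}_\mathbb{R})/Z_{G_\mathbb{R}}(\mathfrak{a}_\mathbb{R})$. It acts on $\mathfrak{a}_\mathbb{R}$ with fundamental domain $\mathfrak{a}^+ = \mathfrak{h}^+ \cap \mathfrak{a}_\mathbb{R}$, and its longest element $w_0$ is the unique element of $W$ with $w_0(\mathfrak{a}^+) = -\mathfrak{a}^+$. The action of $w_0$ on $V^{\mathfrak{l}}$ is the action of any representative of $w_0$ in $N_{G_\mathbb{R}}(\mathfrak{a}_\mathbb{R})$, where $G_\mathbb{R}$ is a connected Lie group with Lie algebra $\mathfrak{g}_\mathbb{R}$ to which the representation $V$ integrates (e.g. the simply connected one). It is a known fact that this action on $V^{\mathfrak{l}}$ is well-defined and depends only on $\mathfrak{g}_\mathbb{R}$ (not on the choice of $G_\mathbb{R}$ or of the representative). Coordinates for $\mathfrak{g} = \mathfrak{so}_{n+1}(\mathbb{C})$. The basis $(\varepsilon_1, \ldots, \varepsilon_r)$ of $\mathfrak{h}_{(\mathbb{R})}^*$ is the Bourbaki one: - if $n = 2r$ is even (type $B_r$, $r \geq 1$), the simple roots are $\varepsilon_i - \varepsilon_{i+1}$ for $1 \leq i \leq r-1$, together with $\varepsilon_r$; - if $n = 2r-1$ is odd (type $D_r$,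 $r \geq 2$; for $r = 2$ this is the non-simple algebra $\mathfrak{so}_4(\mathbb{C})$), the simple roots are $\varepsilon_i - \varepsilon_{i+1}$ for $1 \leq i \leq r-1$, together with $\varepsilon_{r-1} + \varepsilon_r$. *)

theory Defs
  imports "HOL-Analysis.Analysis" "HOL-Number_Theory.Cong"
begin

section \<open>Complex Lie algebras of matrices\<close>

text \<open>The operation \<open>*s\<close> of HOL-Analysis on \<open>complex^'m^'m\<close> expects a row as its scalar, so scalar
  multiplication of matrices is introduced here. Complex-linear notions on matrices carry the prefix
  \<open>cmat\<close>; unprefixed \<open>subspace\<close>, \<open>span\<close> and \<open>independent\<close> are the real-linear ones.\<close>

definition cscale :: "complex \<Rightarrow> complex^'k^'m \<Rightarrow> complex^'k^'m" where
  "cscale c X = (\<chi> i j. c * X $ i $ j)"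

interpretation cmat: vector_space "cscale :: complex \<Rightarrow> complex^'k^'m \<Rightarrow> complex^'k^'m"
  by unfold_locales (simp_all add: cscale_def vec_eq_iff algebra_simps)

definition bracket :: "complex^'m^'m \<Rightarrow> complex^'m^'m \<Rightarrow> complex^'m^'m" where
  "bracket X Y = X ** Y - Y ** X"

text \<open>Trace of a complex-linear endomorphism of a complex subspace \<open>W\<close> (independent of the chosen basis).\<close>

definition trace_on :: "(complex^'m^'m) set \<Rightarrow> (complex^'m^'m \<Rightarrow> complex^'m^'m) \<Rightarrow> complex" where
  "trace_on W T =
     (let B = (SOME B. cmat.independent B \<and> cmat.span B = W)
      in \<Sum>b\<in>B. cmat.representation B (T b) b)"

definition killing :: "(complex^'m^'m) set \<Rightarrow> complex^'m^'m \<Rightarrow> complex^'m^'m \<Rightarrow> complex" where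
  "killing g X Y = trace_on g (\<lambda>Z. bracket X (bracket Y Z))"

definition real_ad_diagonalizable :: "(complex^'m^'m) set \<Rightarrow> complex^'m^'m \<Rightarrow> bool" where
  "real_ad_diagonalizable gR X \<longleftrightarrow> span {Y \<in> gR. \<exists>c::real. bracket X Y = c *\<^sub>R Y} = gR"

definition complex_ad_diagonalizable :: "(complex^'m^'m) set \<Rightarrow> complex^'m^'m \<Rightarrow> bool" where
  "complex_ad_diagonalizable g X \<longleftrightarrow> cmat.span {Y \<in> g. \<exists>c. bracket X Y = cscale c Y} = g"

definition split_abelian_subalgebra :: "(complex^'m^'m) set \<Rightarrow> (complex^'m^'m) set \<Rightarrow> bool" where
  "split_abelian_subalgebra gR A \<longleftrightarrow>
     subspace A \<and> A \<subseteq> gR \<and> (\<forall>X\<in>A. \<forall>Y\<in>A. bracket X Y = 0) \<and>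
     (\<forall>X\<in>A. real_ad_diagonalizable gR X)"

definition cartan_subspace :: "(complex^'m^'m) set \<Rightarrow> (complex^'m^'m) set \<Rightarrow> bool" where
  "cartan_subspace gR A \<longleftrightarrow>
     split_abelian_subalgebra gR A \<and>
     (\<forall>A'. split_abelian_subalgebra gR A' \<and> A \<subseteq> A' \<longrightarrow> A' = A)"

definition toral_subalgebra :: "(complex^'m^'m) set \<Rightarrow> (complex^'m^'m) set \<Rightarrow> bool" where
  "toral_subalgebra g H \<longleftrightarrow>
     cmat.subspace H \<and> H \<subseteq> g \<and> (\<forall>X\<in>H. \<forall>Y\<in>H. bracket X Y = 0) \<and>
     (\<forall>X\<in>H. complex_ad_diagonalizable g X)"

text \<open>For a semisimple \<open>g\<close>, the Cartan subalgebras are the maximal toral subalgebras.\<close>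

definition cartan_subalgebra :: "(complex^'m^'m) set \<Rightarrow> (complex^'m^'m) set \<Rightarrow> bool" where
  "cartan_subalgebra g H \<longleftrightarrow>
     toral_subalgebra g H \<and> (\<forall>H'. toral_subalgebra g H' \<and> H \<subseteq> H' \<longrightarrow> H' = H)"

definition centralizer_in :: "(complex^'m^'m) set \<Rightarrow> (complex^'m^'m) set \<Rightarrow> (complex^'m^'m) set" where
  "centralizer_in g S = {X \<in> g. \<forall>Y\<in>S. bracket X Y = 0}"


section \<open>Roots and weights\<close>

text \<open>The dual of \<open>H\<close> is identified with \<open>H\<close> through the Killing form throughout: a root or weight is
  an element \<open>a\<close> of \<open>H\<close>, standing for the functional \<open>\<lambda>X. killing g a X\<close> on \<open>H\<close>.\<close>

definition root_space ::
    "(complex^'m^'m) set \<Rightarrow> (complex^'m^'m) set \<Rightarrow> complex^'m^'m \<Rightarrow> (complex^'m^'m) set" where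
  "root_space g H a = {Y \<in> g. \<forall>X\<in>H. bracket X Y = cscale (killing g a X) Y}"

definition roots :: "(complex^'m^'m) set \<Rightarrow> (complex^'m^'m) set \<Rightarrow> (complex^'m^'m) set" where
  "roots g H = {a \<in> H. a \<noteq> 0 \<and> root_space g H a \<noteq> {0}}"

definition real_cartan :: "(complex^'m^'m) set \<Rightarrow> (complex^'m^'m) set \<Rightarrow> (complex^'m^'m) set" where
  "real_cartan g H = span (roots g H)"

definition lex_pos :: "(complex^'m^'m) list \<Rightarrow> complex^'m^'m \<Rightarrow> bool" where
  "lex_pos es X \<longleftrightarrow>
     (\<exists>c::nat \<Rightarrow> real. X = (\<Sum>i<length es. c i *\<^sub>R es ! i) \<and>
        (\<exists>k<length es. c k > 0 \<and> (\<forall>j<k. c j = 0)))"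

text \<open>The list \<open>es\<close> is a basis of \<open>real_cartan g H\<close> whose lexicographical ordering puts the Cartan
  subspace \<open>A\<close> first; below, \<open>P\<close> is the orthogonal projection of \<open>X\<close> onto \<open>A\<close>.\<close>

definition lex_order_first ::
    "(complex^'m^'m) set \<Rightarrow> (complex^'m^'m) set \<Rightarrow> (complex^'m^'m) set \<Rightarrow> (complex^'m^'m) list \<Rightarrow> bool" where
  "lex_order_first g H A es \<longleftrightarrow>
     distinct es \<and> independent (set es) \<and> span (set es) = real_cartan g H \<and>
     (\<forall>X\<in>real_cartan g H. \<forall>P\<in>A.
        (\<forall>Y\<in>A. killing g (X - P) Y = 0) \<and> lex_pos es P \<longrightarrow> lex_pos es X)"

definition positive_roots ::
    "(complex^'m^'m) set \<Rightarrow> (complex^'m^'m) set \<Rightarrow> (complex^'m^'m) list \<Rightarrow> (complex^'m^'m) set" where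
  "positive_roots g H es = {a \<in> roots g H. lex_pos es a}"

definition simple_roots ::
    "(complex^'m^'m) set \<Rightarrow> (complex^'m^'m) set \<Rightarrow> (complex^'m^'m) list \<Rightarrow> (complex^'m^'m) set" where
  "simple_roots g H es =
     {a \<in> positive_roots g H es.
        \<not> (\<exists>b\<in>positive_roots g H es. \<exists>c\<in>positive_roots g H es. a = b + c)}"

text \<open>The Killing form is real-valued on \<open>real_cartan g H\<close>, so \<open>Re\<close> loses nothing.\<close>

definition dominant_chamber ::
    "(complex^'m^'m) set \<Rightarrow> (complex^'m^'m) set \<Rightarrow> (complex^'m^'m) list \<Rightarrow> (complex^'m^'m) set" where
  "dominant_chamber g H es =
     {X \<in> real_cartan g H. \<forall>a\<in>simple_roots g H es. Re (killing g a X) \<ge> 0}"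

definition weight_lattice :: "(complex^'m^'m) set \<Rightarrow> (complex^'m^'m) set \<Rightarrow> (complex^'m^'m) set" where
  "weight_lattice g H =
     {m \<in> real_cartan g H. \<forall>a\<in>roots g H. 2 * killing g m a / killing g a a \<in> \<int>}"


section \<open>Representations on \<open>complex^'d\<close>\<close>

definition representation_of ::
    "(complex^'m^'m) set \<Rightarrow> (complex^'m^'m \<Rightarrow> complex^'d^'d) \<Rightarrow> bool" where
  "representation_of g \<rho> \<longleftrightarrow>
     (\<forall>X\<in>g. \<forall>Y\<in>g. \<rho> (X + Y) = \<rho> X + \<rho> Y) \<and>
     (\<forall>X\<in>g. \<forall>c. \<rho> (cscale c X) = cscale c (\<rho> X)) \<and>
     (\<forall>X\<in>g. \<forall>Y\<in>g. \<rho> (bracket X Y) = bracket (\<rho> X) (\<rho> Y))"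

definition irreducible_representation ::
    "(complex^'m^'m) set \<Rightarrow> (complex^'m^'m \<Rightarrow> complex^'d^'d) \<Rightarrow> bool" where
  "irreducible_representation g \<rho> \<longleftrightarrow>
     representation_of g \<rho> \<and>
     (\<forall>U. vec.subspace U \<and> (\<forall>X\<in>g. \<forall>u\<in>U. \<rho> X *v u \<in> U) \<longrightarrow> U = {0} \<or> U = UNIV)"

definition has_highest_weight ::
    "(complex^'m^'m) set \<Rightarrow> (complex^'m^'m) set \<Rightarrow> (complex^'m^'m) list \<Rightarrow>
     (complex^'m^'m \<Rightarrow> complex^'d^'d) \<Rightarrow> complex^'m^'m \<Rightarrow> bool" where
  "has_highest_weight g H es \<rho> lam \<longleftrightarrow>
     (\<exists>v. v \<noteq> 0 \<and> (\<forall>X\<in>H. \<rho> X *v v = killing g lam X *s v) \<and>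
          (\<forall>a\<in>positive_roots g H es. \<forall>Y\<in>root_space g H a. \<rho> Y *v v = 0))"

definition invariants ::
    "(complex^'m^'m) set \<Rightarrow> (complex^'m^'m \<Rightarrow> complex^'d^'d) \<Rightarrow> (complex^'d) set" where
  "invariants l \<rho> = {v. \<forall>X\<in>l. \<rho> X *v v = 0}"


section \<open>The restricted Weyl group and its longest element\<close>

definition mexp :: "complex^'m^'m \<Rightarrow> complex^'m^'m" where
  "mexp X = (\<Sum>k. (1 / fact k) *\<^sub>R (((**) X ^^ k) (mat 1)))"

text \<open>A connected Lie group with Lie algebra \<open>gR\<close> to which \<open>\<rho>\<close> integrates: the subgroup of
  \<open>GL \<times> GL(V)\<close> generated by the one-parameter groups of the graph of \<open>\<rho>\<close> on \<open>gR\<close>. The first component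
  gives the adjoint action (by conjugation), the second one the action on \<open>V\<close>. For any other
  connected Lie group to which \<open>\<rho>\<close> integrates, the pairs (adjoint action, action on \<open>V\<close>) of its elements
  are the same, since it too is generated by the exponentials of elements of \<open>gR\<close>.\<close>

inductive_set lie_group ::
    "(complex^'m^'m) set \<Rightarrow> (complex^'m^'m \<Rightarrow> complex^'d^'d) \<Rightarrow> ((complex^'m^'m) \<times> (complex^'d^'d)) set"
  for gR \<rho> where
    one: "(mat 1, mat 1) \<in> lie_group gR \<rho>"
  | mult_exp: "(a, b) \<in> lie_group gR \<rho> \<Longrightarrow> X \<in> gR \<Longrightarrow> (a ** mexp X, b ** mexp (\<rho> X)) \<in> lie_group gR \<rho>"

definition gmult ::
    "(complex^'m^'m) \<times> (complex^'d^'d) \<Rightarrow> (complex^'m^'m) \<times> (complex^'d^'d) \<Rightarrow> (complex^'m^'m) \<times> (complex^'d^'d)" where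
  "gmult x y = (fst x ** fst y, snd x ** snd y)"

definition Ad :: "(complex^'m^'m) \<times> (complex^'d^'d) \<Rightarrow> complex^'m^'m \<Rightarrow> complex^'m^'m" where
  "Ad x X = fst x ** X ** matrix_inv (fst x)"

definition group_normalizer ::
    "(complex^'m^'m) set \<Rightarrow> (complex^'m^'m \<Rightarrow> complex^'d^'d) \<Rightarrow> (complex^'m^'m) set \<Rightarrow>
     ((complex^'m^'m) \<times> (complex^'d^'d)) set" where
  "group_normalizer gR \<rho> A = {x \<in> lie_group gR \<rho>. Ad x ` A = A}"

definition group_centralizer ::
    "(complex^'m^'m) set \<Rightarrow> (complex^'m^'m \<Rightarrow> complex^'d^'d) \<Rightarrow> (complex^'m^'m) set \<Rightarrow>
     ((complex^'m^'m) \<times> (complex^'d^'d)) set" where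
  "group_centralizer gR \<rho> A = {x \<in> lie_group gR \<rho>. \<forall>X\<in>A. Ad x X = X}"

text \<open>Elements are cosets, i.e. sets of representatives.\<close>

definition restricted_weyl_group ::
    "(complex^'m^'m) set \<Rightarrow> (complex^'m^'m \<Rightarrow> complex^'d^'d) \<Rightarrow> (complex^'m^'m) set \<Rightarrow>
     ((complex^'m^'m) \<times> (complex^'d^'d)) set set" where
  "restricted_weyl_group gR \<rho> A =
     (\<lambda>x. gmult x ` group_centralizer gR \<rho> A) ` group_normalizer gR \<rho> A"

definition longest_element ::
    "(complex^'m^'m) set \<Rightarrow> (complex^'m^'m \<Rightarrow> complex^'d^'d) \<Rightarrow> (complex^'m^'m) set \<Rightarrow>
     (complex^'m^'m) set \<Rightarrow> ((complex^'m^'m) \<times> (complex^'d^'d)) set" where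
  "longest_element gR \<rho> A Aplus =
     (THE w. w \<in> restricted_weyl_group gR \<rho> A \<and> (\<forall>x\<in>w. Ad x ` Aplus = uminus ` Aplus))"


section \<open>The algebras \<open>so(1,n)\<close>\<close>

text \<open>The index type \<open>'n option\<close> has \<open>CARD('n) + 1\<close> elements; \<open>None\<close> is the index of the single
  positive square.\<close>

definition lorentz :: "complex^('n::finite option)^('n option)" where
  "lorentz = (\<chi> i j. if i = j then (if i = None then 1 else -1) else 0)"

text \<open>The complexification of \<open>so(1,n)\<close>: the complex orthogonal algebra of the form \<open>lorentz\<close>.\<close>

definition so1n_complex :: "(complex^('n::finite option)^('n option)) set" where
  "so1n_complex = {X. transpose X ** lorentz + lorentz ** X = 0}"

definition so1n :: "(complex^('n::finite option)^('n option)) set" where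
  "so1n = {X \<in> so1n_complex. \<forall>i j. X $ i $ j \<in> \<real>}"

text \<open>In Bourbaki, the \<open>\<epsilon>\<^sub>i\<close> are weights of the defining representation on \<open>complex^('n option)\<close>. For
  \<open>D\<^sub>4\<close> this cannot be omitted: triality yields further bases for which the simple roots have the
  prescribed form.\<close>

definition bourbaki_basis ::
    "(complex^('n::finite option)^('n option)) set \<Rightarrow> (complex^('n option)^('n option)) list \<Rightarrow>
     (nat \<Rightarrow> complex^('n option)^('n option)) \<Rightarrow> bool" where
  "bourbaki_basis H es \<epsilon> \<longleftrightarrow>
     (let n = CARD('n); r = (n + 1) div 2 in
        inj_on \<epsilon> {1..r} \<and> independent (\<epsilon> ` {1..r}) \<and> span (\<epsilon> ` {1..r}) = real_cartan so1n_complex H \<and>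
        (\<forall>i\<in>{1..r}. \<exists>v. v \<noteq> 0 \<and> (\<forall>X\<in>H. X *v v = killing so1n_complex (\<epsilon> i) X *s v)) \<and>
        simple_roots so1n_complex H es =
          (\<lambda>i. \<epsilon> i - \<epsilon> (i + 1)) ` {1..<r} \<union> {if even n then \<epsilon> r else \<epsilon> (r - 1) + \<epsilon> r})"

definition star_condition ::
    "nat \<Rightarrow> (nat \<Rightarrow> complex^'m^'m) \<Rightarrow> complex^'m^'m \<Rightarrow> int \<Rightarrow> int \<Rightarrow> bool" where
  "star_condition n \<epsilon> lam l1 l2 \<longleftrightarrow>
     (if n \<ge> 3 then lam = of_int l1 *\<^sub>R \<epsilon> 1 + of_int l2 *\<^sub>R \<epsilon> 2 \<and> [l1 + l2 = 0] (mod 2)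
      else lam = of_int l1 *\<^sub>R \<epsilon> 1)"

end

theory Submission
  imports Defs "HOL-Library.Function_Algebras"
begin

text \<open>Choose weight vectors \<open>v\<^sub>k\<close> of the defining representation \<open>E = \<complex>\<^sup>n\<^sup>+\<^sup>1\<close> such that \<open>v\<^sub>k\<close> and \<open>v\<^sub>-\<^sub>k\<close> are
  dual to each other. The lexicographical ordering forces \<open>A = \<real> h\<^sub>1\<close>, so that \<open>\<ll>\<close> is the stabilizer of
  the two lines spanned by \<open>v\<^sub>1\<close> and \<open>v\<^sub>-\<^sub>1\<close>. Let \<open>\<Phi>\<close> be the coefficient of the highest weight vector, moved
  by the exponential of a nilpotent element that sends \<open>v\<^sub>-\<^sub>1\<close> out of these lines. It is an eigenvector of a
  Borel subalgebra \<open>\<bb>\<close> with \<open>\<gg> = \<bb> + \<ll>\<close>, so if \<open>\<Phi>\<close> vanishes at an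
  \<open>\<ll>\<close>-invariant vector \<open>u\<close>, it vanishes on \<open>U(\<bb>) u = U(\<gg>) u\<close>, hence \<open>u = 0\<close>. This bounds the dimension by
  one. Applying powers of the root vectors of weight \<open>\<epsilon>\<^sub>1 \<plusminus> \<epsilon>\<^sub>2\<close> to \<open>u\<close> gives a recursion that must terminate, which shows that
  \<open>\<lambda>\<^sub>1 \<plusminus> \<lambda>\<^sub>2\<close> are even natural numbers.

  Conversely, for \<open>\<lambda> = (2a + b, b)\<close> the representation is generated inside a tensor power of \<open>E\<close> by
  \<open>v\<^sub>1\<^sup>2\<^sup>a (v\<^sub>1 \<and> v\<^sub>2)\<^sup>b\<close>, and the orthogonal projection to it of the invariant tensor
  \<open>(v\<^sub>1 v\<^sub>-\<^sub>1)\<^sup>a (v\<^sub>1 \<and> v\<^sub>-\<^sub>1)\<^sup>b\<close> is not zero. A representative of the longest element maps \<open>v\<^sub>1\<close> to \<open>\<alpha> v\<^sub>-\<^sub>1\<close> and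
  \<open>v\<^sub>-\<^sub>1\<close> to \<open>\<alpha>\<^sup>-\<^sup>1 v\<^sub>1\<close>, and therefore multiplies this tensor by \<open>(-1)\<^sup>b\<close>.\<close>


section \<open>Eigenvectors\<close>

text \<open>The lowering Borel subalgebra shares its Cartan subalgebra with \<open>levi\<close>, and
  the two span only a parabolic subalgebra. Moving the functional by \<open>exp N\<close> puts it in
  general position: \<open>levi\<close> is so(2) + so(n - 1), a symmetric subalgebra whose group has
  an open orbit on the flag variety, and \<open>so_sum_space\<close> is the infinitesimal form of
  this.

  No structure theory of semisimple algebras enters. The eigenvalues of the single element
  \<open>D\<close> stand in for weight spaces, conjugate transposition in the weight basis for
  complete reducibility, and a submodule generated by a pair of highest weight vectors, shown to be
  a graph, for the uniqueness of the irreducible module of given highest weight.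

  The Killing form is the other obstacle. Roots and the \<epsilon>_i are given through it, but its
  values on \<open>H\<close> can be computed only in a weight basis, such a basis comes from an
  element of \<open>H\<close> with distinct eigenvalues, and finding that element needs
  nondegeneracy on \<open>H\<close>. So nondegeneracy is drawn first from the ordering and the
  simple roots (\<open>kil_nondegenerate\<close>).\<close>

context vector_space
begin

text \<open>The factors \<open>T - c\<close> commute, so the factors that kill two vectors, taken
  together, kill every combination of them. With no dimension assumed, such a product replaces a
  minimal polynomial.\<close>

lemma span_eigenvectors_annihilated:
  assumes add: "\<And>x y. T (x + y) = T x + T y" and sc: "\<And>c x. T (scale c x) = scale c (T x)"
    and x: "x \<in> span {y. \<exists>c\<in>L. T y = scale c y}"
  shows "\<exists>cs. set cs \<subseteq> L \<and> foldr (\<lambda>c y. T y - scale c y) cs x = 0"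
proof -
  let ?f = "\<lambda>c y. T y - scale c y"
  have Tdiff: "T (x - y) = T x - T y" for x y
    using add[of "x - y" y] by (simp add: algebra_simps)
  have fadd: "foldr ?f cs (x + y) = foldr ?f cs x + foldr ?f cs y" for cs x y
    by (induction cs) (simp_all add: add algebra_simps)
  have fsc: "foldr ?f cs (scale c x) = scale c (foldr ?f cs x)" for cs c x
    by (induction cs) (simp_all add: sc algebra_simps)
  have f0: "foldr ?f cs 0 = 0" for cs
    using fsc[of cs 0 0] by simp
  have comm1: "?f c (?f d y) = ?f d (?f c y)" for c d y
    by (simp add: Tdiff sc algebra_simps)
  have comm2: "foldr ?f cs (?f d y) = ?f d (foldr ?f cs y)" for cs d y
  proof (induction cs)
    case (Cons c cs)
    have "foldr ?f (c # cs) (?f d y) = ?f c (foldr ?f cs (?f d y))" by simp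
    also have "\<dots> = ?f c (?f d (foldr ?f cs y))" using Cons by simp
    also have "\<dots> = ?f d (?f c (foldr ?f cs y))" by (rule comm1)
    finally show ?case by simp
  qed simp
  have comm: "foldr ?f cs (foldr ?f ds y) = foldr ?f ds (foldr ?f cs y)" for cs ds y
  proof (induction ds)
    case (Cons d ds)
    have "foldr ?f cs (foldr ?f (d # ds) y) = foldr ?f cs (?f d (foldr ?f ds y))" by simp
    also have "\<dots> = ?f d (foldr ?f cs (foldr ?f ds y))" by (rule comm2)
    also have "\<dots> = foldr ?f (d # ds) (foldr ?f cs y)" using Cons by simp
    finally show ?case .
  qed simp
  show ?thesis
    using x
  proof (induction rule: span_induct_alt)
    case base
    show ?case by (rule exI[of _ "[]"]) simp
  next
    case (step c x y)
    then obtain e cs where e: "e \<in> L" "T x = scale e x" and cs: "set cs \<subseteq> L" "foldr ?f cs y = 0"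
      by blast
    have "foldr ?f (cs @ [e]) (scale c x) = 0"
      using e by (simp add: sc f0 mult.commute)
    moreover have "foldr ?f (cs @ [e]) y = 0"
      using comm[of "[e]" cs y] cs f0[of "[e]"] by simp
    ultimately have "foldr ?f (cs @ [e]) (scale c x + y) = 0"
      by (simp only: fadd) simp
    then show ?case using e cs by (intro exI[of _ "cs @ [e]"]) auto
  qed
qed

text \<open>On an eigenvector for \<open>d\<close> the annihilating product acts as the product of
  the numbers \<open>d - c\<close>, which is not zero. This one fact serves the grading by
  \<open>D\<close>, the independence of the weight vectors and the reality of eigenvalues in the
  real form.\<close>

lemma eigenvector_in_span_eigenvectors:
  assumes add: "\<And>x y. T (x + y) = T x + T y" and sc: "\<And>c x. T (scale c x) = scale c (T x)"
    and x: "x \<in> span {y. \<exists>c\<in>L. T y = scale c y}" and d: "T x = scale d x" "d \<notin> L"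
  shows "x = 0"
proof -
  obtain cs where cs: "set cs \<subseteq> L" "foldr (\<lambda>c y. T y - scale c y) cs x = 0"
    using span_eigenvectors_annihilated[OF add sc x] by blast
  have "foldr (\<lambda>c y. T y - scale c y) cs x = scale (\<Prod>c\<leftarrow>cs. d - c) x"
    by (induction cs) (simp_all add: sc d left_diff_distrib scale_left_diff_distrib mult.commute)
  moreover have "(\<Prod>c\<leftarrow>cs. d - c) \<noteq> 0"
    using cs(1) d(2) by (induction cs) auto
  ultimately show ?thesis using cs(2) by simp
qed

end


section \<open>Matrices\<close>

lemma cscale_mult_vec [simp]: "cscale c X *v x = c *s (X *v x)"
  by (simp add: vec_eq_iff cscale_def matrix_vector_mult_def sum_distrib_left mult.assoc)

lemma scaleR_cscale: "c *\<^sub>R X = cscale (complex_of_real c) X"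
  unfolding cscale_def by (simp add: vec_eq_iff) (simp add: scaleR_conv_of_real)

lemma scaleR_vec_complex: "c *\<^sub>R (x :: complex^'m) = complex_of_real c *s x"
  by (simp add: vec_eq_iff) (simp add: scaleR_conv_of_real)

lemma bracket_mult_vec: "bracket X Y *v x = X *v (Y *v x) - Y *v (X *v x)"
  by (simp add: bracket_def matrix_vector_mult_diff_rdistrib matrix_vector_mul_assoc)

lemma matrix_vector_mult_uminus_left [simp]: "(- A) *v x = - (A *v (x :: complex^'m))"
  by (simp add: vec_eq_iff matrix_vector_mult_def sum_negf)

lemma matrix_vector_mult_uminus_right [simp]: "A *v (- x) = - (A *v (x :: complex^'m))"
  by (simp add: vec_eq_iff matrix_vector_mult_def sum_negf)

lemma sum_matrix_vector_mult: "(\<Sum>k\<in>K. f k) *v x = (\<Sum>k\<in>K. f k *v (x :: complex^'m))"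
  by (induction K rule: infinite_finite_induct) (simp_all add: matrix_vector_mult_add_rdistrib)

lemmas mv_simps = matrix_vector_mult_add_rdistrib matrix_vector_mult_diff_rdistrib
  matrix_vector_right_distrib matrix_vector_mult_diff_distrib matrix_vector_mult_0_right
  bracket_mult_vec vector_scalar_commute

lemma bracket_add_left: "bracket (X + Y) Z = bracket X Z + bracket Y Z"
  and bracket_add_right: "bracket Z (X + Y) = bracket Z X + bracket Z Y"
  and bracket_diff_left: "bracket (X - Y) Z = bracket X Z - bracket Y Z"
  and bracket_diff_right: "bracket Z (X - Y) = bracket Z X - bracket Z Y"
  and bracket_cscale_left: "bracket (cscale c X) Z = cscale c (bracket X Z)"
  and bracket_cscale_right: "bracket Z (cscale c X) = cscale c (bracket Z X)"
  and bracket_anticommute: "bracket X Z = - bracket Z X"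
  by (simp_all add: matrix_eq mv_simps algebra_simps)

lemma bracket_zero [simp]: "bracket 0 X = 0" "bracket X 0 = 0" "bracket X X = 0"
  by (simp_all add: matrix_eq mv_simps)


section \<open>The matrix exponential\<close>

definition mpow :: "complex^'m^'m \<Rightarrow> nat \<Rightarrow> complex^'m^'m" where
  "mpow X n = ((**) X ^^ n) (mat 1)"

lemma mpow_0 [simp]: "mpow X 0 = mat 1"
  and mpow_Suc: "mpow X (Suc n) = X ** mpow X n"
  by (simp_all add: mpow_def)

lemma mpow_Suc2: "mpow X (Suc n) = mpow X n ** X"
  by (induction n) (simp_all add: mpow_Suc, metis matrix_mul_assoc)

lemma mpow_add: "mpow X (m + n) = mpow X m ** mpow X n"
  by (induction m) (simp_all add: mpow_Suc matrix_mul_assoc)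

lemma mpow_uminus: "mpow (- X) n *v x = (-1) ^ n *s (mpow X n *v x)"
proof (induction n arbitrary: x)
  case (Suc n)
  then show ?case
    by (simp add: mpow_Suc matrix_vector_mul_assoc[symmetric] vector_scalar_commute)
qed simp

text \<open>Factorials stay outside the sequence, so that a product of two exponential series
  becomes a binomial convolution, the shape in which the Leibniz rule for tensors arrives.\<close>

definition exp_summable :: "(nat \<Rightarrow> complex) \<Rightarrow> bool" where
  "exp_summable f \<longleftrightarrow> summable (\<lambda>n. norm (f n / fact n))"

definition exp_sum :: "(nat \<Rightarrow> complex) \<Rightarrow> complex" where
  "exp_sum f = (\<Sum>n. f n / fact n)"

lemma exp_summable_sums: "exp_summable f \<Longrightarrow> (\<lambda>n. f n / fact n) sums exp_sum f"
  unfolding exp_summable_def exp_sum_def by (rule summable_sums[OF summable_norm_cancel])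

lemma exp_summable_sum:
  assumes "\<And>k. k \<in> K \<Longrightarrow> exp_summable (f k)"
  shows "exp_summable (\<lambda>n. \<Sum>k\<in>K. f k n)" "exp_sum (\<lambda>n. \<Sum>k\<in>K. f k n) = (\<Sum>k\<in>K. exp_sum (f k))"
proof -
  have "summable (\<lambda>n. \<Sum>k\<in>K. norm (f k n / fact n))"
    using assms unfolding exp_summable_def by (rule summable_sum)
  then show 1: "exp_summable (\<lambda>n. \<Sum>k\<in>K. f k n)"
    unfolding exp_summable_def
    by (rule summable_comparison_test[rotated])
      (auto simp: sum_divide_distrib simp del: norm_divide intro!: exI[of _ 0] norm_sum)
  have "(\<lambda>n. \<Sum>k\<in>K. f k n / fact n) sums (\<Sum>k\<in>K. exp_sum (f k))"
    by (intro sums_sum exp_summable_sums assms)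
  then show "exp_sum (\<lambda>n. \<Sum>k\<in>K. f k n) = (\<Sum>k\<in>K. exp_sum (f k))"
    unfolding exp_sum_def by (simp add: sum_divide_distrib sums_iff)
qed

lemma exp_summable_Cauchy:
  assumes a: "exp_summable a" and b: "exp_summable b"
  shows "exp_summable (\<lambda>n. \<Sum>i\<le>n. of_nat (n choose i) * (a i * b (n - i)))"
    and "exp_sum (\<lambda>n. \<Sum>i\<le>n. of_nat (n choose i) * (a i * b (n - i))) = exp_sum a * exp_sum b"
proof -
  have eq: "(\<Sum>i\<le>n. of_nat (n choose i) * (a i * b (n - i))) / fact n =
      (\<Sum>i\<le>n. a i / fact i * (b (n - i) / fact (n - i)))" for n
    by (auto simp: sum_divide_distrib binomial_fact intro!: sum.cong)
  have "summable (\<lambda>n. \<Sum>i\<le>n. norm (a i / fact i) * norm (b (n - i) / fact (n - i)))"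
    using a b unfolding exp_summable_def by (intro summable_Cauchy_product) simp_all
  then show "exp_summable (\<lambda>n. \<Sum>i\<le>n. of_nat (n choose i) * (a i * b (n - i)))"
    unfolding exp_summable_def eq
    by (rule summable_comparison_test[rotated])
      (auto intro!: exI[of _ 0] sum_norm_le simp: norm_mult norm_divide)
  show "exp_sum (\<lambda>n. \<Sum>i\<le>n. of_nat (n choose i) * (a i * b (n - i))) = exp_sum a * exp_sum b"
    unfolding exp_sum_def eq using a b unfolding exp_summable_def by (rule Cauchy_product[symmetric])
qed

lemma exp_summable_mpow: "exp_summable (\<lambda>n. mpow X n $ i $ j)"
proof -
  \<comment> \<open>The sum of all entry norms bounds every row sum, hence the entries of X^n by its
    n-th power.\<close>
  define c where "c = (\<Sum>i\<in>UNIV. \<Sum>j\<in>UNIV. norm (X $ i $ j))"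
  have row: "(\<Sum>k\<in>UNIV. norm (X $ i $ k)) \<le> c" for i
    unfolding c_def by (rule member_le_sum) (auto intro: sum_nonneg)
  have c0: "c \<ge> 0" unfolding c_def by (intro sum_nonneg) auto
  have bound: "norm (mpow X n $ i $ j) \<le> c ^ n" for n i j
  proof (induction n arbitrary: i j)
    case 0
    then show ?case by (simp add: mat_def)
  next
    case (Suc n)
    have "norm (mpow X (Suc n) $ i $ j) \<le> (\<Sum>k\<in>UNIV. norm (X $ i $ k) * c ^ n)"
      unfolding mpow_Suc matrix_matrix_mult_def
      by (auto intro!: sum_norm_le mult_left_mono Suc simp: norm_mult)
    also have "\<dots> \<le> c * c ^ n"
      unfolding sum_distrib_right[symmetric] using row c0 by (intro mult_right_mono) auto
    finally show ?case by simp
  qed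
  have "summable (\<lambda>n. inverse (fact n) * c ^ n)" by (rule summable_exp)
  then have "summable (\<lambda>n. c ^ n / fact n)" by (simp add: field_simps)
  then show ?thesis
    unfolding exp_summable_def
    by (rule summable_comparison_test[rotated])
      (auto intro!: exI[of _ 0] divide_right_mono bound simp: norm_divide)
qed

lemma mexp_sums: "(\<lambda>n. (1 / fact n) *\<^sub>R mpow X n) sums mexp X"
proof -
  have "(\<lambda>n. (1 / fact n) *\<^sub>R mpow X n) sums (\<chi> i j. exp_sum (\<lambda>n. mpow X n $ i $ j))"
    unfolding sums_def
  proof (intro vec_tendstoI)
    fix i j
    have "(\<lambda>n. mpow X n $ i $ j / fact n) sums exp_sum (\<lambda>n. mpow X n $ i $ j)"
      by (rule exp_summable_sums[OF exp_summable_mpow])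
    moreover have "((1 / fact k) *\<^sub>R mpow X k) $ i $ j = mpow X k $ i $ j / fact k" for k
      by (simp only: vector_scaleR_component) (simp add: scaleR_conv_of_real)
    ultimately show "(\<lambda>n. (\<Sum>i<n. (1 / fact i) *\<^sub>R mpow X i) $ i $ j)
        \<longlonglongrightarrow> (\<chi> i j. exp_sum (\<lambda>n. mpow X n $ i $ j)) $ i $ j"
      unfolding sums_def by (simp only: sum_component vec_lambda_beta)
  qed
  then show ?thesis
    unfolding mexp_def mpow_def by (simp add: sums_iff)
qed

lemma mexp_sums_linear:
  fixes F :: "complex^'m^'m \<Rightarrow> 'b::real_normed_vector"
  assumes "linear F"
  shows "(\<lambda>n. (1 / fact n) *\<^sub>R F (mpow X n)) sums F (mexp X)"
  using bounded_linear.sums[OF _ mexp_sums, of F X] assms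
  by (simp add: linear_conv_bounded_linear[symmetric] linear_cmul)

lemma mexp_entry: "mexp X $ i $ j = exp_sum (\<lambda>n. mpow X n $ i $ j)"
proof -
  have "linear (\<lambda>M. M $ i $ j)" by (rule linearI) simp_all
  from mexp_sums_linear[OF this, of X]
  have "(\<lambda>n. mpow X n $ i $ j / fact n) sums mexp X $ i $ j"
    by (simp add: scaleR_conv_of_real)
  then show ?thesis unfolding exp_sum_def by (simp add: sums_iff)
qed

text \<open>A linear functional is a finite combination of entries, the case settled by
  \<open>exp_summable_mpow\<close>. It is applied to entries in another basis, to values of the
  bilinear form and to coefficients of tensors.\<close>

lemma exp_summable_mpow_linear:
  assumes add: "\<And>A B. F (A + B) = F A + F B" and sc: "\<And>c A. F (cscale c A) = c * F A"
  shows "exp_summable (\<lambda>n. F (mpow X n))" "exp_sum (\<lambda>n. F (mpow X n)) = F (mexp X)"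
proof -
  let ?E = "\<lambda>i j. (\<chi> i' j'. if i' = i \<and> j' = j then 1 else 0) :: complex^'a^'a"
  have Fs: "F (\<Sum>k\<in>K. f k) = (\<Sum>k\<in>K. F (f k))" if "finite K" for f :: "'x \<Rightarrow> _" and K
    using that sc[of 0 0] by (induction K rule: finite_induct) (simp_all add: add)
  have exp: "F A = (\<Sum>i\<in>UNIV. \<Sum>j\<in>UNIV. F (?E i j) * A $ i $ j)" for A
  proof -
    have "A = (\<Sum>i\<in>UNIV. \<Sum>j\<in>UNIV. cscale (A $ i $ j) (?E i j))"
    proof -
      have "(\<Sum>i\<in>UNIV. \<Sum>j\<in>UNIV. cscale (A $ i $ j) (?E i j)) $ a $ b = A $ a $ b" for a b
      proof -
        have "(\<Sum>i\<in>UNIV. \<Sum>j\<in>UNIV. cscale (A $ i $ j) (?E i j)) $ a $ b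
            = (\<Sum>i\<in>UNIV. \<Sum>j\<in>UNIV. if a = i then if b = j then A $ i $ j else 0 else 0)"
          by (auto simp: cscale_def intro!: sum.cong)
        also have "\<dots> = (\<Sum>i\<in>UNIV. if a = i then A $ i $ b else 0)"
          by (intro sum.cong) simp_all
        finally show ?thesis by simp
      qed
      then show ?thesis by (simp add: vec_eq_iff)
    qed
    then have "F A = F (\<Sum>i\<in>UNIV. \<Sum>j\<in>UNIV. cscale (A $ i $ j) (?E i j))" by simp
    then show ?thesis by (simp add: Fs sc mult.commute)
  qed
  have mono: "exp_summable (\<lambda>n. c * mpow X n $ i $ j)"
    "exp_sum (\<lambda>n. c * mpow X n $ i $ j) = c * mexp X $ i $ j" for c i j
  proof -
    have "summable (\<lambda>n. norm c * norm (mpow X n $ i $ j / fact n))"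
      using exp_summable_mpow[of X i j] unfolding exp_summable_def by (rule summable_mult)
    then show "exp_summable (\<lambda>n. c * mpow X n $ i $ j)"
      unfolding exp_summable_def by (simp add: norm_mult norm_divide)
    have "(\<lambda>n. c * (mpow X n $ i $ j / fact n)) sums (c * exp_sum (\<lambda>n. mpow X n $ i $ j))"
      by (intro sums_mult exp_summable_sums exp_summable_mpow)
    then show "exp_sum (\<lambda>n. c * mpow X n $ i $ j) = c * mexp X $ i $ j"
      by (simp add: exp_sum_def mexp_entry sums_iff)
  qed
  show "exp_summable (\<lambda>n. F (mpow X n))" "exp_sum (\<lambda>n. F (mpow X n)) = F (mexp X)"
    by (simp_all add: exp[of "mpow X _"] exp[of "mexp X"] exp_summable_sum mono)
qed

text \<open>The term of degree n in the product is \<open>(1 + (-1)) ^ n\<close> times X^n / n!, so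
  only n = 0 survives.\<close>

lemma mexp_uminus_cancel: "mexp X ** mexp (- X) = mat 1"
proof -
  have "(mexp X ** mexp (- X)) $ i $ j = mat 1 $ i $ j" for i j
  proof -
    have "(mexp X ** mexp (- X)) $ i $ j =
        (\<Sum>k\<in>UNIV. exp_sum (\<lambda>n. mpow X n $ i $ k) * exp_sum (\<lambda>n. mpow (- X) n $ k $ j))"
      by (simp add: matrix_matrix_mult_def mexp_entry)
    also have "\<dots> = (\<Sum>k\<in>UNIV. exp_sum (\<lambda>n. \<Sum>p\<le>n. of_nat (n choose p) *
        (mpow X p $ i $ k * mpow (- X) (n - p) $ k $ j)))"
      by (simp only: exp_summable_Cauchy(2)[OF exp_summable_mpow exp_summable_mpow])
    also have "\<dots> = exp_sum (\<lambda>n. \<Sum>k\<in>UNIV. \<Sum>p\<le>n. of_nat (n choose p) *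
        (mpow X p $ i $ k * mpow (- X) (n - p) $ k $ j))"
      by (rule exp_summable_sum(2)[symmetric])
        (rule exp_summable_Cauchy(1)[OF exp_summable_mpow exp_summable_mpow])
    also have "(\<lambda>n. \<Sum>k\<in>UNIV. \<Sum>p\<le>n. of_nat (n choose p) *
        (mpow X p $ i $ k * mpow (- X) (n - p) $ k $ j)) = (\<lambda>n. if n = 0 then mat 1 $ i $ j else 0)"
    proof
      fix n
      have e: "(\<Sum>k\<in>UNIV. mpow X p $ i $ k * mpow (- X) (n - p) $ k $ j) = (-1) ^ (n - p) * mpow X n $ i $ j"
        if "p \<le> n" for p
      proof -
        have "mpow (- X) m = cscale ((-1) ^ m) (mpow X m)" for m
          by (simp add: matrix_eq mpow_uminus)
        moreover have "mpow X n = mpow X p ** mpow X (n - p)" using that mpow_add[of X p "n - p"] by simp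
        ultimately show ?thesis
          by (simp add: matrix_matrix_mult_def cscale_def sum_distrib_left mult_ac)
      qed
      have "(\<Sum>k\<in>UNIV. \<Sum>p\<le>n. of_nat (n choose p) * (mpow X p $ i $ k * mpow (- X) (n - p) $ k $ j))
          = (\<Sum>p\<le>n. of_nat (n choose p) * (\<Sum>k\<in>UNIV. mpow X p $ i $ k * mpow (- X) (n - p) $ k $ j))"
        by (subst sum.swap) (simp add: sum_distrib_left)
      also have "\<dots> = (\<Sum>p\<le>n. of_nat (n choose p) * 1 ^ p * (-1) ^ (n - p)) * mpow X n $ i $ j"
        by (simp add: e sum_distrib_right mult.assoc)
      also have "\<dots> = (1 + (-1)) ^ n * mpow X n $ i $ j"
        by (subst binomial_ring) simp
      finally show "(\<Sum>k\<in>UNIV. \<Sum>p\<le>n. of_nat (n choose p) *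
          (mpow X p $ i $ k * mpow (- X) (n - p) $ k $ j)) = (if n = 0 then mat 1 $ i $ j else 0)"
        by simp
    qed
    also have "exp_sum (\<lambda>n. if n = 0 then mat 1 $ i $ j else 0) = mat 1 $ i $ j"
      unfolding exp_sum_def by (subst suminf_finite[of "{0}"]) auto
    finally show ?thesis .
  qed
  then show ?thesis by (simp add: vec_eq_iff)
qed

lemma mexp_uminus_cancel': "mexp (- X) ** mexp X = mat 1"
  using mexp_uminus_cancel[of "- X"] by simp

lemma mexp_vec_sums: "(\<lambda>n. (1 / fact n) *\<^sub>R (mpow X n *v x)) sums (mexp X *v x)"
proof -
  have "linear (\<lambda>M. M *v x)"
    by (rule linearI) (simp_all add: mv_simps scaleR_cscale scaleR_vec_complex)
  from mexp_sums_linear[OF this] show ?thesis .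
qed

lemma mexp_eigenvector:
  assumes "X *v x = c *s x"
  shows "mexp X *v x = exp c *s x"
proof -
  have p: "mpow X n *v x = c ^ n *s x" for n
    by (induction n) (simp_all add: mpow_Suc matrix_vector_mul_assoc[symmetric] vector_scalar_commute assms)
  have "(\<lambda>n. (1 / fact n) *\<^sub>R (c ^ n *s x)) sums (mexp X *v x)"
    using mexp_vec_sums[of X x] by (simp add: p)
  moreover have "(\<lambda>n. (1 / fact n) *\<^sub>R (c ^ n *s x)) sums (exp c *s x)"
    unfolding sums_def
  proof (intro vec_tendstoI)
    fix i
    have "(\<lambda>n. (c ^ n /\<^sub>R fact n) * x $ i) sums (exp c * x $ i)"
      by (intro sums_mult2 exp_converges)
    then show "(\<lambda>n. (\<Sum>k<n. (1 / fact k) *\<^sub>R (c ^ k *s x)) $ i) \<longlonglongrightarrow> (exp c *s x) $ i"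
      unfolding sums_def by (simp add: divide_inverse)
  qed
  ultimately show ?thesis by (rule sums_unique2)
qed

lemma mexp_nilpotent3:
  assumes "X *v (X *v (X *v x)) = 0"
  shows "mexp X *v x = x + X *v x + (1/2) *s (X *v (X *v x))"
proof -
  have z: "mpow X (n + 3) *v x = 0" for n
    by (induction n) (simp_all add: numeral_3_eq_3 mpow_Suc matrix_vector_mul_assoc[symmetric] assms)
  have "(\<lambda>n. (1 / fact n) *\<^sub>R (mpow X n *v x)) sums (\<Sum>n<3. (1 / fact n) *\<^sub>R (mpow X n *v x))"
    by (rule sums_finite) (auto, metis z le_add_diff_inverse2 not_le)
  from sums_unique2[OF mexp_vec_sums this] show ?thesis
    by (simp add: numeral_3_eq_3 mpow_Suc matrix_vector_mul_assoc[symmetric] scaleR_vec_complex)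
qed

text \<open>Conjugation by the exponential of A is the exponential series of \<open>ad A\<close>,
  here cut off after the quadratic term by \<open>C3\<close>.\<close>

lemma mexp_conjugate3:
  assumes C3: "bracket A (bracket A (bracket A C)) = 0"
  shows "mexp A ** C = (C + bracket A C + cscale (1/2) (bracket A (bracket A C))) ** mexp A"
proof -
  define C1 where "C1 = bracket A C"
  define C2 where "C2 = bracket A C1"
  have AC: "A *v (C *v x) = C *v (A *v x) + C1 *v x" "A *v (C1 *v x) = C1 *v (A *v x) + C2 *v x"
    for x by (simp_all add: C1_def C2_def bracket_mult_vec)
  have AC2: "A *v (C2 *v x) = C2 *v (A *v x)" for x
  proof -
    have "bracket A C2 *v x = 0" using C3 by (simp add: C1_def C2_def)
    then show ?thesis by (simp add: bracket_mult_vec)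
  qed
  \<comment> \<open>Binomial expansion of A^n C in powers of \<open>ad A\<close>. The truncated
    exponents n - 1 and n - 2 come with coefficient 0 whenever the truncation takes effect.\<close>
  have pow: "mpow A n *v (C *v x) = C *v (mpow A n *v x) + of_nat n *s (C1 *v (mpow A (n - 1) *v x))
       + (of_nat n * (of_nat n - 1) / 2) *s (C2 *v (mpow A (n - 2) *v x))" for n x
  proof (induction n)
    case (Suc n)
    have s1: "of_nat n *s (A *v (mpow A (n - 1) *v x)) = of_nat n *s (mpow A n *v x)"
      by (cases n) (simp_all add: mpow_Suc matrix_vector_mul_assoc)
    have s1': "of_nat n *s (C1 *v (A *v (mpow A (n - 1) *v x))) = of_nat n *s (C1 *v (mpow A n *v x))"
      by (cases n) (simp_all add: mpow_Suc matrix_vector_mul_assoc)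
    have s2: "(of_nat n * (of_nat n - 1) / 2) *s (C2 *v (A *v (mpow A (n - 2) *v x))) =
        (of_nat n * (of_nat n - 1) / 2) *s (C2 *v (mpow A (n - 1) *v x))"
    proof (cases n)
      case (Suc k)
      then show ?thesis by (cases k) (simp_all add: mpow_Suc matrix_vector_mul_assoc)
    qed simp
    have "mpow A (Suc n) *v (C *v x) = A *v (mpow A n *v (C *v x))"
      by (simp add: mpow_Suc matrix_vector_mul_assoc matrix_mul_assoc)
    also have "\<dots> = C *v (A *v (mpow A n *v x)) + C1 *v (mpow A n *v x)
        + of_nat n *s (C1 *v (A *v (mpow A (n - 1) *v x))) + of_nat n *s (C2 *v (mpow A (n - 1) *v x))
        + (of_nat n * (of_nat n - 1) / 2) *s (C2 *v (A *v (mpow A (n - 2) *v x)))"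
      unfolding Suc by (simp add: mv_simps AC AC2 vec.scale_right_distrib)
    also have "\<dots> = C *v (mpow A (Suc n) *v x) + of_nat (Suc n) *s (C1 *v (mpow A n *v x))
       + (of_nat (Suc n) * (of_nat (Suc n) - 1) / 2) *s (C2 *v (mpow A (n - 1) *v x))"
      unfolding s1' s2
      by (simp add: mpow_Suc matrix_vector_mul_assoc vec_eq_iff field_simps)
    finally show ?case by simp
  qed simp
  have lin: "linear (\<lambda>y::complex^'a. B *v y)" for B :: "complex^'a^'a" by simp
  have L: "(\<lambda>n. B *v ((1 / fact n) *\<^sub>R (mpow A n *v x))) sums (B *v (mexp A *v x))"
    for B :: "complex^'a^'a" and x
    using bounded_linear.sums[OF _ mexp_vec_sums, of "\<lambda>y. B *v y" A x] lin[of B]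
    by (simp add: linear_conv_bounded_linear[symmetric])
  have "mexp A *v (C *v x) = (C + C1 + cscale (1/2) C2) *v (mexp A *v x)" for x
  proof -
    \<comment> \<open>Dividing by n! turns the coefficient n into a shift of the series by one
      place, and n (n - 1) / 2 below into a shift by two.\<close>
    have t1: "(\<lambda>n. (1 / fact n) *\<^sub>R (of_nat n *s (C1 *v (mpow A (n - 1) *v x)))) sums (C1 *v (mexp A *v x))"
    proof -
      have f1: "(1 / fact (Suc n)) *\<^sub>R (of_nat (Suc n) *s y) = (1 / fact n) *\<^sub>R (y :: complex^'a)" for n y
        by (simp add: scaleR_vec_complex vec.scale_scale del: of_nat_Suc)
      have "(\<lambda>n. (1 / fact (Suc n)) *\<^sub>R (of_nat (Suc n) *s (C1 *v (mpow A (Suc n - 1) *v x))))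
           sums (C1 *v (mexp A *v x))"
        using L[of C1 x] unfolding f1 by (simp add: scaleR_vec_complex vector_scalar_commute)
      from sums_Suc[OF this] show ?thesis by simp
    qed
    have t2: "(\<lambda>n. (1 / fact n) *\<^sub>R ((of_nat n * (of_nat n - 1) / 2) *s (C2 *v (mpow A (n - 2) *v x))))
        sums (cscale (1/2) C2 *v (mexp A *v x))"
    proof -
      have f2: "(1 / fact (Suc (Suc n))) *\<^sub>R ((of_nat (Suc (Suc n)) * (of_nat (Suc (Suc n)) - 1) / 2) *s y)
          = (1 / fact n) *\<^sub>R ((1/2) *s (y :: complex^'a))" for n y
      proof -
        have "complex_of_real (1 / fact (Suc (Suc n))) * (of_nat (Suc (Suc n)) * (of_nat (Suc (Suc n)) - 1) / 2)
           = complex_of_real (1 / fact n) * (1/2)"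
          by (simp add: divide_simps del: of_nat_Suc) (simp add: algebra_simps)
        then show ?thesis by (simp only: scaleR_vec_complex vec.scale_scale)
      qed
      have "(\<lambda>n. (1 / fact (Suc (Suc n))) *\<^sub>R ((of_nat (Suc (Suc n)) * (of_nat (Suc (Suc n)) - 1) / 2) *s
          (C2 *v (mpow A (Suc (Suc n) - 2) *v x)))) sums (cscale (1/2) C2 *v (mexp A *v x))"
        using L[of "cscale (1/2) C2" x] unfolding f2
        by (simp add: scaleR_vec_complex vector_scalar_commute vec.scale_scale mult.commute)
      from sums_Suc[OF sums_Suc[OF this]] show ?thesis by simp
    qed
    have "(\<lambda>n. (1 / fact n) *\<^sub>R (mpow A n *v (C *v x))) sums
      (C *v (mexp A *v x) + C1 *v (mexp A *v x) + cscale (1/2) C2 *v (mexp A *v x))"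
      using sums_add[OF sums_add[OF L[of C x] t1] t2]
      by (simp add: pow scaleR_add_right scaleR_vec_complex vector_scalar_commute)
    from sums_unique2[OF mexp_vec_sums this] show ?thesis by (simp add: mv_simps)
  qed
  then show ?thesis
    by (simp add: matrix_eq matrix_vector_mul_assoc[symmetric] C1_def C2_def)
qed


section \<open>The invariant bilinear form\<close>

definition lsign :: "'n option \<Rightarrow> complex" where
  "lsign i = (if i = None then 1 else -1)"

definition bf :: "complex^('n::finite option) \<Rightarrow> complex^('n option) \<Rightarrow> complex" where
  "bf x y = (\<Sum>i\<in>UNIV. lsign i * x $ i * y $ i)"

lemma bf_sym: "bf x y = bf y x"
  by (simp add: bf_def mult_ac)

lemma bf_add_left: "bf (x + y) z = bf x z + bf y z"
  and bf_add_right: "bf z (x + y) = bf z x + bf z y"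
  and bf_diff_left: "bf (x - y) z = bf x z - bf y z"
  and bf_diff_right: "bf z (x - y) = bf z x - bf z y"
  and bf_scale_left: "bf (c *s x) z = c * bf x z"
  and bf_scale_right: "bf z (c *s x) = c * bf z x"
  by (simp_all add: bf_def algebra_simps sum.distrib sum_subtractf sum_distrib_left)

lemma bf_zero [simp]: "bf 0 z = 0" "bf z 0 = 0"
  by (simp_all add: bf_def)

lemma bf_uminus [simp]: "bf (- x) z = - bf x z" "bf z (- x) = - bf z x"
  by (simp_all add: bf_def sum_negf)

lemma bf_sum_right: "bf z (\<Sum>k\<in>K. f k) = (\<Sum>k\<in>K. bf z (f k))"
  by (induction K rule: infinite_finite_induct) (simp_all add: bf_add_right)

lemmas bf_simps = bf_add_left bf_add_right bf_diff_left bf_diff_right bf_scale_left bf_scale_right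

lemma bf_axis: "bf x (axis i 1) = lsign i * x $ i"
  unfolding bf_def axis_def by (simp add: if_distrib cong: if_cong)

lemma lsign_square [simp]: "lsign i * lsign i = 1" "lsign i \<noteq> 0"
  by (simp_all add: lsign_def)

lemma bf_nondegenerate: "(\<And>y. bf x y = 0) \<Longrightarrow> x = 0"
  by (simp add: vec_eq_iff) (metis bf_axis lsign_square(2) mult_eq_0_iff)

lemma mv_axis: "((A :: complex^'k^'m) *v axis i 1) $ j = A $ j $ i"
  by (simp add: matrix_vector_mult_def axis_def if_distrib cong: if_cong)

lemma mv_sum_right: "(A :: complex^'k^'m) *v (\<Sum>k\<in>K. f k) = (\<Sum>k\<in>K. A *v f k)"
  by (induction K rule: infinite_finite_induct) (simp_all add: matrix_vector_right_distrib)

lemma so_entries: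
  "X \<in> so1n_complex \<longleftrightarrow> (\<forall>i j. lsign j * X $ j $ i + lsign i * X $ i $ j = 0)"
proof -
  have "(transpose X ** lorentz + lorentz ** X) $ i $ j = lsign j * X $ j $ i + lsign i * X $ i $ j" for i j
  proof -
    have l: "lorentz $ k $ l = (if k = l then lsign l else 0)" for k l :: "'a option"
      by (simp add: lorentz_def lsign_def)
    have "(\<Sum>k\<in>UNIV. X $ k $ i * lorentz $ k $ j) = lsign j * X $ j $ i"
      unfolding l by (simp add: if_distrib cong: if_cong)
    moreover have "(\<Sum>k\<in>UNIV. lorentz $ i $ k * X $ k $ j) = lsign i * X $ i $ j"
    proof -
      have "(\<Sum>k\<in>UNIV. lorentz $ i $ k * X $ k $ j) = (\<Sum>k\<in>UNIV. if i = k then lsign i * X $ i $ j else 0)"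
        by (intro sum.cong) (auto simp: l)
      then show ?thesis by simp
    qed
    ultimately show ?thesis
      by (simp add: matrix_matrix_mult_def transpose_def)
  qed
  then show ?thesis by (simp add: so1n_complex_def vec_eq_iff)
qed

lemma so_iff: "X \<in> so1n_complex \<longleftrightarrow> (\<forall>x y. bf (X *v x) y = - bf x (X *v y))"
proof -
  have 1: "bf (X *v x) y = (\<Sum>i\<in>UNIV. \<Sum>j\<in>UNIV. (lsign i * X $ i $ j) * (x $ j * y $ i))" for x y
    by (simp add: bf_def matrix_vector_mult_def sum_distrib_left sum_distrib_right mult_ac)
  have 2: "bf x (X *v y) = (\<Sum>i\<in>UNIV. \<Sum>j\<in>UNIV. (lsign j * X $ j $ i) * (x $ j * y $ i))" for x y
    by (subst sum.swap) (simp add: bf_def matrix_vector_mult_def sum_distrib_left sum_distrib_right mult_ac)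
  have 3: "bf (X *v x) y + bf x (X *v y) = (\<Sum>i\<in>UNIV. \<Sum>j\<in>UNIV. (lsign j * X $ j $ i + lsign i * X $ i $ j) * (x $ j * y $ i))"
    for x y
    unfolding 1 2 by (simp add: sum.distrib[symmetric] algebra_simps)
  show ?thesis
  proof
    assume "X \<in> so1n_complex"
    then have "bf (X *v x) y + bf x (X *v y) = 0" for x y
      unfolding so_entries 3 by simp
    then show "\<forall>x y. bf (X *v x) y = - bf x (X *v y)" by (simp add: add_eq_0_iff2)
  next
    assume *: "\<forall>x y. bf (X *v x) y = - bf x (X *v y)"
    have "lsign j * X $ j $ i + lsign i * X $ i $ j = 0" for i j
      using *[rule_format, of "axis i 1" "axis j 1"] bf_sym[of "axis i 1" "X *v axis j 1"]
      by (simp add: bf_axis mv_axis)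
    then show "X \<in> so1n_complex" unfolding so_entries by simp
  qed
qed

lemma so_skew: "X \<in> so1n_complex \<Longrightarrow> bf (X *v x) y = - bf x (X *v y)"
  by (simp add: so_iff)

lemma so_subspace: "cmat.subspace so1n_complex"
  unfolding cmat.subspace_def by (auto simp: so_iff mv_simps bf_simps)

lemmas so_closed = cmat.subspace_add[OF so_subspace] cmat.subspace_diff[OF so_subspace]
  cmat.subspace_scale[OF so_subspace] cmat.subspace_0[OF so_subspace] cmat.subspace_neg[OF so_subspace]
  cmat.subspace_sum[OF so_subspace]

lemma so_bracket: "X \<in> so1n_complex \<Longrightarrow> Y \<in> so1n_complex \<Longrightarrow> bracket X Y \<in> so1n_complex"
  by (simp add: so_iff mv_simps bf_simps)

text \<open>The identification of the second exterior power of E with so(E); \<open>lsign j\<close>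
  lowers an index with the form. Wedges of weight vectors are then root vectors, Cartan elements or
  zero.\<close>

definition wedge :: "complex^('n::finite option) \<Rightarrow> complex^('n option) \<Rightarrow> complex^('n option)^('n option)" where
  "wedge x y = (\<chi> i j. lsign j * (x $ i * y $ j - y $ i * x $ j))"

lemma wedge_mult_vec: "wedge x y *v z = bf y z *s x - bf x z *s y"
  by (simp add: vec_eq_iff wedge_def matrix_vector_mult_def bf_def algebra_simps sum_subtractf sum_distrib_left)

lemma wedge_so [simp]: "wedge x y \<in> so1n_complex"
  by (simp add: so_iff wedge_mult_vec bf_simps) (simp add: bf_sym algebra_simps)

lemma wedge_add_left: "wedge (x + y) z = wedge x z + wedge y z"
  and wedge_add_right: "wedge z (x + y) = wedge z x + wedge z y"
  and wedge_diff_right: "wedge z (x - y) = wedge z x - wedge z y"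
  and wedge_scale_left: "wedge (c *s x) z = cscale c (wedge x z)"
  and wedge_scale_right: "wedge z (c *s x) = cscale c (wedge z x)"
  and wedge_anticommute: "wedge x z = - wedge z x"
  and wedge_uminus_left: "wedge (- x) z = - wedge x z"
  and wedge_uminus_right: "wedge z (- x) = - wedge z x"
  by (simp_all add: matrix_eq wedge_mult_vec mv_simps bf_simps algebra_simps vec_eq_iff)

lemma wedge_self [simp]: "wedge x x = 0" "wedge 0 x = 0" "wedge x 0 = 0"
  by (simp_all add: matrix_eq wedge_mult_vec)

lemma wedge_sum_left: "wedge (\<Sum>k\<in>K. f k) z = (\<Sum>k\<in>K. wedge (f k) z)"
  by (induction K rule: infinite_finite_induct) (simp_all add: wedge_add_left)

lemma wedge_sum_right: "wedge z (\<Sum>k\<in>K. f k) = (\<Sum>k\<in>K. wedge z (f k))"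
  by (induction K rule: infinite_finite_induct) (simp_all add: wedge_add_right)

lemma bracket_wedge:
  assumes "X \<in> so1n_complex"
  shows "bracket X (wedge x y) = wedge (X *v x) y + wedge x (X *v y)"
  by (simp add: matrix_eq mv_simps wedge_mult_vec so_skew[OF assms] vec_eq_iff)


section \<open>Witt bases\<close>

text \<open>An index k > 0 stands for the weight \<epsilon>_k of E, -k for its negative, and 0 for
  the zero weight, which is present when \<open>z\<close> holds (type B). The condition
  \<open>rank\<close> says that the dimension 2 r or 2 r + 1 of E is at least 3.\<close>

locale witt =
  fixes v :: "int \<Rightarrow> complex^('n::finite option)" and r :: int and z :: bool and I :: "int set"
  defines "I \<equiv> {k. \<bar>k\<bar> \<le> r \<and> (k = 0 \<longrightarrow> z)}"
  assumes rank: "r \<ge> 2 \<or> (r = 1 \<and> z)"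
    and form: "\<And>k m. k \<in> I \<Longrightarrow> m \<in> I \<Longrightarrow> bf (v k) (v m) = (if k = - m then 1 else 0)"
    and expansion: "\<And>x. x = (\<Sum>k\<in>I. bf (v (- k)) x *s v k)"
begin

abbreviation "g \<equiv> so1n_complex :: (complex^('n option)^('n option)) set"

lemma finite_I [simp]: "finite I"
proof -
  have "I \<subseteq> {-r..r}" by (auto simp: I_def)
  then show ?thesis by (rule finite_subset) simp
qed

lemma uminus_I [simp]: "- k \<in> I \<longleftrightarrow> k \<in> I"
  by (auto simp: I_def)

lemma in_I: "1 \<le> i \<Longrightarrow> i \<le> r \<Longrightarrow> i \<in> I"
  by (auto simp: I_def)

lemma one_I [simp]: "1 \<in> I"
  using rank by (auto simp: I_def)

lemma r_pos: "r \<ge> 1"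
  using rank by auto

lemma mat_eqI:
  assumes "\<And>k. k \<in> I \<Longrightarrow> X *v v k = Y *v v k"
  shows "X = Y"
proof -
  have "X *v x = Y *v x" for x
    by (subst (1 2) expansion[of x]) (simp add: mv_sum_right vector_scalar_commute assms cong: sum.cong)
  then show ?thesis by (simp add: matrix_eq)
qed

definition h :: "int \<Rightarrow> complex^('n option)^('n option)" where
  "h i = wedge (v i) (v (- i))"

lemma h_so [simp]: "h i \<in> g"
  by (simp add: h_def)

lemma h_mult_vec:
  assumes "1 \<le> i" "i \<le> r" "k \<in> I"
  shows "h i *v v k = (if k = i then 1 else if k = - i then -1 else 0) *s v k"
  using assms in_I[of i] by (auto simp: h_def wedge_mult_vec form)

text \<open>Heights r, ..., 1 for \<open>v 1\<close>, ..., \<open>v r\<close>. The sum over a pair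
  of indices vanishes only for opposite ones, so its sign separates raising from lowering root
  vectors uniformly in types B and D.\<close>

definition ht :: "int \<Rightarrow> int" where
  "ht k = sgn k * (r + 1 - \<bar>k\<bar>)"

lemma ht_simps [simp]: "ht (- k) = - ht k" "ht 0 = 0"
  by (auto simp: ht_def)

lemma ht_inj: "k \<in> I \<Longrightarrow> m \<in> I \<Longrightarrow> ht k + ht m = 0 \<Longrightarrow> m = - k"
  by (auto simp: ht_def I_def sgn_if split: if_splits)

text \<open>A regular element of the Cartan subalgebra: its eigenvalues alone give a grading fine
  enough to replace the weight spaces.\<close>

definition D :: "complex^('n option)^('n option)" where
  "D = (\<Sum>i\<in>{1..r}. cscale (of_int (ht i)) (h i))"

lemma D_so [simp]: "D \<in> g"
  unfolding D_def by (intro so_closed) auto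

lemma D_mult_vec:
  assumes "k \<in> I"
  shows "D *v v k = of_int (ht k) *s v k"
proof -
  have "D *v v k = (\<Sum>i\<in>{1..r}. of_int (ht i) *s (h i *v v k))"
    by (simp add: D_def sum_matrix_vector_mult)
  also have "\<dots> = (\<Sum>i\<in>{1..r}. if i = \<bar>k\<bar> then of_int (ht k) *s v k else 0)"
    using assms by (intro sum.cong) (auto simp: h_mult_vec abs_if split: if_splits)
  also have "\<dots> = of_int (ht k) *s v k"
    using assms by (cases "k = 0") (auto simp: I_def)
  finally show ?thesis .
qed

lemma bracket_wedge_eigen:
  assumes "X \<in> g" "X *v x = a *s x" "X *v y = b *s y"
  shows "bracket X (wedge x y) = cscale (a + b) (wedge x y)"
  using assms by (simp add: bracket_wedge wedge_scale_left wedge_scale_right cmat.scale_left_distrib)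

lemma bracket_D_wedge:
  "k \<in> I \<Longrightarrow> m \<in> I \<Longrightarrow> bracket D (wedge (v k) (v m)) = cscale (of_int (ht k + ht m)) (wedge (v k) (v m))"
  by (simp add: bracket_wedge_eigen[OF D_so D_mult_vec D_mult_vec])

text \<open>At a vector each wedge contributes two terms. One kind adds up to half of X by expansion
  in the basis, the other by skewness and expansion in the dual basis. The formula yields generators
  of \<open>g\<close> and, later, the frame for the trace in the Killing form.\<close>

lemma so_frame:
  assumes "X \<in> g"
  shows "X = (\<Sum>k\<in>I. cscale (1/2) (wedge (X *v v k) (v (- k))))"
proof (rule matrix_eq[THEN iffD2], rule allI)
  fix x
  have e: "(\<Sum>k\<in>I. bf (v (- k)) y *s v k) = y" for y
    by (rule expansion[symmetric])
  have e': "(\<Sum>k\<in>I. bf (v k) y *s v (- k)) = y" for y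
  proof -
    have "(\<Sum>k\<in>I. bf (v k) y *s v (- k)) = (\<Sum>k\<in>I. bf (v (- k)) y *s v k)"
      by (rule sum.reindex_bij_witness[of _ uminus uminus]) auto
    then show ?thesis by (simp add: e)
  qed
  have "(\<Sum>k\<in>I. cscale (1/2) (wedge (X *v v k) (v (- k)))) *v x
      = (\<Sum>k\<in>I. (1/2) *s (bf (v (- k)) x *s (X *v v k)) + (1/2) *s (bf (v k) (X *v x) *s v (- k)))"
    by (simp add: sum_matrix_vector_mult wedge_mult_vec so_skew[OF assms] vec.scale_right_distrib)
  also have "\<dots> = (1/2) *s (X *v (\<Sum>k\<in>I. bf (v (- k)) x *s v k)) + (1/2) *s (\<Sum>k\<in>I. bf (v k) (X *v x) *s v (- k))"
    by (simp add: sum.distrib vec.scale_sum_right mv_sum_right vector_scalar_commute)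
  also have "\<dots> = X *v x"
    unfolding e e' by (simp add: vec.scale_left_distrib[symmetric])
  finally show "X *v x = (\<Sum>k\<in>I. cscale (1/2) (wedge (X *v v k) (v (- k)))) *v x" by simp
qed

lemma so_span:
  assumes "X \<in> g"
  shows "X \<in> cmat.span {wedge (v k) (v m) | k m. k \<in> I \<and> m \<in> I}"
proof -
  have w: "wedge x (v m) = (\<Sum>k\<in>I. cscale (bf (v (- k)) x) (wedge (v k) (v m)))" for x m
    using arg_cong[OF expansion[of x], of "\<lambda>y. wedge y (v m)"]
    by (simp only: wedge_sum_left wedge_scale_left)
  have 1: "wedge x (v m) \<in> cmat.span {wedge (v k) (v m) | k m. k \<in> I \<and> m \<in> I}" if "m \<in> I" for x m
  proof -
    have "cscale (bf (v (- k)) x) (wedge (v k) (v m)) \<in> cmat.span {wedge (v k) (v m) | k m. k \<in> I \<and> m \<in> I}"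
      if "k \<in> I" for k
      using that \<open>m \<in> I\<close> by (blast intro: cmat.span_scale[OF cmat.span_base])
    from cmat.span_sum[OF this] show ?thesis
      by (rule ssubst[OF w[of x m]])
  qed
  have "(\<Sum>k\<in>I. cscale (1/2) (wedge (X *v v k) (v (- k)))) \<in>
      cmat.span {wedge (v k) (v m) | k m. k \<in> I \<and> m \<in> I}"
    by (rule cmat.span_sum, rule cmat.span_scale, rule 1) simp
  then show ?thesis by (rule ssubst[OF so_frame[OF assms]])
qed

lemma so_induct [consumes 1, case_names wedge zero add scale]:
  assumes "X \<in> g"
    and "\<And>k m. k \<in> I \<Longrightarrow> m \<in> I \<Longrightarrow> P (wedge (v k) (v m))" "P 0"
    and "\<And>X Y. X \<in> g \<Longrightarrow> Y \<in> g \<Longrightarrow> P X \<Longrightarrow> P Y \<Longrightarrow> P (X + Y)"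
    and "\<And>c X. X \<in> g \<Longrightarrow> P X \<Longrightarrow> P (cscale c X)"
  shows "P X"
proof -
  have "X \<in> g \<and> P X"
    using so_span[OF assms(1)]
    by (induction rule: cmat.span_induct_alt) (auto simp: so_closed assms)
  then show ?thesis ..
qed

end


section \<open>Highest weight modules\<close>

text \<open>Kept abstract over the vector space because it is used twice: for the given
  representation, and for its product with a space of tensors.\<close>

locale hw_module = witt v r z I + vector_space scale
  for v :: "int \<Rightarrow> complex^('n::finite option)" and r z I
    and scale :: "complex \<Rightarrow> 'v::ab_group_add \<Rightarrow> 'v" +
  fixes act :: "complex^('n option)^('n option) \<Rightarrow> 'v \<Rightarrow> 'v" and w :: 'v and L :: "int \<Rightarrow> real"
  assumes act_add_right: "\<And>X x y. X \<in> g \<Longrightarrow> act X (x + y) = act X x + act X y"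
    and act_scale_right: "\<And>X c x. X \<in> g \<Longrightarrow> act X (scale c x) = scale c (act X x)"
    and act_add_left: "\<And>X Y x. X \<in> g \<Longrightarrow> Y \<in> g \<Longrightarrow> act (X + Y) x = act X x + act Y x"
    and act_scale_left: "\<And>X c x. X \<in> g \<Longrightarrow> act (cscale c X) x = scale c (act X x)"
    and act_bracket: "\<And>X Y x. X \<in> g \<Longrightarrow> Y \<in> g \<Longrightarrow> act (bracket X Y) x = act X (act Y x) - act Y (act X x)"
    and weight: "\<And>i. 1 \<le> i \<Longrightarrow> i \<le> r \<Longrightarrow> act (h i) w = scale (of_real (L i)) w"
    and raising: "\<And>k m. k \<in> I \<Longrightarrow> m \<in> I \<Longrightarrow> ht k + ht m > 0 \<Longrightarrow> act (wedge (v k) (v m)) w = 0"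
begin

lemma act_zero_left [simp]: "act 0 x = 0"
  using act_scale_left[of 0 0 x] so_closed(4) by simp

lemma act_zero_right [simp]: "X \<in> g \<Longrightarrow> act X 0 = 0"
  using act_scale_right[of X 0 0] by simp

lemma act_sum_left: "finite K \<Longrightarrow> (\<And>k. k \<in> K \<Longrightarrow> f k \<in> g) \<Longrightarrow> act (\<Sum>k\<in>K. f k) x = (\<Sum>k\<in>K. act (f k) x)"
  by (induction K rule: finite_induct) (simp_all add: act_add_left so_closed)

definition d :: real where
  "d = (\<Sum>i\<in>{1..r}. of_int (ht i) * L i)"

text \<open>Only lowering operators are applied here; that the span is nevertheless stable under all
  of \<open>g\<close> is \<open>generated_stable\<close>.\<close>

inductive_set words :: "'v set" where
  base: "w \<in> words"
| lower: "y \<in> words \<Longrightarrow> k \<in> I \<Longrightarrow> m \<in> I \<Longrightarrow> ht k + ht m < 0 \<Longrightarrow> act (wedge (v k) (v m)) y \<in> words"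

definition generated :: "'v set" where
  "generated = span words"

text \<open>All eigenvectors of \<open>D\<close> below the top eigenvalue in integer steps, whether
  generated by \<open>w\<close> or not. The set does not depend on how a vector is written in
  \<open>words\<close>, which makes the coefficient of a nonzero \<open>w\<close> well
  defined.\<close>

definition below :: "'v set" where
  "below = span {y. \<exists>c\<in>(\<lambda>j. of_real (d - real j)) ` {1..}. act D y = scale c y}"

lemma belowI: "j \<ge> 1 \<Longrightarrow> act D y = scale (of_real (d - real j)) y \<Longrightarrow> y \<in> below"
  unfolding below_def by (intro span_base CollectI bexI[of _ "of_real (d - real j)"] imageI) simp_all

lemma act_D_w: "act D w = scale (of_real d) w"
proof -
  have "act D w = (\<Sum>i\<in>{1..r}. scale (of_int (ht i)) (act (h i) w))"
    unfolding D_def by (simp add: act_sum_left so_closed act_scale_left)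
  then show ?thesis
    by (simp add: weight d_def scale_sum_left)
qed

lemma act_span:
  assumes X: "X \<in> g" and S: "\<And>y. y \<in> S \<Longrightarrow> act X y \<in> span T" and y: "y \<in> span S"
  shows "act X y \<in> span T"
  using y
proof (induction rule: span_induct_alt)
  case base
  show ?case using X by (simp add: span_zero)
next
  case (step c x y)
  have "scale c (act X x) + act X y \<in> span T"
    using step by (intro span_add[OF span_scale[OF S]])
  then show ?case using X by (simp add: act_add_right act_scale_right)
qed

lemma generated_lower:
  assumes "y \<in> generated" "k \<in> I" "m \<in> I" "ht k + ht m < 0"
  shows "act (wedge (v k) (v m)) y \<in> generated"
  using assms(1) unfolding generated_def
proof (rule act_span[OF wedge_so, rotated])
  fix y assume "y \<in> words"
  from words.lower[OF this assms(2-4)] show "act (wedge (v k) (v m)) y \<in> span words"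
    by (rule span_base)
qed

text \<open>Commuting X past a lowering operator costs a bracket acting on a shorter word, so X is
  arbitrary in the induction. Only on \<open>w\<close> itself is it split into lowering, raising and
  Cartan parts.\<close>

lemma generated_stable:
  assumes "y \<in> generated" "X \<in> g"
  shows "act X y \<in> generated"
proof -
  have "act X y \<in> generated" if "y \<in> words" "X \<in> g" for y X
    using that
  proof (induction arbitrary: X)
    case base
    show ?case using base
    proof (induction X rule: so_induct)
      case (wedge k m)
      have w: "w \<in> generated" unfolding generated_def by (intro span_base words.base)
      consider "ht k + ht m < 0" | "ht k + ht m > 0" | "m = - k" 
        using ht_inj[of k m] wedge by (cases "ht k + ht m" "0::int" rule: linorder_cases) auto
      then show ?case
      proof cases
        case 1
        then show ?thesis using w generated_lower wedge by simp
      next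
        case 2
        then show ?thesis using raising wedge by (simp add: generated_def span_zero)
      next
        case 3
        consider "k = 0" | "1 \<le> k" "k \<le> r" | "1 \<le> - k" "- k \<le> r" 
          using wedge(1) unfolding I_def by (cases k "0::int" rule: linorder_cases) auto
        then show ?thesis
        proof cases
          case 1
          then show ?thesis using 3 by (simp add: generated_def span_zero)
        next
          case 2
          then show ?thesis using 3 weight[of k] w by (simp add: h_def generated_def span_scale)
        next
          case a: 3
          have "wedge (v k) (v m) = cscale (-1) (h (- k))"
            using 3 wedge_anticommute[of "v k" "v m"] by (simp add: h_def)
          then have "act (wedge (v k) (v m)) w = scale (-1) (scale (of_real (L (- k))) w)"
            using a weight[of "- k"] by (simp only: act_scale_left h_so)
          then show ?thesis using w by (simp only: generated_def span_scale)
        qed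
      qed
    next
      case zero
      then show ?case by (simp add: generated_def span_zero)
    next
      case (add X Y)
      then show ?case by (simp add: act_add_left generated_def span_add)
    next
      case (scale c X)
      then show ?case by (simp add: act_scale_left generated_def span_scale)
    qed
  next
    case (lower y k m X)
    let ?Y = "wedge (v k) (v m)"
    have "act X (act ?Y y) = act (bracket X ?Y) y + act ?Y (act X y)"
      using lower by (simp add: act_bracket)
    moreover have "act (bracket X ?Y) y \<in> generated" using lower by (simp add: so_bracket)
    moreover have "act ?Y (act X y) \<in> generated" using lower by (intro generated_lower) auto
    ultimately show ?case by (simp add: generated_def span_add)
  qed
  then show ?thesis
    using act_span[of X words words y] assms unfolding generated_def by simp
qed

lemma below_lower:
  assumes y: "y \<in> below" and "k \<in> I" "m \<in> I" and neg: "ht k + ht m < 0"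
  shows "act (wedge (v k) (v m)) y \<in> below"
  using y unfolding below_def
proof (rule act_span[rotated 2])
  fix y assume "y \<in> {y. \<exists>c\<in>(\<lambda>j. of_real (d - real j)) ` {1..}. act D y = scale c y}"
  then obtain j :: nat where j: "j \<ge> 1" "act D y = scale (of_real (d - real j)) y" by auto
  let ?Y = "wedge (v k) (v m)"
  have "act D (act ?Y y) = act (bracket D ?Y) y + act ?Y (act D y)"
    by (simp add: act_bracket)
  also have "\<dots> = scale (of_int (ht k + ht m)) (act ?Y y) + scale (of_real (d - real j)) (act ?Y y)"
    using assms j by (simp add: bracket_D_wedge act_scale_left act_scale_right)
  also have "\<dots> = scale (of_real (d - real (j + nat (- (ht k + ht m))))) (act ?Y y)"
    using neg by (simp add: scale_left_distrib[symmetric])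
  finally show "act ?Y y \<in> span {y. \<exists>c\<in>(\<lambda>j. of_real (d - real j)) ` {1..}. act D y = scale c y}"
    using j(1) belowI[of "j + nat (- (ht k + ht m))"] unfolding below_def by simp
qed simp

lemma below_h:
  assumes y: "y \<in> below" and i: "1 \<le> i" "i \<le> r"
  shows "act (h i) y \<in> below"
  using y unfolding below_def
proof (rule act_span[rotated 2])
  fix y assume "y \<in> {y. \<exists>c\<in>(\<lambda>j. of_real (d - real j)) ` {1..}. act D y = scale c y}"
  then obtain c where c: "c \<in> (\<lambda>j. of_real (d - real j)) ` {1..}" "act D y = scale c y" by auto
  have "bracket D (h i) = 0"
    using bracket_D_wedge[of i "- i"] in_I i by (simp add: h_def)
  then have "act D (act (h i) y) = act (h i) (act D y)"
    using act_bracket[of D "h i" y] by simp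
  then have "act D (act (h i) y) = scale c (act (h i) y)"
    using c by (simp add: act_scale_right)
  then show "act (h i) y \<in> span {y. \<exists>c\<in>(\<lambda>j. of_real (d - real j)) ` {1..}. act D y = scale c y}"
    using c by (intro span_base) auto
qed simp

lemma below_eigen_zero:
  assumes "y \<in> below" "act D y = scale c y" "c \<notin> (\<lambda>j. of_real (d - real j)) ` {1..}"
  shows "y = 0"
  by (rule eigenvector_in_span_eigenvectors[OF _ _ assms(1)[unfolded below_def] assms(2,3)])
    (simp_all add: act_add_right act_scale_right)

lemma d_not_below: "complex_of_real d \<notin> (\<lambda>j. of_real (d - real j)) ` {1..}"
  by (auto simp: complex_eq_iff)

lemma w_not_below: "w \<noteq> 0 \<Longrightarrow> w \<notin> below"
  using below_eigen_zero[OF _ act_D_w d_not_below] by blast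

lemma below_lower_w:
  assumes "k \<in> I" "m \<in> I" and neg: "ht k + ht m < 0"
  shows "act (wedge (v k) (v m)) w \<in> below"
proof -
  let ?Y = "wedge (v k) (v m)"
  have "act D (act ?Y w) = act (bracket D ?Y) w + act ?Y (act D w)"
    by (simp add: act_bracket)
  also have "\<dots> = scale (of_int (ht k + ht m)) (act ?Y w) + scale (of_real d) (act ?Y w)"
    using assms by (simp add: bracket_D_wedge act_scale_left act_scale_right act_D_w)
  also have "\<dots> = scale (of_real (d - real (nat (- (ht k + ht m))))) (act ?Y w)"
    using neg by (simp add: scale_left_distrib[symmetric])
  finally show ?thesis
    using neg by (intro belowI[of "nat (- (ht k + ht m))"]) auto
qed

lemma generated_decomp:
  assumes "y \<in> generated"
  shows "\<exists>c. y - scale c w \<in> below"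
proof -
  have wb: "x = w \<or> x \<in> below" if "x \<in> words" for x
    using that by induction (auto intro: below_lower below_lower_w)
  have 1: "\<exists>c. x - scale c w \<in> below" if "x \<in> words" for x
  proof -
    have "w - scale 1 w \<in> below" by (simp add: below_def span_zero)
    moreover have "x \<in> below \<Longrightarrow> x - scale 0 w \<in> below" by simp
    ultimately show ?thesis using wb[OF that] by blast
  qed
  show ?thesis
    using assms unfolding generated_def
  proof (induction rule: span_induct_alt)
    case base
    show ?case by (rule exI[of _ 0]) (simp add: below_def span_zero)
  next
    case (step c x y)
    then obtain a b where "x - scale a w \<in> below" "y - scale b w \<in> below" using 1 by blast
    then have "scale c (x - scale a w) + (y - scale b w) \<in> below"
      unfolding below_def by (intro span_add span_scale)
    then show ?case
      by (intro exI[of _ "c * a + b"]) (simp add: algebra_simps)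
  qed
qed

end


section \<open>Invariant vectors of irreducible highest weight modules\<close>

lemma cscale_two: "X + Y + (X - Y) = cscale 2 X" "X + Y - (X - Y) = cscale 2 Y" "X + X = cscale 2 X"
  "2 * X = cscale 2 X"
  by (simp_all add: vec_eq_iff cscale_def)

section \<open>The stabilizer of the two lines and the nilpotent element \<open>N\<close>\<close>

context witt
begin

definition levi :: "(complex^('n option)^('n option)) set" where
  "levi = {X \<in> g. \<exists>c. X *v v 1 = c *s v 1 \<and> X *v v (-1) = (- c) *s v (-1)}"

lemma levi_so: "X \<in> levi \<Longrightarrow> X \<in> g"
  by (simp add: levi_def)

lemma levi_subspace: "cmat.subspace levi"
proof -
  have "X + Y \<in> levi" if "X \<in> levi" "Y \<in> levi" for X Y
  proof -
    obtain c d where "X *v v 1 = c *s v 1" "X *v v (-1) = (- c) *s v (-1)"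
      "Y *v v 1 = d *s v 1" "Y *v v (-1) = (- d) *s v (-1)"
      using \<open>X \<in> levi\<close> \<open>Y \<in> levi\<close> unfolding levi_def by blast
    then have "(X + Y) *v v 1 = (c + d) *s v 1 \<and> (X + Y) *v v (-1) = (- (c + d)) *s v (-1)"
      by (simp add: mv_simps vec.scale_left_distrib vec.scale_left_diff_distrib)
    then show ?thesis using that unfolding levi_def mem_Collect_eq by (blast intro: so_closed(1))
  qed
  moreover have "cscale a X \<in> levi" if "X \<in> levi" for a X
  proof -
    obtain c where "X *v v 1 = c *s v 1" "X *v v (-1) = (- c) *s v (-1)"
      using \<open>X \<in> levi\<close> unfolding levi_def by blast
    then have "cscale a X *v v 1 = (a * c) *s v 1 \<and> cscale a X *v v (-1) = (- (a * c)) *s v (-1)"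
      by simp
    then show ?thesis using that unfolding levi_def mem_Collect_eq by (blast intro: so_closed(3))
  qed
  moreover have "0 \<in> levi"
    unfolding levi_def by (auto simp: so_closed intro!: exI[of _ 0])
  ultimately show ?thesis by (simp add: cmat.subspace_def)
qed

lemmas levi_closed = cmat.subspace_add[OF levi_subspace] cmat.subspace_diff[OF levi_subspace]
  cmat.subspace_scale[OF levi_subspace] cmat.subspace_0[OF levi_subspace] cmat.subspace_neg[OF levi_subspace]
  cmat.subspace_sum[OF levi_subspace]

lemma h_levi: "1 \<le> i \<Longrightarrow> i \<le> r \<Longrightarrow> h i \<in> levi"
  unfolding levi_def by (cases "i = 1") (auto simp: h_mult_vec intro: exI[of _ 1] exI[of _ 0])

lemma wedge_levi:
  assumes "bf (v 1) x = 0" "bf (v (-1)) x = 0" "bf (v 1) y = 0" "bf (v (-1)) y = 0"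
  shows "wedge x y \<in> levi"
  unfolding levi_def using assms bf_sym[of x] bf_sym[of y]
  by (auto simp: wedge_mult_vec intro!: exI[of _ 0])

lemma D_levi: "D \<in> levi"
  unfolding D_def by (intro levi_closed(6)) (auto intro!: levi_closed(3) h_levi)

lemma two_I: "r \<ge> 2 \<Longrightarrow> 2 \<in> I"
  by (simp add: I_def)

lemma zero_I: "r = 1 \<Longrightarrow> 0 \<in> I"
  using rank by (auto simp: I_def)

text \<open>A non-isotropic vector orthogonal to both lines. Components along \<open>v 2\<close> and
  \<open>v (-2)\<close> are both present so that \<open>h 2\<close> can tell them apart; in rank 1
  only \<open>v 0\<close> is left.\<close>

definition s0 :: "complex^('n option)" where
  "s0 = (if r \<ge> 2 then v 2 + v (-2) else v 0)"

lemma bf_s0 [simp]: "bf (v 1) s0 = 0" "bf (v (-1)) s0 = 0" "bf s0 (v 1) = 0" "bf s0 (v (-1)) = 0"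
proof -
  show *: "bf (v 1) s0 = 0" "bf (v (-1)) s0 = 0"
    using rank two_I zero_I by (auto simp: s0_def bf_simps form)
  then show "bf s0 (v 1) = 0" "bf s0 (v (-1)) = 0" by (simp_all add: bf_sym[of s0])
qed

definition N :: "complex^('n option)^('n option)" where
  "N = wedge (v 1) s0"

lemma N_so [simp]: "N \<in> g"
  by (simp add: N_def)

lemma form1 [simp]: "bf (v 1) (v 1) = 0" "bf (v 1) (v (-1)) = 1" "bf (v (-1)) (v 1) = 1" "bf (v (-1)) (v (-1)) = 0"
  by (simp_all add: form)

lemma N_v1: "N *v v 1 = 0"
  by (simp add: N_def wedge_mult_vec)

text \<open>\<open>h 1\<close> grades \<open>g\<close> in degrees -1, 0, 1, with \<open>levi\<close>
  in degree 0 and \<open>N\<close> in degree 1. This lemma, \<open>bracket_N_levi\<close> and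
  \<open>bracket_N_opp\<close> say that \<open>ad N\<close> raises the degree by one; hence its
  third power vanishes, as \<open>mexp_conjugate3\<close> demands.\<close>

lemma bracket_N_nil: "bf (v 1) y = 0 \<Longrightarrow> bracket N (wedge (v 1) y) = 0"
  by (simp add: bracket_wedge N_v1) (simp add: N_def wedge_mult_vec wedge_scale_right)

lemma bracket_N_levi:
  assumes "X \<in> levi"
  obtains y where "bf (v 1) y = 0" "bracket N X = wedge (v 1) y"
proof -
  obtain c where c: "X *v v 1 = c *s v 1" "X \<in> g" using assms by (auto simp: levi_def)
  let ?y = "- (c *s s0 + X *v s0)"
  have "bracket N X = - bracket X N" by (rule bracket_anticommute)
  also have "\<dots> = wedge (v 1) ?y"
    using c by (simp add: N_def bracket_wedge wedge_scale_left wedge_add_right wedge_scale_right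
        wedge_uminus_right wedge_diff_right)
  finally have "bracket N X = wedge (v 1) ?y" .
  moreover have "bf (v 1) ?y = 0"
    using so_skew[OF c(2), of "v 1" s0] c(1) by (simp add: bf_simps)
  ultimately show ?thesis using that by blast
qed

lemma bracket_N_levi3: "X \<in> levi \<Longrightarrow> bracket N (bracket N X) = 0"
  by (metis bracket_N_levi bracket_N_nil)

lemma bracket_N_opp:
  assumes "bf (v (-1)) y = 0" "bf (v 1) y = 0"
  shows "bracket N (wedge (v (-1)) y) \<in> levi"
proof -
  have N: "N *v v (-1) = - s0" "N *v y = bf s0 y *s v 1"
    using assms by (simp_all add: N_def wedge_mult_vec)
  have "bracket N (wedge (v (-1)) y) = cscale (- bf s0 y) (h 1) - wedge s0 y"
    by (simp add: bracket_wedge N wedge_uminus_left wedge_scale_right h_def wedge_anticommute[of "v 1" "v (-1)"])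
  then show ?thesis
    using assms r_pos by (simp add: levi_closed h_levi wedge_levi del: cmat.scale_minus_left)
qed

end

section \<open>The coefficient of the highest weight vector\<close>

locale hw_rep = witt v r z I
  for v :: "int \<Rightarrow> complex^('n::finite option)" and r z I +
  fixes \<rho> :: "complex^('n option)^('n option) \<Rightarrow> complex^('d::finite)^'d" and v0 and L :: "int \<Rightarrow> real"
  assumes irred: "irreducible_representation so1n_complex \<rho>"
    and v0: "v0 \<noteq> 0"
    and hw: "\<And>i. 1 \<le> i \<Longrightarrow> i \<le> r \<Longrightarrow> \<rho> (h i) *v v0 = of_real (L i) *s v0"
    and hw_raising: "\<And>k m. k \<in> I \<Longrightarrow> m \<in> I \<Longrightarrow> ht k + ht m > 0 \<Longrightarrow> \<rho> (wedge (v k) (v m)) *v v0 = 0"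
begin

lemma rep: "X \<in> g \<Longrightarrow> Y \<in> g \<Longrightarrow> \<rho> (X + Y) = \<rho> X + \<rho> Y"
  "X \<in> g \<Longrightarrow> \<rho> (cscale c X) = cscale c (\<rho> X)"
  "X \<in> g \<Longrightarrow> Y \<in> g \<Longrightarrow> \<rho> (bracket X Y) = bracket (\<rho> X) (\<rho> Y)"
  using irred by (auto simp: irreducible_representation_def representation_of_def)

lemma rep0: "\<rho> 0 = 0"
  using rep(2)[of 0 0] so_closed(4) by simp

lemma rep_diff: "X \<in> g \<Longrightarrow> Y \<in> g \<Longrightarrow> \<rho> (X - Y) = \<rho> X - \<rho> Y"
  using rep(1)[of "X - Y" Y] by (simp add: so_closed)

sublocale V: hw_module v r z I "(*s)" "\<lambda>X x. \<rho> X *v x" v0 L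
  by unfold_locales (use hw_raising[unfolded I_def] in \<open>simp_all add: rep hw mv_simps\<close>)

lemma irreducible:
  "vec.subspace U \<Longrightarrow> (\<And>X u. X \<in> g \<Longrightarrow> u \<in> U \<Longrightarrow> \<rho> X *v u \<in> U) \<Longrightarrow> x \<in> U \<Longrightarrow> x \<noteq> 0 \<Longrightarrow> U = UNIV"
  using irred unfolding irreducible_representation_def by blast

lemma generated_UNIV: "V.generated = UNIV"
proof (rule irreducible[of _ v0])
  show "v0 \<in> V.generated"
    unfolding V.generated_def by (intro vec.span_base V.words.base)
  show "vec.subspace V.generated" by (simp add: V.generated_def)
qed (simp_all add: V.generated_stable v0)

lemma below_subspace: "vec.subspace V.below"
  by (simp add: V.below_def)

text \<open>The projection to the line of \<open>v0\<close> along \<open>below\<close>. It exists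
  because \<open>generated\<close> is the whole space, and it is unique because \<open>v0\<close> is
  not in \<open>below\<close>.\<close>

definition hw_coeff :: "complex^'d \<Rightarrow> complex" where
  "hw_coeff x = (THE c. x - c *s v0 \<in> V.below)"

lemma hw_coeff_eqI:
  assumes "x - c *s v0 \<in> V.below"
  shows "hw_coeff x = c"
  unfolding hw_coeff_def
proof (rule the_equality)
  fix c' assume "x - c' *s v0 \<in> V.below"
  then have "(c - c') *s v0 \<in> V.below"
    using vec.subspace_diff[OF below_subspace \<open>x - c' *s v0 \<in> V.below\<close> assms]
    by (simp add: vec.scale_left_diff_distrib)
  then have "(1 / (c - c')) *s ((c - c') *s v0) \<in> V.below"
    by (rule vec.subspace_scale[OF below_subspace])
  moreover have "(1 / (c - c')) *s ((c - c') *s v0) = v0" if "c \<noteq> c'"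
    unfolding vec.scale_scale using that by simp
  ultimately show "c' = c" using V.w_not_below[OF v0] by metis
qed (rule assms)

lemma hw_coeff_decomp: "x - hw_coeff x *s v0 \<in> V.below"
  using V.generated_decomp[of x] hw_coeff_eqI by (auto simp: generated_UNIV)

lemma hw_coeff_add: "hw_coeff (x + y) = hw_coeff x + hw_coeff y"
  using vec.subspace_add[OF below_subspace hw_coeff_decomp[of x] hw_coeff_decomp[of y]]
  by (intro hw_coeff_eqI) (simp add: vec.scale_left_distrib algebra_simps)

lemma hw_coeff_scale: "hw_coeff (c *s x) = c * hw_coeff x"
  using vec.subspace_scale[OF below_subspace hw_coeff_decomp[of x], of c]
  by (intro hw_coeff_eqI) (simp add: vec.scale_right_diff_distrib)

lemma hw_coeff_v0: "hw_coeff v0 = 1"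
  by (intro hw_coeff_eqI) (simp add: vec.subspace_0[OF below_subspace])

lemma hw_coeff_h:
  assumes "1 \<le> i" "i \<le> r"
  shows "hw_coeff (\<rho> (h i) *v x) = of_real (L i) * hw_coeff x"
  using V.below_h[OF hw_coeff_decomp[of x] assms]
  by (intro hw_coeff_eqI) (simp add: mv_simps hw[OF assms] mult.commute)

lemma hw_coeff_lower:
  assumes "k \<in> I" "m \<in> I" "ht k + ht m < 0"
  shows "hw_coeff (\<rho> (wedge (v k) (v m)) *v x) = 0"
  using vec.subspace_add[OF below_subspace V.below_lower[OF hw_coeff_decomp[of x] assms]
      vec.subspace_scale[OF below_subspace V.below_lower_w[OF assms], of "hw_coeff x"]]
  by (intro hw_coeff_eqI) (simp add: mv_simps)

text \<open>The whole space is the line of \<open>v0\<close> plus \<open>below\<close>, hence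
  spanned by eigenvectors for the eigenvalues \<open>d - j\<close>. The bound is what makes high
  powers of a raising operator vanish.\<close>

lemma eigenvalue_bound:
  assumes "\<rho> D *v x = of_real c *s x" "x \<noteq> 0"
  shows "c \<le> V.d"
proof (rule ccontr)
  assume c: "\<not> c \<le> V.d"
  let ?L = "(\<lambda>j. complex_of_real (V.d - real j)) ` UNIV"
  let ?E = "{y. \<exists>c\<in>?L. \<rho> D *v y = c *s y}"
  have "v0 \<in> vec.span ?E"
    using V.act_D_w by (intro vec.span_base) (auto intro!: exI[of _ 0])
  moreover have "V.below \<subseteq> vec.span ?E"
    unfolding V.below_def by (rule vec.span_mono) auto
  ultimately have "(x - hw_coeff x *s v0) + hw_coeff x *s v0 \<in> vec.span ?E"
    using hw_coeff_decomp[of x] by (intro vec.span_add vec.span_scale) auto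
  then have x: "x \<in> vec.span ?E" by simp
  have "x = 0"
    by (rule vec.eigenvector_in_span_eigenvectors[OF _ _ x assms(1)])
      (use c in \<open>auto simp: mv_simps complex_eq_iff\<close>)
  then show False using assms by simp
qed

text \<open>The coefficient functional is a lowest weight vector of the dual module; moved by \<open>exp N\<close> it
  becomes one for a Borel subalgebra that, unlike the original one, is transversal to \<open>levi\<close>.\<close>

definition moved_coeff :: "complex^'d \<Rightarrow> complex" where
  "moved_coeff x = hw_coeff (mexp (\<rho> N) *v x)"

lemma moved_coeff_add: "moved_coeff (x + y) = moved_coeff x + moved_coeff y"
  and moved_coeff_scale: "moved_coeff (c *s x) = c * moved_coeff x"
  by (simp_all add: moved_coeff_def mv_simps hw_coeff_add hw_coeff_scale)

lemma moved_coeff_zero [simp]: "moved_coeff 0 = 0"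
  using moved_coeff_scale[of 0 0] by simp

lemma moved_coeff_nonzero: "moved_coeff (mexp (- \<rho> N) *v v0) = 1"
  by (simp add: moved_coeff_def matrix_vector_mul_assoc mexp_uminus_cancel hw_coeff_v0)

section \<open>The Borel subalgebra moved by the exponential of \<open>N\<close>\<close>

definition moved_borel :: "(complex^('n option)^('n option)) set" where
  "moved_borel = {B \<in> g. \<exists>c. \<forall>x. moved_coeff (\<rho> B *v x) = c * moved_coeff x}"

text \<open>The acting element is \<open>exp (- ad N)\<close> applied to B, cut off by
  \<open>nil\<close>. The exponential of \<open>N\<close> intertwines it with B, so the moved
  functional inherits the eigenvalue of \<open>hw_coeff\<close> under B.\<close>

lemma moved:
  assumes B: "B \<in> g" and c: "\<And>x. hw_coeff (\<rho> B *v x) = c * hw_coeff x"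
    and nil: "bracket N (bracket N (bracket N B)) = 0"
  shows "moved_coeff (\<rho> (B - bracket N B + cscale (1/2) (bracket N (bracket N B))) *v x) = c * moved_coeff x"
proof -
  define A C C1 C2 where "A = \<rho> N" and "C = \<rho> B" and "C1 = bracket A C" and "C2 = bracket A C1"
  let ?B = "B - bracket N B + cscale (1/2) (bracket N (bracket N B))"
  have BB: "bracket N B \<in> g" "bracket N (bracket N B) \<in> g" using B by (simp_all add: so_bracket)
  have rB: "\<rho> ?B = C - C1 + cscale (1/2) C2"
    using B BB by (simp add: rep rep_diff so_closed A_def C_def C1_def C2_def)
  have "bracket A C2 = \<rho> (bracket N (bracket N (bracket N B)))"
    using B BB by (simp add: rep A_def C_def C1_def C2_def)
  then have C3: "bracket A C2 = 0" using nil by (simp add: rep0)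
  \<comment> \<open>Combined with the coefficients 1, -1 and 1/2, these three lines cancel to
    C.\<close>
  have e: "mexp A *v (C *v x) = (C + C1 + cscale (1/2) C2) *v (mexp A *v x)"
    "mexp A *v (C1 *v x) = (C1 + C2) *v (mexp A *v x)" "mexp A *v (C2 *v x) = C2 *v (mexp A *v x)"
    using mexp_conjugate3[of A C] mexp_conjugate3[of A C1] mexp_conjugate3[of A C2] C3
    by (simp_all add: C1_def[symmetric] C2_def[symmetric] matrix_vector_mul_assoc)
  have "mexp A *v (\<rho> ?B *v x) = C *v (mexp A *v x)"
    unfolding rB by (simp add: mv_simps e vec_eq_iff)
  then show ?thesis
    by (simp add: moved_coeff_def A_def C_def c)
qed

lemma moved_h:
  assumes "1 \<le> i" "i \<le> r"
  shows "moved_coeff (\<rho> (h i + bracket (h i) N) *v x) = of_real (L i) * moved_coeff x"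
proof -
  have "bracket N (bracket N (h i)) = 0" using assms by (intro bracket_N_levi3 h_levi)
  then show ?thesis
    using moved[of "h i" "of_real (L i)"] hw_coeff_h[OF assms] bracket_anticommute[of N "h i"] by simp
qed

lemma moved_h_borel:
  assumes "1 \<le> i" "i \<le> r"
  shows "h i + bracket (h i) N \<in> moved_borel"
  unfolding moved_borel_def using moved_h[OF assms] by (auto simp: so_closed so_bracket)

lemma moved_borel_subspace: "cmat.subspace moved_borel"
proof -
  have "X + Y \<in> moved_borel" if "X \<in> moved_borel" "Y \<in> moved_borel" for X Y
  proof -
    obtain c d where "\<forall>x. moved_coeff (\<rho> X *v x) = c * moved_coeff x" "\<forall>x. moved_coeff (\<rho> Y *v x) = d * moved_coeff x"
      and XY: "X \<in> g" "Y \<in> g"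
      using \<open>X \<in> moved_borel\<close> \<open>Y \<in> moved_borel\<close> by (auto simp: moved_borel_def)
    then have "\<forall>x. moved_coeff (\<rho> (X + Y) *v x) = (c + d) * moved_coeff x"
      by (simp add: rep mv_simps moved_coeff_add distrib_right)
    then show ?thesis using XY unfolding moved_borel_def by (blast intro: so_closed(1))
  qed
  moreover have "cscale a X \<in> moved_borel" if "X \<in> moved_borel" for a X
  proof -
    obtain c where "\<forall>x. moved_coeff (\<rho> X *v x) = c * moved_coeff x" "X \<in> g"
      using \<open>X \<in> moved_borel\<close> by (auto simp: moved_borel_def)
    then have "\<forall>x. moved_coeff (\<rho> (cscale a X) *v x) = (a * c) * moved_coeff x"
      by (simp add: rep moved_coeff_scale)
    then show ?thesis using \<open>X \<in> g\<close> unfolding moved_borel_def by (blast intro: so_closed(3))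
  qed
  moreover have "0 \<in> moved_borel"
    unfolding moved_borel_def by (auto simp: so_closed rep0 intro!: exI[of _ 0])
  ultimately show ?thesis by (simp add: cmat.subspace_def)
qed

section \<open>The moved Borel subalgebra and \<open>levi\<close> span \<open>g\<close>\<close>

definition sum_space :: "(complex^('n option)^('n option)) set" where
  "sum_space = {B + X | B X. B \<in> moved_borel \<and> X \<in> levi}"

lemma sum_space_subspace: "cmat.subspace sum_space"
  unfolding sum_space_def by (rule cmat.subspace_sums[OF moved_borel_subspace levi_subspace])

lemmas sum_closed = cmat.subspace_add[OF sum_space_subspace] cmat.subspace_diff[OF sum_space_subspace]
  cmat.subspace_scale[OF sum_space_subspace] cmat.subspace_neg[OF sum_space_subspace]
  cmat.subspace_0[OF sum_space_subspace]

lemma sum_spaceI: "X \<in> moved_borel \<Longrightarrow> X \<in> sum_space" "X \<in> levi \<Longrightarrow> X \<in> sum_space"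
  unfolding sum_space_def using cmat.subspace_0[OF moved_borel_subspace] levi_closed(4)
  by (metis (mono_tags, lifting) mem_Collect_eq add_0_right add_0)+

lemma sum_space_moved_h:
  assumes "1 \<le> i" "i \<le> r"
  shows "bracket (h i) N \<in> sum_space"
  using sum_closed(2)[OF sum_spaceI(1)[OF moved_h_borel[OF assms]] sum_spaceI(2)[OF h_levi[OF assms]]]
  by simp

lemma h1_N: "bracket (h 1) N = N"
  using r_pos h_mult_vec[of 1 1] two_I zero_I rank in_I[of 1]
  by (auto simp: N_def bracket_wedge h_mult_vec s0_def matrix_vector_right_distrib)

lemma h2_N: "r \<ge> 2 \<Longrightarrow> bracket (h 2) N = wedge (v 1) (v 2) - wedge (v 1) (v (-2))"
  using two_I by (simp add: N_def bracket_wedge h_mult_vec s0_def matrix_vector_right_distrib wedge_diff_right)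

text \<open>For m = 2 and m = -2 the two vectors are separated by \<open>[h 1, N]\<close>, their
  sum, and \<open>[h 2, N]\<close>, their difference. For the remaining m in rank at least 2,
  \<open>v (-2) \<and> v m\<close> is a lowering vector inside \<open>levi\<close>, and moving it
  subtracts \<open>v 1 \<and> v m\<close>.\<close>

lemma wedge1_basis:
  assumes m: "m \<in> I"
  shows "wedge (v 1) (v m) \<in> sum_space"
proof -
  consider "m = 1" | "m = -1" | "m = 0" "r = 1" | "m = 2" | "m = -2"
    | "r \<ge> 2" "m \<notin> {1,-1,2,-2}" "m \<in> I"
    using m rank unfolding I_def by force
  then show ?thesis
  proof cases
    case 1
    then show ?thesis by (simp add: sum_closed)
  next
    case 2
    then show ?thesis using h_levi[of 1] r_pos by (simp add: sum_spaceI h_def)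
  next
    case 3
    have "s0 = v 0" unfolding s0_def using 3(2) by simp
    then have "N = wedge (v 1) (v 0)" by (simp add: N_def)
    moreover have "N \<in> sum_space" using sum_space_moved_h[of 1] r_pos by (simp add: h1_N)
    ultimately show ?thesis using 3(1) by metis
  next
    case 6
    have bm: "bf (v m) s0 = 0" "bf (v (-2)) s0 = 1"
      using 6 two_I by (auto simp: s0_def bf_simps form)
    let ?B = "wedge (v (-2)) (v m)"
    have lv: "?B \<in> levi" using 6 two_I by (intro wedge_levi) (auto simp: form)
    \<comment> \<open>Here m is 0 or of absolute value at least 3, so its height is smaller in
      absolute value than that of 2.\<close>
    have "ht (-2) + ht m < 0" using 6 by (auto simp: ht_def I_def sgn_if)
    then have "hw_coeff (\<rho> ?B *v x) = 0 * hw_coeff x" for x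
      using 6 two_I by (simp add: hw_coeff_lower)
    moreover have "bracket N (bracket N ?B) = 0" using bracket_N_levi3[OF lv] .
    ultimately have "moved_coeff (\<rho> (?B - bracket N ?B) *v x) = 0 * moved_coeff x" for x
      using moved[of ?B 0 x] by simp
    then have mb: "?B - bracket N ?B \<in> moved_borel"
      unfolding moved_borel_def by (auto simp: so_closed so_bracket)
    have "bracket N ?B = - bracket ?B N" by (rule bracket_anticommute)
    also have "\<dots> = wedge (v 1) (v m)"
      using 6 two_I bm bf_sym[of "v m" "v 1"] bf_sym[of "v (-2)" "v 1"]
      by (simp add: N_def bracket_wedge wedge_mult_vec form wedge_uminus_right wedge_scale_right)
    finally have "?B - wedge (v 1) (v m) \<in> sum_space" using mb by (simp add: sum_spaceI)
    from sum_closed(2)[OF sum_spaceI(2)[OF lv] this] show ?thesis by simp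
  next
    case 4
    then have r2: "r \<ge> 2" using m by (simp add: I_def)
    have "cscale (1/2) (bracket (h 1) N + bracket (h 2) N) \<in> sum_space"
      using r2 by (intro sum_closed sum_space_moved_h) auto
    moreover have "bracket (h 1) N + bracket (h 2) N = cscale 2 (wedge (v 1) (v 2))"
      using r2 by (simp add: h1_N h2_N) (simp add: N_def s0_def wedge_add_right cscale_two)
    ultimately show ?thesis using 4 by simp
  next
    case 5
    then have r2: "r \<ge> 2" using m by (simp add: I_def)
    have "cscale (1/2) (bracket (h 1) N - bracket (h 2) N) \<in> sum_space"
      using r2 by (intro sum_closed sum_space_moved_h) auto
    moreover have "bracket (h 1) N - bracket (h 2) N = cscale 2 (wedge (v 1) (v (-2)))"
      using r2 by (simp add: h1_N h2_N) (simp add: N_def s0_def wedge_add_right cscale_two)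
    ultimately show ?thesis using 5 by simp
  qed
qed

lemma wedge1: "wedge (v 1) y \<in> sum_space"
proof -
  have "wedge (v 1) y = (\<Sum>k\<in>I. cscale (bf (v (- k)) y) (wedge (v 1) (v k)))"
    using arg_cong[OF expansion[of y], of "wedge (v 1)"] by (simp only: wedge_sum_right wedge_scale_right)
  moreover have "(\<Sum>k\<in>I. cscale (bf (v (- k)) y) (wedge (v 1) (v k))) \<in> sum_space"
    by (rule cmat.subspace_sum[OF sum_space_subspace], rule sum_closed(3), rule wedge1_basis)
  ultimately show ?thesis by simp
qed

text \<open>In degree -1 the correction terms of the moved vector lie in \<open>levi\<close> and
  among the \<open>v 1 \<and> y\<close>, which are already available.\<close>

lemma wedge_m1:
  assumes "m \<in> I"
  shows "wedge (v (-1)) (v m) \<in> sum_space"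
proof -
  consider "m = -1" | "m = 1" | "m \<notin> {1,-1}" by auto
  then show ?thesis
  proof cases
    case 1
    then show ?thesis by (simp add: sum_closed)
  next
    case 2
    then show ?thesis using wedge1[of "v (-1)"] wedge_anticommute[of "v (-1)" "v 1"] by (simp add: sum_closed)
  next
    case 3
    let ?B = "wedge (v (-1)) (v m)"
    have "ht (-1) + ht m < 0" using 3 assms r_pos by (auto simp: ht_def I_def sgn_if)
    then have c: "hw_coeff (\<rho> ?B *v x) = 0 * hw_coeff x" for x
      using assms by (simp add: hw_coeff_lower)
    have lv: "bracket N ?B \<in> levi" using 3 assms by (intro bracket_N_opp) (auto simp: form)
    obtain y where y: "bracket N (bracket N ?B) = wedge (v 1) y" "bf (v 1) y = 0"
      using bracket_N_levi[OF lv] by metis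
    have "moved_coeff (\<rho> (?B - bracket N ?B + cscale (1/2) (wedge (v 1) y)) *v x) = 0 * moved_coeff x" for x
      using moved[of ?B 0 x] c bracket_N_nil[OF y(2)] y(1) by simp
    then have "?B - bracket N ?B + cscale (1/2) (wedge (v 1) y) \<in> moved_borel"
      unfolding moved_borel_def by (auto simp: so_closed so_bracket)
    then have "?B - bracket N ?B + cscale (1/2) (wedge (v 1) y) - cscale (1/2) (wedge (v 1) y) + bracket N ?B
       \<in> sum_space"
      by (rule sum_closed(1)[OF sum_closed(2)[OF sum_spaceI(1) sum_closed(3)[OF wedge1]] sum_spaceI(2)[OF lv]])
    then show ?thesis by simp
  qed
qed

lemma so_sum_space:
  assumes "X \<in> g"
  shows "X \<in> sum_space"
  using assms
proof (induction rule: so_induct)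
  case (wedge k m)
  show ?case
  proof (cases "k \<in> {1,-1} \<or> m \<in> {1,-1}")
    case True
    have a: "wedge (v k) (v m) = - wedge (v m) (v k)" by (rule wedge_anticommute)
    from True consider "k = 1" | "k = -1" | "m = 1" | "m = -1" by blast
    then show ?thesis
    proof cases
      case 3
      then show ?thesis unfolding a using wedge1 by (intro sum_closed(4)) simp
    next
      case 4
      then show ?thesis unfolding a using wedge_m1[of k] wedge by (intro sum_closed(4)) simp
    qed (use wedge wedge1 wedge_m1 in simp_all)
  next
    case False
    then show ?thesis using wedge by (intro sum_spaceI wedge_levi) (auto simp: form)
  qed
qed (auto simp: sum_closed)

text \<open>\<open>F n\<close> collects what at most n elements of \<open>g\<close> make of u. Each
  \<open>F n\<close> is stable under \<open>levi\<close>, because \<open>levi\<close> kills u and a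
  commutator costs no extra factor. So in a decomposition of an element of \<open>g\<close> the
  \<open>levi\<close> part stays in \<open>F n\<close>, while the Borel part only multiplies
  \<open>moved_coeff\<close> by a scalar.\<close>

lemma moved_coeff_injective:
  assumes u: "u \<in> invariants levi \<rho>" and 0: "moved_coeff u = 0"
  shows "u = 0"
proof (rule ccontr)
  assume "u \<noteq> 0"
  define F where "F = rec_nat (vec.span {u}) (\<lambda>_ S. vec.span (S \<union> {\<rho> X *v y | X y. X \<in> g \<and> y \<in> S}))"
  have F0: "F 0 = vec.span {u}" and FS: "F (Suc n) = vec.span (F n \<union> {\<rho> X *v y | X y. X \<in> g \<and> y \<in> F n})" for n
    by (simp_all add: F_def)
  have F_sub: "vec.subspace (F n)" for n by (cases n) (simp_all add: F0 FS)
  have F_mono: "F n \<subseteq> F (Suc n)" for n unfolding FS by (auto intro: vec.span_base)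
  have F_act: "X \<in> g \<Longrightarrow> y \<in> F n \<Longrightarrow> \<rho> X *v y \<in> F (Suc n)" for X y n
    unfolding FS by (auto intro: vec.span_base)
  have F_levi: "\<rho> X *v y \<in> F n" if "X \<in> levi" "y \<in> F n" for X y n
    using that
  proof (induction n arbitrary: X y)
    case 0
    then obtain c where "y = c *s u" by (auto simp: F0 vec.span_singleton)
    then show ?case using u 0 by (simp add: invariants_def mv_simps vec.subspace_0[OF F_sub])
  next
    case (Suc n)
    show ?case using Suc.prems(2) unfolding FS
    proof (induction rule: vec.span_induct_alt)
      case base
      show ?case by (simp add: vec.span_zero)
    next
      case (step c x y)
      have "\<rho> X *v x \<in> F (Suc n)"
      proof (cases "x \<in> F n")
        case True
        then show ?thesis using Suc F_mono by blast
      next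
        case False
        then obtain Y y' where Y: "x = \<rho> Y *v y'" "Y \<in> g" "y' \<in> F n" using step by blast
        have "\<rho> X *v x = \<rho> (bracket X Y) *v y' + \<rho> Y *v (\<rho> X *v y')"
          using Y Suc.prems levi_so by (simp add: rep mv_simps)
        then show ?thesis
          using Y Suc.IH[OF Suc.prems(1) Y(3)] Suc.prems levi_so F_act
          by (simp add: vec.subspace_add[OF F_sub] so_bracket)
      qed
      then have "\<rho> X *v x \<in> vec.span (F n \<union> {\<rho> X *v y | X y. X \<in> g \<and> y \<in> F n})" by (simp add: FS)
      then show ?case using step(2) by (simp add: mv_simps vec.span_add vec.span_scale)
    qed
  qed
  have F_zero: "moved_coeff y = 0" if "y \<in> F n" for n y
    using that
  proof (induction n arbitrary: y)
    case 0
    then obtain c where "y = c *s u" by (auto simp: F0 vec.span_singleton)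
    then show ?case using assms by (simp add: moved_coeff_scale)
  next
    case (Suc n)
    show ?case using Suc.prems unfolding FS
    proof (induction rule: vec.span_induct_alt)
      case (step c x y)
      have "moved_coeff x = 0"
      proof (cases "x \<in> F n")
        case False
        then obtain Y y' where Y: "x = \<rho> Y *v y'" "Y \<in> g" "y' \<in> F n" using step by blast
        obtain B X where BX: "Y = B + X" "B \<in> moved_borel" "X \<in> levi"
          using so_sum_space[OF Y(2)] by (auto simp: sum_space_def)
        obtain c where c: "B \<in> g" "\<And>x. moved_coeff (\<rho> B *v x) = c * moved_coeff x"
          using BX(2) by (auto simp: moved_borel_def)
        have "moved_coeff x = c * moved_coeff y' + moved_coeff (\<rho> X *v y')"
          using Y BX c levi_so by (simp add: rep mv_simps moved_coeff_add)
        then show ?thesis using Suc.IH[OF Y(3)] Suc.IH[OF F_levi[OF BX(3) Y(3)]] by simp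
      qed (use Suc in auto)
      then show ?case using step by (simp add: moved_coeff_add moved_coeff_scale)
    qed simp
  qed
  have "(\<Union>n. F n) = UNIV"
  proof (rule irreducible[of _ u])
    have mono: "m \<le> n \<Longrightarrow> F m \<subseteq> F n" for m n by (rule lift_Suc_mono_le[of F, OF F_mono])
    show "vec.subspace (\<Union>n. F n)"
    proof (rule vec.subspaceI)
      fix x y assume "x \<in> (\<Union>n. F n)" "y \<in> (\<Union>n. F n)"
      then obtain m n where "x \<in> F m" "y \<in> F n" by auto
      then have "x \<in> F (max m n)" "y \<in> F (max m n)" using mono[of m "max m n"] mono[of n "max m n"] by auto
      then show "x + y \<in> (\<Union>n. F n)" using vec.subspace_add[OF F_sub] by blast
    next
      fix c x assume "x \<in> (\<Union>n. F n)"
      then show "c *s x \<in> (\<Union>n. F n)" using vec.subspace_scale[OF F_sub] by blast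
    qed (use vec.subspace_0[OF F_sub] in auto)
    show "u \<in> (\<Union>n. F n)" using F0 vec.span_base[of u "{u}"] by blast
  qed (use F_act \<open>u \<noteq> 0\<close> in auto)
  then have "moved_coeff (mexp (- \<rho> N) *v v0) = 0" using F_zero by auto
  then show False using moved_coeff_nonzero by simp
qed

theorem invariants_unique:
  assumes "u \<in> invariants levi \<rho>" "u' \<in> invariants levi \<rho>" "u \<noteq> 0"
  shows "\<exists>c. u' = c *s u"
proof -
  have m: "moved_coeff u \<noteq> 0" using moved_coeff_injective assms by blast
  let ?c = "moved_coeff u' / moved_coeff u"
  have "u' + (- ?c) *s u \<in> invariants levi \<rho>" using assms by (simp add: invariants_def mv_simps)
  moreover have "moved_coeff (u' + (- ?c) *s u) = 0" using m by (simp add: moved_coeff_add moved_coeff_scale del: vec.scale_minus_left)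
  ultimately have "u' + (- ?c) *s u = 0" by (rule moved_coeff_injective)
  then show ?thesis by (intro exI[of _ ?c]) simp
qed

text \<open>K acts on the vector E^k u by a k, while the functional has eigenvalue c under K + a E.
  This gives the recursion \<open>step\<close>. As E^k u vanishes for some k but the functional does
  not vanish at u, a factor c - a k must be zero.\<close>

lemma integrality:
  assumes u: "u \<in> invariants levi \<rho>" "u \<noteq> 0"
    and K: "K \<in> levi" and m: "m \<in> I" "m \<noteq> 1" "m \<noteq> -1" and a: "a \<noteq> 0"
    and KE: "bracket K (wedge (v 1) (v m)) = cscale a (wedge (v 1) (v m))"
    and c: "\<And>x. moved_coeff (\<rho> (K + cscale a (wedge (v 1) (v m))) *v x) = c * moved_coeff x"
  shows "\<exists>k::nat. c = a * of_nat k"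
proof -
  let ?E = "wedge (v 1) (v m)"
  define e where "e k = (((*v) (\<rho> ?E)) ^^ k) u" for k
  have e0: "e 0 = u" and eS: "e (Suc k) = \<rho> ?E *v e k" for k by (simp_all add: e_def)
  have com: "\<rho> X *v e k = (b * of_nat k) *s e k" if "X \<in> levi" "bracket X ?E = cscale b ?E" for X b k
  proof (induction k)
    case 0
    then show ?case using u that by (simp add: e0 invariants_def)
  next
    case (Suc k)
    have "\<rho> (bracket X ?E) = bracket (\<rho> X) (\<rho> ?E)" using that levi_so by (intro rep(3)) auto
    then have "\<rho> X *v e (Suc k) = \<rho> (bracket X ?E) *v e k + \<rho> ?E *v (\<rho> X *v e k)"
      by (simp only: bracket_mult_vec eS) simp
    then show ?case using Suc that by (simp add: rep mv_simps eS algebra_simps vec.scale_left_distrib)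
  qed
  have step: "a * moved_coeff (e (Suc k)) = (c - a * of_nat k) * moved_coeff (e k)" for k
  proof -
    have "c * moved_coeff (e k) = moved_coeff ((a * of_nat k) *s e k + a *s e (Suc k))"
      using c[of "e k"] K levi_so com[OF K KE] by (simp add: rep mv_simps so_closed eS)
    then show ?thesis by (simp add: moved_coeff_add moved_coeff_scale algebra_simps)
  qed
  \<comment> \<open>Each application of E raises the eigenvalue of \<open>D\<close> by at least 1,
    which \<open>eigenvalue_bound\<close> cannot allow forever.\<close>
  have deg: "ht 1 + ht m \<ge> 1" using m r_pos by (auto simp: ht_def I_def sgn_if)
  have "\<exists>k. e k = 0"
  proof (rule ccontr)
    assume "\<nexists>k. e k = 0"
    then have ne: "e k \<noteq> 0" for k by blast
    have "real_of_int (ht 1 + ht m) * real k \<le> V.d" for k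
    proof (rule eigenvalue_bound[OF _ ne])
      show "\<rho> D *v e k = of_real (real_of_int (ht 1 + ht m) * real k) *s e k"
        using com[OF D_levi bracket_D_wedge[OF one_I m(1)], of k] by simp
    qed
    moreover have "real k \<le> real_of_int (ht 1 + ht m) * real k" for k
      using deg mult_right_mono[of 1 "real_of_int (ht 1 + ht m)" "real k"] by simp
    ultimately have "real k \<le> V.d" for k using order_trans by blast
    then show False using reals_Archimedean2[of V.d] by (meson not_le)
  qed
  then obtain k where "e k = 0" ..
  then have "moved_coeff (e k) = 0" by simp
  then show ?thesis
  proof (induction k)
    case 0
    then show ?case using moved_coeff_injective u by (simp add: e0)
  next
    case (Suc k)
    then show ?case using step[of k] by auto
  qed
qed

text \<open>Adding or subtracting the moved versions of \<open>h 1\<close> and \<open>h 2\<close>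
  leaves \<open>h 1 \<plusminus> h 2\<close> plus twice a single root vector, so
  \<open>integrality\<close> applies with a = 2, the source of the evenness. For i \<ge> 3 the
  element \<open>h i\<close> commutes with \<open>N\<close> and lies in both algebras, which forces
  the eigenvalue 0.\<close>

theorem invariants_weight:
  assumes u: "u \<in> invariants levi \<rho>" "u \<noteq> 0"
  shows "r = 1 \<Longrightarrow> \<exists>k::nat. L 1 = k"
    and "r \<ge> 2 \<Longrightarrow> \<exists>(i::nat) (j::nat). L 1 + L 2 = 2 * i \<and> L 1 - L 2 = 2 * j"
    and "3 \<le> i \<Longrightarrow> i \<le> r \<Longrightarrow> L i = 0"
proof -
  assume r: "r = 1"
  have "s0 = v 0" unfolding s0_def using r by simp
  then have N: "N = wedge (v 1) (v 0)" by (simp add: N_def)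
  have "\<exists>k::nat. complex_of_real (L 1) = 1 * of_nat k"
    by (rule integrality[OF u h_levi[of 1], of 0])
      (use r zero_I h1_N moved_h[of 1] in \<open>auto simp flip: N\<close>)
  then show "\<exists>k::nat. L 1 = k" by (auto simp: complex_eq_iff)
next
  assume r: "r \<ge> 2"
  have N: "N = wedge (v 1) (v 2) + wedge (v 1) (v (-2))" using r by (simp add: N_def s0_def wedge_add_right)
  have mv: "h i \<in> levi" "h i \<in> g" "1 \<le> i \<and> i \<le> r" if "i = 1 \<or> i = 2" for i using r that by (auto intro: h_levi)
  have hE: "bracket (h 1) (wedge (v 1) (v m)) = wedge (v 1) (v m)"
    "bracket (h 2) (wedge (v 1) (v m)) = cscale (if m = 2 then 1 else - 1) (wedge (v 1) (v m))" if "m = 2 \<or> m = -2" for m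
    using r that two_I by (auto simp: bracket_wedge h_mult_vec wedge_uminus_right)
  have H1: "moved_coeff (\<rho> (h 1 + N) *v x) = of_real (L 1) * moved_coeff x" for x
    using moved_h[of 1 x] r by (simp add: h1_N)
  have H2: "moved_coeff (\<rho> (h 2 + (wedge (v 1) (v 2) - wedge (v 1) (v (-2)))) *v x) = of_real (L 2) * moved_coeff x" for x
    using moved_h[of 2 x] r by (simp add: h2_N)
  have "\<exists>k::nat. complex_of_real (L 1) + of_real (L 2) = 2 * of_nat k"
  proof (rule integrality[OF u])
    show "h 1 + h 2 \<in> levi" using mv by (simp add: levi_closed)
    show "moved_coeff (\<rho> (h 1 + h 2 + cscale 2 (wedge (v 1) (v 2))) *v x) =
        (complex_of_real (L 1) + of_real (L 2)) * moved_coeff x" for x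
    proof -
      have "h 1 + h 2 + cscale 2 (wedge (v 1) (v 2)) = (h 1 + N) + (h 2 + (wedge (v 1) (v 2) - wedge (v 1) (v (-2))))"
        unfolding N by (simp add: matrix_eq mv_simps vec_eq_iff cscale_two(4))
      moreover have "moved_coeff (\<rho> (X + Y) *v x) = moved_coeff (\<rho> X *v x) + moved_coeff (\<rho> Y *v x)"
        if "X \<in> g" "Y \<in> g" for X Y
        using that by (simp add: rep mv_simps moved_coeff_add)
      ultimately show ?thesis
        by (simp only: so_closed h_so N_so wedge_so H1 H2 distrib_right)
    qed
    show "bracket (h 1 + h 2) (wedge (v 1) (v 2)) = cscale 2 (wedge (v 1) (v 2))"
      by (simp add: bracket_add_left hE) (simp add: cscale_two)
  qed (use r two_I in auto)
  moreover have "\<exists>k::nat. complex_of_real (L 1) - of_real (L 2) = 2 * of_nat k"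
  proof (rule integrality[OF u])
    show "h 1 - h 2 \<in> levi" using mv by (simp add: levi_closed)
    show "moved_coeff (\<rho> (h 1 - h 2 + cscale 2 (wedge (v 1) (v (-2)))) *v x) =
        (complex_of_real (L 1) - of_real (L 2)) * moved_coeff x" for x
    proof -
      have "h 1 - h 2 + cscale 2 (wedge (v 1) (v (-2))) = (h 1 + N) + cscale (-1) (h 2 + (wedge (v 1) (v 2) - wedge (v 1) (v (-2))))"
        unfolding N by (simp add: matrix_eq mv_simps vec_eq_iff cscale_two(4))
      moreover have "moved_coeff (\<rho> (X + cscale (-1) Y) *v x) = moved_coeff (\<rho> X *v x) - moved_coeff (\<rho> Y *v x)"
        if "X \<in> g" "Y \<in> g" for X Y
        using that rep(2)[OF that(2), of "-1"] moved_coeff_scale[of "-1" "\<rho> Y *v x"]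
          moved_coeff_add[of "\<rho> X *v x" "- (\<rho> Y *v x)"]
        by (simp add: rep(1) so_closed mv_simps moved_coeff_add del: cmat.scale_minus_left)
      ultimately show ?thesis
        by (simp only: so_closed h_so N_so wedge_so H1 H2 left_diff_distrib)
    qed
    show "bracket (h 1 - h 2) (wedge (v 1) (v (-2))) = cscale 2 (wedge (v 1) (v (-2)))"
      by (simp add: bracket_diff_left hE) (simp add: cscale_two)
  qed (use r two_I in auto)
  ultimately show "\<exists>(i::nat) (j::nat). L 1 + L 2 = 2 * i \<and> L 1 - L 2 = 2 * j"
    by (auto simp: complex_eq_iff)
next
  assume i: "3 \<le> i" "i \<le> r"
  have "bracket (h i) N = 0"
    using i two_I in_I[of i]
    by (simp add: N_def bracket_wedge h_mult_vec s0_def matrix_vector_right_distrib)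
  then have "of_real (L i) * moved_coeff u = 0"
    using moved_h[of i u] i u h_levi[of i] by (simp add: invariants_def)
  then show "L i = 0" using moved_coeff_injective[OF u(1)] u(2) by auto
qed

end


section \<open>Tensor powers of the defining representation\<close>

text \<open>Pascal's rule in the shape that a derivation on a product of two factors requires: G i m
  stands for i applications to the first factor and m to the rest.\<close>

lemma binomial_shift:
  fixes G :: "nat \<Rightarrow> nat \<Rightarrow> complex"
  shows "(\<Sum>i\<le>n. of_nat (n choose i) * (G (Suc i) (n - i) + G i (Suc (n - i)))) =
    (\<Sum>i\<le>Suc n. of_nat (Suc n choose i) * G i (Suc n - i))"
proof -
  have 1: "(\<Sum>i\<le>n. of_nat (n choose i) * G i (Suc (n - i))) =
      G 0 (Suc n) + (\<Sum>i\<le>n. of_nat (n choose Suc i) * G (Suc i) (n - i))"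
  proof -
    have "(\<Sum>i\<le>n. of_nat (n choose i) * G i (Suc (n - i))) = (\<Sum>i\<le>n. of_nat (n choose i) * G i (Suc n - i))"
      by (intro sum.cong) (auto simp: Suc_diff_le)
    also have "\<dots> = (\<Sum>i\<le>Suc n. of_nat (n choose i) * G i (Suc n - i))"
      by (simp add: binomial_eq_0)
    also have "\<dots> = G 0 (Suc n) + (\<Sum>i\<le>n. of_nat (n choose Suc i) * G (Suc i) (n - i))"
      by (subst sum.atMost_Suc_shift) simp
    finally show ?thesis .
  qed
  have 2: "(\<Sum>i\<le>Suc n. of_nat (Suc n choose i) * G i (Suc n - i)) =
      G 0 (Suc n) + (\<Sum>i\<le>n. (of_nat (n choose i) + of_nat (n choose Suc i)) * G (Suc i) (n - i))"
    by (subst sum.atMost_Suc_shift) simp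
  show ?thesis
    unfolding 2 by (simp add: distrib_left distrib_right sum.distrib 1)
qed

text \<open>A tensor product of factors of degree two; the last equation makes it vanish on lists of
  the wrong length, as membership in \<open>tensors\<close> demands.\<close>

fun pair_tensor :: "(int \<Rightarrow> int \<Rightarrow> complex) list \<Rightarrow> int list \<Rightarrow> complex" where
  "pair_tensor [] [] = 1"
| "pair_tensor (\<theta> # \<theta>s) (k # l # ks) = \<theta> k l * pair_tensor \<theta>s ks"
| "pair_tensor _ _ = 0"

definition dl :: "int \<Rightarrow> int \<Rightarrow> complex" where
  "dl a k = (if k = a then 1 else 0)"

context witt
begin

lemma sum_dl [simp]: "a \<in> I \<Longrightarrow> (\<Sum>j\<in>I. f j * dl a j) = f a" "a \<in> I \<Longrightarrow> (\<Sum>j\<in>I. dl a j * f j) = f a"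
  by (simp_all add: dl_def if_distrib if_distribR cong: if_cong)

section \<open>Matrix entries in the weight basis and adjoints\<close>

definition ent :: "complex^('n option)^('n option) \<Rightarrow> int \<Rightarrow> int \<Rightarrow> complex" where
  "ent X k l = (if k \<in> I \<and> l \<in> I then bf (v (- k)) (X *v v l) else 0)"

lemma ent_add: "ent (X + Y) k l = ent X k l + ent Y k l"
  and ent_diff: "ent (X - Y) k l = ent X k l - ent Y k l"
  and ent_cscale: "ent (cscale c X) k l = c * ent X k l"
  by (simp_all add: ent_def mv_simps bf_simps)

lemma ent_zero [simp]: "ent 0 k l = 0"
  by (simp add: ent_def)

lemma ent_mult: "ent (X ** Y) k l = (\<Sum>j\<in>I. ent X k j * ent Y j l)"
proof (cases "k \<in> I \<and> l \<in> I")
  case True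
  have "X *v (Y *v v l) = (\<Sum>j\<in>I. bf (v (- j)) (Y *v v l) *s (X *v v j))"
    using arg_cong[OF expansion[of "Y *v v l"], of "\<lambda>y. X *v y"]
    by (simp only: mv_sum_right vector_scalar_commute)
  then show ?thesis
    using True by (simp add: ent_def matrix_vector_mul_assoc[symmetric] bf_sum_right bf_simps mult.commute)
qed (auto simp: ent_def)

lemma ent_one: "ent (mat 1) k l = (if k \<in> I \<and> l = k then 1 else 0)"
  by (auto simp: ent_def form)

lemma ent_bracket: "ent (bracket X Y) k l = (\<Sum>j\<in>I. ent X k j * ent Y j l) - (\<Sum>j\<in>I. ent Y k j * ent X j l)"
  by (simp add: bracket_def ent_diff ent_mult)

lemma ent_column:
  assumes "X *v v a = c *s v a" "a \<in> I"
  shows "ent X k a = c * dl a k"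
  using assms by (auto simp: ent_def dl_def bf_simps form)

text \<open>Conjugate transposition in the weight basis preserves \<open>g\<close>, since it maps
  \<open>v k \<and> v m\<close> to \<open>v (-m) \<and> v (-k)\<close>. Arguments with this adjoint
  take the place of complete reducibility.\<close>

lemma adjoint_exists:
  assumes "X \<in> g"
  shows "\<exists>Y\<in>g. \<forall>a b. ent Y a b = cnj (ent X b a)"
  using assms
proof (induction rule: so_induct)
  case (wedge k m)
  have "ent (wedge (v (- m)) (v (- k))) a b = cnj (ent (wedge (v k) (v m)) b a)" for a b
    using wedge by (auto simp: ent_def wedge_mult_vec bf_simps form)
  then show ?case by (intro bexI[of _ "wedge (v (- m)) (v (- k))"]) auto
next
  case zero
  show ?case by (intro bexI[of _ 0]) (auto simp: so_closed)
next
  case (add X Y)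
  then obtain X' Y' where "X' \<in> g" "\<forall>a b. ent X' a b = cnj (ent X b a)" "Y' \<in> g" "\<forall>a b. ent Y' a b = cnj (ent Y b a)"
    by blast
  then show ?case by (intro bexI[of _ "X' + Y'"]) (auto simp: so_closed ent_add)
next
  case (scale c X)
  then obtain X' where "X' \<in> g" "\<forall>a b. ent X' a b = cnj (ent X b a)" by blast
  then show ?case by (intro bexI[of _ "cscale (cnj c) X'"]) (auto simp: so_closed ent_cscale)
qed

text \<open>A tensor of degree \<open>n\<close> is a function on index lists of length \<open>n\<close>. Recursion on the list makes
  \<open>E\<^sup>\<otimes>\<^sup>n\<^sup>+\<^sup>1 = E \<otimes> E\<^sup>\<otimes>\<^sup>n\<close> definitional.\<close>

primrec tact :: "complex^('n option)^('n option) \<Rightarrow> int list \<Rightarrow> (int list \<Rightarrow> complex) \<Rightarrow> complex" where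
  "tact X [] = (\<lambda>t. 0)"
| "tact X (k # ks) = (\<lambda>t. (\<Sum>l\<in>I. ent X k l * t (l # ks)) + tact X ks (\<lambda>y. t (k # y)))"

primrec tgrp :: "complex^('n option)^('n option) \<Rightarrow> int list \<Rightarrow> (int list \<Rightarrow> complex) \<Rightarrow> complex" where
  "tgrp X [] = (\<lambda>t. t [])"
| "tgrp X (k # ks) = (\<lambda>t. \<Sum>l\<in>I. ent X k l * tgrp X ks (\<lambda>y. t (l # y)))"

primrec ip :: "nat \<Rightarrow> (int list \<Rightarrow> complex) \<Rightarrow> (int list \<Rightarrow> complex) \<Rightarrow> complex" where
  "ip 0 = (\<lambda>s t. s [] * cnj (t []))"
| "ip (Suc n) = (\<lambda>s t. \<Sum>k\<in>I. ip n (\<lambda>y. s (k # y)) (\<lambda>y. t (k # y)))"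

lemma tact_add: "tact X ks (\<lambda>y. s y + t y) = tact X ks s + tact X ks t"
  by (induction ks arbitrary: s t) (simp_all add: distrib_left sum.distrib)

lemma tact_scale: "tact X ks (\<lambda>y. c * t y) = c * tact X ks t"
  by (induction ks arbitrary: t) (simp_all add: distrib_left sum_distrib_left mult_ac)

lemma tact_zero [simp]: "tact X ks (\<lambda>y. 0) = 0"
  using tact_scale[of X ks 0] by simp

lemma tact_sum: "tact X ks (\<lambda>y. \<Sum>k\<in>K. f k y) = (\<Sum>k\<in>K. tact X ks (f k))"
  by (induction K rule: infinite_finite_induct) (simp_all add: tact_add)

lemma tact_add_left: "tact (X + Y) ks t = tact X ks t + tact Y ks t"
  by (induction ks arbitrary: t) (simp_all add: distrib_right sum.distrib ent_add)

lemma tact_scale_left: "tact (cscale c X) ks t = c * tact X ks t"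
  by (induction ks arbitrary: t) (simp_all add: distrib_left sum_distrib_left mult_ac ent_cscale)

lemma tact_bracket:
  "tact (bracket X Y) ks t = tact X ks (\<lambda>y. tact Y y t) - tact Y ks (\<lambda>y. tact X y t)"
proof (induction ks arbitrary: t)
  case (Cons k ks)
  \<comment> \<open>The two middle sums are symmetric in X and Y and cancel in the
    commutator.\<close>
  have *: "tact X (k # ks) (\<lambda>y. tact Y y t) =
      (\<Sum>j\<in>I. (\<Sum>l\<in>I. ent X k l * ent Y l j) * t (j # ks)) + (\<Sum>l\<in>I. ent X k l * tact Y ks (\<lambda>y. t (l # y)))
      + (\<Sum>l\<in>I. ent Y k l * tact X ks (\<lambda>y. t (l # y))) + tact X ks (\<lambda>y. tact Y y (\<lambda>y. t (k # y)))" for X Y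
  proof -
    have "(\<Sum>l\<in>I. ent X k l * (\<Sum>j\<in>I. ent Y l j * t (j # ks))) = (\<Sum>j\<in>I. (\<Sum>l\<in>I. ent X k l * ent Y l j) * t (j # ks))"
      by (simp only: sum_distrib_left sum_distrib_right mult.assoc) (rule sum.swap)
    then show ?thesis
      by (simp add: tact_add tact_sum tact_scale distrib_left sum.distrib)
  qed
  show ?case
    unfolding * by (simp add: Cons ent_bracket left_diff_distrib sum_subtractf)
qed simp

text \<open>The support condition makes the Hermitian form definite, since \<open>ip n\<close> looks
  only at index lists over \<open>I\<close> of length n.\<close>

definition tensors :: "nat \<Rightarrow> (int list \<Rightarrow> complex) set" where
  "tensors n = {t. \<forall>ks. t ks \<noteq> 0 \<longrightarrow> set ks \<subseteq> I \<and> length ks = n}"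

lemma tact_tensors:
  assumes "t \<in> tensors n"
  shows "(\<lambda>ks. tact X ks t) \<in> tensors n"
proof -
  have *: "set ks \<subseteq> I \<and> length ks = n" if "tact X ks t \<noteq> 0" "t \<in> tensors n" for ks n t
    using that
  proof (induction ks arbitrary: t n)
    case (Cons k ks)
    show ?case
    proof (cases "(\<Sum>l\<in>I. ent X k l * t (l # ks)) = 0")
      case True
      then have ne: "tact X ks (\<lambda>y. t (k # y)) \<noteq> 0" using Cons.prems by simp
      have "\<exists>y. t (k # y) \<noteq> 0"
      proof (rule ccontr)
        assume "\<nexists>y. t (k # y) \<noteq> 0"
        then have "(\<lambda>y. t (k # y)) = (\<lambda>y. 0)" by blast
        then show False using ne by simp
      qed
      then obtain m where m: "k \<in> I" "n = Suc m" using Cons.prems(2) by (cases n) (auto simp: tensors_def)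
      then have "(\<lambda>y. t (k # y)) \<in> tensors m" using Cons.prems(2) unfolding tensors_def by fastforce
      from Cons.IH[OF ne this] show ?thesis using m by simp
    next
      case False
      then obtain l where "l \<in> I" "ent X k l * t (l # ks) \<noteq> 0" by (meson sum.not_neutral_contains_not_neutral)
      then have "k \<in> I" "t (l # ks) \<noteq> 0" by (auto simp: ent_def split: if_splits)
      moreover from this(2) have "set (l # ks) \<subseteq> I \<and> length (l # ks) = n"
        using Cons.prems(2) unfolding tensors_def by blast
      ultimately show ?thesis by simp
    qed
  qed simp
  show ?thesis by (subst tensors_def) (use *[OF _ assms] in blast)
qed

section \<open>The Hermitian form on tensors\<close>

lemma ip_add_left: "ip n (\<lambda>y. s y + s' y) t = ip n s t + ip n s' t"
  by (induction n arbitrary: s s' t) (simp_all add: distrib_right sum.distrib)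

lemma ip_scale_left: "ip n (\<lambda>y. c * s y) t = c * ip n s t"
  by (induction n arbitrary: s t) (simp_all add: sum_distrib_left)

lemma ip_cnj: "ip n t s = cnj (ip n s t)"
proof (induction n arbitrary: s t)
  case (Suc n)
  show ?case unfolding ip.simps cnj_sum by (intro sum.cong refl Suc)
qed simp

lemma ip_diff_left: "ip n (\<lambda>y. s y - s' y) t = ip n s t - ip n s' t"
  using ip_add_left[of n "\<lambda>y. s y - s' y" s' t] by simp

lemma ip_add_right: "ip n s (\<lambda>y. t y + t' y) = ip n s t + ip n s t'"
  unfolding ip_cnj[of n s] by (simp add: ip_add_left)

lemma ip_scale_right: "ip n s (\<lambda>y. c * t y) = cnj c * ip n s t"
  unfolding ip_cnj[of n s] by (simp add: ip_scale_left)

lemma ip_zero [simp]: "ip n (\<lambda>y. 0) t = 0" "ip n t (\<lambda>y. 0) = 0"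
  using ip_scale_left[of n 0 t t] ip_scale_right[of n t 0 t] by simp_all

lemma ip_sum_right: "ip n s (\<lambda>y. \<Sum>k\<in>K. f k y) = (\<Sum>k\<in>K. ip n s (f k))"
  by (induction K rule: infinite_finite_induct) (simp_all add: ip_add_right)

lemma ip_sum_left: "ip n (\<lambda>y. \<Sum>k\<in>K. f k y) t = (\<Sum>k\<in>K. ip n (f k) t)"
  by (induction K rule: infinite_finite_induct) (simp_all add: ip_add_left)

lemma ip_cong:
  assumes "\<And>ks. set ks \<subseteq> I \<Longrightarrow> s ks = s' ks"
  shows "ip n s t = ip n s' t"
  using assms
proof (induction n arbitrary: s s' t)
  case (Suc n)
  show ?case unfolding ip.simps by (intro sum.cong refl Suc.IH Suc.prems) auto
qed simp

lemma ip_adjoint: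
  assumes adj: "\<forall>a b. ent Y a b = cnj (ent X b a)"
  shows "ip n (\<lambda>ks. tact X ks s) t = ip n s (\<lambda>ks. tact Y ks t)"
proof (induction n arbitrary: s t)
  case (Suc n)
  have "(\<Sum>k\<in>I. \<Sum>l\<in>I. ent X k l * ip n (\<lambda>y. s (l # y)) (\<lambda>y. t (k # y)))
      = (\<Sum>k\<in>I. \<Sum>l\<in>I. ent X l k * ip n (\<lambda>y. s (k # y)) (\<lambda>y. t (l # y)))"
    by (rule sum.swap)
  then show ?case
    by (simp add: ip_add_left ip_add_right ip_sum_left ip_sum_right ip_scale_left ip_scale_right
        sum.distrib Suc adj)
qed simp

lemma ip_definite_aux:
  "\<exists>q. ip n t t = complex_of_real q \<and> q \<ge> 0 \<and> (q = 0 \<longrightarrow> (\<forall>ks. set ks \<subseteq> I \<and> length ks = n \<longrightarrow> t ks = 0))"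
proof (induction n arbitrary: t)
  case 0
  show ?case
    by (rule exI[of _ "(cmod (t []))\<^sup>2"]) (simp add: complex_norm_square[symmetric])
next
  case (Suc n)
  have "\<forall>k. \<exists>q. ip n (\<lambda>y. t (k # y)) (\<lambda>y. t (k # y)) = complex_of_real q \<and> q \<ge> 0 \<and>
     (q = 0 \<longrightarrow> (\<forall>ks. set ks \<subseteq> I \<and> length ks = n \<longrightarrow> t (k # ks) = 0))"
    using Suc by blast
  then obtain q where q: "\<And>k. ip n (\<lambda>y. t (k # y)) (\<lambda>y. t (k # y)) = complex_of_real (q k)" "\<And>k. q k \<ge> 0"
    "\<And>k ks. q k = 0 \<Longrightarrow> set ks \<subseteq> I \<Longrightarrow> length ks = n \<Longrightarrow> t (k # ks) = 0"
    by metis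
  show ?case
  proof (intro exI[of _ "\<Sum>k\<in>I. q k"] conjI impI allI)
    show "ip (Suc n) t t = complex_of_real (\<Sum>k\<in>I. q k)" by (simp add: q)
    show "(\<Sum>k\<in>I. q k) \<ge> 0" by (simp add: q sum_nonneg)
    fix ks assume 0: "(\<Sum>k\<in>I. q k) = 0" and ks: "set ks \<subseteq> I \<and> length ks = Suc n"
    then show "t ks = 0"
      using q(2,3) by (cases ks) (auto simp: sum_nonneg_eq_0_iff)
  qed
qed

lemma ip_definite:
  assumes "ip n t t = 0" "t \<in> tensors n"
  shows "t = (\<lambda>ks. 0)"
proof -
  have "\<forall>ks. set ks \<subseteq> I \<and> length ks = n \<longrightarrow> t ks = 0"
    using ip_definite_aux[of n t] assms(1) by auto
  then show ?thesis using assms(2) unfolding tensors_def by (intro ext) blast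
qed


subsection \<open>Exponentials\<close>

definition tpow :: "complex^('n option)^('n option) \<Rightarrow> nat \<Rightarrow> (int list \<Rightarrow> complex) \<Rightarrow> int list \<Rightarrow> complex" where
  "tpow X n = (\<lambda>t ks. tact X ks t) ^^ n"

lemma tpow_0 [simp]: "tpow X 0 t = t"
  and tpow_Suc: "tpow X (Suc n) t ks = tact X ks (tpow X n t)"
  by (simp_all add: tpow_def)

lemma tpow_Suc2: "tpow X (Suc n) t = tpow X n (\<lambda>ks. tact X ks t)"
  unfolding tpow_def by (simp only: funpow_Suc_right o_apply)

lemma tpow_add: "tpow X n (\<lambda>y. s y + t y) ks = tpow X n s ks + tpow X n t ks"
proof (induction n arbitrary: ks)
  case (Suc n)
  have "tpow X n (\<lambda>y. s y + t y) = (\<lambda>ks. tpow X n s ks + tpow X n t ks)" using Suc by blast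
  then show ?case by (simp add: tpow_Suc tact_add)
qed simp

lemma tpow_scale: "tpow X n (\<lambda>y. c * t y) ks = c * tpow X n t ks"
proof (induction n arbitrary: ks)
  case (Suc n)
  have "tpow X n (\<lambda>y. c * t y) = (\<lambda>ks. c * tpow X n t ks)" using Suc by blast
  then show ?case by (simp add: tpow_Suc tact_scale)
qed simp

lemma tpow_sum: "tpow X n (\<lambda>y. \<Sum>k\<in>K. f k y) ks = (\<Sum>k\<in>K. tpow X n (f k) ks)"
  using tpow_scale[of X n 0 "\<lambda>_. 0"]
  by (induction K rule: infinite_finite_induct) (simp_all add: tpow_add)

text \<open>The binomial theorem for the two commuting parts of the action, on the first factor and
  on the remaining ones.\<close>

lemma tpow_Cons:
  assumes k: "k \<in> I"
  shows "tpow X n t (k # ks) =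
    (\<Sum>i\<le>n. of_nat (n choose i) * (\<Sum>l\<in>I. ent (mpow X i) k l * tpow X (n - i) (\<lambda>y. t (l # y)) ks))"
proof (induction n arbitrary: t)
  case 0
  have "(\<Sum>l\<in>I. ent (mat 1) k l * t (l # ks)) = (\<Sum>l\<in>I. if l = k then t (l # ks) else 0)"
    using k by (intro sum.cong) (auto simp: ent_one)
  then show ?case using k by simp
next
  case (Suc n)
  define G where "G i m = (\<Sum>l\<in>I. ent (mpow X i) k l * tpow X m (\<lambda>y. t (l # y)) ks)" for i m
  have "(\<Sum>l\<in>I. ent (mpow X i) k l * tpow X m (\<lambda>y. tact X (l # y) t) ks) = G (Suc i) m + G i (Suc m)" for i m
  proof -
    have "tpow X m (\<lambda>y. tact X (l # y) t) ks = (\<Sum>j\<in>I. ent X l j * tpow X m (\<lambda>y. t (j # y)) ks)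
        + tpow X (Suc m) (\<lambda>y. t (l # y)) ks" for l
      by (simp add: tpow_add tpow_sum tpow_scale tpow_Suc2)
    then have "(\<Sum>l\<in>I. ent (mpow X i) k l * tpow X m (\<lambda>y. tact X (l # y) t) ks) =
        (\<Sum>l\<in>I. \<Sum>j\<in>I. ent (mpow X i) k l * ent X l j * tpow X m (\<lambda>y. t (j # y)) ks) + G i (Suc m)"
      by (simp add: G_def distrib_left sum.distrib sum_distrib_left mult.assoc)
    also have "(\<Sum>l\<in>I. \<Sum>j\<in>I. ent (mpow X i) k l * ent X l j * tpow X m (\<lambda>y. t (j # y)) ks) = G (Suc i) m"
      unfolding G_def mpow_Suc2 ent_mult by (subst sum.swap) (simp add: sum_distrib_right)
    finally show ?thesis .
  qed
  then have "tpow X (Suc n) t (k # ks) = (\<Sum>i\<le>n. of_nat (n choose i) * (G (Suc i) (n - i) + G i (Suc (n - i))))"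
    unfolding tpow_Suc2 Suc by (intro sum.cong) auto
  also have "\<dots> = (\<Sum>i\<le>Suc n. of_nat (Suc n choose i) * G i (Suc n - i))"
    by (rule binomial_shift)
  finally show ?case unfolding G_def .
qed

text \<open>By the Leibniz rule \<open>tpow_Cons\<close>, the exponential series on a longer list is
  a sum of Cauchy products of the matrix series with the series on the shorter list.\<close>

lemma tgrp_mexp:
  assumes "set ks \<subseteq> I"
  shows "exp_summable (\<lambda>n. tpow X n t ks)" "exp_sum (\<lambda>n. tpow X n t ks) = tgrp (mexp X) ks t"
proof -
  have "exp_summable (\<lambda>n. tpow X n t ks) \<and> exp_sum (\<lambda>n. tpow X n t ks) = tgrp (mexp X) ks t"
    using assms
  proof (induction ks arbitrary: t)
    case Nil
    have "tpow X n t [] = (if n = 0 then t [] else 0)" for n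
      by (cases n) (simp_all add: tpow_Suc)
    then have n: "(\<lambda>n. tpow X n t []) = (\<lambda>n. if n = 0 then t [] else 0)" by blast
    have "summable (\<lambda>n. norm ((if n = 0 then t [] else 0) / fact n))"
      by (rule summable_finite[of "{0}"]) auto
    moreover have "exp_sum (\<lambda>n. if n = 0 then t [] else 0) = t []"
      unfolding exp_sum_def by (subst suminf_finite[of "{0}"]) auto
    ultimately show ?case unfolding n by (simp add: exp_summable_def)
  next
    case (Cons k ks)
    have k: "k \<in> I" using Cons.prems by simp
    have IH: "exp_summable (\<lambda>n. tpow X n (\<lambda>y. t (l # y)) ks)"
      "exp_sum (\<lambda>n. tpow X n (\<lambda>y. t (l # y)) ks) = tgrp (mexp X) ks (\<lambda>y. t (l # y))" for l
      using Cons by simp_all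
    have E: "exp_summable (\<lambda>n. ent (mpow X n) k l)" "exp_sum (\<lambda>n. ent (mpow X n) k l) = ent (mexp X) k l" for l
      using exp_summable_mpow_linear[of "\<lambda>A. ent A k l" X] by (simp_all add: ent_add ent_cscale)
    have eq: "tpow X n t (k # ks) = (\<Sum>l\<in>I. \<Sum>i\<le>n. of_nat (n choose i) *
        (ent (mpow X i) k l * tpow X (n - i) (\<lambda>y. t (l # y)) ks))" for n
      unfolding tpow_Cons[OF k] by (subst sum.swap) (simp add: sum_distrib_left)
    show ?case
      unfolding eq
      using exp_summable_sum[of I "\<lambda>l n. \<Sum>i\<le>n. of_nat (n choose i) *
        (ent (mpow X i) k l * tpow X (n - i) (\<lambda>y. t (l # y)) ks)"]
      by (simp add: exp_summable_Cauchy[OF E(1) IH(1)] E(2) IH(2))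
  qed
  then show "exp_summable (\<lambda>n. tpow X n t ks)" "exp_sum (\<lambda>n. tpow X n t ks) = tgrp (mexp X) ks t" by auto
qed

text \<open>Exponential series of tensors converge entry by entry, and the form is a finite sum over
  entries.\<close>

lemma ip_exp_sum:
  assumes "\<And>ks. set ks \<subseteq> I \<Longrightarrow> exp_summable (\<lambda>m. s m ks)"
  shows "exp_summable (\<lambda>m. ip n (s m) t)" "exp_sum (\<lambda>m. ip n (s m) t) = ip n (\<lambda>ks. exp_sum (\<lambda>m. s m ks)) t"
proof -
  have "exp_summable (\<lambda>m. ip n (s m) t) \<and> exp_sum (\<lambda>m. ip n (s m) t) = ip n (\<lambda>ks. exp_sum (\<lambda>m. s m ks)) t"
    using assms
  proof (induction n arbitrary: s t)
    case 0
    have s: "summable (\<lambda>m. norm (s m [] / fact m))" using 0[of "[]"] by (simp add: exp_summable_def)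
    then have "summable (\<lambda>m. norm (s m [] / fact m) * norm (t []))" by (rule summable_mult2)
    moreover have "(\<Sum>m. s m [] / fact m * cnj (t [])) = (\<Sum>m. s m [] / fact m) * cnj (t [])"
      using suminf_mult2[OF summable_norm_cancel[OF s]] by simp
    ultimately show ?case by (simp add: exp_summable_def exp_sum_def norm_mult norm_divide)
  next
    case (Suc n)
    have IH: "exp_summable (\<lambda>m. ip n (\<lambda>y. s m (k # y)) (\<lambda>y. t (k # y)))"
      "exp_sum (\<lambda>m. ip n (\<lambda>y. s m (k # y)) (\<lambda>y. t (k # y))) = ip n (\<lambda>ks. exp_sum (\<lambda>m. s m (k # ks))) (\<lambda>y. t (k # y))"
      if "k \<in> I" for k
      using Suc.IH[of "\<lambda>m y. s m (k # y)" "\<lambda>y. t (k # y)"] Suc.prems that by simp_all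
    show ?case
      using exp_summable_sum[of I "\<lambda>k m. ip n (\<lambda>y. s m (k # y)) (\<lambda>y. t (k # y))"] IH
      by simp
  qed
  then show "exp_summable (\<lambda>m. ip n (s m) t)" "exp_sum (\<lambda>m. ip n (s m) t) = ip n (\<lambda>ks. exp_sum (\<lambda>m. s m ks)) t"
    by auto
qed

lemma ip_tgrp_mexp: "ip n (\<lambda>ks. tgrp (mexp X) ks s) t = exp_sum (\<lambda>m. ip n (tpow X m s) t)"
  by (subst ip_exp_sum(2)) (simp_all add: tgrp_mexp cong: ip_cong)

lemma tgrp_cong:
  assumes "\<And>ks. set ks \<subseteq> I \<Longrightarrow> s ks = t ks"
  shows "tgrp X ks s = tgrp X ks t"
  using assms
proof (induction ks arbitrary: s t)
  case (Cons k ks)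
  show ?case unfolding tgrp.simps by (intro sum.cong refl arg_cong2[of _ _ _ _ "(*)"] Cons.IH Cons.prems) auto
qed simp

lemma tgrp_add: "tgrp X ks (\<lambda>y. s y + t y) = tgrp X ks s + tgrp X ks t"
  by (induction ks arbitrary: s t) (simp_all add: distrib_left sum.distrib)

lemma tgrp_scale: "tgrp X ks (\<lambda>y. c * t y) = c * tgrp X ks t"
  by (induction ks arbitrary: t) (simp_all add: sum_distrib_left mult_ac)

lemma tgrp_diff: "tgrp X ks (\<lambda>y. s y - t y) = tgrp X ks s - tgrp X ks t"
  using tgrp_add[of X ks "\<lambda>y. s y - t y" t] by simp

lemma tgrp_zero [simp]: "tgrp X ks (\<lambda>y. 0) = 0"
  using tgrp_scale[of X ks 0] by simp

lemma tgrp_sum: "tgrp X ks (\<lambda>y. \<Sum>k\<in>K. f k y) = (\<Sum>k\<in>K. tgrp X ks (f k))"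
  by (induction K rule: infinite_finite_induct) (simp_all add: tgrp_add)

lemma tgrp_mult: "tgrp (X ** Y) ks t = tgrp X ks (\<lambda>y. tgrp Y y t)"
proof (induction ks arbitrary: t)
  case (Cons k ks)
  have "tgrp (X ** Y) (k # ks) t = (\<Sum>l\<in>I. \<Sum>j\<in>I. ent X k j * ent Y j l * tgrp (X ** Y) ks (\<lambda>y. t (l # y)))"
    by (simp add: ent_mult sum_distrib_right)
  also have "\<dots> = (\<Sum>j\<in>I. \<Sum>l\<in>I. ent X k j * ent Y j l * tgrp (X ** Y) ks (\<lambda>y. t (l # y)))"
    by (rule sum.swap)
  also have "\<dots> = tgrp X (k # ks) (\<lambda>y. tgrp Y y t)"
    by (simp add: Cons tgrp_sum tgrp_scale sum_distrib_left mult.assoc)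
  finally show ?case .
qed simp

lemma tgrp_one: "set ks \<subseteq> I \<Longrightarrow> tgrp (mat 1) ks t = t ks"
proof (induction ks arbitrary: t)
  case (Cons k ks)
  have "(\<Sum>l\<in>I. ent (mat 1) k l * tgrp (mat 1) ks (\<lambda>y. t (l # y))) = (\<Sum>l\<in>I. if l = k then t (l # ks) else 0)"
    using Cons by (intro sum.cong) (auto simp: ent_one)
  then show ?case using Cons by simp
qed simp


subsection \<open>Products of tensors of degree two\<close>

lemma tact_pair_tensor:
  assumes "\<And>\<theta> k l. \<theta> \<in> set \<theta>s \<Longrightarrow> (\<Sum>j\<in>I. ent X k j * \<theta> j l) + (\<Sum>j\<in>I. ent X l j * \<theta> k j) = c \<theta> * \<theta> k l"
  shows "tact X ks (pair_tensor \<theta>s) = (\<Sum>\<theta>\<leftarrow>\<theta>s. c \<theta>) * pair_tensor \<theta>s ks"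
  using assms
proof (induction \<theta>s arbitrary: ks)
  case Nil
  then show ?case by (cases ks) simp_all
next
  case (Cons \<theta> \<theta>s)
  have th: "(\<Sum>j\<in>I. ent X k j * \<theta> j l) + (\<Sum>j\<in>I. ent X l j * \<theta> k j) = c \<theta> * \<theta> k l" for k l
    using Cons.prems by simp
  have IH: "tact X ks (pair_tensor \<theta>s) = (\<Sum>\<theta>\<leftarrow>\<theta>s. c \<theta>) * pair_tensor \<theta>s ks" for ks
    using Cons by simp
  show ?case
  proof (cases ks)
    case ks1: (Cons k ks')
    show ?thesis
    proof (cases ks')
      case (Cons l ks'')
      have "tact X ks (pair_tensor (\<theta> # \<theta>s)) = ((\<Sum>j\<in>I. ent X k j * \<theta> j l) + (\<Sum>j\<in>I. ent X l j * \<theta> k j)) * pair_tensor \<theta>s ks''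
         + \<theta> k l * tact X ks'' (pair_tensor \<theta>s)"
        by (simp add: ks1 Cons tact_scale distrib_right sum_distrib_right mult.assoc)
      also have "\<dots> = c \<theta> * \<theta> k l * pair_tensor \<theta>s ks'' + \<theta> k l * ((\<Sum>\<theta>\<leftarrow>\<theta>s. c \<theta>) * pair_tensor \<theta>s ks'')"
        unfolding th IH ..
      finally show ?thesis by (simp add: ks1 Cons algebra_simps)
    qed (simp add: ks1)
  qed simp
qed

definition conj2 :: "complex^('n option)^('n option) \<Rightarrow> (int \<Rightarrow> int \<Rightarrow> complex) \<Rightarrow> int \<Rightarrow> int \<Rightarrow> complex" where
  "conj2 X \<theta> k l = (\<Sum>i\<in>I. \<Sum>j\<in>I. ent X k i * (ent X l j * \<theta> i j))"

lemma tgrp_pair_tensor: "tgrp X ks (pair_tensor \<theta>s) = pair_tensor (map (conj2 X) \<theta>s) ks"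
proof (induction \<theta>s arbitrary: ks)
  case Nil
  then show ?case by (cases ks) simp_all
next
  case (Cons \<theta> \<theta>s)
  show ?case
  proof (cases ks)
    case ks1: (Cons k ks')
    show ?thesis
    proof (cases ks')
      case (Cons l ks'')
      show ?thesis
        by (simp add: ks1 Cons tgrp_scale Cons.IH conj2_def sum_distrib_left sum_distrib_right mult.assoc)
    qed (simp add: ks1)
  qed simp
qed

lemma ip_pair_tensor:
  assumes "length \<theta>s = length \<eta>s"
  shows "ip (2 * length \<theta>s) (pair_tensor \<theta>s) (pair_tensor \<eta>s) =
    (\<Prod>(\<theta>, \<eta>)\<leftarrow>zip \<theta>s \<eta>s. \<Sum>k\<in>I. \<Sum>l\<in>I. \<theta> k l * cnj (\<eta> k l))"
  using assms
proof (induction rule: list_induct2)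
  case (Cons \<theta> \<theta>s \<eta> \<eta>s)
  have "ip (2 * length (\<theta> # \<theta>s)) (pair_tensor (\<theta> # \<theta>s)) (pair_tensor (\<eta> # \<eta>s)) =
    (\<Sum>k\<in>I. \<Sum>l\<in>I. \<theta> k l * (cnj (\<eta> k l) * ip (2 * length \<theta>s) (pair_tensor \<theta>s) (pair_tensor \<eta>s)))"
    by (simp add: ip_scale_left ip_scale_right)
  then show ?case
    unfolding Cons.IH by (simp add: sum_distrib_right mult.assoc)
qed simp

lemma pair_tensor_tensors:
  assumes "\<And>\<theta> k l. \<theta> \<in> set \<theta>s \<Longrightarrow> \<theta> k l \<noteq> 0 \<Longrightarrow> k \<in> I \<and> l \<in> I"
  shows "pair_tensor \<theta>s \<in> tensors (2 * length \<theta>s)"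
proof -
  have "set ks \<subseteq> I \<and> length ks = 2 * length \<theta>s" if "pair_tensor \<theta>s ks \<noteq> 0" for ks
    using that assms
  proof (induction \<theta>s ks rule: pair_tensor.induct)
    case (2 \<theta> \<theta>s k l ks)
    then show ?case by auto
  qed auto
  then show ?thesis by (auto simp: tensors_def)
qed

lemma pair_tensor_scale:
  "pair_tensor (map (\<lambda>\<theta> k l. c \<theta> * \<theta> k l) \<theta>s) ks = (\<Prod>\<theta>\<leftarrow>\<theta>s. c \<theta>) * pair_tensor \<theta>s ks"
  by (induction \<theta>s ks rule: pair_tensor.induct) simp_all

end


section \<open>Existence of the invariant vector\<close>

text \<open>The numbers a and b parametrize the weights \<open>(2 a + b, b)\<close>, whose entries
  have equal parity. In rank 1 the vector \<open>v 1 \<and> v 0\<close> has weight \<epsilon>_1, and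
  b alone is the weight.\<close>

locale hw_tensor = hw_rep v r z I \<rho> v0 L
  for v :: "int \<Rightarrow> complex^('n::finite option)" and r z I
    and \<rho> :: "complex^('n option)^('n option) \<Rightarrow> complex^('d::finite)^'d" and v0 L +
  fixes a b :: nat
  assumes L1: "L 1 = 2 * a + b" and a0: "r = 1 \<Longrightarrow> a = 0" and L2: "r \<ge> 2 \<Longrightarrow> L 2 = b"
    and L3: "\<And>i. 3 \<le> i \<Longrightarrow> i \<le> r \<Longrightarrow> L i = 0"
begin

section \<open>The highest weight tensor and the \<open>levi\<close>-invariant tensor\<close>

definition kap :: int where
  "kap = (if r \<ge> 2 then 2 else 0)"

lemma kap: "kap \<in> I" "kap \<noteq> 1" "kap \<noteq> -1"
  using rank two_I zero_I by (auto simp: kap_def)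

definition th1 :: "int \<Rightarrow> int \<Rightarrow> complex" where "th1 k l = dl 1 k * dl 1 l"
definition th2 :: "int \<Rightarrow> int \<Rightarrow> complex" where "th2 k l = dl 1 k * dl kap l - dl kap k * dl 1 l"
definition et1 :: "int \<Rightarrow> int \<Rightarrow> complex" where "et1 k l = dl 1 k * dl (-1) l + dl (-1) k * dl 1 l"
definition et2 :: "int \<Rightarrow> int \<Rightarrow> complex" where "et2 k l = dl 1 k * dl (-1) l - dl (-1) k * dl 1 l"

text \<open>Up to the embedding into the tensor power, \<open>w = v\<^sub>1\<^sup>2\<^sup>a (v\<^sub>1 \<and> v\<^sub>2)\<^sup>b\<close> is a highest weight vector of
  weight \<open>(2a + b, b)\<close>, and \<open>u0 = (v\<^sub>1 v\<^sub>-\<^sub>1)\<^sup>a (v\<^sub>1 \<and> v\<^sub>-\<^sub>1)\<^sup>b\<close> is killed by \<open>levi\<close>. For \<open>r = 1\<close> the vector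
  \<open>v\<^sub>0\<close> takes the place of \<open>v\<^sub>2\<close>.\<close>

definition w :: "int list \<Rightarrow> complex" where
  "w = pair_tensor (replicate a th1 @ replicate b th2)"

definition u0 :: "int list \<Rightarrow> complex" where
  "u0 = pair_tensor (replicate a et1 @ replicate b et2)"

definition deg :: nat where
  "deg = 2 * (a + b)"

lemma sum_dl2:
  "p \<in> I \<Longrightarrow> (\<Sum>j\<in>I. f j * (dl p j * c)) = f p * c" "p \<in> I \<Longrightarrow> (\<Sum>j\<in>I. f j * (c * dl p j)) = f p * c"
  by (simp_all add: dl_def if_distrib if_distribR cong: if_cong)

lemma m1_I: "-1 \<in> I"
  by simp

text \<open>Distinctness lets a scalar that depends on the factor be given by a case distinction on
  the factor itself.\<close>

lemma th12: "th1 \<noteq> th2" "et1 \<noteq> et2"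
proof -
  have "th1 1 1 \<noteq> th2 1 1" "et1 (-1) 1 \<noteq> et2 (-1) 1"
    using kap by (auto simp: th1_def th2_def et1_def et2_def dl_def)
  then show "th1 \<noteq> th2" "et1 \<noteq> et2" by metis+
qed

text \<open>The component e along \<open>v 1\<close> drops out of \<open>v 1 \<and> v kap\<close>,
  so Cartan elements and raising operators are covered at once.\<close>

lemma tact_w:
  assumes X1: "X *v v 1 = c *s v 1" and X2: "X *v v kap = c' *s v kap + e *s v 1"
  shows "tact X ks w = (of_nat a * (2 * c) + of_nat b * (c + c')) * w ks"
proof -
  have e1: "ent X k 1 = c * dl 1 k" for k using X1 by (intro ent_column) simp_all
  have e2: "ent X k kap = c' * dl kap k + e * dl 1 k" for k
    using X2 kap(1) by (auto simp: ent_def dl_def bf_simps form)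
  have "tact X ks w = (\<Sum>\<theta>\<leftarrow>replicate a th1 @ replicate b th2. if \<theta> = th1 then 2 * c else c + c') * w ks"
    unfolding w_def
  proof (rule tact_pair_tensor)
    fix \<theta> k l assume "\<theta> \<in> set (replicate a th1 @ replicate b th2)"
    then consider "\<theta> = th1" | "\<theta> = th2" by auto
    then show "(\<Sum>j\<in>I. ent X k j * \<theta> j l) + (\<Sum>j\<in>I. ent X l j * \<theta> k j) = (if \<theta> = th1 then 2 * c else c + c') * \<theta> k l"
    proof cases
      case 1
      then show ?thesis by (simp add: th1_def sum_dl2 e1)
    next
      case 2
      have "(\<Sum>j\<in>I. ent X k j * th2 j l) + (\<Sum>j\<in>I. ent X l j * th2 k j) = (c + c') * th2 k l"
        using kap(1) by (simp add: th2_def right_diff_distrib sum_subtractf sum_dl2 e1 e2) (simp add: algebra_simps)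
      then show ?thesis using 2 th12 by simp
    qed
  qed
  then show ?thesis using th12 by (simp add: sum_list_replicate)
qed

lemma tact_u0:
  assumes "X \<in> levi"
  shows "tact X ks u0 = 0"
proof -
  obtain c where X: "X *v v 1 = c *s v 1" "X *v v (-1) = (- c) *s v (-1)"
    using assms by (auto simp: levi_def)
  have e1: "ent X k 1 = c * dl 1 k" "ent X k (-1) = (- c) * dl (-1) k" for k
    using X by (simp_all only: ent_column one_I m1_I)
  have "tact X ks u0 = (\<Sum>\<theta>\<leftarrow>replicate a et1 @ replicate b et2. 0) * u0 ks"
    unfolding u0_def
  proof (rule tact_pair_tensor)
    fix \<theta> k l assume "\<theta> \<in> set (replicate a et1 @ replicate b et2)"
    then consider "\<theta> = et1" | "\<theta> = et2" by auto
    then show "(\<Sum>j\<in>I. ent X k j * \<theta> j l) + (\<Sum>j\<in>I. ent X l j * \<theta> k j) = 0 * \<theta> k l"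
      by cases (simp add: et1_def distrib_left sum.distrib sum_dl2 e1,
        simp add: et2_def right_diff_distrib sum_subtractf sum_dl2 e1)
  qed
  then show ?thesis by (simp add: sum_list_replicate)
qed

lemma w_raising:
  assumes "k \<in> I" "m \<in> I" "ht k + ht m > 0"
  shows "tact (wedge (v k) (v m)) ks w = 0"
proof -
  have b1: "\<bar>ht j\<bar> \<le> r" if "j \<in> I" for j using that by (auto simp: ht_def I_def sgn_if abs_if)
  have h1: "ht (-1) = - r" using r_pos by (simp add: ht_def)
  \<comment> \<open>\<open>v (-1)\<close> is the lowest vector, so it cannot occur in a raising
    wedge, and it alone pairs with \<open>v 1\<close>.\<close>
  have ne: "k \<noteq> -1" "m \<noteq> -1" using b1[OF assms(1)] b1[OF assms(2)] h1 assms(3) by auto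
  then have "bf (v k) (v 1) = 0" "bf (v m) (v 1) = 0" using assms by (auto simp: form)
  then have 1: "wedge (v k) (v m) *v v 1 = 0 *s v 1" by (simp add: wedge_mult_vec)
  have "\<exists>e. wedge (v k) (v m) *v v kap = e *s v 1"
  proof -
    \<comment> \<open>Only \<open>v 1\<close> is higher than \<open>v kap\<close>, so a raising
      operator sends \<open>v kap\<close> into the line of \<open>v 1\<close>.\<close>
    have k1: "j = 1" if "j \<in> I" "ht j > ht kap" for j
      using that rank by (auto simp: ht_def I_def sgn_if kap_def abs_if split: if_splits)
    show ?thesis
    proof (cases "m = - kap")
      case m: True
      show ?thesis
      proof (cases "k = - kap")
        case True
        then show ?thesis using m by (intro exI[of _ 0]) (simp add: wedge_mult_vec)
      next
        case False
        then have "k = 1" using k1[of k] assms m by simp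
        then show ?thesis using m assms kap by (intro exI[of _ 1]) (simp add: wedge_mult_vec form)
      qed
    next
      case m: False
      show ?thesis
      proof (cases "k = - kap")
        case True
        then have "m = 1" using k1[of m] assms by simp
        then show ?thesis using True assms kap by (intro exI[of _ "-1"]) (simp add: wedge_mult_vec form)
      next
        case False
        then show ?thesis using m assms kap by (intro exI[of _ 0]) (simp add: wedge_mult_vec form)
      qed
    qed
  qed
  then obtain e where "wedge (v k) (v m) *v v kap = 0 *s v kap + e *s v 1" by auto
  from tact_w[OF 1 this] show ?thesis by simp
qed

lemma w_weight:
  assumes i: "1 \<le> i" "i \<le> r"
  shows "tact (h i) ks w = of_real (L i) * w ks"
proof -
  have "h i *v v 1 = (if i = 1 then 1 else 0) *s v 1"
    using h_mult_vec[OF i one_I] i by simp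
  moreover have "h i *v v kap = (if i = kap then 1 else 0) *s v kap + 0 *s v 1"
    using h_mult_vec[OF i kap(1)] i by (auto simp: kap_def)
  ultimately have eq: "tact (h i) ks w = (of_nat a * (2 * (if i = 1 then 1 else 0)) +
     of_nat b * ((if i = 1 then 1 else 0) + (if i = kap then 1 else 0))) * w ks"
    by (rule tact_w)
  consider "i = 1" | "i = 2" | "i \<ge> 3" using i by linarith
  then show ?thesis
  proof cases
    case 1
    then show ?thesis using L1 kap eq by simp
  next
    case 2
    then show ?thesis using L2 i eq by (simp add: kap_def)
  next
    case 3
    then show ?thesis using L3 i eq by (simp add: kap_def)
  qed
qed

lemma w_tensors: "w \<in> tensors deg"
proof -
  have "pair_tensor (replicate a th1 @ replicate b th2) \<in> tensors (2 * length (replicate a th1 @ replicate b th2))"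
    by (rule pair_tensor_tensors) (use kap in \<open>auto simp: th1_def th2_def dl_def split: if_splits\<close>)
  then show ?thesis by (simp add: w_def deg_def)
qed

section \<open>The submodule generated by a pair of highest weight vectors\<close>

abbreviation "pscale \<equiv> \<lambda>c (p :: (complex^'d) \<times> (int list \<Rightarrow> complex)). (c *s fst p, \<lambda>ks. c * snd p ks)"
abbreviation "pact \<equiv> \<lambda>X (p :: (complex^'d) \<times> (int list \<Rightarrow> complex)). (\<rho> X *v fst p, \<lambda>ks. tact X ks (snd p))"

text \<open>The submodule generated by (v0, w) will turn out to be the graph of an equivariant map
  \<open>emb\<close> from the given representation to tensors.\<close>

sublocale S: hw_module v r z I pscale pact "(v0, w)" L
proof (unfold_locales, goal_cases)
  case (10 i)
  then show ?case by (simp add: hw w_weight)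
next
  case (11 k m)
  then show ?case using hw_raising[unfolded I_def, of k m] w_raising[unfolded I_def, of k m]
    by (simp add: zero_prod_def zero_fun_def)
qed (simp_all add: prod_eq_iff plus_fun_def fun_eq_iff algebra_simps rep mv_simps tact_add tact_scale
    tact_add_left tact_scale_left tact_bracket fun_diff_def)

lemma S_tensors: "p \<in> S.generated \<Longrightarrow> snd p \<in> tensors deg"
proof -
  have words: "snd p \<in> tensors deg" if "p \<in> S.words" for p
    using that by induction (simp_all add: w_tensors tact_tensors)
  assume "p \<in> S.generated"
  then show ?thesis unfolding S.generated_def
  proof (induction rule: S.span_induct_alt)
    case base
    show ?case by (simp add: tensors_def)
  next
    case (step c x y)
    then have "snd x \<in> tensors deg" "snd y \<in> tensors deg" using words by auto
    moreover have "snd (pscale c x + y) ks \<noteq> 0 \<Longrightarrow> snd x ks \<noteq> 0 \<or> snd y ks \<noteq> 0" for ks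
      by (auto simp: plus_fun_def)
    ultimately show ?case unfolding tensors_def by blast
  qed
qed

lemma S_fst_below: "p \<in> S.below \<Longrightarrow> fst p \<in> V.below"
  unfolding S.below_def
proof (induction rule: S.span_induct_alt)
  case base
  show ?case by (simp add: vec.subspace_0[OF below_subspace])
next
  case (step c x y)
  then have "fst x \<in> V.below"
    unfolding V.below_def by (auto simp: prod_eq_iff S.d_def V.d_def intro!: vec.span_base)
  then show ?case using step by (simp add: vec.subspace_add[OF below_subspace] vec.subspace_scale[OF below_subspace])
qed

lemma D_adjoint: "\<forall>a b. ent D a b = cnj (ent D b a)"
proof (intro allI)
  fix a b
  have "ent D a b = (if a \<in> I \<and> b \<in> I then of_int (ht b) * (if a = b then 1 else 0) else 0)" for a b
    by (simp add: ent_def D_mult_vec bf_simps form)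
  then show "ent D a b = cnj (ent D b a)" by simp
qed

text \<open>\<open>D\<close> is self-adjoint with real eigenvalues, and those occurring in
  \<open>below\<close> differ from that of \<open>w\<close>.\<close>

lemma S_below_orth: "p \<in> S.below \<Longrightarrow> ip n (snd p) w = 0"
  unfolding S.below_def
proof (induction rule: S.span_induct_alt)
  case base
  show ?case by (simp add: zero_fun_def)
next
  case (step c x y)
  then obtain j :: nat where j: "j \<ge> 1" "(\<lambda>ks. tact D ks (snd x)) = (\<lambda>ks. complex_of_real (S.d - real j) * snd x ks)"
    by auto
  have w: "(\<lambda>ks. tact D ks w) = (\<lambda>ks. complex_of_real S.d * w ks)"
    using S.act_D_w by simp
  have "complex_of_real (S.d - real j) * ip n (snd x) w = ip n (\<lambda>ks. tact D ks (snd x)) w"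
    by (simp only: j(2) ip_scale_left)
  also have "\<dots> = ip n (snd x) (\<lambda>ks. tact D ks w)" by (rule ip_adjoint[OF D_adjoint])
  also have "\<dots> = complex_of_real S.d * ip n (snd x) w" by (simp only: w ip_scale_right complex_cnj_complex_of_real)
  finally have "(complex_of_real (S.d - real j) - complex_of_real S.d) * ip n (snd x) w = 0"
    by (simp add: algebra_simps)
  then have "ip n (snd x) w = 0" using j(1) by simp
  then show ?case using step by (simp add: plus_fun_def ip_add_left ip_scale_left)
qed

lemma S_closed:
  "p \<in> S.generated \<Longrightarrow> q \<in> S.generated \<Longrightarrow> p + q \<in> S.generated"
  "p \<in> S.generated \<Longrightarrow> q \<in> S.generated \<Longrightarrow> p - q \<in> S.generated"
  "p \<in> S.generated \<Longrightarrow> pscale c p \<in> S.generated"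
  unfolding S.generated_def by (rule S.span_add S.span_diff S.span_scale; assumption)+

lemma S_base: "(v0, w) \<in> S.generated"
  unfolding S.generated_def by (intro S.span_base S.words.base)

lemma S_total: "\<exists>t. (x, t) \<in> S.generated"
proof -
  have "{x. \<exists>t. (x, t) \<in> S.generated} = UNIV"
  proof (rule irreducible[of _ v0])
    show "vec.subspace {x. \<exists>t. (x, t) \<in> S.generated}"
    proof (rule vec.subspaceI)
      have "(0, 0) \<in> S.generated" unfolding S.generated_def using S.span_zero by (simp add: zero_prod_def)
      then show "0 \<in> {x. \<exists>t. (x, t) \<in> S.generated}" by blast
    next
      fix x y assume "x \<in> {x. \<exists>t. (x, t) \<in> S.generated}" "y \<in> {x. \<exists>t. (x, t) \<in> S.generated}"
      then obtain s t where "(x, s) \<in> S.generated" "(y, t) \<in> S.generated" by blast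
      from S_closed(1)[OF this] show "x + y \<in> {x. \<exists>t. (x, t) \<in> S.generated}" by auto
    next
      fix c x assume "x \<in> {x. \<exists>t. (x, t) \<in> S.generated}"
      then obtain s where "(x, s) \<in> S.generated" by blast
      from S_closed(3)[OF this, of c] show "c *s x \<in> {x. \<exists>t. (x, t) \<in> S.generated}" by auto
    qed
    show "\<rho> X *v u \<in> {x. \<exists>t. (x, t) \<in> S.generated}" if "X \<in> g" "u \<in> {x. \<exists>t. (x, t) \<in> S.generated}" for X u
    proof -
      obtain s where "(u, s) \<in> S.generated" using \<open>u \<in> _\<close> by blast
      from S.generated_stable[OF this that(1)] show ?thesis by auto
    qed
  qed (use S_base v0 in auto)
  then show ?thesis by blast
qed

text \<open>An element (0, s) has no component along (v0, w), because 0 has none along v0; hence s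
  is orthogonal to \<open>w\<close>. Taking adjoints moves lowering operators to the other side and
  keeps the form (0, s), so s is orthogonal to every generated tensor, itself included.\<close>

lemma S_functional:
  assumes "(0, t) \<in> S.generated"
  shows "t = (\<lambda>ks. 0)"
proof -
  have 1: "ip deg s w = 0" if s: "(0, s) \<in> S.generated" for s
  proof -
    obtain c where c: "(0, s) - pscale c (v0, w) \<in> S.below" using S.generated_decomp[OF s] by blast
    then have "- (c *s v0) \<in> V.below" using S_fst_below[OF c] by simp
    then have "0 - c *s v0 \<in> V.below" by simp
    then have "hw_coeff 0 = c" by (rule hw_coeff_eqI)
    moreover have "hw_coeff 0 = 0" using hw_coeff_scale[of 0 0] by simp
    ultimately have "c = 0" by simp
    then have "(0, s) \<in> S.below" using c by (simp add: zero_fun_def[symmetric] zero_prod_def[symmetric])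
    then show ?thesis using S_below_orth by fastforce
  qed
  have 2: "ip deg s (snd p) = 0" if "p \<in> S.words" "(0, s) \<in> S.generated" for p s
    using that
  proof (induction arbitrary: s)
    case base
    then show ?case using 1 by simp
  next
    case (lower y k m)
    obtain Y where Y: "Y \<in> g" "\<forall>a b. ent Y a b = cnj (ent (wedge (v k) (v m)) b a)"
      using adjoint_exists[of "wedge (v k) (v m)"] by auto
    then have Y': "\<forall>a b. ent (wedge (v k) (v m)) a b = cnj (ent Y b a)" by simp
    have "(0, \<lambda>ks. tact Y ks s) \<in> S.generated" using S.generated_stable[OF lower.prems Y(1)] by simp
    then show ?case using lower.IH ip_adjoint[OF Y', of deg s "snd y"] by simp
  qed
  have "ip deg t (snd p) = 0" if "p \<in> S.generated" for p
    using that unfolding S.generated_def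
  proof (induction rule: S.span_induct_alt)
    case base
    show ?case by (simp add: zero_fun_def)
  next
    case (step c x y)
    then show ?case using 2[OF step(1) assms] by (simp add: plus_fun_def ip_add_right ip_scale_right)
  qed
  from this[OF assms] have "ip deg t t = 0" by simp
  then show ?thesis using S_tensors[OF assms] ip_definite by simp
qed

section \<open>The embedding into the tensor power\<close>

definition emb :: "complex^'d \<Rightarrow> int list \<Rightarrow> complex" where
  "emb x = (THE t. (x, t) \<in> S.generated)"

lemma emb_eqI: "(x, t) \<in> S.generated \<Longrightarrow> emb x = t"
  unfolding emb_def
proof (rule the_equality)
  fix s assume "(x, t) \<in> S.generated" "(x, s) \<in> S.generated"
  from S_closed(2)[OF this] have "(0, t - s) \<in> S.generated" by simp
  from S_functional[OF this] show "s = t" by (auto simp: fun_eq_iff)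
qed

lemma emb_in: "(x, emb x) \<in> S.generated"
  using S_total[of x] emb_eqI by blast

lemma emb_v0: "emb v0 = w"
  by (rule emb_eqI[OF S_base])

lemma emb_add: "emb (x + y) = (\<lambda>ks. emb x ks + emb y ks)"
  using S_closed(1)[OF emb_in[of x] emb_in[of y]] by (intro emb_eqI) (simp add: plus_fun_def)

lemma emb_scale: "emb (c *s x) = (\<lambda>ks. c * emb x ks)"
  using S_closed(3)[OF emb_in[of x]] by (intro emb_eqI) simp

lemma emb_diff: "emb (x - y) = (\<lambda>ks. emb x ks - emb y ks)"
  using S_closed(2)[OF emb_in[of x] emb_in[of y]] by (intro emb_eqI) (simp add: fun_diff_def)

lemma emb_zero: "emb 0 = (\<lambda>ks. 0)"
  using emb_scale[of 0 0] by simp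

lemma emb_sum: "emb (\<Sum>k\<in>K. f k) = (\<lambda>ks. \<Sum>k\<in>K. emb (f k) ks)"
  by (induction K rule: infinite_finite_induct) (simp_all add: emb_zero emb_add)

lemma emb_act: "X \<in> g \<Longrightarrow> emb (\<rho> X *v x) = (\<lambda>ks. tact X ks (emb x))"
  using S.generated_stable[OF emb_in[of x]] by (intro emb_eqI) simp

lemma emb_tensors: "emb x \<in> tensors deg"
  using S_tensors[OF emb_in] by simp

text \<open>The kernel of \<open>emb\<close> is a submodule, and irreducibility makes it zero as
  soon as \<open>w\<close> is not.\<close>

lemma emb_definite:
  assumes "w \<noteq> (\<lambda>ks. 0)" "ip deg (emb x) (emb x) = 0"
  shows "x = 0"
proof (rule ccontr)
  assume "x \<noteq> 0"
  have x: "emb x = (\<lambda>ks. 0)" by (rule ip_definite[OF assms(2) emb_tensors])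
  have "{x. emb x = (\<lambda>ks. 0)} = UNIV"
  proof (rule irreducible[of _ x])
    show "vec.subspace {x. emb x = (\<lambda>ks. 0)}"
      by (rule vec.subspaceI) (auto simp: emb_zero emb_add emb_scale)
  qed (use x \<open>x \<noteq> 0\<close> in \<open>auto simp: emb_act\<close>)
  then have "emb v0 = (\<lambda>ks. 0)" by blast
  then show False using assms(1) by (simp add: emb_v0)
qed

lemma emb_tpow: "X \<in> g \<Longrightarrow> emb (mpow (\<rho> X) m *v x) = tpow X m (emb x)"
proof (induction m)
  case (Suc m)
  then show ?case
    by (auto simp: mpow_Suc matrix_vector_mul_assoc[symmetric] emb_act tpow_Suc)
qed simp

lemma emb_mexp:
  assumes "X \<in> g" "set ks \<subseteq> I"
  shows "emb (mexp (\<rho> X) *v x) ks = tgrp (mexp X) ks (emb x)"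
proof -
  have "exp_sum (\<lambda>m. emb (mpow (\<rho> X) m *v x) ks) = emb (mexp (\<rho> X) *v x) ks"
    by (rule exp_summable_mpow_linear(2)) (simp_all add: mv_simps emb_add emb_scale)
  then show ?thesis using assms tgrp_mexp(2)[of ks X "emb x"] by (simp add: emb_tpow)
qed

text \<open>If \<open>u0\<close> were orthogonal to the image, it would be orthogonal to
  \<open>w\<close> moved by the exponential of X. This X, opposite to \<open>N\<close>, carries
  \<open>v 1\<close> to a vector with components along both \<open>v 1\<close> and
  \<open>v (-1)\<close>, so that factors of either kind pair nontrivially with those of
  \<open>u0\<close>.\<close>

lemma pairing_nonzero: "\<exists>x. ip deg (emb x) u0 \<noteq> 0"
proof (rule ccontr)
  assume "\<nexists>x. ip deg (emb x) u0 \<noteq> 0"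
  then have z: "ip deg (emb x) u0 = 0" for x by blast
  define X where "X = wedge (v (-1)) s0"
  have X: "X \<in> g" by (simp add: X_def)
  define G where "G = mexp X"
  have "ip deg (\<lambda>ks. tgrp G ks w) u0 = exp_sum (\<lambda>m. ip deg (tpow X m w) u0)"
    unfolding G_def by (rule ip_tgrp_mexp)
  also have "\<dots> = 0"
    using emb_tpow[OF X, of _ v0] z by (simp add: emb_v0[symmetric] exp_sum_def flip: emb_tpow[OF X])
  finally have 0: "ip deg (\<lambda>ks. tgrp G ks w) u0 = 0" .
  have fs: "bf s0 (v kap) = 1" "bf s0 s0 \<noteq> 0" "bf (v (-1)) (v kap) = 0"
    using rank two_I zero_I by (auto simp: s0_def kap_def bf_simps form)
  have Xs: "X *v v 1 = - s0" "X *v s0 = bf s0 s0 *s v (-1)" "X *v v (-1) = 0" "X *v v kap = v (-1)"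
    by (simp_all add: X_def wedge_mult_vec fs)
  have G1: "G *v v 1 = v 1 - s0 - (bf s0 s0 / 2) *s v (-1)"
    unfolding G_def by (subst mexp_nilpotent3) (simp_all add: Xs vector_scalar_commute vec_eq_iff)
  have Gk: "G *v v kap = v kap + v (-1)"
    unfolding G_def by (subst mexp_nilpotent3) (simp_all add: Xs)
  have ent: "ent G 1 1 = 1" "ent G (-1) 1 = - (bf s0 s0 / 2)" "ent G 1 kap = 0" "ent G (-1) kap = 1"
    using kap fs bf_sym[of "v 1" "v kap"] by (simp_all add: ent_def G1 Gk bf_simps form)
  have pair: "(\<Sum>k\<in>I. \<Sum>l\<in>I. \<theta> k l * cnj (et1 k l)) = \<theta> 1 (-1) + \<theta> (-1) 1"
    "(\<Sum>k\<in>I. \<Sum>l\<in>I. \<theta> k l * cnj (et2 k l)) = \<theta> 1 (-1) - \<theta> (-1) 1" for \<theta>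
  proof -
    have "(\<Sum>k\<in>I. \<Sum>l\<in>I. \<theta> k l * (dl p k * dl q l)) = \<theta> p q" if "p \<in> I" "q \<in> I" for p q
      using that by (simp add: sum_dl2)
    moreover have "cnj (dl p k) = dl p k" for p k by (simp add: dl_def)
    ultimately show "(\<Sum>k\<in>I. \<Sum>l\<in>I. \<theta> k l * cnj (et1 k l)) = \<theta> 1 (-1) + \<theta> (-1) 1"
      "(\<Sum>k\<in>I. \<Sum>l\<in>I. \<theta> k l * cnj (et2 k l)) = \<theta> 1 (-1) - \<theta> (-1) 1"
      by (simp_all add: et1_def et2_def distrib_left right_diff_distrib sum.distrib sum_subtractf)
  qed
  have c1: "conj2 G th1 k l = ent G k 1 * ent G l 1" for k l
    by (simp add: conj2_def th1_def sum_dl2 sum_distrib_left[symmetric])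
  have c2: "conj2 G th2 k l = ent G k 1 * ent G l kap - ent G k kap * ent G l 1" for k l
    using kap(1) by (simp add: conj2_def th2_def right_diff_distrib sum_subtractf sum_dl2 sum_distrib_left[symmetric])
  have "ip deg (\<lambda>ks. tgrp G ks w) u0 =
      (\<Prod>(\<theta>, \<eta>)\<leftarrow>zip (map (conj2 G) (replicate a th1 @ replicate b th2)) (replicate a et1 @ replicate b et2).
        \<Sum>k\<in>I. \<Sum>l\<in>I. \<theta> k l * cnj (\<eta> k l))"
    unfolding w_def u0_def tgrp_pair_tensor
    using ip_pair_tensor[of "map (conj2 G) (replicate a th1 @ replicate b th2)" "replicate a et1 @ replicate b et2"]
    by (simp add: deg_def)
  also have "\<dots> = (\<Sum>k\<in>I. \<Sum>l\<in>I. conj2 G th1 k l * cnj (et1 k l)) ^ a * (\<Sum>k\<in>I. \<Sum>l\<in>I. conj2 G th2 k l * cnj (et2 k l)) ^ b"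
    by (simp add: zip_append zip_replicate map_replicate prod_list_replicate)
  \<comment> \<open>The bases come from the entries above: twice 1 * (- bf s0 s0 / 2) for a
    symmetric factor, and 1 - (-1) for an alternating one.\<close>
  also have "\<dots> = (- bf s0 s0) ^ a * 2 ^ b"
    unfolding pair c1 c2 ent by simp
  also have "\<dots> \<noteq> 0" using fs by simp
  finally show False using 0 by simp
qed

lemma w_nonzero: "w \<noteq> (\<lambda>ks. 0)"
proof
  assume w: "w = (\<lambda>ks. 0)"
  have "{x. emb x = (\<lambda>ks. 0)} = UNIV"
  proof (rule irreducible[of _ v0])
    show "vec.subspace {x. emb x = (\<lambda>ks. 0)}"
      by (rule vec.subspaceI) (auto simp: emb_zero emb_add emb_scale)
  qed (use v0 w emb_v0 in \<open>auto simp: emb_act\<close>)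
  then have "emb x = (\<lambda>ks. 0)" for x by blast
  then show False using pairing_nonzero by simp
qed

text \<open>The Gram matrix of the embedded standard basis is injective by definiteness, hence
  invertible, and u solves the normal equations for \<open>u0\<close>.\<close>

lemma projection_exists: "\<exists>u. \<forall>x. ip deg (emb u) (emb x) = ip deg u0 (emb x)"
proof -
  define G :: "complex^'d^'d" where "G = (\<chi> k l. ip deg (emb (axis l 1)) (emb (axis k 1)))"
  have ex: "x = (\<Sum>k\<in>UNIV. x $ k *s axis k 1)" for x :: "complex^'d"
    by (simp add: vec_eq_iff axis_def if_distrib cong: if_cong)
  have G: "(G *v y) $ k = ip deg (emb y) (emb (axis k 1))" for y k
    using arg_cong[OF ex[of y], of "\<lambda>y. ip deg (emb y) (emb (axis k 1))"]
    by (simp add: G_def matrix_vector_mult_def emb_sum emb_scale ip_sum_left ip_scale_left mult.commute)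
  have ext: "ip deg s (emb x) = (\<Sum>k\<in>UNIV. cnj (x $ k) * ip deg s (emb (axis k 1)))" for s x
    using arg_cong[OF ex[of x], of "\<lambda>x. ip deg s (emb x)"]
    by (simp add: emb_sum emb_scale ip_sum_right ip_scale_right)
  have "y = 0" if "G *v y = 0" for y
  proof (rule emb_definite[OF w_nonzero])
    have "ip deg (emb y) (emb (axis k 1)) = 0" for k using G[of y k] that by simp
    then show "ip deg (emb y) (emb y) = 0" by (subst ext) simp
  qed
  then have "inj ((*v) G)" by (simp add: vec.inj_iff_eq_0)
  then obtain B where "B ** G = mat 1" using matrix_left_invertible_injective by blast
  then have GB: "G ** B = mat 1" by (simp add: matrix_left_right_inverse)
  define u where "u = B *v (\<chi> k. ip deg u0 (emb (axis k 1)))"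
  have "G *v u = (\<chi> k. ip deg u0 (emb (axis k 1)))" by (simp add: u_def matrix_vector_mul_assoc GB)
  then have "ip deg (emb u) (emb (axis k 1)) = ip deg u0 (emb (axis k 1))" for k using G[of u k] by simp
  then have "ip deg (emb u) (emb x) = ip deg u0 (emb x)" for x
    unfolding ext[of "emb u" x] ext[of u0 x] by simp
  then show ?thesis by blast
qed

section \<open>The orthogonal complement of the image and the group action\<close>

definition perp :: "(int list \<Rightarrow> complex) set" where
  "perp = {t. \<forall>x. ip deg t (emb x) = 0}"

lemma perp_tact:
  assumes "t \<in> perp" "X \<in> g"
  shows "(\<lambda>ks. tact X ks t) \<in> perp"
proof -
  obtain Y where Y: "Y \<in> g" "\<forall>a b. ent Y a b = cnj (ent X b a)" using adjoint_exists[OF assms(2)] by blast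
  then show ?thesis using assms(1) by (auto simp: perp_def ip_adjoint[OF Y(2)] emb_act[symmetric])
qed

lemma perp_mexp:
  assumes "t \<in> perp" "X \<in> g"
  shows "(\<lambda>ks. tgrp (mexp X) ks t) \<in> perp"
proof -
  have "tpow X m t \<in> perp" for m
  proof (induction m)
    case (Suc m)
    have "tpow X (Suc m) t = (\<lambda>ks. tact X ks (tpow X m t))" by (simp add: tpow_Suc fun_eq_iff)
    then show ?case using perp_tact[OF Suc assms(2)] by simp
  qed (use assms in simp)
  then show ?thesis unfolding perp_def by (simp add: ip_tgrp_mexp exp_sum_def)
qed

lemma lie_group_emb:
  assumes "(p, q) \<in> lie_group gR \<rho>" "gR \<subseteq> g" "set ks \<subseteq> I"
  shows "emb (q *v x) ks = tgrp p ks (emb x)"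
  using assms(1,3)
proof (induction arbitrary: x ks rule: lie_group.induct)
  case one
  then show ?case by (simp add: tgrp_one)
next
  case (mult_exp p q X)
  then have "emb ((q ** mexp (\<rho> X)) *v x) ks = tgrp p ks (emb (mexp (\<rho> X) *v x))"
    by (simp add: matrix_vector_mul_assoc[symmetric])
  also have "\<dots> = tgrp p ks (\<lambda>ks. tgrp (mexp X) ks (emb x))"
    using mult_exp assms(2) by (intro tgrp_cong emb_mexp) auto
  finally show ?case by (simp add: tgrp_mult)
qed

lemma lie_group_perp:
  assumes "(p, q) \<in> lie_group gR \<rho>" "gR \<subseteq> g" "t \<in> perp"
  shows "(\<lambda>ks. tgrp p ks t) \<in> perp"
  using assms(1,3)
proof (induction arbitrary: t rule: lie_group.induct)
  case one
  have "ip deg (\<lambda>ks. tgrp (mat 1) ks t) s = ip deg t s" for s by (rule ip_cong) (simp add: tgrp_one)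
  then show ?case using one by (simp add: perp_def)
next
  case (mult_exp p q X)
  then show ?case using assms(2) perp_mexp[of t X] by (auto simp: tgrp_mult)
qed

lemma tgrp_u0:
  assumes p: "p *v v 1 = \<alpha> *s v (-1)" "p *v v (-1) = \<beta> *s v 1" "\<alpha> * \<beta> = 1"
  shows "tgrp p ks u0 = (-1) ^ b * u0 ks"
proof -
  have e: "ent p k 1 = \<alpha> * dl (-1) k" "ent p k (-1) = \<beta> * dl 1 k" for k
    by (auto simp: ent_def p bf_simps form dl_def)
  have c: "(\<Sum>i\<in>I. \<Sum>j\<in>I. ent p k i * (ent p l j * (dl x i * dl y j))) = ent p k x * ent p l y"
    if "x \<in> I" "y \<in> I" for x y k l
    using that by (simp add: sum_dl2 sum_distrib_left[symmetric])
  have "conj2 p et1 k l = 1 * et1 k l" for k l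
    unfolding conj2_def et1_def by (simp add: distrib_left sum.distrib c e) (use p(3) in algebra)
  moreover have "conj2 p et2 k l = (- 1) * et2 k l" for k l
    unfolding conj2_def et2_def by (simp add: right_diff_distrib sum_subtractf c e) (use p(3) in algebra)
  ultimately have "map (conj2 p) (replicate a et1 @ replicate b et2) =
      map (\<lambda>\<theta> k l. (if \<theta> = et1 then 1 else -1) * \<theta> k l) (replicate a et1 @ replicate b et2)"
    using th12 by (auto simp: fun_eq_iff)
  then have "tgrp p ks u0 = (\<Prod>\<theta>\<leftarrow>replicate a et1 @ replicate b et2. if \<theta> = et1 then 1 else -1) * u0 ks"
    unfolding u0_def tgrp_pair_tensor by (simp only: pair_tensor_scale)
  then show ?thesis using th12 by (simp add: prod_list_replicate map_replicate)
qed

text \<open>The vector u is the orthogonal projection of \<open>u0\<close>. The difference of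
  \<open>emb u\<close> and \<open>u0\<close> is orthogonal to the image, and this complement is
  stable under \<open>g\<close> and under the group, so both act on u as they act on
  \<open>u0\<close>.\<close>

theorem invariant_exists:
  obtains u where "u \<in> invariants levi \<rho>" "u \<noteq> 0"
    "\<And>p q gR \<alpha> \<beta>. (p, q) \<in> lie_group gR \<rho> \<Longrightarrow> gR \<subseteq> g \<Longrightarrow> p *v v 1 = \<alpha> *s v (-1) \<Longrightarrow>
       p *v v (-1) = \<beta> *s v 1 \<Longrightarrow> \<alpha> * \<beta> = 1 \<Longrightarrow> q *v u = (-1) ^ b *s u"
proof -
  obtain u where u: "\<And>x. ip deg (emb u) (emb x) = ip deg u0 (emb x)" using projection_exists by blast
  have eq: "y = y'" if "\<And>x. ip deg (emb y) (emb x) = ip deg (emb y') (emb x)" for y y'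
  proof -
    have "ip deg (emb (y - y')) (emb (y - y')) = 0" using that[of "y - y'"] by (simp add: emb_diff ip_diff_left)
    then show ?thesis using emb_definite[OF w_nonzero] by fastforce
  qed
  have "\<rho> X *v u = 0" if X: "X \<in> levi" for X
  proof (rule eq)
    fix x
    obtain Y where Y: "Y \<in> g" "\<forall>a b. ent Y a b = cnj (ent X b a)" using adjoint_exists levi_so[OF X] by blast
    have "ip deg (emb (\<rho> X *v u)) (emb x) = ip deg (emb u) (emb (\<rho> Y *v x))"
      using Y levi_so[OF X] by (simp add: emb_act ip_adjoint[OF Y(2)])
    also have "\<dots> = ip deg u0 (emb (\<rho> Y *v x))" by (rule u)
    also have "\<dots> = ip deg (\<lambda>ks. tact X ks u0) (emb x)"
      using Y by (simp add: emb_act ip_adjoint[OF Y(2)])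
    finally show "ip deg (emb (\<rho> X *v u)) (emb x) = ip deg (emb 0) (emb x)"
      using tact_u0[OF X] by (simp add: emb_zero)
  qed
  then have "u \<in> invariants levi \<rho>" by (simp add: invariants_def)
  moreover have "u \<noteq> 0"
  proof
    assume "u = 0"
    then have "ip deg u0 (emb x) = 0" for x using u[of x] by (simp add: emb_zero)
    then show False using pairing_nonzero ip_cnj[of deg _ u0] by auto
  qed
  moreover have "q *v u = (-1) ^ b *s u"
    if pq: "(p, q) \<in> lie_group gR \<rho>" "gR \<subseteq> g" and p: "p *v v 1 = \<alpha> *s v (-1)" "p *v v (-1) = \<beta> *s v 1" "\<alpha> * \<beta> = 1"
    for p q gR \<alpha> \<beta>
  proof (rule eq)
    fix x
    have "(\<lambda>ks. emb u ks - u0 ks) \<in> perp" by (simp add: perp_def ip_diff_left u)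
    from lie_group_perp[OF pq this] have "ip deg (\<lambda>ks. tgrp p ks (emb u) - (-1) ^ b * u0 ks) (emb x) = 0"
      by (simp add: perp_def tgrp_diff tgrp_u0[OF p])
    then have "ip deg (\<lambda>ks. tgrp p ks (emb u)) (emb x) = (-1) ^ b * ip deg u0 (emb x)"
      by (simp add: ip_diff_left ip_scale_left)
    moreover have "ip deg (emb (q *v u)) (emb x) = ip deg (\<lambda>ks. tgrp p ks (emb u)) (emb x)"
      using lie_group_emb[OF pq] by (intro ip_cong)
    ultimately show "ip deg (emb (q *v u)) (emb x) = ip deg (emb ((-1) ^ b *s u)) (emb x)"
      by (simp add: emb_scale ip_scale_left u)
  qed
  ultimately show ?thesis using that by blast
qed

end


section \<open>Lexicographical orderings\<close>

lemma span_set_nth: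
  fixes es :: "'a::real_vector list"
  assumes "distinct es" "independent (set es)" "X \<in> span (set es)"
  shows "X = (\<Sum>i<length es. representation (set es) X (es ! i) *\<^sub>R es ! i)"
proof -
  have "(\<Sum>b\<in>set es. representation (set es) X b *\<^sub>R b) = X"
    using assms by (intro real_vector.sum_representation_eq) auto
  then show ?thesis
    using sum.reindex_bij_betw[OF bij_betw_nth[OF assms(1) refl refl], of "\<lambda>b. representation (set es) X b *\<^sub>R b"]
    by (simp add: lessThan_atLeast0)
qed

text \<open>By independence the coefficients are unique, so the existential definition can be read
  off \<open>representation\<close>.\<close>

lemma lex_pos_iff:
  assumes es: "distinct es" "independent (set es)"
  shows "lex_pos es X \<longleftrightarrow> X \<in> span (set es) \<and> (\<exists>k<length es. representation (set es) X (es ! k) > 0 \<and>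
    (\<forall>j<k. representation (set es) X (es ! j) = 0))"
proof
  assume "lex_pos es X"
  then obtain c k where c: "X = (\<Sum>i<length es. c i *\<^sub>R es ! i)" and k: "k < length es" "c k > 0" "\<forall>j<k. c j = (0::real)"
    by (auto simp: lex_pos_def)
  have X: "X \<in> span (set es)" unfolding c by (rule span_sum, rule span_scale, rule span_base) simp
  have "representation (set es) X (es ! i) = c i" if "i < length es" for i
  proof -
    have "representation (set es) X (es ! i) = (\<Sum>j<length es. representation (set es) (c j *\<^sub>R es ! j) (es ! i))"
      unfolding c by (subst real_vector.representation_sum[OF es(2)]) (simp_all add: span_scale span_base)
    also have "\<dots> = (\<Sum>j<length es. if j = i then c j else 0)"
      using that es by (intro sum.cong refl)
        (simp add: real_vector.representation_scale real_vector.representation_basis span_base nth_eq_iff_index_eq)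
    finally show ?thesis using that by simp
  qed
  then show "X \<in> span (set es) \<and> (\<exists>k<length es. representation (set es) X (es ! k) > 0 \<and>
    (\<forall>j<k. representation (set es) X (es ! j) = 0))"
    using X k by (intro conjI exI[of _ k]) auto
next
  assume *: "X \<in> span (set es) \<and> (\<exists>k<length es. representation (set es) X (es ! k) > 0 \<and>
    (\<forall>j<k. representation (set es) X (es ! j) = 0))"
  then show "lex_pos es X"
    using span_set_nth[OF es, of X] unfolding lex_pos_def
    by (intro exI[of _ "\<lambda>i. representation (set es) X (es ! i)"]) blast
qed

lemma lex_pos_add:
  assumes "lex_pos es X" "lex_pos es Y"
  shows "lex_pos es (X + Y)"
proof -
  obtain c k where c: "X = (\<Sum>i<length es. c i *\<^sub>R es ! i)" and k: "k < length es" "c k > 0" "\<forall>j<k. c j = (0::real)"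
    using assms(1) by (auto simp: lex_pos_def)
  obtain d l where d: "Y = (\<Sum>i<length es. d i *\<^sub>R es ! i)" and l: "l < length es" "d l > 0" "\<forall>j<l. d j = (0::real)"
    using assms(2) by (auto simp: lex_pos_def)
  have "X + Y = (\<Sum>i<length es. (c i + d i) *\<^sub>R es ! i)"
    by (simp add: c d scaleR_add_left sum.distrib)
  moreover have "min k l < length es \<and> c (min k l) + d (min k l) > 0 \<and> (\<forall>j<min k l. c j + d j = 0)"
    using k l by (cases "k < l"; cases "k = l") (auto simp: min_def)
  ultimately show ?thesis unfolding lex_pos_def
    by (intro exI[of _ "\<lambda>i. c i + d i"]) blast
qed

lemma lex_pos_scaleR:
  assumes "lex_pos es X" "a > 0"
  shows "lex_pos es (a *\<^sub>R X)"
proof -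
  obtain c k where c: "X = (\<Sum>i<length es. c i *\<^sub>R es ! i)" and k: "k < length es" "c k > 0" "\<forall>j<k. c j = (0::real)"
    using assms(1) by (auto simp: lex_pos_def)
  have "a *\<^sub>R X = (\<Sum>i<length es. (a * c i) *\<^sub>R es ! i)" by (simp add: c scaleR_sum_right)
  then show ?thesis unfolding lex_pos_def using k assms(2)
    by (intro exI[of _ "\<lambda>i. a * c i"] conjI exI[of _ k]) auto
qed

lemma lex_pos_nonzero:
  assumes "distinct es" "independent (set es)" "lex_pos es X"
  shows "X \<noteq> 0"
  using assms(3) unfolding lex_pos_iff[OF assms(1,2)] by (auto simp: real_vector.representation_zero)

lemma lex_pos_antisym:
  assumes "distinct es" "independent (set es)" "lex_pos es X"
  shows "\<not> lex_pos es (- X)"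
  using lex_pos_nonzero[OF assms(1,2) lex_pos_add[OF assms(3)]] by fastforce

lemma lex_pos_total:
  assumes es: "distinct es" "independent (set es)" and X: "X \<in> span (set es)" "X \<noteq> 0"
  shows "lex_pos es X \<or> lex_pos es (- X)"
proof -
  let ?c = "\<lambda>i. representation (set es) X (es ! i)"
  have "\<exists>k. k < length es \<and> ?c k \<noteq> 0"
  proof (rule ccontr)
    assume "\<nexists>k. k < length es \<and> ?c k \<noteq> 0"
    then have "X = 0" by (subst span_set_nth[OF es X(1)]) simp
    then show False using X(2) by simp
  qed
  then obtain k where k: "k < length es" "?c k \<noteq> 0" "\<And>j. j < k \<Longrightarrow> \<not> (j < length es \<and> ?c j \<noteq> 0)"
    using exists_least_iff[of "\<lambda>k. k < length es \<and> ?c k \<noteq> 0"] by auto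
  have "representation (set es) (- X) b = - representation (set es) X b" for b
    using es X by (simp add: real_vector.representation_neg)
  then show ?thesis unfolding lex_pos_iff[OF es] using k X
    by (cases "?c k > 0") (auto simp: span_neg intro!: exI[of _ k])
qed


section \<open>Cartan subalgebras and the Killing form\<close>

lemma ex_basis_subspace:
  fixes W :: "(complex^'k^'m) set"
  assumes "cmat.subspace W"
  shows "\<exists>B. cmat.independent B \<and> cmat.span B = W"
proof -
  obtain B where "B \<subseteq> W" "cmat.independent B" "W \<subseteq> cmat.span B" by (rule cmat.basis_exists)
  then show ?thesis using cmat.span_minimal[OF _ assms] by blast
qed

lemma trace_on_add:
  assumes W: "cmat.subspace W" and T: "\<And>b. b \<in> W \<Longrightarrow> T b \<in> W" "\<And>b. b \<in> W \<Longrightarrow> T' b \<in> W"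
  shows "trace_on W (\<lambda>b. T b + T' b) = trace_on W T + trace_on W T'"
proof -
  define B where "B = (SOME B. cmat.independent B \<and> cmat.span B = W)"
  have B: "cmat.independent B" "cmat.span B = W"
    using someI_ex[OF ex_basis_subspace[OF W]] unfolding B_def by auto
  have "b \<in> W" if "b \<in> B" for b using B(2) cmat.span_base[OF that] by simp
  then show ?thesis
    using B T by (simp add: trace_on_def B_def[symmetric] Let_def cmat.representation_add sum.distrib)
qed

lemma trace_on_scale:
  assumes W: "cmat.subspace W" and T: "\<And>b. b \<in> W \<Longrightarrow> T b \<in> W"
  shows "trace_on W (\<lambda>b. cscale c (T b)) = c * trace_on W T"
proof -
  define B where "B = (SOME B. cmat.independent B \<and> cmat.span B = W)"
  have B: "cmat.independent B" "cmat.span B = W"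
    using someI_ex[OF ex_basis_subspace[OF W]] unfolding B_def by auto
  have "b \<in> W" if "b \<in> B" for b using B(2) cmat.span_base[OF that] by simp
  then show ?thesis
    using B T by (simp add: trace_on_def B_def[symmetric] Let_def cmat.representation_scale sum_distrib_left)
qed

text \<open>The identity of W factors through the coefficients of the frame, and tr (F C) = tr (C
  F). The vectors \<open>f k\<close> may be dependent, which admits the redundant frame of all
  \<open>v m \<and> v (-k)\<close>.\<close>

lemma trace_on_frame:
  assumes W: "cmat.subspace W" and T: "\<And>x. x \<in> W \<Longrightarrow> T x \<in> W"
    and Tadd: "\<And>x y. x \<in> W \<Longrightarrow> y \<in> W \<Longrightarrow> T (x + y) = T x + T y"
    and Tsc: "\<And>a x. x \<in> W \<Longrightarrow> T (cscale a x) = cscale a (T x)"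
    and K: "finite K" "\<And>k. k \<in> K \<Longrightarrow> f k \<in> W"
    and frame: "\<And>x. x \<in> W \<Longrightarrow> x = (\<Sum>k\<in>K. cscale (c k x) (f k))"
    and cadd: "\<And>k x y. k \<in> K \<Longrightarrow> c k (x + y) = c k x + c k y"
    and csc: "\<And>k a x. k \<in> K \<Longrightarrow> c k (cscale a x) = a * c k x"
  shows "trace_on W T = (\<Sum>k\<in>K. c k (T (f k)))"
proof -
  define B where "B = (SOME B. cmat.independent B \<and> cmat.span B = W)"
  have B: "cmat.independent B" "cmat.span B = W"
    using someI_ex[OF ex_basis_subspace[OF W]] unfolding B_def by auto
  have BW: "b \<in> W" if "b \<in> B" for b using B(2) cmat.span_base[OF that] by simp
  have "W \<subseteq> cmat.span (f ` K)"
  proof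
    fix x assume "x \<in> W"
    have "(\<Sum>k\<in>K. cscale (c k x) (f k)) \<in> cmat.span (f ` K)"
      by (rule cmat.span_sum, rule cmat.span_scale, rule cmat.span_base) simp
    then show "x \<in> cmat.span (f ` K)" using frame[OF \<open>x \<in> W\<close>] by simp
  qed
  then have fB: "finite B"
    using cmat.independent_span_bound[of "f ` K" B] B K BW by blast
  have Tsum: "T (\<Sum>k\<in>K'. cscale (a k) (f k)) = (\<Sum>k\<in>K'. cscale (a k) (T (f k)))" if "K' \<subseteq> K" for a K'
    using finite_subset[OF that K(1)] that
  proof (induction K' rule: finite_induct)
    case empty
    show ?case using Tsc[OF cmat.subspace_0[OF W], of 0] by simp
  next
    case (insert k K')
    then have "(\<Sum>k\<in>K'. cscale (a k) (f k)) \<in> W" "cscale (a k) (f k) \<in> W"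
      using K by (auto intro!: cmat.subspace_sum[OF W] cmat.subspace_scale[OF W])
    then show ?case using insert K by (simp add: Tadd Tsc)
  qed
  have csum: "c k (\<Sum>b\<in>B. g b) = (\<Sum>b\<in>B. c k (g b))" if "k \<in> K" for k g
    using fB csc[OF that, of 0 0] by (induction B rule: finite_induct) (simp_all add: cadd that)
  have "trace_on W T = (\<Sum>b\<in>B. cmat.representation B (T b) b)"
    by (simp add: trace_on_def B_def[symmetric] Let_def)
  also have "\<dots> = (\<Sum>b\<in>B. \<Sum>k\<in>K. c k b * cmat.representation B (T (f k)) b)"
  proof (intro sum.cong refl)
    fix b assume b: "b \<in> B"
    have "T b = (\<Sum>k\<in>K. cscale (c k b) (T (f k)))"
      using frame[OF BW[OF b]] Tsum[of K "\<lambda>k. c k b"] by simp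
    then show "cmat.representation B (T b) b = (\<Sum>k\<in>K. c k b * cmat.representation B (T (f k)) b)"
      using B K T by (simp add: cmat.representation_sum cmat.representation_scale cmat.subspace_scale[OF W])
  qed
  also have "\<dots> = (\<Sum>k\<in>K. \<Sum>b\<in>B. c k (cscale (cmat.representation B (T (f k)) b) b))"
    by (subst sum.swap) (simp add: csc mult.commute)
  also have "\<dots> = (\<Sum>k\<in>K. c k (\<Sum>b\<in>B. cscale (cmat.representation B (T (f k)) b) b))"
    by (simp add: csum)
  also have "\<dots> = (\<Sum>k\<in>K. c k (T (f k)))"
    using B K T fB by (intro sum.cong refl) (simp add: cmat.sum_representation_eq)
  finally show ?thesis .
qed

lemma killing_add_left:
  assumes "X \<in> so1n_complex" "Y \<in> so1n_complex" "Z \<in> so1n_complex"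
  shows "killing so1n_complex (X + Y) Z = killing so1n_complex X Z + killing so1n_complex Y Z"
  unfolding killing_def bracket_add_left
  by (rule trace_on_add[OF so_subspace]) (simp_all add: so_bracket assms)

lemma killing_add_right:
  assumes "X \<in> so1n_complex" "Y \<in> so1n_complex" "Z \<in> so1n_complex"
  shows "killing so1n_complex Z (X + Y) = killing so1n_complex Z X + killing so1n_complex Z Y"
  unfolding killing_def bracket_add_left bracket_add_right
  by (rule trace_on_add[OF so_subspace]) (simp_all add: so_bracket assms)

lemma killing_cscale_left:
  assumes "X \<in> so1n_complex" "Z \<in> so1n_complex"
  shows "killing so1n_complex (cscale c X) Z = c * killing so1n_complex X Z"
  unfolding killing_def bracket_cscale_left
  by (rule trace_on_scale[OF so_subspace]) (simp_all add: so_bracket assms)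

lemma killing_cscale_right:
  assumes "X \<in> so1n_complex" "Z \<in> so1n_complex"
  shows "killing so1n_complex Z (cscale c X) = c * killing so1n_complex Z X"
  unfolding killing_def bracket_cscale_left bracket_cscale_right
  by (rule trace_on_scale[OF so_subspace]) (simp_all add: so_bracket assms)

lemma cmat_subspace_real: "cmat.subspace W \<Longrightarrow> subspace W"
  unfolding cmat.subspace_def subspace_def by (simp add: scaleR_cscale)

section \<open>Eigenvectors of skew matrices\<close>

lemma injective_surjective_matrix:
  fixes M :: "complex^'m^'m"
  assumes "\<And>x. M *v x = 0 \<Longrightarrow> x = 0"
  obtains x where "M *v x = y"
proof -
  have "inj ((*v) M)" using assms by (simp add: vec.inj_iff_eq_0)
  then obtain B where "B ** M = mat 1" using matrix_left_invertible_injective by blast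
  then have "M ** B = mat 1" by (simp add: matrix_left_right_inverse)
  then have "M *v (B *v y) = y" by (simp add: matrix_vector_mul_assoc)
  then show ?thesis by (rule that)
qed

text \<open>By skewness the range of X + c is orthogonal to v. So X + c is not onto, hence not
  injective.\<close>

lemma so_eigenvalue_uminus:
  assumes X: "X \<in> so1n_complex" and v: "X *v v = c *s v" "v \<noteq> 0"
  shows "\<exists>u. u \<noteq> 0 \<and> X *v u = (- c) *s u"
proof (rule ccontr)
  assume no: "\<nexists>u. u \<noteq> 0 \<and> X *v u = (- c) *s u"
  let ?M = "X + cscale c (mat 1)"
  have inj: "u = 0" if "?M *v u = 0" for u
    using no that by (auto simp: mv_simps add_eq_0_iff2)
  have "bf v y = 0" for y
  proof -
    obtain u where "?M *v u = y" using injective_surjective_matrix[of ?M y] inj by blast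
    then have "y = X *v u + c *s u" by (simp add: mv_simps)
    then have "bf y v = 0" by (simp add: bf_simps so_skew[OF X] v)
    then show ?thesis by (simp add: bf_sym)
  qed
  then show False using v bf_nondegenerate by blast
qed

text \<open>The transpose of X is conjugate to -X by \<open>lorentz\<close>, so in odd dimension the
  determinant equals its own negative.\<close>

lemma so_odd_singular:
  fixes X :: "complex^('n::finite option)^('n option)"
  assumes X: "X \<in> so1n_complex" and odd: "odd CARD('n option)"
  shows "\<exists>u. u \<noteq> 0 \<and> X *v u = 0"
proof (rule ccontr)
  assume no: "\<nexists>u. u \<noteq> 0 \<and> X *v u = 0"
  let ?J = "lorentz :: complex^('n option)^('n option)"
  have "inj ((*v) X)" using no by (auto simp: vec.inj_iff_eq_0)
  then have "\<exists>B. B ** X = mat 1" using matrix_left_invertible_injective by blast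
  then have "invertible X" unfolding invertible_def using matrix_left_right_inverse by blast
  then have dX: "det X \<noteq> 0" by (simp add: invertible_det_nz)
  have dJ: "det ?J \<noteq> 0"
    by (subst det_diagonal) (simp_all add: lorentz_def)
  let ?S = "cscale (-1) (mat 1) :: complex^('n option)^('n option)"
  have dS: "det ?S = -1"
    using odd by (subst det_diagonal) (simp_all add: mat_def cscale_def)
  have "transpose X ** ?J = - (?J ** X)" using X by (simp add: so1n_complex_def add_eq_0_iff2)
  also have "\<dots> = ?S ** (?J ** X)"
    by (simp only: matrix_eq matrix_vector_mul_assoc[symmetric] cscale_mult_vec matrix_vector_mul_lid
        matrix_vector_mult_uminus_left vec.scale_minus_left vec.scale_one simp_thms)
  finally have "det (transpose X ** ?J) = det (?S ** (?J ** X))" by simp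
  then have "det X * det ?J = - (det ?J * det X)"
    by (simp only: det_mul det_transpose dS mult_minus1)
  then show False using dX dJ by simp
qed

text \<open>Distinct eigenvalues make the eigenvectors a basis. By skewness two of them are
  orthogonal unless their eigenvalues are opposite, and nondegeneracy makes the remaining pairings
  nonzero.\<close>

lemma witt_basis_exists:
  fixes X :: "complex^('n::finite option)^('n option)" and u :: "int \<Rightarrow> complex^('n option)"
  assumes X: "X \<in> so1n_complex" and I: "finite I" "card I = CARD('n option)" "\<And>k. k \<in> I \<Longrightarrow> - k \<in> I"
    and u: "\<And>k. k \<in> I \<Longrightarrow> X *v u k = ev k *s u k" "\<And>k. k \<in> I \<Longrightarrow> u k \<noteq> 0"
    and ev: "inj_on ev I" "\<And>k. k \<in> I \<Longrightarrow> ev (- k) = - ev k"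
  shows "\<exists>v. (\<forall>k\<in>I. \<forall>m\<in>I. bf (v k) (v m) = (if k = - m then 1 else 0)) \<and>
    (\<forall>x. x = (\<Sum>k\<in>I. bf (v (- k)) x *s v k)) \<and> (\<forall>k\<in>I. X *v v k = ev k *s v k) \<and> (\<forall>k>0. v k = u k)"
proof -
  have inj_u: "inj_on u I"
  proof (rule inj_onI)
    fix k m assume km: "k \<in> I" "m \<in> I" "u k = u m"
    then have "(ev k - ev m) *s u k = 0" using u by (metis vec.scale_left_diff_distrib diff_self)
    then have "ev k = ev m" using u km by auto
    then show "k = m" using ev(1) km by (simp add: inj_on_eq_iff)
  qed
  have "vec.independent (u ` I)"
    unfolding vec.dependent_def
  proof
    assume "\<exists>a\<in>u ` I. a \<in> vec.span (u ` I - {a})"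
    then obtain k where k: "k \<in> I" "u k \<in> vec.span (u ` I - {u k})" by blast
    have "u ` I - {u k} \<subseteq> {y. \<exists>c\<in>ev ` (I - {k}). X *v y = c *s y}" using u by auto
    from vec.span_mono[OF this] have s: "u k \<in> vec.span {y. \<exists>c\<in>ev ` (I - {k}). X *v y = c *s y}" using k(2) by blast
    have "u k = 0"
      by (rule vec.eigenvector_in_span_eigenvectors[OF _ _ s u(1)[OF k(1)]])
        (use ev(1) k in \<open>auto simp: mv_simps inj_on_eq_iff\<close>)
    then show False using u k by simp
  qed
  moreover have "card (u ` I) = CARD('n option)" by (simp add: card_image[OF inj_u] I)
  ultimately have "vec.dim (u ` I) = CARD('n option)" by (simp add: vec.dim_eq_card_independent)
  then have span: "vec.span (u ` I) = UNIV"
    by (simp add: vec.dim_eq_full[symmetric] vec_dim_card vec.dimension_def card_cart_basis)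
  have zero: "y = 0" if "\<And>k. k \<in> I \<Longrightarrow> bf (u k) y = 0" for y
  proof -
    have "bf x y = 0" if "x \<in> vec.span (u ` I)" for x
      using that by (induction rule: vec.span_induct_alt) (auto simp: bf_simps \<open>\<And>k. k \<in> I \<Longrightarrow> bf (u k) y = 0\<close>)
    then have "bf y x = 0" for x using span by (simp add: bf_sym[of y x])
    then show ?thesis by (rule bf_nondegenerate)
  qed
  have orth: "bf (u k) (u m) = 0" if "k \<in> I" "m \<in> I" "k \<noteq> - m" for k m
  proof -
    have "ev k * bf (u k) (u m) = - ev m * bf (u k) (u m)"
      using so_skew[OF X, of "u k" "u m"] u that by (simp add: bf_simps)
    have "ev k \<noteq> ev (- m)" using ev(1) that I(3) by (metis inj_on_eq_iff)
    then have "ev k + ev m \<noteq> 0" using ev(2)[OF that(2)] by (simp add: add_eq_0_iff2)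
    moreover have "(ev k + ev m) * bf (u k) (u m) = 0"
      using \<open>ev k * _ = _\<close> by (simp add: distrib_right)
    ultimately show ?thesis by simp
  qed
  have nz: "bf (u k) (u (- k)) \<noteq> 0" if k: "k \<in> I" for k
  proof
    assume 0: "bf (u k) (u (- k)) = 0"
    have "bf (u m) (u k) = 0" if "m \<in> I" for m
      using orth[OF that k] 0 by (cases "m = - k") (auto simp: bf_sym)
    from zero[OF this] u(2)[OF k] show False by simp
  qed
  \<comment> \<open>Rescaling is confined to the indices k \<le> 0, so that the prescribed vectors
    \<open>u k\<close> with k > 0 survive unchanged.\<close>
  define v where "v k = (if k > 0 then u k else if k < 0 then (1 / bf (u (- k)) (u k)) *s u k
      else (1 / csqrt (bf (u 0) (u 0))) *s u 0)" for k
  have vu: "v k = (1 / (if k > 0 then 1 else if k < 0 then bf (u (- k)) (u k) else csqrt (bf (u 0) (u 0)))) *s u k" for k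
    by (simp add: v_def)
  have form: "bf (v k) (v m) = (if k = - m then 1 else 0)" if "k \<in> I" "m \<in> I" for k m
  proof (cases "k = - m")
    case False
    then show ?thesis unfolding vu[of k] vu[of m] by (simp only: bf_scale_left bf_scale_right orth[OF that False]) simp
  next
    case True
    consider "k > 0" | "k < 0" | "k = 0" by linarith
    then show ?thesis
    proof cases
      case 1
      then show ?thesis using True nz[OF that(1)] by (simp add: v_def bf_simps)
    next
      case 2
      then show ?thesis using True nz[OF that(2)] by (simp add: v_def bf_simps bf_sym)
    next
      case 3
      then have "bf (u 0) (u 0) \<noteq> 0" using nz[OF that(1)] by simp
      moreover have "csqrt c * csqrt c = c" for c by (metis power2_csqrt power2_eq_square)
      ultimately show ?thesis using True 3 by (simp add: v_def bf_simps)
    qed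
  qed
  have vnz: "(if k > 0 then 1 else if k < 0 then bf (u (- k)) (u k) else csqrt (bf (u 0) (u 0))) \<noteq> 0" if "k \<in> I" for k
    using nz[OF that] nz[OF I(3)[OF that]] that by (cases "k = 0") auto
  have "x = (\<Sum>k\<in>I. bf (v (- k)) x *s v k)" for x
  proof -
    have "x - (\<Sum>k\<in>I. bf (v (- k)) x *s v k) = 0"
    proof (rule zero)
      fix m assume m: "m \<in> I"
      have "bf (v m) (\<Sum>k\<in>I. bf (v (- k)) x *s v k) = (\<Sum>k\<in>I. if k = - m then bf (v m) x else 0)"
        unfolding bf_sum_right using m by (intro sum.cong refl) (auto simp: bf_simps form)
      then have "bf (v m) (x - (\<Sum>k\<in>I. bf (v (- k)) x *s v k)) = 0"
        using I m by (simp add: bf_simps)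
      then show "bf (u m) (x - (\<Sum>k\<in>I. bf (v (- k)) x *s v k)) = 0"
        using vnz[OF m] unfolding vu[of m] bf_scale_left by simp
    qed
    then show ?thesis by simp
  qed
  moreover have "X *v v k = ev k *s v k" if "k \<in> I" for k
    unfolding vu[of k] vector_scalar_commute u(1)[OF that] vec.scale_scale by (simp only: mult.commute)
  moreover have "v k = u k" if "k > 0" for k using that by (simp add: v_def)
  ultimately show ?thesis using form by blast
qed

section \<open>Simple roots and nondegeneracy of the Killing form on the Cartan subalgebra\<close>

locale so1n_cartan =
  fixes n :: nat and H :: "(complex^('n::finite option)^('n option)) set"
    and es :: "(complex^('n option)^('n option)) list"
    and \<epsilon> :: "nat \<Rightarrow> complex^('n option)^('n option)"
  assumes n: "n = CARD('n)" and card: "n \<ge> 2"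
    and cartan: "cartan_subalgebra so1n_complex H"
    and es: "distinct es" "independent (set es)" "span (set es) = real_cartan so1n_complex H"
    and bourbaki: "bourbaki_basis H es \<epsilon>"
begin

abbreviation "gC \<equiv> so1n_complex :: (complex^('n option)^('n option)) set"
abbreviation "kil \<equiv> killing gC"

definition rk :: nat where
  "rk = (n + 1) div 2"

lemma rk_pos: "rk \<ge> 1"
  using card by (simp add: rk_def)

lemma H: "cmat.subspace H" "H \<subseteq> gC" "\<And>X Y. X \<in> H \<Longrightarrow> Y \<in> H \<Longrightarrow> bracket X Y = 0"
  using cartan by (auto simp: cartan_subalgebra_def toral_subalgebra_def)

lemmas H_closed = cmat.subspace_add[OF H(1)] cmat.subspace_diff[OF H(1)]
  cmat.subspace_scale[OF H(1)] cmat.subspace_neg[OF H(1)] cmat.subspace_0[OF H(1)]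

lemma H_gC: "X \<in> H \<Longrightarrow> X \<in> gC"
  using H(2) by blast

lemma kil_simps:
  "X \<in> H \<Longrightarrow> Y \<in> H \<Longrightarrow> Z \<in> H \<Longrightarrow> kil (X + Y) Z = kil X Z + kil Y Z"
  "X \<in> H \<Longrightarrow> Y \<in> H \<Longrightarrow> Z \<in> H \<Longrightarrow> kil (X - Y) Z = kil X Z - kil Y Z"
  "X \<in> H \<Longrightarrow> Y \<in> H \<Longrightarrow> Z \<in> H \<Longrightarrow> kil Z (X + Y) = kil Z X + kil Z Y"
  "X \<in> H \<Longrightarrow> Z \<in> H \<Longrightarrow> kil (cscale c X) Z = c * kil X Z"
  "X \<in> H \<Longrightarrow> Z \<in> H \<Longrightarrow> kil Z (cscale c X) = c * kil Z X"
  using killing_add_left[of "X - Y" Y Z]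
  by (auto simp: H_gC so_closed killing_add_left killing_add_right killing_cscale_left killing_cscale_right)

lemma real_cartan_H: "real_cartan gC H \<subseteq> H"
  unfolding real_cartan_def
  by (rule span_minimal) (auto simp: roots_def cmat_subspace_real[OF H(1)])

lemma bourbaki_facts:
  "inj_on \<epsilon> {1..rk}" "independent (\<epsilon> ` {1..rk})" "span (\<epsilon> ` {1..rk}) = real_cartan gC H"
  "\<And>i. i \<in> {1..rk} \<Longrightarrow> \<exists>v. v \<noteq> 0 \<and> (\<forall>X\<in>H. X *v v = kil (\<epsilon> i) X *s v)"
  "simple_roots gC H es = (\<lambda>i. \<epsilon> i - \<epsilon> (i + 1)) ` {1..<rk} \<union>
     {if even n then \<epsilon> rk else \<epsilon> (rk - 1) + \<epsilon> rk}"
  using bourbaki unfolding bourbaki_basis_def Let_def n[symmetric] rk_def[symmetric] by auto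

lemma eps_real_cartan: "i \<in> {1..rk} \<Longrightarrow> \<epsilon> i \<in> real_cartan gC H"
  unfolding bourbaki_facts(3)[symmetric] by (intro span_base) auto

lemma eps_H: "i \<in> {1..rk} \<Longrightarrow> \<epsilon> i \<in> H"
  using eps_real_cartan real_cartan_H by blast

lemma rk_odd: "odd n \<Longrightarrow> rk \<ge> 2"
  using card unfolding rk_def by (auto elim!: oddE)

lemma eps_span_simple: "i \<in> {1..rk} \<Longrightarrow> \<epsilon> i \<in> span (simple_roots gC H es)"
proof -
  have "\<epsilon> (rk - j) \<in> span (simple_roots gC H es)" if "j < rk" for j
    using that
  proof (induction j)
    case 0
    show ?case
    proof (cases "even n")
      case True
      then show ?thesis by (intro span_base) (simp add: bourbaki_facts(5))
    next
      case False
      then have "\<epsilon> (rk - 1) + \<epsilon> rk \<in> simple_roots gC H es" "\<epsilon> (rk - 1) - \<epsilon> rk \<in> simple_roots gC H es"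
        using rk_odd unfolding bourbaki_facts(5) by (auto intro!: image_eqI[of _ _ "rk - 1"])
      then have "(1/2) *\<^sub>R ((\<epsilon> (rk - 1) + \<epsilon> rk) - (\<epsilon> (rk - 1) - \<epsilon> rk)) \<in> span (simple_roots gC H es)"
        by (intro span_scale span_diff span_base)
      then show ?thesis by (simp add: scaleR_2[symmetric])
    qed
  next
    case (Suc j)
    let ?i = "rk - Suc j"
    have i: "?i + 1 = rk - j" "?i \<in> {1..<rk}" using Suc.prems by auto
    then have "\<epsilon> ?i - \<epsilon> (rk - j) \<in> simple_roots gC H es"
      unfolding bourbaki_facts(5) by (intro UnI1 image_eqI[of _ _ ?i]) (simp_all only: i)
    then have "\<epsilon> ?i - \<epsilon> (rk - j) + \<epsilon> (rk - j) \<in> span (simple_roots gC H es)"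
      using Suc by (intro span_add) (simp_all add: span_base)
    then show ?case by simp
  qed
  from this[of "rk - i"] show "i \<in> {1..rk} \<Longrightarrow> \<epsilon> i \<in> span (simple_roots gC H es)" by simp
qed

lemma real_cartan_span_simple: "real_cartan gC H \<subseteq> span (simple_roots gC H es)"
  unfolding bourbaki_facts(3)[symmetric] using eps_span_simple by (intro span_minimal) auto

text \<open>An element of the radical would be a root, and a small multiple of it could be split off from
  every simple root that does not come after it in the ordering. So no simple root has a component in
  its leading direction, although the simple roots span.\<close>

lemma kil_nondegenerate:
  assumes x: "x \<in> H" and rad: "\<And>X. X \<in> H \<Longrightarrow> kil x X = 0"
  shows "x = 0"
proof (rule ccontr)
  assume x0: "x \<noteq> 0"
  have root: "y \<in> roots gC H" if "y \<in> H" "y \<noteq> 0" "\<And>X. X \<in> H \<Longrightarrow> kil y X = 0" for y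
  proof -
    \<comment> \<open>The bracket with \<open>H\<close> and the functional of y both vanish on
      \<open>H\<close>, so y is a root vector for itself.\<close>
    have "y \<in> root_space gC H y" using that H by (auto simp: root_space_def)
    then show ?thesis using that by (auto simp: roots_def)
  qed
  define y where "y = (if lex_pos es x then x else - x)"
  have "x \<in> span (set es)" using root[OF x x0 rad] es(3) by (simp add: real_cartan_def span_base)
  then have y: "lex_pos es y" using lex_pos_total[OF es(1,2) _ x0] by (auto simp: y_def)
  have yH: "y \<in> H" "y \<noteq> 0" using x x0 by (auto simp: y_def H_closed)
  have yrad: "kil y X = 0" if "X \<in> H" for X
    using rad[OF that] kil_simps(4)[OF x that, of "-1"] by (auto simp: y_def)
  let ?co = "\<lambda>X i. representation (set es) X (es ! i)"
  obtain k where k: "k < length es" "?co y k > 0" "\<forall>j<k. ?co y j = 0" and ysp: "y \<in> span (set es)"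
    using y unfolding lex_pos_iff[OF es(1,2)] by blast
  have simple0: "?co a k = 0" if a: "a \<in> simple_roots gC H es" for a
  proof (rule ccontr)
    assume ak: "?co a k \<noteq> 0"
    have apos: "a \<in> positive_roots gC H es" using a by (simp add: simple_roots_def)
    then have aH: "a \<in> H" and al: "lex_pos es a" and ar: "root_space gC H a \<noteq> {0}"
      by (auto simp: positive_roots_def roots_def)
    obtain l where l: "l < length es" "?co a l > 0" "\<forall>j<l. ?co a j = 0" and asp: "a \<in> span (set es)"
      using al unfolding lex_pos_iff[OF es(1,2)] by blast
    have lk: "l \<le> k" using ak l(3) by (meson not_le)
    \<comment> \<open>If l = k, half of the leading coefficient of a is left after the subtraction;
      if l < k, it is untouched.\<close>
    define c where "c = ?co a l / (2 * ?co y k)"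
    have c: "c > 0" using l k by (simp add: c_def)
    have co: "?co (a - c *\<^sub>R y) j = ?co a j - c * ?co y j" for j
      using es(2) asp ysp by (simp add: real_vector.representation_diff real_vector.representation_scale span_scale)
    have "?co (a - c *\<^sub>R y) l > 0"
    proof -
      have "c * ?co y l = (if l = k then ?co a l / 2 else 0)" using lk l k by (auto simp: c_def)
      then show ?thesis using co[of l] l by (auto split: if_splits)
    qed
    moreover have "\<forall>j<l. ?co (a - c *\<^sub>R y) j = 0" using l lk k by (auto simp: co)
    ultimately have lp: "lex_pos es (a - c *\<^sub>R y)"
      unfolding lex_pos_iff[OF es(1,2)] using l asp ysp by (auto intro: span_diff span_scale)
    have cyH: "c *\<^sub>R y \<in> H" using yH by (simp add: scaleR_cscale H_closed)
    have cyrad: "kil (c *\<^sub>R y) X = 0" if "X \<in> H" for X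
      using yrad[OF that] by (simp add: scaleR_cscale kil_simps yH that)
    have "a - c *\<^sub>R y \<in> H" using aH cyH by (rule H_closed)
    moreover have "root_space gC H (a - c *\<^sub>R y) = root_space gC H a"
      using aH cyH cyrad by (auto simp: root_space_def kil_simps)
    ultimately have "a - c *\<^sub>R y \<in> positive_roots gC H es"
      using lp ar lex_pos_nonzero[OF es(1,2) lp] by (auto simp: positive_roots_def roots_def)
    moreover have "c *\<^sub>R y \<in> positive_roots gC H es"
      using root[OF cyH _ cyrad] yH c lex_pos_scaleR[OF y c] by (simp add: positive_roots_def)
    moreover have "a = (a - c *\<^sub>R y) + c *\<^sub>R y" by simp
    ultimately show False using a unfolding simple_roots_def by blast
  qed
  have "simple_roots gC H es \<subseteq> {X \<in> span (set es). ?co X k = 0}"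
    using simple0 es(3) by (auto simp: simple_roots_def positive_roots_def real_cartan_def span_base)
  moreover have "subspace {X \<in> span (set es). ?co X k = 0}"
    using es(2) by (auto simp: subspace_def span_zero span_add span_scale real_vector.representation_zero
        real_vector.representation_add real_vector.representation_scale)
  ultimately have "span (simple_roots gC H es) \<subseteq> {X \<in> span (set es). ?co X k = 0}"
    by (rule span_minimal)
  then have "y \<in> {X \<in> span (set es). ?co X k = 0}"
    using ysp es(3) real_cartan_span_simple by blast
  then show False using k by simp
qed

text \<open>Along the line X + t Y each functional vanishes for only finitely many t. Nondegeneracy
  supplies a Y at which the new functional is not zero.\<close>

lemma generic_element:
  assumes "finite F" "F \<subseteq> H" "0 \<notin> F"
  shows "\<exists>X\<in>H. \<forall>f\<in>F. kil f X \<noteq> 0"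
  using assms
proof (induction F rule: finite_induct)
  case empty
  show ?case using H_closed(5) by blast
next
  case (insert f F)
  then obtain X where X: "X \<in> H" "\<forall>f\<in>F. kil f X \<noteq> 0" by auto
  obtain Y where Y: "Y \<in> H" "kil f Y \<noteq> 0" using kil_nondegenerate[of f] insert by blast
  define bad where "bad f' = {t::nat. kil f' X + of_nat t * kil f' Y = 0}" for f'
  have "finite (bad f')" if "f' \<in> insert f F" for f'
  proof (cases "kil f' Y = 0")
    case True
    then have "bad f' = {}" using that X Y by (auto simp: bad_def)
    then show ?thesis by simp
  next
    case False
    have "bad f' \<subseteq> {t. of_nat t = - kil f' X / kil f' Y}"
      using False by (auto simp: bad_def field_simps add_eq_0_iff)
    moreover have "finite {t. (of_nat t :: complex) = - kil f' X / kil f' Y}"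
      using finite_vimageI[of "{- kil f' X / kil f' Y}" "of_nat :: nat \<Rightarrow> complex"]
      by (simp add: vimage_def inj_of_nat)
    ultimately show ?thesis by (rule finite_subset)
  qed
  then have "finite (\<Union>f'\<in>insert f F. bad f')" using insert by blast
  then obtain t where t: "t \<notin> (\<Union>f'\<in>insert f F. bad f')" using ex_new_if_finite infinite_UNIV_nat by blast
  have "kil f' (X + cscale (of_nat t) Y) \<noteq> 0" if "f' \<in> insert f F" for f'
  proof -
    have "f' \<in> H" using that insert by auto
    then have "kil f' (X + cscale (of_nat t) Y) = kil f' X + of_nat t * kil f' Y"
      using X Y by (simp add: kil_simps H_closed)
    then show ?thesis using t that by (auto simp: bad_def)
  qed
  then show ?case using X Y by (intro bexI[of _ "X + cscale (of_nat t) Y"]) (auto simp: H_closed)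
qed

section \<open>A weight basis of the defining representation\<close>

abbreviation "WI \<equiv> {k::int. \<bar>k\<bar> \<le> int rk \<and> (k = 0 \<longrightarrow> even n)}"

lemma card_WI: "finite WI" "card WI = CARD('n option)"
proof -
  have WI: "WI = (if even n then {- int rk..int rk} else {- int rk..int rk} - {0})" by auto
  show "finite WI" unfolding WI by simp
  have "card {- int rk..int rk} = 2 * rk + 1" by simp
  moreover have "card ({- int rk..int rk} - {0}) = 2 * rk"
    by (subst card_Diff_singleton) auto
  ultimately show "card WI = CARD('n option)"
    unfolding WI using rk_def n by (auto elim!: evenE oddE)
qed

lemma eps_independent:
  assumes "i \<in> {1..rk}" "j \<in> {1..rk}"
  shows "\<epsilon> i \<noteq> 0" "i \<noteq> j \<Longrightarrow> \<epsilon> i - \<epsilon> j \<noteq> 0" "\<epsilon> i + \<epsilon> j \<noteq> 0"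
proof -
  show 0: "\<epsilon> i \<noteq> 0" using bourbaki_facts(2) assms(1) by (metis dependent_zero imageI)
  show "i \<noteq> j \<Longrightarrow> \<epsilon> i - \<epsilon> j \<noteq> 0" using bourbaki_facts(1) assms by (auto simp: inj_on_eq_iff)
  show "\<epsilon> i + \<epsilon> j \<noteq> 0"
  proof
    assume s: "\<epsilon> i + \<epsilon> j = 0"
    show False
    proof (cases "i = j")
      case True
      then show False using s 0 by (simp add: scaleR_2[symmetric])
    next
      case False
      then have "\<epsilon> j \<in> \<epsilon> ` {1..rk} - {\<epsilon> i}" using assms bourbaki_facts(1) by (auto simp: inj_on_eq_iff)
      then have "- \<epsilon> j \<in> span (\<epsilon> ` {1..rk} - {\<epsilon> i})" by (intro span_neg span_base)
      moreover have "- \<epsilon> j = \<epsilon> i" using s by (simp add: add_eq_0_iff2)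
      ultimately have "\<epsilon> i \<in> span (\<epsilon> ` {1..rk} - {\<epsilon> i})" by simp
      then show False using bourbaki_facts(2) assms(1) unfolding dependent_def by blast
    qed
  qed
qed

text \<open>\<open>F\<close> lists the functionals that must not vanish at X for its eigenvalues on
  E to be distinct. The Bourbaki vectors serve the positive indices; opposite eigenvalues and, in
  odd dimension, the kernel provide the others. Whatever commutes with X preserves its eigenlines,
  so the basis diagonalizes all of \<open>H\<close>.\<close>

lemma weight_basis:
  "\<exists>v. (\<forall>k\<in>WI. \<forall>m\<in>WI. bf (v k) (v m) = (if k = - m then 1 else 0)) \<and>
    (\<forall>x. x = (\<Sum>k\<in>WI. bf (v (- k)) x *s v k)) \<and>
    (\<forall>i\<in>{1..rk}. \<forall>Y\<in>H. Y *v v (int i) = kil (\<epsilon> i) Y *s v (int i)) \<and>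
    (\<forall>k\<in>WI. \<forall>Y\<in>H. \<exists>c. Y *v v k = c *s v k)"
proof -
  define F where "F = \<epsilon> ` {1..rk} \<union> {\<epsilon> i - \<epsilon> j | i j. i \<in> {1..rk} \<and> j \<in> {1..rk} \<and> i \<noteq> j} \<union>
    {\<epsilon> i + \<epsilon> j | i j. i \<in> {1..rk} \<and> j \<in> {1..rk}}"
  have "F \<subseteq> \<epsilon> ` {1..rk} \<union> (\<lambda>(i, j). \<epsilon> i - \<epsilon> j) ` ({1..rk} \<times> {1..rk}) \<union> (\<lambda>(i, j). \<epsilon> i + \<epsilon> j) ` ({1..rk} \<times> {1..rk})"
    by (auto simp: F_def)
  then have "finite F" by (rule finite_subset) auto
  moreover have "F \<subseteq> H" unfolding F_def using eps_H by (auto simp: H_closed)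
  moreover have "0 \<notin> F" unfolding F_def using eps_independent by (auto simp: eq_commute[of 0])
  ultimately have "\<exists>X\<in>H. \<forall>f\<in>F. kil f X \<noteq> 0" by (rule generic_element)
  then obtain X where XH: "X \<in> H" and gen: "\<And>f. f \<in> F \<Longrightarrow> kil f X \<noteq> 0" by blast
  define om where "om i = kil (\<epsilon> i) X" for i
  have om: "om i \<noteq> 0" "i \<noteq> j \<Longrightarrow> om i \<noteq> om j" "om i \<noteq> - om j" if "i \<in> {1..rk}" "j \<in> {1..rk}" for i j
  proof -
    show "om i \<noteq> 0" using gen[of "\<epsilon> i"] that by (auto simp: F_def om_def)
    show "om i \<noteq> om j" if "i \<noteq> j"
    proof -
      have "kil (\<epsilon> i - \<epsilon> j) X \<noteq> 0" using that \<open>i \<in> _\<close> \<open>j \<in> _\<close> by (intro gen) (auto simp: F_def)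
      then show ?thesis using \<open>i \<in> _\<close> \<open>j \<in> _\<close> XH by (simp add: om_def kil_simps eps_H)
    qed
    have "\<epsilon> i + \<epsilon> j \<in> F" unfolding F_def using that by blast
    then have "kil (\<epsilon> i + \<epsilon> j) X \<noteq> 0" by (rule gen)
    then show "om i \<noteq> - om j" using that XH by (simp add: om_def kil_simps eps_H add_eq_0_iff2)
  qed
  define ev where "ev k = (if k > 0 then om (nat k) else if k < 0 then - om (nat (- k)) else 0)" for k :: int
  have ev_neg: "ev (- k) = - ev k" for k by (simp add: ev_def)
  have ev_inj: "inj_on ev WI"
  proof (rule inj_onI)
    fix k m assume km: "k \<in> WI" "m \<in> WI" "ev k = ev m"
    have n: "nat \<bar>k\<bar> \<in> {1..rk}" if "k \<in> WI" "k \<noteq> 0" for k using that by auto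
    show "k = m"
    proof (cases "k = 0 \<or> m = 0")
      case True
      show ?thesis
      proof (rule ccontr)
        assume "k \<noteq> m"
        then obtain j where j: "j \<in> WI" "j \<noteq> 0" "ev j = 0" using True km by (auto simp: ev_def)
        then show False using om(1)[OF n[OF j(1,2)] n[OF j(1,2)]] by (auto simp: ev_def split: if_splits)
      qed
    next
      case False
      then have k: "nat \<bar>k\<bar> \<in> {1..rk}" "nat \<bar>m\<bar> \<in> {1..rk}" using n km by auto
      have e: "ev j = (if j > 0 then om (nat \<bar>j\<bar>) else - om (nat \<bar>j\<bar>))" if "j \<noteq> 0" for j using that by (auto simp: ev_def)
      have s: "k > 0 \<longleftrightarrow> m > 0"
        using om(3)[OF k] km(3) False e[of k] e[of m] om(3)[OF k(2,1)] by (auto split: if_splits)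
      then have "om (nat \<bar>k\<bar>) = om (nat \<bar>m\<bar>)" using e[of k] e[of m] km(3) False by (auto split: if_splits)
      then have "nat \<bar>k\<bar> = nat \<bar>m\<bar>" using om(2)[OF k] by blast
      then show ?thesis using s False by auto
    qed
  qed
  have XG: "X \<in> gC" using XH H_gC by blast
  have "\<forall>i\<in>{1..rk}. \<exists>v. v \<noteq> 0 \<and> (\<forall>Y\<in>H. Y *v v = kil (\<epsilon> i) Y *s v)" using bourbaki_facts(4) by blast
  then obtain b where b: "\<And>i. i \<in> {1..rk} \<Longrightarrow> b i \<noteq> 0"
    "\<And>i Y. i \<in> {1..rk} \<Longrightarrow> Y \<in> H \<Longrightarrow> Y *v b i = kil (\<epsilon> i) Y *s b i" by metis
  have "\<forall>k\<in>WI. \<exists>u. u \<noteq> 0 \<and> X *v u = ev k *s u \<and> (k > 0 \<longrightarrow> u = b (nat k))"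
  proof
    fix k assume k: "k \<in> WI"
    consider "k > 0" | "k < 0" | "k = 0" by linarith
    then show "\<exists>u. u \<noteq> 0 \<and> X *v u = ev k *s u \<and> (k > 0 \<longrightarrow> u = b (nat k))"
    proof cases
      case 1
      then have "nat k \<in> {1..rk}" using k by auto
      then show ?thesis using b[of "nat k"] XH 1 by (intro exI[of _ "b (nat k)"]) (simp add: ev_def om_def)
    next
      case 2
      then have i: "nat (- k) \<in> {1..rk}" using k by auto
      have "X *v b (nat (- k)) = om (nat (- k)) *s b (nat (- k))" using b(2)[OF i XH] by (simp add: om_def)
      from so_eigenvalue_uminus[OF XG this b(1)[OF i]] show ?thesis using 2 by (auto simp: ev_def)
    next
      case 3
      then have "odd CARD('n option)" using k n by simp
      from so_odd_singular[OF XG this] show ?thesis using 3 by (auto simp: ev_def)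
    qed
  qed
  from bchoice[OF this] obtain u where
    "\<forall>k\<in>WI. u k \<noteq> 0 \<and> X *v u k = ev k *s u k \<and> (k > 0 \<longrightarrow> u k = b (nat k))" by (elim exE)
  then have u: "\<And>k. k \<in> WI \<Longrightarrow> u k \<noteq> 0" "\<And>k. k \<in> WI \<Longrightarrow> X *v u k = ev k *s u k"
    "\<And>k. k \<in> WI \<Longrightarrow> k > 0 \<Longrightarrow> u k = b (nat k)" by simp_all
  have neg: "\<And>k. k \<in> WI \<Longrightarrow> - k \<in> WI" by simp
  have "\<exists>v. (\<forall>k\<in>WI. \<forall>m\<in>WI. bf (v k) (v m) = (if k = - m then 1 else 0)) \<and>
     (\<forall>x. x = (\<Sum>k\<in>WI. bf (v (- k)) x *s v k)) \<and> (\<forall>k\<in>WI. X *v v k = ev k *s v k) \<and> (\<forall>k>0. v k = u k)"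
    by (rule witt_basis_exists[OF XG card_WI neg u(2,1) ev_inj ev_neg])
  then obtain v where v':
    "(\<forall>k\<in>WI. \<forall>m\<in>WI. bf (v k) (v m) = (if k = - m then 1 else 0)) \<and>
     (\<forall>x. x = (\<Sum>k\<in>WI. bf (v (- k)) x *s v k)) \<and> (\<forall>k\<in>WI. X *v v k = ev k *s v k) \<and> (\<forall>k>0. v k = u k)"
    ..
  have v: "\<And>k m. k \<in> WI \<Longrightarrow> m \<in> WI \<Longrightarrow> bf (v k) (v m) = (if k = - m then 1 else 0)"
    "\<And>x. x = (\<Sum>k\<in>WI. bf (v (- k)) x *s v k)" "\<And>k. k \<in> WI \<Longrightarrow> X *v v k = ev k *s v k" "\<And>k. k > 0 \<Longrightarrow> v k = u k"
    using v' by blast+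
  have "Y *v v (int i) = kil (\<epsilon> i) Y *s v (int i)" if "i \<in> {1..rk}" "Y \<in> H" for i Y
    using that v(4)[of "int i"] u(3)[of "int i"] b(2)[of i Y] by auto
  moreover have "\<exists>c. Y *v v k = c *s v k" if k: "k \<in> WI" and Y: "Y \<in> H" for k Y
  proof -
    have "bracket X Y *v v k = 0" using H(3)[OF XH Y] by simp
    then have XY: "X *v (Y *v v k) = ev k *s (Y *v v k)" using v(3)[OF k] by (simp add: mv_simps)
    have "bf (v (- m)) (Y *v v k) = 0" if m: "m \<in> WI" "m \<noteq> k" for m
    proof -
      have m': "- m \<in> WI" using m by auto
      have "ev k * bf (v (- m)) (Y *v v k) = bf (v (- m)) (X *v (Y *v v k))" by (simp add: XY bf_simps)
      also have "\<dots> = - bf (X *v v (- m)) (Y *v v k)" using so_skew[OF XG, of "v (- m)" "Y *v v k"] by simp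
      also have "\<dots> = ev m * bf (v (- m)) (Y *v v k)" by (simp only: v(3)[OF m'] bf_simps ev_neg) simp
      finally have "ev k * bf (v (- m)) (Y *v v k) = ev m * bf (v (- m)) (Y *v v k)" .
      moreover have "ev k \<noteq> ev m" using ev_inj m k by (auto dest: inj_onD)
      ultimately show ?thesis by simp
    qed
    then have "(\<Sum>m\<in>WI. bf (v (- m)) (Y *v v k) *s v m) = (\<Sum>m\<in>WI. if m = k then bf (v (- k)) (Y *v v k) *s v k else 0)"
      by (intro sum.cong) auto
    also have "\<dots> = bf (v (- k)) (Y *v v k) *s v k" using k card_WI(1) by simp
    finally show ?thesis using v(2)[of "Y *v v k"] by metis
  qed
  ultimately show ?thesis using v(1,2) by (intro exI[of _ v]) blast
qed

end

section \<open>Weights, diagonal matrices and values of the Killing form\<close>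

context so1n_cartan
begin

definition wv :: "int \<Rightarrow> complex^('n option)" where
  "wv = (SOME v. (\<forall>k\<in>WI. \<forall>m\<in>WI. bf (v k) (v m) = (if k = - m then 1 else 0)) \<and>
    (\<forall>x. x = (\<Sum>k\<in>WI. bf (v (- k)) x *s v k)) \<and>
    (\<forall>i\<in>{1..rk}. \<forall>Y\<in>H. Y *v v (int i) = kil (\<epsilon> i) Y *s v (int i)) \<and>
    (\<forall>k\<in>WI. \<forall>Y\<in>H. \<exists>c. Y *v v k = c *s v k))"

lemma wv: "\<forall>k\<in>WI. \<forall>m\<in>WI. bf (wv k) (wv m) = (if k = - m then 1 else 0)"
  "\<forall>x. x = (\<Sum>k\<in>WI. bf (wv (- k)) x *s wv k)"
  "\<And>i Y. i \<in> {1..rk} \<Longrightarrow> Y \<in> H \<Longrightarrow> Y *v wv (int i) = kil (\<epsilon> i) Y *s wv (int i)"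
  "\<And>k Y. k \<in> WI \<Longrightarrow> Y \<in> H \<Longrightarrow> \<exists>c. Y *v wv k = c *s wv k"
proof -
  note c = someI_ex[OF weight_basis, folded wv_def]
  show "\<forall>k\<in>WI. \<forall>m\<in>WI. bf (wv k) (wv m) = (if k = - m then 1 else 0)"
    "\<forall>x. x = (\<Sum>k\<in>WI. bf (wv (- k)) x *s wv k)"
    by (rule conjunct1[OF c], rule conjunct1[OF conjunct2[OF c]])
  note c' = conjunct2[OF conjunct2[OF c]]
  show "Y *v wv (int i) = kil (\<epsilon> i) Y *s wv (int i)" if "i \<in> {1..rk}" "Y \<in> H" for i Y
    using conjunct1[OF c'] that by blast
  show "\<exists>c. Y *v wv k = c *s wv k" if "k \<in> WI" "Y \<in> H" for k Y
    using conjunct2[OF c'] that by blast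
qed

lemma nat_WI: "k \<in> WI \<Longrightarrow> k > 0 \<Longrightarrow> nat k \<in> {1..rk}" "k \<in> WI \<Longrightarrow> k < 0 \<Longrightarrow> nat (- k) \<in> {1..rk}"
  by auto

lemma rank_cases: "int rk \<ge> 2 \<or> (int rk = 1 \<and> even n)"
  using rk_pos rk_odd by (cases "even n") auto

sublocale W: witt wv "int rk" "even n" WI
proof unfold_locales
  show "int rk \<ge> 2 \<or> (int rk = 1 \<and> even n)" by (rule rank_cases)
  show "bf (wv k) (wv m) = (if k = - m then 1 else 0)" if "k \<in> WI" "m \<in> WI" for k m
    using wv(1) that by blast
  show "x = (\<Sum>k\<in>WI. bf (wv (- k)) x *s wv k)" for x using wv(2) by blast
qed

lemma wv_nonzero: "k \<in> WI \<Longrightarrow> wv k \<noteq> 0"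
  using W.form[of k "- k"] by fastforce

definition wt :: "int \<Rightarrow> complex^('n option)^('n option)" where
  "wt k = (if k > 0 then \<epsilon> (nat k) else if k < 0 then - \<epsilon> (nat (- k)) else 0)"

lemma wt_H: "k \<in> WI \<Longrightarrow> wt k \<in> H"
proof -
  assume k: "k \<in> WI"
  consider "k > 0" | "k < 0" | "k = 0" by linarith
  then show ?thesis
  proof cases
    case 1
    then show ?thesis using eps_H[OF nat_WI(1)[OF k]] by (simp add: wt_def)
  next
    case 2
    then show ?thesis using H_closed(4)[OF eps_H[OF nat_WI(2)[OF k]]] by (simp add: wt_def)
  qed (simp add: wt_def H_closed(5))
qed

lemma kil_uminus: "X \<in> H \<Longrightarrow> Y \<in> H \<Longrightarrow> kil (- X) Y = - kil X Y"
  using kil_simps(4)[of X Y "-1"] by simp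

lemma kil_zero: "Y \<in> H \<Longrightarrow> kil 0 Y = 0"
  using kil_simps(4)[of Y Y 0] by simp

lemma H_eigen:
  assumes k: "k \<in> WI" and Y: "Y \<in> H"
  shows "Y *v wv k = kil (wt k) Y *s wv k"
proof -
  consider "k > 0" | "k < 0" | "k = 0" by linarith
  then show ?thesis
  proof cases
    case 1
    then show ?thesis using wv(3)[OF nat_WI(1)[OF k] Y] by (simp add: wt_def)
  next
    case 2
    then have i: "nat (- k) \<in> {1..rk}" using k by (intro nat_WI)
    obtain c where c: "Y *v wv k = c *s wv k" using wv(4)[OF k Y] by blast
    have "bf (Y *v wv k) (wv (- k)) = - bf (wv k) (Y *v wv (- k))" by (rule so_skew[OF H_gC[OF Y]])
    moreover have "Y *v wv (- k) = kil (\<epsilon> (nat (- k))) Y *s wv (- k)"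
      using wv(3)[OF i Y] 2 by simp
    ultimately have "c = - kil (\<epsilon> (nat (- k))) Y" using c k W.form[of k "- k"] by (simp add: bf_simps)
    then show ?thesis using c 2 eps_H[OF i] Y by (simp add: wt_def kil_uminus)
  next
    case 3
    obtain c where c: "Y *v wv k = c *s wv k" using wv(4)[OF k Y] by blast
    have "bf (Y *v wv k) (wv k) = - bf (wv k) (Y *v wv k)" by (rule so_skew[OF H_gC[OF Y]])
    then have "c = - c" using c 3 k W.form[of k k] by (simp add: bf_simps)
    then have "c = 0" by (simp add: equal_neg_zero)
    then show ?thesis using c 3 Y by (simp add: wt_def kil_zero)
  qed
qed

text \<open>The matrices of \<open>gC\<close> that are diagonal in the weight basis form a toral
  subalgebra containing \<open>H\<close>, and \<open>H\<close> is maximal.\<close>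

lemma H_diagonal: "H = {X \<in> gC. \<forall>k\<in>WI. \<exists>c. X *v wv k = c *s wv k}"
proof -
  let ?T = "{X \<in> gC. \<forall>k\<in>WI. \<exists>c. X *v wv k = c *s wv k}"
  have HT: "H \<subseteq> ?T" using H_gC wv(4) by blast
  have "toral_subalgebra gC ?T"
    unfolding toral_subalgebra_def
  proof (intro conjI ballI)
    show "cmat.subspace ?T"
      unfolding cmat.subspace_def
    proof (intro conjI ballI allI)
      show "0 \<in> ?T" by (auto simp: so_closed intro!: exI[of _ 0])
      fix X Y assume XY: "X \<in> ?T" "Y \<in> ?T"
      have XYg: "X \<in> gC" "Y \<in> gC" using XY by blast+
      have e: "\<exists>c. (X + Y) *v wv k = c *s wv k" if "k \<in> WI" for k
      proof -
        obtain a b where "X *v wv k = a *s wv k" "Y *v wv k = b *s wv k" using XY \<open>k \<in> WI\<close> by blast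
        then show ?thesis by (intro exI[of _ "a + b"]) (simp add: mv_simps vec.scale_left_distrib)
      qed
      show "X + Y \<in> ?T"
        by (rule CollectI, rule conjI[OF so_closed(1)[OF XYg]], rule ballI, erule e)
    next
      fix c X assume X: "X \<in> ?T"
      have Xg: "X \<in> gC" using X by blast
      have e: "\<exists>d. cscale c X *v wv k = d *s wv k" if "k \<in> WI" for k
      proof -
        obtain a where "X *v wv k = a *s wv k" using X \<open>k \<in> WI\<close> by blast
        then show ?thesis by (intro exI[of _ "c * a"]) simp
      qed
      show "cscale c X \<in> ?T"
        by (rule CollectI, rule conjI[OF so_closed(3)[OF Xg]], rule ballI, erule e)
    qed
    show "?T \<subseteq> gC" by blast
    fix X assume X: "X \<in> ?T"
    show "bracket X Y = 0" if "Y \<in> ?T" for Y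
    proof (rule W.mat_eqI)
      fix k assume "k \<in> WI"
      then obtain a b where "X *v wv k = a *s wv k" "Y *v wv k = b *s wv k" using X \<open>Y \<in> ?T\<close> by blast
      then show "bracket X Y *v wv k = 0 *v wv k" by (simp add: mv_simps mult.commute)
    qed
    let ?E = "{Y \<in> gC. \<exists>c. bracket X Y = cscale c Y}"
    have XG: "X \<in> gC" using X by blast
    have "wedge (wv k) (wv m) \<in> ?E" if km: "k \<in> WI" "m \<in> WI" for k m
    proof -
      obtain a b where "X *v wv k = a *s wv k" "X *v wv m = b *s wv m" using X km by blast
      from W.bracket_wedge_eigen[OF XG this] show ?thesis by auto
    qed
    then have "{wedge (wv k) (wv m) | k m. k \<in> WI \<and> m \<in> WI} \<subseteq> ?E" by blast
    from cmat.span_mono[OF this] have "gC \<subseteq> cmat.span ?E" using W.so_span by blast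
    moreover have "cmat.span ?E \<subseteq> gC" by (rule cmat.span_minimal[OF _ so_subspace]) blast
    ultimately show "complex_ad_diagonalizable gC X"
      unfolding complex_ad_diagonalizable_def by blast
  qed
  then show ?thesis using cartan HT unfolding cartan_subalgebra_def by blast
qed

lemma h_H: "1 \<le> i \<Longrightarrow> i \<le> int rk \<Longrightarrow> W.h i \<in> H"
proof -
  assume i: "1 \<le> i" "i \<le> int rk"
  have "\<exists>c. W.h i *v wv k = c *s wv k" if "k \<in> WI" for k
    using W.h_mult_vec[OF i that] by (rule exI)
  then show ?thesis by (subst H_diagonal) (rule CollectI, rule conjI[OF W.h_so], rule ballI)
qed

lemma card_n: "of_nat (card WI) = (of_nat n + 1 :: complex)"
  using card_WI n by simp

text \<open>The Killing form of so(N) is N - 2 times the trace form of E, here with N = n + 1. In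
  the frame of all \<open>v m \<and> v (-k)\<close> the eigenvalues are \<open>t m - t k\<close>;
  the factor 1/2 stems from \<open>so_frame\<close>, and the pairs with m = -k drop out because
  \<open>v m \<and> v m\<close> is zero.\<close>

lemma kil_diagonal:
  assumes X: "X \<in> H" "\<And>k. k \<in> WI \<Longrightarrow> X *v wv k = t k *s wv k"
    and Y: "Y \<in> H" "\<And>k. k \<in> WI \<Longrightarrow> Y *v wv k = s k *s wv k"
    and t: "\<And>k. k \<in> WI \<Longrightarrow> t (- k) = - t k" and s: "\<And>k. k \<in> WI \<Longrightarrow> s (- k) = - s k"
  shows "kil X Y = (of_nat n - 1) * (\<Sum>k\<in>WI. t k * s k)"
proof -
  define c where "c p Z = (1/2) * bf (wv (- fst p)) (Z *v wv (snd p))" for p :: "int \<times> int" and Z :: "complex^('n option)^('n option)"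
  define f where "f p = wedge (wv (fst p)) (wv (- snd p))" for p :: "int \<times> int"
  have frame: "Z = (\<Sum>p\<in>WI \<times> WI. cscale (c p Z) (f p))" if Z: "Z \<in> gC" for Z
  proof -
    have w: "wedge x y = (\<Sum>m\<in>WI. cscale (bf (wv (- m)) x) (wedge (wv m) y))" for x y
      using arg_cong[OF W.expansion[of x], of "\<lambda>x. wedge x y"]
      by (simp only: wedge_sum_left wedge_scale_left)
    have "Z = (\<Sum>k\<in>WI. cscale (1/2) (wedge (Z *v wv k) (wv (- k))))" by (rule W.so_frame[OF Z])
    also have "\<dots> = (\<Sum>k\<in>WI. \<Sum>m\<in>WI. cscale (c (m, k) Z) (f (m, k)))"
    proof (rule sum.cong[OF refl])
      fix k
      have "cscale (1/2) (wedge (Z *v wv k) (wv (- k))) =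
          cscale (1/2) (\<Sum>m\<in>WI. cscale (bf (wv (- m)) (Z *v wv k)) (wedge (wv m) (wv (- k))))"
        by (rule arg_cong[OF w])
      then show "cscale (1/2) (wedge (Z *v wv k) (wv (- k))) = (\<Sum>m\<in>WI. cscale (c (m, k) Z) (f (m, k)))"
        by (simp add: cmat.scale_sum_right c_def f_def)
    qed
    also have "\<dots> = (\<Sum>m\<in>WI. \<Sum>k\<in>WI. cscale (c (m, k) Z) (f (m, k)))" by (rule sum.swap)
    also have "\<dots> = (\<Sum>p\<in>WI \<times> WI. cscale (c p Z) (f p))"
      by (simp add: sum.cartesian_product)
    finally show ?thesis .
  qed
  have XG: "X \<in> gC" and YG: "Y \<in> gC" using X(1) Y(1) H_gC by auto
  have "kil X Y = (\<Sum>p\<in>WI \<times> WI. c p (bracket X (bracket Y (f p))))"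
    unfolding killing_def
  proof (rule trace_on_frame[OF so_subspace])
    show "finite (WI \<times> WI)" using card_WI(1) by simp
    show "bracket X (bracket Y Z) \<in> gC" if "Z \<in> gC" for Z using XG YG that by (simp add: so_bracket)
    show "f p \<in> gC" for p by (simp add: f_def)
    show "c p (Z + Z') = c p Z + c p Z'" for p Z Z' by (simp add: c_def mv_simps bf_simps distrib_left add_divide_distrib)
    show "c p (cscale a Z) = a * c p Z" for p a Z by (simp add: c_def bf_simps)
    show "Z = (\<Sum>p\<in>WI \<times> WI. cscale (c p Z) (f p))" if "Z \<in> gC" for Z by (rule frame[OF that])
  qed (simp_all add: bracket_add_right bracket_cscale_right)
  also have "\<dots> = (\<Sum>m\<in>WI. \<Sum>k\<in>WI. (1/2) * ((t m - t k) * (s m - s k) * (1 - (if m = - k then 1 else 0))))"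
    unfolding sum.cartesian_product
  proof (rule sum.cong[OF refl])
    fix p assume "p \<in> WI \<times> WI"
    then obtain m k where p: "p = (m, k)" "m \<in> WI" "k \<in> WI" by auto
    have mk: "- k \<in> WI" using p by simp
    have b: "bracket Z (wedge (wv m) (wv (- k))) = cscale (a m + a (- k)) (wedge (wv m) (wv (- k)))"
      if "Z \<in> gC" "\<And>k. k \<in> WI \<Longrightarrow> Z *v wv k = a k *s wv k" for Z a
      using W.bracket_wedge_eigen[OF that(1) that(2)[OF p(2)] that(2)[OF mk]] .
    have "bracket X (bracket Y (f p)) = cscale ((t m - t k) * (s m - s k)) (wedge (wv m) (wv (- k)))"
      using b[OF XG X(2)] b[OF YG Y(2)] t[OF p(3)] s[OF p(3)]
      by (simp add: f_def p(1) bracket_cscale_right mult.commute)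
    moreover have "bf (wv (- m)) (wedge (wv m) (wv (- k)) *v wv k) = 1 - (if m = - k then 1 else 0)"
      using p by (auto simp: wedge_mult_vec bf_simps W.form)
    ultimately show "c p (bracket X (bracket Y (f p))) =
        (case p of (m, k) \<Rightarrow> (1/2) * ((t m - t k) * (s m - s k) * (1 - (if m = - k then 1 else 0))))"
      by (simp add: c_def p(1) bf_simps)
  qed
  also have "\<dots> = (1/2) * ((\<Sum>m\<in>WI. \<Sum>k\<in>WI. (t m - t k) * (s m - s k)) - (\<Sum>m\<in>WI. \<Sum>k\<in>WI. if m = - k then (t m - t k) * (s m - s k) else 0))"
  proof -
    have "(1/2) * ((t m - t k) * (s m - s k) * (1 - (if m = - k then 1 else 0))) =
        (1/2) * ((t m - t k) * (s m - s k) - (if m = - k then (t m - t k) * (s m - s k) else 0))" for m k :: int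
      by simp
    then show ?thesis by (simp only: sum_distrib_left[symmetric] sum_subtractf)
  qed
  also have "(\<Sum>m\<in>WI. \<Sum>k\<in>WI. if m = - k then (t m - t k) * (s m - s k) else 0) = 4 * (\<Sum>m\<in>WI. t m * s m)"
  proof -
    have "(\<Sum>k\<in>WI. if m = - k then (t m - t k) * (s m - s k) else 0) = 4 * (t m * s m)" if m: "m \<in> WI" for m
    proof -
      have "(\<Sum>k\<in>WI. if m = - k then (t m - t k) * (s m - s k) else 0) =
          (\<Sum>k\<in>WI. if k = - m then (t m - t (- m)) * (s m - s (- m)) else 0)"
        by (intro sum.cong) auto
      also have "\<dots> = (t m - t (- m)) * (s m - s (- m))" using m card_WI(1) by simp
      finally show ?thesis using t[OF m] s[OF m] by simp
    qed
    then show ?thesis by (simp add: sum_distrib_left)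
  qed
  also have "(\<Sum>m\<in>WI. \<Sum>k\<in>WI. (t m - t k) * (s m - s k)) = 2 * (of_nat n + 1) * (\<Sum>m\<in>WI. t m * s m)"
  proof -
    \<comment> \<open>Odd functions sum to zero over the symmetric index set, which removes the
      mixed terms below.\<close>
    have z: "(\<Sum>m\<in>WI. a m) = 0" if "\<And>k. k \<in> WI \<Longrightarrow> a (- k) = - a k" for a :: "int \<Rightarrow> complex"
    proof -
      have "(\<Sum>m\<in>WI. a m) = (\<Sum>m\<in>WI. a (- m))"
        by (rule sum.reindex_bij_witness[of _ uminus uminus]) auto
      also have "\<dots> = - (\<Sum>m\<in>WI. a m)" unfolding sum_negf[symmetric] using that by (intro sum.cong) auto
      finally show ?thesis by (simp add: equal_neg_zero)
    qed
    have zs: "(\<Sum>m\<in>WI. s m) = 0" by (rule z, rule s)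
    have zt: "(\<Sum>m\<in>WI. t m) = 0" by (rule z, rule t)
    have "(\<Sum>m\<in>WI. \<Sum>k\<in>WI. (t m - t k) * (s m - s k)) =
        (\<Sum>m\<in>WI. \<Sum>k\<in>WI. t m * s m) - (\<Sum>m\<in>WI. \<Sum>k\<in>WI. t m * s k) - (\<Sum>m\<in>WI. \<Sum>k\<in>WI. t k * s m) + (\<Sum>m\<in>WI. \<Sum>k\<in>WI. t k * s k)"
    proof -
      have "(t m - t k) * (s m - s k) = t m * s m - t m * s k - t k * s m + t k * s k" for m k
        by (simp add: algebra_simps)
      then show ?thesis by (simp only: sum.distrib sum_subtractf)
    qed
    also have "(\<Sum>m\<in>WI. \<Sum>k\<in>WI. t m * s k) = 0"
      by (simp only: sum_distrib_left[symmetric] zs mult_zero_right sum.neutral_const)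
    also have "(\<Sum>m\<in>WI. \<Sum>k\<in>WI. t k * s m) = 0"
      by (simp only: sum_distrib_right[symmetric] zt mult_zero_left sum.neutral_const)
    also have "(\<Sum>m\<in>WI. \<Sum>k\<in>WI. t m * s m) = (of_nat n + 1) * (\<Sum>m\<in>WI. t m * s m)"
      by (simp only: sum_constant card_n sum_distrib_left)
    also have "(\<Sum>m\<in>WI. \<Sum>k\<in>WI. t k * s k) = (of_nat n + 1) * (\<Sum>m\<in>WI. t m * s m)"
      by (simp only: sum_constant card_n)
    finally show ?thesis by simp
  qed
  moreover have "(1/2) * (2 * (c + 1) * S - 4 * S) = (c - 1) * S" for c S :: complex
    by (simp add: field_simps)
  ultimately show ?thesis by simp
qed

lemma wt_uminus: "wt (- k) = - wt k"
  by (auto simp: wt_def)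

lemma kil_wt_uminus: "k \<in> WI \<Longrightarrow> Y \<in> H \<Longrightarrow> kil (wt (- k)) Y = - kil (wt k) Y"
  by (simp add: wt_uminus kil_uminus wt_H)

lemma kil_eps_h:
  assumes i: "i \<in> {1..rk}" and j: "1 \<le> j" "j \<le> int rk"
  shows "kil (\<epsilon> i) (W.h j) = (if int i = j then 1 else 0)"
proof -
  have I: "int i \<in> WI" using i by auto
  have "kil (\<epsilon> i) (W.h j) *s wv (int i) = (if int i = j then 1 else 0) *s wv (int i)"
    using wv(3)[OF i h_H[OF j]] W.h_mult_vec[OF j I] i j by (auto split: if_splits)
  then show ?thesis using wv_nonzero[OF I] by (auto split: if_splits)
qed

lemma kil_h:
  assumes X: "X \<in> H" and j: "1 \<le> j" "j \<le> int rk"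
  shows "kil X (W.h j) = 2 * (of_nat n - 1) * kil (\<epsilon> (nat j)) X"
proof -
  let ?s = "\<lambda>k. if k = j then 1 else if k = - j then -1 else (0::complex)"
  have "kil X (W.h j) = (of_nat n - 1) * (\<Sum>k\<in>WI. kil (wt k) X * ?s k)"
    by (rule kil_diagonal[OF X H_eigen[OF _ X] h_H[OF j] W.h_mult_vec[OF j] kil_wt_uminus[OF _ X]]) (use j in auto)
  also have "(\<Sum>k\<in>WI. kil (wt k) X * ?s k) = (\<Sum>k\<in>{j, - j}. kil (wt k) X * ?s k)"
    using j card_WI(1) by (intro sum.mono_neutral_right) auto
  also have "\<dots> = kil (wt j) X - kil (wt (- j)) X" using j by simp
  also have "\<dots> = 2 * kil (\<epsilon> (nat j)) X"
    using j kil_wt_uminus[of j X] X by (simp add: wt_def)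
  finally show ?thesis by simp
qed

lemma n_minus_1: "(of_nat n - 1 :: complex) \<noteq> 0"
  using card by (simp add: complex_eq_iff)

text \<open>By \<open>kil_h\<close> the Killing form pairs \<open>h j\<close> with X to 2 (n - 1)
  times the value of \<epsilon>_j at X. The constant turns \<open>h i\<close> into the element that
  represents \<epsilon>_i.\<close>

lemma eps_eq:
  assumes i: "i \<in> {1..rk}"
  shows "\<epsilon> i = cscale (1 / (2 * (of_nat n - 1))) (W.h (int i))"
proof (rule W.mat_eqI)
  fix k assume k: "k \<in> WI"
  have e: "kil (\<epsilon> j) (\<epsilon> i) = (if i = j then 1 / (2 * (of_nat n - 1)) else 0)" if j: "j \<in> {1..rk}" for j
  proof -
    have "2 * (of_nat n - 1) * kil (\<epsilon> j) (\<epsilon> i) = (if i = j then 1 else 0)"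
      using kil_h[OF eps_H[OF i], of "int j"] kil_eps_h[OF i, of "int j"] j by auto
    then show ?thesis using n_minus_1 by (auto simp: field_simps split: if_splits)
  qed
  have "kil (wt k) (\<epsilon> i) = (1 / (2 * (of_nat n - 1))) * (if k = int i then 1 else if k = - int i then -1 else 0)"
  proof -
    consider "k > 0" | "k < 0" | "k = 0" by linarith
    then show ?thesis
    proof cases
      case 1
      then show ?thesis using e[OF nat_WI(1)[OF k]] i by (auto simp: wt_def)
    next
      case 2
      then have "kil (wt k) (\<epsilon> i) = - kil (\<epsilon> (nat (- k))) (\<epsilon> i)"
        using eps_H[OF nat_WI(2)[OF k]] eps_H[OF i] by (simp add: wt_def kil_uminus)
      then show ?thesis using e[OF nat_WI(2)[OF k 2]] 2 i by auto
    next
      case 3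
      then show ?thesis using i eps_H[OF i] by (auto simp: wt_def kil_zero)
    qed
  qed
  moreover have "W.h (int i) *v wv k = (if k = int i then 1 else if k = - int i then -1 else 0) *s wv k"
    using i k by (intro W.h_mult_vec) auto
  ultimately show "\<epsilon> i *v wv k = cscale (1 / (2 * (of_nat n - 1))) (W.h (int i)) *v wv k"
    by (simp only: H_eigen[OF k eps_H[OF i]] cscale_mult_vec vec.scale_scale)
qed

section \<open>Positive roots\<close>

lemma simple_lex_pos: "a \<in> simple_roots gC H es \<Longrightarrow> lex_pos es a"
  by (simp add: simple_roots_def positive_roots_def)

lemma lex_pos_diff:
  assumes "1 \<le> i" "i < j" "j \<le> rk"
  shows "lex_pos es (\<epsilon> i - \<epsilon> j)"
  using assms(2,3)
proof (induction j)
  case (Suc j)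
  have step: "lex_pos es (\<epsilon> j - \<epsilon> (Suc j))" if "1 \<le> j"
    using that Suc.prems by (intro simple_lex_pos) (auto simp: bourbaki_facts(5))
  show ?case
  proof (cases "i = j")
    case True
    then show ?thesis using step assms by simp
  next
    case False
    then have "lex_pos es (\<epsilon> i - \<epsilon> j)" using Suc by simp
    from lex_pos_add[OF this step] show ?thesis using Suc.prems assms by simp
  qed
qed simp

lemma lex_pos_eps:
  assumes "even n" "1 \<le> i" "i \<le> rk"
  shows "lex_pos es (\<epsilon> i)"
proof -
  have r: "lex_pos es (\<epsilon> rk)" using assms(1) by (intro simple_lex_pos) (simp add: bourbaki_facts(5))
  show ?thesis
  proof (cases "i = rk")
    case False
    then show ?thesis using lex_pos_add[OF lex_pos_diff[of i rk] r] assms by simp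
  qed (use r in simp)
qed

lemma lex_pos_sum:
  assumes "1 \<le> i" "i < j" "j \<le> rk"
  shows "lex_pos es (\<epsilon> i + \<epsilon> j)"
proof (cases "even n")
  case True
  then show ?thesis using assms by (intro lex_pos_add lex_pos_eps) auto
next
  case False
  then have s: "lex_pos es (\<epsilon> (rk - 1) + \<epsilon> rk)" by (intro simple_lex_pos) (simp add: bourbaki_facts(5))
  have s2: "lex_pos es (\<epsilon> i + \<epsilon> rk)" if "1 \<le> i" "i < rk" for i
  proof (cases "i = rk - 1")
    case False
    then show ?thesis using lex_pos_add[OF lex_pos_diff[of i "rk - 1"] s] that by simp
  qed (use s in simp)
  show ?thesis
  proof (cases "j = rk")
    case False
    have "(\<epsilon> i - \<epsilon> rk) + (\<epsilon> j + \<epsilon> rk) = \<epsilon> i + \<epsilon> j" by simp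
    then show ?thesis using lex_pos_add[OF lex_pos_diff[of i rk] s2[of j]] assms False by simp
  qed (use s2 assms in simp)
qed

text \<open>Of the lexicographical ordering only the simple roots are known explicitly; it agrees
  with \<open>ht\<close> on the roots of positive height. Hence their root vectors kill a highest
  weight vector.\<close>

lemma wt_pos:
  assumes km: "k \<in> WI" "m \<in> WI" "W.ht k + W.ht m > 0" "k \<noteq> m"
  shows "lex_pos es (wt k + wt m)"
proof -
  have "lex_pos es (wt k + wt m)" if km: "k \<in> WI" "m \<in> WI" "W.ht k + W.ht m > 0" "\<bar>k\<bar> < \<bar>m\<bar>" for k m
  proof (cases "k = 0")
    case True
    then have "m > 0" using km by (auto simp: W.ht_def sgn_if split: if_splits)
    then show ?thesis using True km lex_pos_eps[of "nat m"] by (simp add: wt_def)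
  next
    case False
    then have k: "k > 0" using km by (auto simp: W.ht_def sgn_if split: if_splits)
    show ?thesis
    proof (cases "m > 0")
      case True
      then show ?thesis using k km lex_pos_sum[of "nat k" "nat m"] by (simp add: wt_def)
    next
      case False
      then show ?thesis using k km lex_pos_diff[of "nat k" "nat (- m)"] by (simp add: wt_def)
    qed
  qed
  note * = this
  \<comment> \<open>Equal absolute values would mean k = m, which is excluded, or k = -m, where the
    heights cancel.\<close>
  have "\<bar>k\<bar> \<noteq> \<bar>m\<bar>" using km by (auto simp: abs_if split: if_splits)
  then show ?thesis using *[of k m] *[of m k] km by (cases "\<bar>k\<bar> < \<bar>m\<bar>") (auto simp: add.commute)
qed

lemma wedge_root:
  assumes "k \<in> WI" "m \<in> WI"
  shows "wedge (wv k) (wv m) \<in> root_space gC H (wt k + wt m)"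
proof -
  have "bracket X (wedge (wv k) (wv m)) = cscale (kil (wt k + wt m) X) (wedge (wv k) (wv m))" if "X \<in> H" for X
    using W.bracket_wedge_eigen[OF H_gC[OF that] H_eigen[OF assms(1) that] H_eigen[OF assms(2) that]] that assms
    by (simp add: kil_simps wt_H)
  then show ?thesis by (simp add: root_space_def)
qed

lemma wt_positive_root:
  assumes km: "k \<in> WI" "m \<in> WI" "W.ht k + W.ht m > 0" "k \<noteq> m"
  shows "wt k + wt m \<in> positive_roots gC H es"
proof -
  have lp: "lex_pos es (wt k + wt m)" by (rule wt_pos[OF km])
  have "wedge (wv k) (wv m) *v wv (- m) = wv k"
    using km W.form by (auto simp: wedge_mult_vec)
  then have "wedge (wv k) (wv m) \<noteq> 0" using wv_nonzero[OF km(1)] by auto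
  then have "root_space gC H (wt k + wt m) \<noteq> {0}" using wedge_root[OF km(1,2)] by blast
  then show ?thesis
    using lp lex_pos_nonzero[OF es(1,2) lp] km wt_H by (simp add: positive_roots_def roots_def H_closed)
qed

section \<open>Coordinates of the highest weight\<close>

lemma real_cartan_expand:
  assumes "lam \<in> real_cartan gC H"
  shows "\<exists>x. lam = (\<Sum>i\<in>{1..rk}. x i *\<^sub>R \<epsilon> i)"
proof -
  have "lam \<in> span (\<epsilon> ` {1..rk})" using assms bourbaki_facts(3) by simp
  then obtain u where "lam = (\<Sum>b\<in>\<epsilon> ` {1..rk}. u b *\<^sub>R b)"
    using span_finite[of "\<epsilon> ` {1..rk}"] by auto
  then have "lam = (\<Sum>i\<in>{1..rk}. u (\<epsilon> i) *\<^sub>R \<epsilon> i)"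
    using sum.reindex_cong[OF bourbaki_facts(1) refl, of "\<lambda>b. u b *\<^sub>R b" "\<lambda>i. u (\<epsilon> i) *\<^sub>R \<epsilon> i"] by simp
  then show ?thesis by (rule exI[of _ "\<lambda>i. u (\<epsilon> i)"])
qed

lemma H_scaleR: "X \<in> H \<Longrightarrow> c *\<^sub>R X \<in> H"
  by (simp add: scaleR_cscale H_closed)

lemma kil_scaleR: "X \<in> H \<Longrightarrow> Y \<in> H \<Longrightarrow> kil (c *\<^sub>R X) Y = of_real c * kil X Y"
  by (simp add: scaleR_cscale kil_simps)

lemma kil_sum:
  "finite K \<Longrightarrow> (\<And>k. k \<in> K \<Longrightarrow> f k \<in> H) \<Longrightarrow> Y \<in> H \<Longrightarrow> kil (\<Sum>k\<in>K. f k) Y = (\<Sum>k\<in>K. kil (f k) Y)"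
proof (induction K rule: finite_induct)
  case (insert k K)
  then have "(\<Sum>k\<in>K. f k) \<in> H" by (intro cmat.subspace_sum[OF H(1)]) auto
  then show ?case using insert by (simp add: kil_simps)
qed (simp add: kil_zero)

lemma kil_weight_h:
  assumes "lam = (\<Sum>i\<in>{1..rk}. x i *\<^sub>R \<epsilon> i)" and j: "1 \<le> j" "j \<le> int rk"
  shows "kil lam (W.h j) = of_real (x (nat j))"
proof -
  have "kil lam (W.h j) = (\<Sum>i\<in>{1..rk}. of_real (x i) * kil (\<epsilon> i) (W.h j))"
    unfolding assms(1) using h_H[OF j] eps_H
    by (subst kil_sum) (simp_all add: kil_scaleR H_scaleR)
  also have "\<dots> = (\<Sum>i\<in>{1..rk}. if i = nat j then of_real (x (nat j)) else 0)"
    using j by (intro sum.cong) (auto simp: kil_eps_h)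
  also have "\<dots> = of_real (x (nat j))" using j by auto
  finally show ?thesis .
qed

lemma highest_weight_vector:
  assumes hw: "has_highest_weight gC H es \<rho> lam" and rep: "representation_of gC \<rho>"
    and lam: "lam = (\<Sum>i\<in>{1..rk}. x i *\<^sub>R \<epsilon> i)"
  shows "\<exists>v0. v0 \<noteq> 0 \<and> (\<forall>i. 1 \<le> i \<longrightarrow> i \<le> int rk \<longrightarrow> \<rho> (W.h i) *v v0 = of_real (x (nat i)) *s v0) \<and>
    (\<forall>k\<in>WI. \<forall>m\<in>WI. W.ht k + W.ht m > 0 \<longrightarrow> \<rho> (wedge (wv k) (wv m)) *v v0 = 0)"
proof -
  obtain v0 where v0: "v0 \<noteq> 0" "\<And>X. X \<in> H \<Longrightarrow> \<rho> X *v v0 = kil lam X *s v0"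
    "\<And>a Y. a \<in> positive_roots gC H es \<Longrightarrow> Y \<in> root_space gC H a \<Longrightarrow> \<rho> Y *v v0 = 0"
    using hw unfolding has_highest_weight_def by blast
  have "\<rho> (wedge (wv k) (wv m)) *v v0 = 0" if km: "k \<in> WI" "m \<in> WI" "W.ht k + W.ht m > 0" for k m
  proof (cases "k = m")
    case True
    have "\<rho> (cscale 0 0) = cscale 0 (\<rho> 0)"
      using rep so_closed(4) unfolding representation_of_def by blast
    then show ?thesis using True by simp
  next
    case False
    then show ?thesis using v0(3)[OF wt_positive_root wedge_root] km by blast
  qed
  moreover have "\<rho> (W.h i) *v v0 = of_real (x (nat i)) *s v0" if "1 \<le> i" "i \<le> int rk" for i
    using v0(2)[OF h_H[OF that]] kil_weight_h[OF lam that] by simp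
  ultimately show ?thesis using v0(1) by blast
qed

end


section \<open>Cartan subspaces of the real form\<close>

definition cv :: "complex^'k \<Rightarrow> complex^'k" where
  "cv x = (\<chi> i. cnj (x $ i))"

lemma cv_simps: "cv (x + y) = cv x + cv y" "cv (x - y) = cv x - cv y" "cv (c *s x) = cnj c *s cv x"
  "cv (- x) = - cv x" "cv (cv x) = x" "cv (axis i 1) = axis i 1"
  by (simp_all add: cv_def vec_eq_iff axis_def)

lemma cv_mult_vec: "(\<And>i j. X $ i $ j \<in> \<real>) \<Longrightarrow> cv (X *v x) = X *v cv x"
  by (simp add: cv_def vec_eq_iff matrix_vector_mult_def Reals_cnj_iff)

lemma lsign_cnj: "cnj (lsign i) = lsign i"
  by (simp add: lsign_def)

lemma lsign_Re_Im: "lsign i * complex_of_real (Re c) = complex_of_real (Re (lsign i * c))"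
  "lsign i * complex_of_real (Im c) = complex_of_real (Im (lsign i * c))"
  by (simp_all add: lsign_def)

lemma bf_cv: "bf (cv x) (cv y) = cnj (bf x y)"
  by (simp add: bf_def cv_def lsign_cnj)

lemma cv_real: "cv x = x \<longleftrightarrow> (\<forall>i. x $ i \<in> \<real>)"
  by (simp add: cv_def vec_eq_iff Reals_cnj_iff)

lemma bf_real: "cv x = x \<Longrightarrow> cv y = y \<Longrightarrow> bf x y \<in> \<real>"
  using bf_cv[of x y] by (simp add: Reals_cnj_iff)

lemma so1n_so: "X \<in> so1n \<Longrightarrow> X \<in> so1n_complex"
  by (simp add: so1n_def)

lemma so1n_cv: "X \<in> so1n \<Longrightarrow> cv (X *v x) = X *v cv x"
  by (intro cv_mult_vec) (simp add: so1n_def)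

lemma wedge_real: "cv x = x \<Longrightarrow> cv y = y \<Longrightarrow> wedge x y \<in> so1n"
  by (simp add: so1n_def) (auto simp: wedge_def lsign_def cv_real)

lemma so1n_subspace: "subspace so1n"
  unfolding subspace_def by (auto simp: so1n_def so_closed scaleR_cscale) (simp add: cscale_def)

lemma bf_negative:
  assumes "x $ None = 0"
  shows "\<exists>q\<ge>0. bf x (cv x) = - complex_of_real q \<and> (q = 0 \<longrightarrow> x = 0)"
proof (intro exI[of _ "\<Sum>i\<in>UNIV. (cmod (x $ i))\<^sup>2"] conjI impI)
  have "lsign i * x $ i * cv x $ i = - complex_of_real ((cmod (x $ i))\<^sup>2)" for i
    using assms by (auto simp: lsign_def cv_def complex_norm_square simp del: of_real_power)
  then show "bf x (cv x) = - complex_of_real (\<Sum>i\<in>UNIV. (cmod (x $ i))\<^sup>2)"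
    by (simp add: bf_def sum_negf)
qed (auto simp: sum_nonneg sum_nonneg_eq_0_iff vec_eq_iff)

text \<open>In Lorentzian signature a totally isotropic subspace has dimension at most one.\<close>

lemma isotropic_dependent:
  assumes "bf x (cv x) = 0" "bf x (cv y) = 0" "bf y (cv x) = 0" "bf y (cv y) = 0"
  shows "\<exists>a b. (a \<noteq> 0 \<or> b \<noteq> 0) \<and> a *s x + b *s y = 0"
proof -
  obtain a b where ab: "a \<noteq> 0 \<or> b \<noteq> 0" "a * x $ None + b * y $ None = 0"
  proof (cases "x $ None = 0")
    case True
    then show ?thesis by (intro that[of 1 0]) auto
  next
    case False
    then show ?thesis by (intro that[of "y $ None" "- x $ None"]) (auto simp: mult.commute)
  qed
  let ?z = "a *s x + b *s y"
  have "?z $ None = 0" using ab by simp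
  moreover have "bf ?z (cv ?z) = 0" using assms by (simp add: cv_simps bf_simps)
  ultimately have "?z = 0" using bf_negative[of ?z] by auto
  then show ?thesis using ab by blast
qed

section \<open>Real diagonalizable elements\<close>

lemma so_frame_axis:
  fixes Z :: "complex^('n::finite option)^('n option)"
  assumes "Z \<in> so1n_complex"
  shows "Z = (\<Sum>i\<in>UNIV. (1/2) *\<^sub>R wedge (Z *v axis i 1) (lsign i *s axis i 1))"
proof (rule matrix_eq[THEN iffD2], rule allI)
  fix z :: "complex^('n option)"
  have ex: "(\<Sum>i\<in>UNIV. y $ i *s axis i 1) = y" for y :: "complex^('n option)"
    by (simp add: vec_eq_iff axis_def if_distrib cong: if_cong)
  have "bf (lsign i *s axis i 1) z = z $ i" for i
    by (simp add: bf_simps bf_sym[of "axis i 1"] bf_axis mult.assoc[symmetric])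
  moreover have "bf (Z *v axis i 1) z *s (lsign i *s axis i 1) = - ((Z *v z) $ i *s axis i 1)" for i
    by (simp add: so_skew[OF assms] bf_sym[of "axis i 1"] bf_axis)
  ultimately have "(\<Sum>i\<in>UNIV. (1/2) *\<^sub>R wedge (Z *v axis i 1) (lsign i *s axis i 1)) *v z
      = (1/2) *s (Z *v (\<Sum>i\<in>UNIV. z $ i *s axis i 1)) + (1/2) *s (\<Sum>i\<in>UNIV. (Z *v z) $ i *s axis i 1)"
    by (simp add: sum_matrix_vector_mult wedge_mult_vec scaleR_cscale mv_sum_right vector_scalar_commute
        vec.scale_sum_right sum.distrib vec.scale_right_distrib)
  also have "\<dots> = Z *v z"
    unfolding ex by (simp add: vec.scale_left_distrib[symmetric])
  finally show "Z *v z = (\<Sum>i\<in>UNIV. (1/2) *\<^sub>R wedge (Z *v axis i 1) (lsign i *s axis i 1)) *v z" by simp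
qed

text \<open>Wedges of eigenvectors are eigenvectors of \<open>ad X\<close>, and by
  \<open>so_frame_axis\<close> the wedges of real vectors span \<open>so1n\<close>.\<close>

lemma real_ad_diagonalizableI:
  assumes X: "X \<in> so1n" and U: "\<And>x. cv x = x \<Longrightarrow> x \<in> span {x. cv x = x \<and> (\<exists>c. X *v x = complex_of_real c *s x)}"
  shows "real_ad_diagonalizable so1n X"
proof -
  let ?U = "{x. cv x = x \<and> (\<exists>c. X *v x = complex_of_real c *s x)}"
  let ?E = "{Y \<in> so1n. \<exists>c::real. bracket X Y = c *\<^sub>R Y}"
  have UU: "wedge x y \<in> span ?E" if xy: "x \<in> ?U" "y \<in> ?U" for x y
  proof -
    obtain c d where "X *v x = complex_of_real c *s x" "X *v y = complex_of_real d *s y" using xy by blast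
    then have "bracket X (wedge x y) = (c + d) *\<^sub>R wedge x y"
      by (simp add: bracket_wedge[OF so1n_so[OF X]] wedge_scale_left wedge_scale_right scaleR_cscale cmat.scale_left_distrib)
    then have "wedge x y \<in> ?E" using xy wedge_real by blast
    then show ?thesis by (rule span_base)
  qed
  have sc: "wedge (c *\<^sub>R x) y = c *\<^sub>R wedge x y" "wedge x (c *\<^sub>R y) = c *\<^sub>R wedge x y" for c and x y :: "complex^('a option)"
    by (simp_all add: scaleR_vec_complex scaleR_cscale wedge_scale_left wedge_scale_right)
  have US: "wedge x y \<in> span ?E" if x: "x \<in> ?U" and y: "y \<in> span ?U" for x y
    using y
  proof (induction rule: span_induct_alt)
    case (step c a b)
    then show ?case using UU[OF x, of a] by (simp add: wedge_add_right sc span_add span_scale)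
  qed (simp add: span_zero)
  have SS: "wedge x y \<in> span ?E" if x: "x \<in> span ?U" and y: "y \<in> span ?U" for x y
    using x
  proof (induction rule: span_induct_alt)
    case (step c a b)
    then show ?case using US[OF _ y, of a] by (simp add: wedge_add_left sc span_add span_scale)
  qed (simp add: span_zero)
  have "Z \<in> span ?E" if Z: "Z \<in> so1n" for Z
  proof -
    have "wedge (Z *v axis i 1) (lsign i *s axis i 1) \<in> span ?E" for i
      by (rule SS; rule U) (simp_all add: so1n_cv[OF Z] cv_simps lsign_def)
    then have "(\<Sum>i\<in>UNIV. (1/2) *\<^sub>R wedge (Z *v axis i 1) (lsign i *s axis i 1)) \<in> span ?E"
      by (intro span_sum) (simp add: span_scale)
    then show ?thesis using so_frame_axis[OF so1n_so[OF Z]] by simp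
  qed
  moreover have "span ?E \<subseteq> so1n" by (rule span_minimal[OF _ so1n_subspace]) blast
  ultimately show ?thesis unfolding real_ad_diagonalizable_def by blast
qed

text \<open>A boost in the plane of one timelike and one spacelike axis: the lightlike vectors
  \<open>e0 \<plusminus> e\<close> have eigenvalues 2 and -2, and the other axes are killed. Its
  existence shows that a Cartan subspace is not zero.\<close>

lemma boost_exists:
  obtains b :: "complex^('n::finite option)^('n option)"
  where "b \<noteq> 0" "b \<in> so1n" "\<And>c. real_ad_diagonalizable so1n (c *\<^sub>R b)"
proof -
  define e where "e = (axis (Some undefined) 1 :: complex^('n option))"
  define e0 where "e0 = (axis None 1 :: complex^('n option))"
  define b where "b = wedge (e0 + e) (e0 - e)"
  have bfe: "bf e0 e0 = 1" "bf e e = -1" "bf e e0 = 0" "bf e0 e = 0"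
    by (simp_all add: e0_def e_def bf_axis lsign_def) (simp_all add: axis_def)
  have re: "cv e0 = e0" "cv e = e" by (simp_all add: e_def e0_def cv_simps)
  have bso: "b \<in> so1n" unfolding b_def by (intro wedge_real) (simp_all add: cv_simps re)
  have bp: "b *v (e0 + e) = 2 *s (e0 + e)" "b *v (e0 - e) = (-2) *s (e0 - e)"
    by (simp_all add: b_def wedge_mult_vec bf_simps bfe)
  have bj: "b *v axis j 1 = 0" if "j \<noteq> None" "j \<noteq> Some undefined" for j
  proof -
    have "(e0 + e) $ j = 0" "(e0 - e) $ j = 0" using that by (simp_all add: e0_def e_def axis_def)
    then show ?thesis by (simp only: b_def wedge_mult_vec bf_axis mult_zero_right vec.scale_zero_left diff_self)
  qed
  have "e0 + e \<noteq> 0"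
  proof
    assume "e0 + e = 0"
    then have "bf (e0 + e) (e0 - e) = 0" by simp
    then show False by (simp add: bf_simps bfe)
  qed
  then have "b \<noteq> 0" using bp(1) by (metis matrix_vector_mult_0 vec.scale_eq_0_iff zero_neq_numeral)
  moreover have "real_ad_diagonalizable so1n (c *\<^sub>R b)" for c
  proof (rule real_ad_diagonalizableI)
    show "c *\<^sub>R b \<in> so1n" using subspace_scale[OF so1n_subspace bso] .
    let ?U = "{x. cv x = x \<and> (\<exists>d. c *\<^sub>R b *v x = complex_of_real d *s x)}"
    have cb: "c *\<^sub>R b *v x = complex_of_real c *s (b *v x)" for x by (simp add: scaleR_cscale)
    have p: "e0 + e \<in> ?U"
      by (auto simp: cv_simps re cb bp intro!: exI[of _ "c * 2"])
    have q: "e0 - e \<in> ?U"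
    proof -
      have "c *\<^sub>R b *v (e0 - e) = complex_of_real (- c * 2) *s (e0 - e)" unfolding cb bp(2) by simp
      moreover have "cv (e0 - e) = e0 - e" by (simp add: cv_simps re)
      ultimately show ?thesis by blast
    qed
    have "(1/2) *\<^sub>R ((e0 + e) + (e0 - e)) \<in> span ?U" "(1/2) *\<^sub>R ((e0 + e) - (e0 - e)) \<in> span ?U"
      by (rule span_scale[OF span_add[OF span_base[OF p] span_base[OF q]]],
        rule span_scale[OF span_diff[OF span_base[OF p] span_base[OF q]]])
    then have ee: "e0 \<in> span ?U" "e \<in> span ?U" by (simp_all add: scaleR_2[symmetric])
    have ax: "axis j 1 \<in> span ?U" for j
    proof (cases "j = None \<or> j = Some undefined")
      case True
      then show ?thesis using ee by (auto simp: e_def e0_def)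
    next
      case False
      then have "axis j 1 \<in> ?U" by (auto simp: cb bj cv_simps intro!: exI[of _ 0])
      then show ?thesis by (rule span_base)
    qed
    fix x :: "complex^('n option)" assume x: "cv x = x"
    have "complex_of_real (Re (x $ i)) = x $ i" for i using x cv_real[of x] by (simp add: of_real_Re)
    then have "x = (\<Sum>i\<in>UNIV. Re (x $ i) *\<^sub>R axis i 1)"
      by (simp add: vec_eq_iff scaleR_vec_complex axis_def if_distrib cong: if_cong)
    also have "\<dots> \<in> span ?U" by (intro span_sum) (simp add: span_scale ax)
    finally show "x \<in> span ?U" .
  qed
  ultimately show ?thesis using that bso by blast
qed

text \<open>Eigenvectors of \<open>ad a\<close> with real eigenvalues span \<open>so1n\<close> over
  the reals, hence \<open>so1n_complex\<close> over the complex numbers, which leaves no room for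
  another eigenvalue.\<close>

lemma real_ad_eigenvalue:
  assumes a: "a \<in> so1n" "real_ad_diagonalizable so1n a"
    and Y: "Y \<in> so1n_complex" "Y \<noteq> 0" "bracket a Y = cscale c Y"
  shows "c \<in> \<real>"
proof (rule ccontr)
  assume c: "c \<notin> \<real>"
  let ?E = "{Y. \<exists>c\<in>\<real>. bracket a Y = cscale c Y}"
  have "{Y \<in> so1n. \<exists>c::real. bracket a Y = c *\<^sub>R Y} \<subseteq> cmat.span ?E"
    by (auto simp: scaleR_cscale intro!: cmat.span_base)
  from span_minimal[OF this cmat_subspace_real[OF cmat.subspace_span]]
  have sub: "so1n \<subseteq> cmat.span ?E" using a(2) by (simp add: real_ad_diagonalizable_def)
  define Y1 where "Y1 = (\<chi> i j. complex_of_real (Re (Y $ i $ j)))"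
  define Y2 where "Y2 = (\<chi> i j. complex_of_real (Im (Y $ i $ j)))"
  have e: "lsign j * Y $ j $ i + lsign i * Y $ i $ j = 0" for i j using Y(1) so_entries by blast
  have "lsign j * complex_of_real (Re (Y $ j $ i)) + lsign i * complex_of_real (Re (Y $ i $ j)) = 0"
    "lsign j * complex_of_real (Im (Y $ j $ i)) + lsign i * complex_of_real (Im (Y $ i $ j)) = 0" for i j
    unfolding lsign_Re_Im of_real_add[symmetric] plus_complex.simps[symmetric] e by simp_all
  then have "Y1 \<in> so1n" "Y2 \<in> so1n"
    by (simp_all add: so1n_def so_entries Y1_def Y2_def)
  then have "Y1 + cscale \<i> Y2 \<in> cmat.span ?E" using sub by (intro cmat.span_add cmat.span_scale) auto
  moreover have "Y1 + cscale \<i> Y2 = Y" by (simp add: vec_eq_iff Y1_def Y2_def cscale_def complex_eq_iff)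
  ultimately have YE: "Y \<in> cmat.span ?E" by simp
  have "Y = 0"
    by (rule cmat.eigenvector_in_span_eigenvectors[OF _ _ YE Y(3) c]) (simp_all add: bracket_add_right bracket_cscale_right)
  then show False using Y(2) by simp
qed

section \<open>The shape of the Cartan subspace\<close>

locale so1n_full = so1n_cartan n H es \<epsilon>
  for n and H :: "(complex^('n::finite option)^('n option)) set" and es \<epsilon> +
  fixes A :: "(complex^('n option)^('n option)) set"
  assumes cartan_A: "cartan_subspace so1n A" and AH: "cmat.span A \<subseteq> H"
    and first: "\<forall>X\<in>real_cartan so1n_complex H. \<forall>P\<in>A.
        (\<forall>Y\<in>A. killing so1n_complex (X - P) Y = 0) \<and> lex_pos es P \<longrightarrow> lex_pos es X"
begin

lemma A: "subspace A" "A \<subseteq> so1n" "\<And>a. a \<in> A \<Longrightarrow> real_ad_diagonalizable so1n a"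
  using cartan_A by (auto simp: cartan_subspace_def split_abelian_subalgebra_def)

lemma A_H: "a \<in> A \<Longrightarrow> a \<in> H"
  using AH cmat.span_base by blast

lemma A_nonzero: "\<exists>a\<in>A. a \<noteq> 0"
proof (rule ccontr)
  assume "\<not> (\<exists>a\<in>A. a \<noteq> 0)"
  then have A0: "A = {0}" using subspace_0[OF A(1)] by blast
  obtain b :: "complex^('n option)^('n option)" where b: "b \<noteq> 0" "b \<in> so1n" "\<And>c. real_ad_diagonalizable so1n (c *\<^sub>R b)"
    using boost_exists by blast
  have "split_abelian_subalgebra so1n (span {b})"
    unfolding split_abelian_subalgebra_def
  proof (intro conjI ballI)
    show "span {b} \<subseteq> so1n" by (rule span_minimal[OF _ so1n_subspace]) (use b in simp)
    fix X assume "X \<in> span {b}"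
    then obtain c where X: "X = c *\<^sub>R b" by (auto simp: span_singleton)
    then show "real_ad_diagonalizable so1n X" using b(3) by simp
    fix Y assume "Y \<in> span {b}"
    then obtain d where "Y = d *\<^sub>R b" by (auto simp: span_singleton)
    then show "bracket X Y = 0" by (simp add: X scaleR_cscale bracket_cscale_left bracket_cscale_right)
  qed (rule subspace_span)
  moreover have "A \<subseteq> span {b}" using A0 span_zero by auto
  ultimately have "span {b} = A" using cartan_A by (auto simp: cartan_subspace_def)
  then have "b \<in> A" using span_base[of b "{b}"] by blast
  then show False using A0 b(1) by blast
qed

text \<open>\<epsilon>_i is half the sum of the roots \<epsilon>_i + \<epsilon>_j and \<epsilon>_i -
  \<epsilon>_j, and in rank 1 it is itself a root. Roots take real values on A by
  \<open>real_ad_eigenvalue\<close>.\<close>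

lemma A_real:
  assumes a: "a \<in> A" and i: "i \<in> {1..rk}"
  shows "kil (\<epsilon> i) a \<in> \<real>"
proof -
  have aH: "a \<in> H" and aS: "a \<in> so1n" and aG: "a \<in> gC" using a A_H A(2) so1n_so by auto
  have I: "int i \<in> WI" "- int i \<in> WI" using i by auto
  have ei: "a *v wv (int i) = kil (\<epsilon> i) a *s wv (int i)" using wv(3)[OF i aH] .
  have ev: "x + y \<in> \<real>" if "a *v wv k = x *s wv k" "a *v wv m = y *s wv m" "k \<in> WI" "m \<in> WI" "k \<noteq> m" "k \<noteq> - m" for x y k m
  proof (rule real_ad_eigenvalue[OF aS A(3)[OF a] wedge_so _ W.bracket_wedge_eigen[OF aG that(1,2)]])
    have "wedge (wv k) (wv m) *v wv (- m) = wv k" using that W.form by (auto simp: wedge_mult_vec)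
    then show "wedge (wv k) (wv m) \<noteq> 0" using wv_nonzero[OF that(3)] by auto
  qed
  show ?thesis
  proof (cases "rk \<ge> 2")
    case False
    then have "even n" "i = 1" using i rank_cases rk_pos by auto
    then have "0 \<in> WI" by simp
    from ev[OF ei H_eigen[OF this aH] I(1) this] show ?thesis using i aH by (simp add: wt_def kil_zero)
  next
    case True
    define j where "j = (if i = 1 then 2 else 1::nat)"
    have j: "j \<in> {1..rk}" "j \<noteq> i" using True i by (auto simp: j_def)
    then have J: "int j \<in> WI" "- int j \<in> WI" by auto
    have ej: "a *v wv (int j) = kil (\<epsilon> j) a *s wv (int j)" using wv(3)[OF j(1) aH] .
    have ej': "a *v wv (- int j) = (- kil (\<epsilon> j) a) *s wv (- int j)"
      using H_eigen[OF J(2) aH] j eps_H[OF j(1)] aH by (simp add: wt_def kil_uminus)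
    have "(kil (\<epsilon> i) a + kil (\<epsilon> j) a) + (kil (\<epsilon> i) a + - kil (\<epsilon> j) a) \<in> \<real>"
      by (rule Reals_add[OF ev[OF ei ej I(1) J(1)] ev[OF ei ej' I(1) J(2)]]) (use i j in auto)
    then have "2 * kil (\<epsilon> i) a \<in> \<real>" by simp
    then show ?thesis using Reals_mult[of "1/2" "2 * kil (\<epsilon> i) a"] by simp
  qed
qed

text \<open>Two nonzero weights of a, made positive by a choice of signs, would have eigenvectors
  spanning a totally isotropic plane: for eigenvalues t, s > 0 skewness gives
  \<open>(t + s) * bf x (cv y) = 0\<close>.\<close>

lemma A_single:
  assumes a: "a \<in> A" and ij: "i \<in> {1..rk}" "j \<in> {1..rk}" "i \<noteq> j" and ti: "kil (\<epsilon> i) a \<noteq> 0"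
  shows "kil (\<epsilon> j) a = 0"
proof (rule ccontr)
  assume tj: "kil (\<epsilon> j) a \<noteq> 0"
  have aH: "a \<in> H" and aS: "a \<in> so1n" and aG: "a \<in> gC" using a A_H A(2) so1n_so by auto
  have ex: "\<exists>k t. (k = int i \<or> k = - int i) \<and> k \<in> WI \<and> t > 0 \<and> a *v wv k = complex_of_real t *s wv k"
    if i: "i \<in> {1..rk}" "kil (\<epsilon> i) a \<noteq> 0" for i
  proof -
    obtain x where x: "kil (\<epsilon> i) a = complex_of_real x" using A_real[OF a i(1)] by (auto elim: Reals_cases)
    have I: "int i \<in> WI" "- int i \<in> WI" using i by auto
    show ?thesis
    proof (cases "x > 0")
      case True
      then show ?thesis using I wv(3)[OF i(1) aH] x by (intro exI[of _ "int i"] exI[of _ x]) simp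
    next
      case False
      have "a *v wv (- int i) = complex_of_real (- x) *s wv (- int i)"
        using H_eigen[OF I(2) aH] i eps_H[OF i(1)] aH x by (simp add: wt_def kil_uminus)
      moreover have "- x > 0" using False i(2) x by auto
      ultimately show ?thesis using I(2) by blast
    qed
  qed
  obtain k t where k: "k = int i \<or> k = - int i" "k \<in> WI" "t > 0" "a *v wv k = complex_of_real t *s wv k"
    using ex[OF ij(1) ti] by blast
  obtain m s where m: "m = int j \<or> m = - int j" "m \<in> WI" "s > 0" "a *v wv m = complex_of_real s *s wv m"
    using ex[OF ij(2) tj] by blast
  have km: "k \<noteq> m" "k \<noteq> - m" using k m ij by auto
  have iso: "bf x (cv y) = 0" if "a *v x = complex_of_real t *s x" "a *v y = complex_of_real s *s y" "t > 0" "s > 0" for x y t s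
  proof -
    have "a *v cv y = complex_of_real s *s cv y"
      using so1n_cv[OF aS, of y] that(2) by (simp add: cv_simps)
    then have "(complex_of_real t + complex_of_real s) * bf x (cv y) = 0"
      using so_skew[OF aG, of x "cv y"] that(1) by (simp add: bf_simps distrib_right)
    moreover have "complex_of_real t + complex_of_real s \<noteq> 0"
      using that(3,4) by (simp add: complex_eq_iff)
    ultimately show ?thesis by simp
  qed
  obtain c d where cd: "c \<noteq> 0 \<or> d \<noteq> 0" "c *s wv k + d *s wv m = 0"
    using isotropic_dependent[OF iso[OF k(4) k(4)] iso[OF k(4) m(4)] iso[OF m(4) k(4)] iso[OF m(4) m(4)]] k(3) m(3) by blast
  have nI: "- k \<in> WI" "- m \<in> WI" using k(2) m(2) by auto
  have "bf (wv (- k)) (c *s wv k + d *s wv m) = c" "bf (wv (- m)) (c *s wv k + d *s wv m) = d"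
    using W.form[OF nI(1) k(2)] W.form[OF nI(1) m(2)] W.form[OF nI(2) k(2)] W.form[OF nI(2) m(2)] km by (auto simp: bf_simps)
  then show False using cd by simp
qed

lemma H_eqI:
  assumes "X \<in> H" "Y \<in> H" "\<And>i. i \<in> {1..rk} \<Longrightarrow> kil (\<epsilon> i) X = kil (\<epsilon> i) Y"
  shows "X = Y"
proof (rule W.mat_eqI)
  fix k assume k: "k \<in> WI"
  consider "k > 0" | "k < 0" | "k = 0" by linarith
  then have "kil (wt k) X = kil (wt k) Y"
  proof cases
    case 1
    then show ?thesis using assms(3)[OF nat_WI(1)[OF k 1]] by (simp add: wt_def)
  next
    case 2
    then show ?thesis using assms(3)[OF nat_WI(2)[OF k 2]] assms(1,2) eps_H[OF nat_WI(2)[OF k 2]]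
      by (simp add: wt_def kil_uminus)
  next
    case 3
    then show ?thesis using assms(1,2) by (simp add: wt_def kil_zero)
  qed
  then show "X *v wv k = Y *v wv k" using H_eigen[OF k] assms(1,2) by simp
qed

text \<open>By \<open>A_single\<close> every element of A has at most one nonzero coordinate, and
  two elements with different ones would have a sum with two.\<close>

lemma A_line: "\<exists>i\<in>{1..rk}. A = range (\<lambda>t. t *\<^sub>R W.h (int i))"
proof -
  obtain a where a: "a \<in> A" "a \<noteq> 0" using A_nonzero by blast
  have "\<exists>i\<in>{1..rk}. kil (\<epsilon> i) a \<noteq> 0"
  proof (rule ccontr)
    assume "\<not> ?thesis"
    then have "kil (\<epsilon> i) a = kil (\<epsilon> i) 0" if "i \<in> {1..rk}" for i
      using that kil_simps(5)[OF A_H[OF a(1)] eps_H[OF that], of 0] by simp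
    from H_eqI[OF A_H[OF a(1)] H_closed(5) this] show False using a(2) by simp
  qed
  then obtain i where i: "i \<in> {1..rk}" "kil (\<epsilon> i) a \<noteq> 0" by blast
  have mult: "\<exists>t. b = t *\<^sub>R W.h (int i)" if b: "b \<in> A" for b
  proof -
    have z: "kil (\<epsilon> j) b = 0" if j: "j \<in> {1..rk}" "j \<noteq> i" for j
    proof (rule ccontr)
      assume bj: "kil (\<epsilon> j) b \<noteq> 0"
      then have bi: "kil (\<epsilon> i) b = 0" using A_single[OF b j(1) i(1) j(2)] by blast
      have aj: "kil (\<epsilon> j) a = 0" using A_single[OF a(1) i(1) j(1) _ i(2)] j(2) by blast
      have ab: "a + b \<in> A" by (rule subspace_add[OF A(1) a(1) b])
      have k: "kil (\<epsilon> l) (a + b) = kil (\<epsilon> l) a + kil (\<epsilon> l) b" if "l \<in> {1..rk}" for l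
        using kil_simps(3)[OF A_H[OF a(1)] A_H[OF b] eps_H[OF that]] .
      have "kil (\<epsilon> j) (a + b) = 0"
        by (rule A_single[OF ab i(1) j(1)]) (use j i bi k[OF i(1)] in auto)
      then show False using k[OF j(1)] aj bj by simp
    qed
    obtain t where t: "kil (\<epsilon> i) b = complex_of_real t" using A_real[OF b i(1)] by (auto elim: Reals_cases)
    have hi: "W.h (int i) \<in> H" using i by (intro h_H) auto
    have "b = t *\<^sub>R W.h (int i)"
    proof (rule H_eqI[OF A_H[OF b] H_scaleR[OF hi]])
      fix j assume j: "j \<in> {1..rk}"
      have "kil (\<epsilon> j) (t *\<^sub>R W.h (int i)) = complex_of_real t * (if j = i then 1 else 0)"
        using kil_simps(5)[OF hi eps_H[OF j]] kil_eps_h[OF j, of "int i"] i by (simp add: scaleR_cscale)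
      then show "kil (\<epsilon> j) b = kil (\<epsilon> j) (t *\<^sub>R W.h (int i))" using z[OF j] t by auto
    qed
    then show ?thesis by blast
  qed
  obtain t where t: "a = t *\<^sub>R W.h (int i)" using mult[OF a(1)] by blast
  have "s *\<^sub>R W.h (int i) \<in> A" for s
  proof -
    have "(s / t) *\<^sub>R a \<in> A" by (rule subspace_scale[OF A(1) a(1)])
    moreover have "(s / t) *\<^sub>R a = s *\<^sub>R W.h (int i)" using t a(2) by auto
    ultimately show ?thesis by simp
  qed
  then have "A = range (\<lambda>t. t *\<^sub>R W.h (int i))" using mult by blast
  then show ?thesis using i by blast
qed

text \<open>The value of the Killing form at the pair (\<open>h i\<close>,
  \<open>h i\<close>).\<close>

definition q :: real where
  "q = 2 * (real n - 1)"

lemma q_pos: "q > 0"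
  using card by (simp add: q_def)

lemma h_eps: "i \<in> {1..rk} \<Longrightarrow> W.h (int i) = q *\<^sub>R \<epsilon> i"
  using n_minus_1 by (simp add: eps_eq q_def scaleR_cscale)

text \<open>If A were the line of \<epsilon>_i with i > 1, then \<epsilon>_i or its negative would
  be positive in A, and adding the negative of \<epsilon>_1, which is orthogonal to A, would keep it
  positive. But then \<epsilon>_1 - \<epsilon>_i or \<epsilon>_1 + \<epsilon>_i would be negative,
  although both are positive roots.\<close>

lemma A_eq: "A = range (\<lambda>t. t *\<^sub>R W.h 1)"
proof -
  obtain i where i: "i \<in> {1..rk}" and Ai: "A = range (\<lambda>t. t *\<^sub>R W.h (int i))" using A_line by blast
  have "i = 1"
  proof (rule ccontr)
    assume "i \<noteq> 1"
    then have i2: "1 < i" "i \<le> rk" using i by auto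
    have one: "1 \<in> {1..rk}" using rk_pos by simp
    have "t *\<^sub>R \<epsilon> i = (t / q) *\<^sub>R W.h (int i)" for t using h_eps[OF i] q_pos by simp
    then have eA: "t *\<^sub>R \<epsilon> i \<in> A" for t unfolding Ai by blast
    have orth: "kil (\<epsilon> 1) Y = 0" if "Y \<in> A" for Y
    proof -
      obtain t where "Y = t *\<^sub>R W.h (int i)" using \<open>Y \<in> A\<close> Ai by blast
      then show ?thesis
        using kil_simps(5)[OF h_H[of "int i"] eps_H[OF one]] kil_eps_h[OF one, of "int i"] i2 by (simp add: scaleR_cscale)
    qed
    then have orth': "kil (- \<epsilon> 1) Y = 0" if "Y \<in> A" for Y using that A_H eps_H[OF one] by (simp add: kil_uminus)
    have rc: "subspace (real_cartan gC H)" by (simp add: real_cartan_def)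
    have lex: "lex_pos es (- \<epsilon> 1 + s *\<^sub>R \<epsilon> i)" if "lex_pos es (s *\<^sub>R \<epsilon> i)" for s
    proof -
      have "- \<epsilon> 1 + s *\<^sub>R \<epsilon> i \<in> real_cartan gC H"
        using eps_real_cartan[OF one] eps_real_cartan[OF i]
        by (intro subspace_add[OF rc] subspace_neg[OF rc] subspace_scale[OF rc])
      moreover have "- \<epsilon> 1 + s *\<^sub>R \<epsilon> i - s *\<^sub>R \<epsilon> i = - \<epsilon> 1" by simp
      ultimately show ?thesis using first eA[of s] that orth' by metis
    qed
    have "\<epsilon> i \<in> span (set es)" using eps_real_cartan[OF i] es(3) by simp
    then have "lex_pos es (1 *\<^sub>R \<epsilon> i) \<or> lex_pos es ((-1) *\<^sub>R \<epsilon> i)"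
      using lex_pos_total[OF es(1,2)] eps_independent(1)[OF i i] by simp
    then show False
    proof
      assume "lex_pos es (1 *\<^sub>R \<epsilon> i)"
      from lex[OF this] have "lex_pos es (- (\<epsilon> 1 - \<epsilon> i))" by simp
      then show False using lex_pos_antisym[OF es(1,2) lex_pos_diff[of 1 i]] i2 by simp
    next
      assume "lex_pos es ((-1) *\<^sub>R \<epsilon> i)"
      from lex[OF this] have "lex_pos es (- (\<epsilon> 1 + \<epsilon> i))" by simp
      then show False using lex_pos_antisym[OF es(1,2) lex_pos_sum[of 1 i]] i2 by simp
    qed
  qed
  then show ?thesis using Ai by simp
qed

lemma h1_A: "t *\<^sub>R W.h 1 \<in> A"
  unfolding A_eq by blast

lemma simple_h1:
  assumes "a \<in> simple_roots gC H es"
  shows "kil a (W.h 1) \<in> {0, 1}"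
proof -
  have k: "kil (\<epsilon> i) (W.h 1) = (if i = 1 then 1 else 0)" if "i \<in> {1..rk}" for i
    using kil_eps_h[OF that, of 1] rk_pos by simp
  have h1: "W.h 1 \<in> H" using rk_pos by (intro h_H) auto
  consider (diff) i where "i \<in> {1..<rk}" "a = \<epsilon> i - \<epsilon> (i + 1)" | (last) "even n" "a = \<epsilon> rk"
    | (sum) "odd n" "a = \<epsilon> (rk - 1) + \<epsilon> rk"
    using assms unfolding bourbaki_facts(5) by (auto split: if_splits)
  then show ?thesis
  proof cases
    case diff
    then have "i \<in> {1..rk}" "i + 1 \<in> {1..rk}" by auto
    then show ?thesis using diff k[of i] k[of "i + 1"] h1 eps_H by (simp add: kil_simps)
  next
    case last
    then show ?thesis using k[of rk] rk_pos by simp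
  next
    case sum
    then have "rk - 1 \<in> {1..rk}" "rk \<in> {1..rk}" "rk \<noteq> 1" using rk_odd by auto
    then show ?thesis using sum k[of "rk - 1"] k[of rk] h1 eps_H by (simp add: kil_simps)
  qed
qed

lemma simple_first: "\<exists>a\<in>simple_roots gC H es. kil a (W.h 1) = 1"
proof (cases "rk \<ge> 2")
  case True
  then have "\<epsilon> 1 - \<epsilon> (1 + 1) \<in> simple_roots gC H es"
    unfolding bourbaki_facts(5) by (intro UnI1 image_eqI[of _ _ 1]) auto
  moreover have "kil (\<epsilon> 1 - \<epsilon> (1 + 1)) (W.h 1) = 1"
    using True h_H[of 1] eps_H[of 1] eps_H[of 2] kil_eps_h[of 1 1] kil_eps_h[of 2 1] by (simp add: kil_simps numeral_2_eq_2)
  ultimately show ?thesis by blast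
next
  case False
  then have "rk = 1" "even n" using rk_pos rank_cases by auto
  then show ?thesis using kil_eps_h[of 1 1] unfolding bourbaki_facts(5) by auto
qed

text \<open>The simple roots take only the values 0 and 1 on \<open>h 1\<close>, and 1 is attained,
  so dominance on A is the sign of t.\<close>

lemma chamber_A: "dominant_chamber gC H es \<inter> A = (\<lambda>t. t *\<^sub>R W.h 1) ` {0..}"
proof -
  have h1: "W.h 1 \<in> H" using rk_pos by (intro h_H) auto
  have sH: "a \<in> H" if "a \<in> simple_roots gC H es" for a
    using that by (simp add: simple_roots_def positive_roots_def roots_def)
  have k: "Re (kil a (t *\<^sub>R W.h 1)) = t * Re (kil a (W.h 1))" if "a \<in> simple_roots gC H es" for a t
    using kil_simps(5)[OF h1 sH[OF that]] by (simp add: scaleR_cscale)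
  have "t *\<^sub>R W.h 1 \<in> real_cartan gC H" for t
    using h_eps[of 1] rk_pos eps_real_cartan[of 1] by (simp add: real_cartan_def span_scale)
  then have "t *\<^sub>R W.h 1 \<in> dominant_chamber gC H es \<longleftrightarrow> (\<forall>a\<in>simple_roots gC H es. t * Re (kil a (W.h 1)) \<ge> 0)" for t
    by (simp add: dominant_chamber_def k)
  moreover have "(\<forall>a\<in>simple_roots gC H es. t * Re (kil a (W.h 1)) \<ge> 0) \<longleftrightarrow> t \<ge> 0" for t
    using simple_h1 simple_first by (fastforce intro: mult_nonneg_nonneg)
  ultimately show ?thesis unfolding A_eq by auto
qed

text \<open>Commuting with \<open>h 1\<close> means preserving its eigenspaces for 1 and -1, which
  are the two lines. That the eigenvalues on them are opposite is skewness.\<close>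

lemma centralizer_levi: "centralizer_in gC (cmat.span A) = W.levi"
proof
  have h1: "1 \<le> (1::int)" "1 \<le> int rk" using rk_pos by auto
  have hv: "W.h 1 *v y = bf (wv (-1)) y *s wv 1 - bf (wv 1) y *s wv (-1)" for y
    by (simp add: W.h_def wedge_mult_vec)
  show "centralizer_in gC (cmat.span A) \<subseteq> W.levi"
  proof
    fix X assume X: "X \<in> centralizer_in gC (cmat.span A)"
    then have XG: "X \<in> gC" by (simp add: centralizer_in_def)
    have "W.h 1 \<in> cmat.span A" using h1_A[of 1] by (intro cmat.span_base) simp
    then have "bracket X (W.h 1) = 0" using X by (simp add: centralizer_in_def)
    then have com: "W.h 1 *v (X *v y) = X *v (W.h 1 *v y)" for y
      by (metis bracket_mult_vec eq_iff_diff_eq_0 matrix_vector_mult_0)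
    have I: "1 \<in> WI" "-1 \<in> WI" using W.one_I by auto
    have "W.h 1 *v (X *v wv 1) = X *v wv 1"
      using W.h_mult_vec[OF h1 I(1)] by (simp add: com)
    then have e1: "X *v wv 1 = bf (wv (-1)) (X *v wv 1) *s wv 1 - bf (wv 1) (X *v wv 1) *s wv (-1)" by (simp add: hv)
    have s: "bf (wv 1) (X *v wv 1) = 0"
      using so_skew[OF XG, of "wv 1" "wv 1"] bf_sym[of "X *v wv 1" "wv 1"] by (simp add: equal_neg_zero)
    have "W.h 1 *v (X *v wv (-1)) = - (X *v wv (-1))"
      using W.h_mult_vec[OF h1 I(2)] by (simp add: com)
    then have e2: "X *v wv (-1) = - (bf (wv (-1)) (X *v wv (-1)) *s wv 1 - bf (wv 1) (X *v wv (-1)) *s wv (-1))"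
      by (simp add: hv equation_minus_iff)
    have s': "bf (wv (-1)) (X *v wv (-1)) = 0"
      using so_skew[OF XG, of "wv (-1)" "wv (-1)"] bf_sym[of "X *v wv (-1)" "wv (-1)"] by (simp add: equal_neg_zero)
    have "bf (wv 1) (X *v wv (-1)) = - bf (wv (-1)) (X *v wv 1)"
      using so_skew[OF XG, of "wv 1" "wv (-1)"] bf_sym[of "X *v wv 1"] by simp
    then have "X *v wv 1 = bf (wv (-1)) (X *v wv 1) *s wv 1 \<and> X *v wv (-1) = (- bf (wv (-1)) (X *v wv 1)) *s wv (-1)"
      using e1 e2 s s' by simp
    then show "X \<in> W.levi" using XG unfolding W.levi_def by blast
  qed
  show "W.levi \<subseteq> centralizer_in gC (cmat.span A)"
  proof
    fix X assume X: "X \<in> W.levi"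
    then obtain c where c: "X *v wv 1 = c *s wv 1" "X *v wv (-1) = (- c) *s wv (-1)" by (auto simp: W.levi_def)
    have XG: "X \<in> gC" using X W.levi_so by blast
    have Xh: "bracket X (W.h 1) = 0"
      using W.bracket_wedge_eigen[OF XG c] by (simp add: W.h_def)
    have "bracket X Y = 0" if "Y \<in> cmat.span A" for Y
      using that
    proof (induction rule: cmat.span_induct_alt)
      case (step a Y Z)
      then obtain t where "Y = t *\<^sub>R W.h 1" using A_eq by blast
      then show ?case using step Xh by (simp add: bracket_add_right bracket_cscale_right scaleR_cscale)
    qed simp
    then show "X \<in> centralizer_in gC (cmat.span A)" using XG by (simp add: centralizer_in_def)
  qed
qed

end


section \<open>The restricted Weyl group\<close>

lemma mexp_so_orthogonal:
  assumes X: "X \<in> so1n_complex"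
  shows "bf (mexp X *v x) (mexp X *v y) = bf x y"
proof -
  have pow: "bf (mpow X m *v x) y = bf x (mpow (- X) m *v y)" for m x y
  proof (induction m arbitrary: y)
    case (Suc m)
    have "bf (mpow X (Suc m) *v x) y = bf (mpow X m *v x) ((- X) *v y)"
      by (simp add: mpow_Suc matrix_vector_mul_assoc[symmetric] so_skew[OF X])
    then show ?case
      by (simp add: Suc mpow_Suc2 matrix_vector_mul_assoc[symmetric])
  qed simp
  have "bf (mexp X *v x) y = bf x (mexp (- X) *v y)" for x y
    using exp_summable_mpow_linear(2)[of "\<lambda>M. bf (M *v x) y" X]
      exp_summable_mpow_linear(2)[of "\<lambda>M. bf x (M *v y)" "- X"]
    by (simp add: pow mv_simps bf_simps)
  then show ?thesis
    by (simp add: matrix_vector_mul_assoc mexp_uminus_cancel')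
qed

lemma lie_group_mult:
  assumes "(a, b) \<in> lie_group gR \<rho>" "(c, d) \<in> lie_group gR \<rho>"
  shows "(a ** c, b ** d) \<in> lie_group gR \<rho>"
  using assms(2)
proof (induction rule: lie_group.induct)
  case (mult_exp c d X)
  then show ?case using lie_group.mult_exp[of "a ** c" "b ** d" gR \<rho> X] by (simp add: matrix_mul_assoc)
qed (use assms in simp)

text \<open>The inductive set only appends exponentials on the right. An inverse has its factors in
  reverse order, so closure under products comes first.\<close>

lemma lie_group_inverse:
  assumes "(a, b) \<in> lie_group gR \<rho>"
    and neg: "\<And>X. X \<in> gR \<Longrightarrow> - X \<in> gR" "\<And>X. X \<in> gR \<Longrightarrow> \<rho> (- X) = - \<rho> X"
  shows "\<exists>a' b'. (a', b') \<in> lie_group gR \<rho> \<and> a ** a' = mat 1 \<and> a' ** a = mat 1 \<and> b ** b' = mat 1 \<and> b' ** b = mat 1"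
  using assms(1)
proof (induction rule: lie_group.induct)
  case one
  show ?case by (intro exI[of _ "mat 1"]) (simp add: lie_group.one)
next
  case (mult_exp a b X)
  then obtain a' b' where ab: "(a', b') \<in> lie_group gR \<rho>" "a ** a' = mat 1" "a' ** a = mat 1" "b ** b' = mat 1" "b' ** b = mat 1"
    by blast
  have "(mat 1 ** mexp (- X), mat 1 ** mexp (\<rho> (- X))) \<in> lie_group gR \<rho>"
    using mult_exp neg by (intro lie_group.mult_exp lie_group.one)
  from lie_group_mult[OF this ab(1)] have "(mexp (- X) ** a', mexp (- \<rho> X) ** b') \<in> lie_group gR \<rho>"
    using mult_exp neg by simp
  moreover have "(a ** mexp X) ** (mexp (- X) ** a') = mat 1" "(b ** mexp (\<rho> X)) ** (mexp (- \<rho> X) ** b') = mat 1"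
    using ab(2,4) by (metis matrix_mul_assoc matrix_mul_rid mexp_uminus_cancel)+
  moreover have "(mexp (- X) ** a') ** (a ** mexp X) = mat 1" "(mexp (- \<rho> X) ** b') ** (b ** mexp (\<rho> X)) = mat 1"
    using ab(3,5) by (metis matrix_mul_assoc matrix_mul_rid mexp_uminus_cancel')+
  ultimately show ?case by (intro exI[of _ "mexp (- X) ** a'"] exI[of _ "mexp (- \<rho> X) ** b'"] conjI)
qed

lemma lie_group_orthogonal:
  assumes "(a, b) \<in> lie_group gR \<rho>" "gR \<subseteq> so1n_complex"
  shows "bf (a *v x) (a *v y) = bf x y"
  using assms(1)
proof (induction arbitrary: x y rule: lie_group.induct)
  case (mult_exp a b X)
  then show ?case using assms(2) by (auto simp: matrix_vector_mul_assoc[symmetric] mexp_so_orthogonal)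
qed simp

lemma matrix_inv_eqI:
  fixes a :: "complex^'m^'m"
  assumes "a ** a' = mat 1" "a' ** a = mat 1"
  shows "matrix_inv a = a'"
proof -
  have "a ** matrix_inv a = mat 1 \<and> matrix_inv a ** a = mat 1"
    unfolding matrix_inv_def by (rule someI_ex) (use assms in blast)
  then have "matrix_inv a ** (a ** a') = a'" by (simp add: matrix_mul_assoc)
  then show ?thesis by (simp add: assms)
qed

text \<open>Writing \<open>Ad\<close> as an intertwining relation removes \<open>matrix_inv\<close>,
  which is specified only by choice.\<close>

lemma Ad_eq_iff:
  assumes "a ** a' = mat 1" "a' ** a = mat 1"
  shows "Ad (a, b) X = Y \<longleftrightarrow> a ** X = Y ** a"
proof -
  have "Ad (a, b) X = a ** X ** a'" by (simp add: Ad_def matrix_inv_eqI[OF assms])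
  then show ?thesis using assms by (metis matrix_mul_assoc matrix_mul_rid)
qed

lemma Ad_mult:
  assumes "a ** a' = mat 1" "a' ** a = mat 1" "c ** c' = mat 1" "c' ** c = mat 1"
  shows "Ad (a ** c, b ** d) X = Ad (a, b) (Ad (c, d) X)"
proof -
  have "(a ** c) ** (c' ** a') = mat 1" "(c' ** a') ** (a ** c) = mat 1"
    using assms by (metis matrix_mul_assoc matrix_mul_rid)+
  then have "matrix_inv (a ** c) = c' ** a'" by (rule matrix_inv_eqI)
  then show ?thesis
    by (simp add: Ad_def matrix_inv_eqI[OF assms(1,2)] matrix_inv_eqI[OF assms(3,4)] matrix_mul_assoc)
qed

lemma Ad_scaleR: "Ad x (t *\<^sub>R X) = t *\<^sub>R Ad x (X :: complex^'m^'m)"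
  by (simp add: Ad_def scaleR_cscale matrix_eq matrix_vector_mul_assoc[symmetric] vector_scalar_commute)

lemma orthogonal_wedge:
  assumes "\<And>x y. bf (a *v x) (a *v y) = bf x y"
  shows "a ** wedge x y = wedge (a *v x) (a *v y) ** a"
  by (simp add: matrix_eq matrix_vector_mul_assoc[symmetric] wedge_mult_vec mv_simps assms)

section \<open>Elements that reverse the Cartan subspace\<close>

context so1n_full
begin

lemma one_WI: "1 \<in> WI" "-1 \<in> WI"
  using W.one_I by auto

lemma h1_mult_vec: "W.h 1 *v y = bf (wv (-1)) y *s wv 1 - bf (wv 1) y *s wv (-1)"
  by (simp add: W.h_def wedge_mult_vec)

lemma h1_so1n: "W.h 1 \<in> so1n"
  using h1_A[of 1] A(2) by auto

lemma h1_wv: "W.h 1 *v wv 1 = wv 1" "W.h 1 *v wv (-1) = - wv (-1)"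
  by (simp_all add: h1_mult_vec)

lemma h1_eigen1: "W.h 1 *v y = y \<Longrightarrow> y = bf (wv (-1)) y *s wv 1"
proof -
  assume y: "W.h 1 *v y = y"
  then have e: "y = bf (wv (-1)) y *s wv 1 - bf (wv 1) y *s wv (-1)" using h1_mult_vec[of y] by simp
  have "bf (wv 1) (W.h 1 *v y) = - bf (wv 1) y" by (simp add: h1_mult_vec bf_simps)
  then have "bf (wv 1) y = 0" using y by (simp add: equal_neg_zero)
  then show ?thesis using e by simp
qed

lemma h1_eigen_m1: "W.h 1 *v y = - y \<Longrightarrow> y = bf (wv 1) y *s wv (-1)"
proof -
  assume y: "W.h 1 *v y = - y"
  have "bf (wv (-1)) (W.h 1 *v y) = bf (wv (-1)) y" by (simp add: h1_mult_vec bf_simps)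
  then have "bf (wv (-1)) y = 0" using y by (simp add: neg_equal_zero)
  then show ?thesis using y h1_mult_vec[of y] by simp
qed

text \<open>The sum of x and its conjugate is a real multiple of x unless it vanishes; in that case
  \<gamma> = -1 and \<open>\<i> *s x\<close> is real.\<close>

lemma real_multiple:
  assumes x: "x \<noteq> 0" "cv x = \<gamma> *s x"
  obtains \<alpha> where "\<alpha> \<noteq> 0" "cv (\<alpha> *s x) = \<alpha> *s x"
proof (cases "\<gamma> = - 1")
  case True
  then show ?thesis using x by (intro that[of \<i>]) (simp_all add: cv_simps)
next
  case False
  have "cv x + x = (\<gamma> + 1) *s x" using x by (simp add: vec.scale_left_distrib)
  moreover have "cv (cv x + x) = cv x + x" by (simp add: cv_simps add.commute)
  moreover have "\<gamma> + 1 \<noteq> 0" using False by (simp add: add_eq_0_iff2)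
  ultimately show ?thesis using that by metis
qed

text \<open>The rotation by \<open>\<pi>\<close> in the plane spanned by a spacelike combination of the two lightlike
  eigenvectors of \<open>h 1\<close> and by a vector orthogonal to both exchanges the two lightlike lines.\<close>

lemma reflection_exists:
  "\<exists>X\<in>so1n. \<exists>\<alpha> \<beta>. mexp X *v wv 1 = \<alpha> *s wv (-1) \<and> mexp X *v wv (-1) = \<beta> *s wv 1"
proof -
  have wn: "wv 1 \<noteq> 0" "wv (-1) \<noteq> 0" using wv_nonzero one_WI by auto
  have "W.h 1 *v cv (wv 1) = cv (wv 1)" using so1n_cv[OF h1_so1n, of "wv 1"] by (simp add: h1_wv)
  then have "cv (wv 1) = bf (wv (-1)) (cv (wv 1)) *s wv 1" by (rule h1_eigen1)
  then obtain \<alpha> where \<alpha>: "\<alpha> \<noteq> 0" "cv (\<alpha> *s wv 1) = \<alpha> *s wv 1" using real_multiple[OF wn(1)] by blast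
  have "W.h 1 *v cv (wv (-1)) = - cv (wv (-1))" using so1n_cv[OF h1_so1n, of "wv (-1)"] by (simp add: h1_wv cv_simps)
  then have "cv (wv (-1)) = bf (wv 1) (cv (wv (-1))) *s wv (-1)" by (rule h1_eigen_m1)
  then obtain \<beta> where \<beta>: "\<beta> \<noteq> 0" "cv (\<beta> *s wv (-1)) = \<beta> *s wv (-1)" using real_multiple[OF wn(2)] by blast
  define p where "p = \<alpha> *s wv 1"
  have pB: "bf p (\<beta> *s wv (-1)) = \<alpha> * \<beta>" by (simp add: p_def bf_simps)
  then have "\<alpha> * \<beta> \<in> \<real>" using bf_real[OF \<alpha>(2) \<beta>(2)] by (simp add: p_def)
  then obtain B where B: "\<alpha> * \<beta> = complex_of_real B" by (auto elim: Reals_cases)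
  then have B0: "B \<noteq> 0" using \<alpha>(1) \<beta>(1) by auto
  \<comment> \<open>Scaled so that \<open>bf p u = 1/2\<close>, which gives \<open>p + u\<close> and
    \<open>p - u\<close> the norms 1 and -1.\<close>
  define u where "u = complex_of_real (1 / (2 * B)) *s (\<beta> *s wv (-1))"
  have re: "cv p = p" "cv u = u" using \<alpha>(2) \<beta>(2) by (simp_all only: p_def u_def cv_simps(3) complex_cnj_complex_of_real)
  have bfpu: "bf p p = 0" "bf u u = 0" "bf p u = 1/2" "bf u p = 1/2"
    using pB B0 bf_sym[of u p] by (simp_all add: u_def p_def bf_simps B)
  define x where "x = p - u"
  define t where "t = p + u"
  have xt: "bf x x = -1" "bf t t = 1" "bf x t = 0" "bf t x = 0"
    by (simp_all add: x_def t_def bf_simps bfpu)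
  have rxt: "cv x = x" "cv t = t" by (simp_all add: x_def t_def cv_simps re)
  \<comment> \<open>The projection to the orthogonal complement of p and u; the factors 2 undo
    \<open>bf p u = 1/2\<close>.\<close>
  define proj where "proj y = y - (2 * bf u y) *s p - (2 * bf p y) *s u" for y
  have proj_orth: "bf p (proj y) = 0" "bf u (proj y) = 0" for y
    by (simp_all add: proj_def bf_simps bfpu)
  have "\<exists>j. proj (axis j 1) \<noteq> 0"
  proof (rule ccontr)
    assume "\<nexists>j. proj (axis j 1) \<noteq> 0"
    then have z: "proj (axis j 1) = 0" for j by blast
    \<comment> \<open>A weight vector outside the two lines. It is orthogonal to p and u, so if all
      projections of the axes vanished, it would be orthogonal to every axis.\<close>
    define m where "m = (if rk \<ge> 2 then 2 else 0::int)"
    have m: "m \<in> WI" "m \<noteq> 1" "m \<noteq> -1" using rank_cases by (auto simp: m_def)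
    have b0: "bf p (wv m) = 0" "bf u (wv m) = 0"
      using m W.form[OF one_WI(1) m(1)] W.form[OF one_WI(2) m(1)] by (auto simp: p_def u_def bf_simps)
    have "bf (proj y) (wv m) = bf y (wv m)" for y
      by (simp add: proj_def bf_simps b0)
    then have "bf (axis j 1) (wv m) = 0" for j using z[of j] by (metis bf_zero(1))
    then have "wv m = 0" by (simp add: bf_sym[of "axis _ 1"] bf_axis vec_eq_iff)
    then show False using wv_nonzero[OF m(1)] by simp
  qed
  then obtain j where j: "proj (axis j 1) \<noteq> 0" by blast
  define y where "y = proj (axis j 1)"
  have y0: "y \<noteq> 0" using j by (simp add: y_def)
  have ry: "cv y = y"
  proof -
    have "cnj (bf u (axis j 1)) = bf u (axis j 1)" "cnj (bf p (axis j 1)) = bf p (axis j 1)"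
      using bf_cv[of u "axis j 1"] bf_cv[of p "axis j 1"] by (simp_all add: re cv_simps)
    then show ?thesis by (simp add: y_def proj_def cv_simps re)
  qed
  have yx: "bf y x = 0" "bf x y = 0" "bf y t = 0" "bf t y = 0"
    using proj_orth bf_sym[of y] by (simp_all add: y_def x_def t_def bf_simps)
  obtain c where c: "bf y y = complex_of_real c" using bf_real[OF ry ry] by (auto elim: Reals_cases)
  \<comment> \<open>As t is timelike, y must be spacelike. Otherwise the combination of t and y
    without \<open>None\<close> coordinate has norm both \<ge> 0 and \<le> 0, which forces the
    \<open>None\<close> coordinate of t to vanish, against \<open>bf t t = 1\<close>.\<close>
  have c0: "c < 0"
  proof (rule ccontr)
    assume "\<not> c < 0"
    have "y $ None \<in> \<real>" "t $ None \<in> \<real>" using ry rxt(2) cv_real by blast+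
    then obtain yN tN where N: "y $ None = complex_of_real yN" "t $ None = complex_of_real tN" by (auto elim!: Reals_cases)
    let ?z = "complex_of_real yN *s t - complex_of_real tN *s y"
    have "?z $ None = 0" by (simp add: N)
    then obtain e where e: "e \<ge> 0" "bf ?z (cv ?z) = - complex_of_real e" "e = 0 \<longrightarrow> ?z = 0" using bf_negative[of ?z] by auto
    have "bf ?z (cv ?z) = complex_of_real (yN ^ 2 + tN ^ 2 * c)"
      by (simp add: cv_simps rxt ry bf_simps xt yx c power2_eq_square mult.assoc)
    then have "yN ^ 2 + tN ^ 2 * c = - e" using e(2) by (metis of_real_minus of_real_eq_iff)
    moreover have "yN ^ 2 \<ge> 0" "tN ^ 2 * c \<ge> 0" using \<open>\<not> c < 0\<close> by auto
    ultimately have "e = 0" "yN ^ 2 = 0" using e(1) by linarith+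
    then have yz: "e = 0" "yN = 0" by simp_all
    then have "complex_of_real tN *s y = 0" using e(3) by simp
    then have "tN = 0" using y0 by simp
    then have "t $ None = 0" using N by simp
    then obtain e' where "e' \<ge> 0" "bf t (cv t) = - complex_of_real e'" using bf_negative[of t] by auto
    then have "(1::real) = - e'" using rxt(2) xt(2) by (metis of_real_1 of_real_minus of_real_eq_iff)
    then show False using \<open>e' \<ge> 0\<close> by simp
  qed
  define s where "s = complex_of_real (1 / sqrt (- c)) *s y"
  have "sqrt (- c) * sqrt (- c) = - c" using c0 by simp
  then have "(1 / sqrt (- c)) * ((1 / sqrt (- c)) * c) = -1" using c0 by (simp add: field_simps)
  then have ss: "bf s s = -1"
    unfolding s_def bf_simps c by (metis of_real_mult of_real_minus of_real_1)
  have rs: "cv s = s" by (simp add: s_def cv_simps ry)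
  have sx: "bf s x = 0" "bf x s = 0" "bf s t = 0" "bf t s = 0" by (simp_all add: s_def bf_simps yx)
  define X where "X = cscale (complex_of_real pi) (wedge x s)"
  have X: "X \<in> so1n" using subspace_scale[OF so1n_subspace wedge_real[OF rxt(1) rs], of pi] by (simp add: X_def scaleR_cscale)
  have Xx: "X *v x = complex_of_real pi *s s" "X *v s = - (complex_of_real pi *s x)" "X *v t = 0"
    by (simp_all add: X_def wedge_mult_vec xt ss sx)
  have ii: "\<i> * (\<i> * z) = - z" for z by (simp add: mult.assoc[symmetric])
  \<comment> \<open>On the plane of x and s the eigenvalues of X are \<open>- \<i> * pi\<close> and
    \<open>\<i> * pi\<close>, both with exponential -1.\<close>
  have e1: "X *v (x + \<i> *s s) = (- (\<i> * complex_of_real pi)) *s (x + \<i> *s s)"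
    by (simp add: mv_simps Xx vec_eq_iff algebra_simps ii)
  have e2: "X *v (x + (-\<i>) *s s) = (\<i> * complex_of_real pi) *s (x + (-\<i>) *s s)"
    by (simp add: mv_simps Xx vec_eq_iff algebra_simps ii)
  have ex: "exp (- (\<i> * complex_of_real pi)) = -1" "exp (\<i> * complex_of_real pi) = -1"
    by (simp_all add: exp_minus exp_pi_i')
  have "mexp X *v (2 *s x) = mexp X *v ((x + \<i> *s s) + (x + (-\<i>) *s s))"
    by (rule arg_cong[of _ _ "(*v) (mexp X)"]) (simp add: vec_eq_iff)
  also have "\<dots> = mexp X *v (x + \<i> *s s) + mexp X *v (x + (-\<i>) *s s)"
    by (simp only: matrix_vector_right_distrib)
  also have "\<dots> = (-1) *s (x + \<i> *s s) + (-1) *s (x + (-\<i>) *s s)"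
    by (simp only: mexp_eigenvector[OF e1] mexp_eigenvector[OF e2] ex)
  also have "\<dots> = 2 *s (- x)" by (simp add: vec_eq_iff)
  finally have "mexp X *v (2 *s x) = 2 *s (- x)" .
  then have "2 *s (mexp X *v x) = 2 *s (- x)" by (simp only: vector_scalar_commute)
  then have mx: "mexp X *v x = - x" by (simp only: vec.scale_cancel_left) simp
  have mt: "mexp X *v t = t" using mexp_eigenvector[of X t 0] Xx(3) by simp
  have "p = (1/2) *s (t + x)" "u = (1/2) *s (t - x)" by (simp_all add: x_def t_def vec_eq_iff)
  then have mp: "mexp X *v p = u" "mexp X *v u = p"
    by (simp_all only: vector_scalar_commute matrix_vector_right_distrib matrix_vector_mult_diff_distrib mx mt)
      (simp_all add: vec_eq_iff)
  have wp: "wv 1 = (1 / \<alpha>) *s p" using \<alpha>(1) by (simp add: p_def)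
  have wu: "wv (-1) = (2 * complex_of_real B / \<beta>) *s u" using \<beta>(1) B0 by (simp add: u_def)
  have "mexp X *v wv 1 = (1 / \<alpha>) *s u" unfolding wp by (simp only: vector_scalar_commute mp)
  then have "mexp X *v wv 1 = ((1 / \<alpha>) * (complex_of_real (1 / (2 * B)) * \<beta>)) *s wv (-1)"
    by (simp only: u_def vec.scale_scale)
  moreover have "mexp X *v wv (-1) = (2 * complex_of_real B / \<beta>) *s p" unfolding wu by (simp only: vector_scalar_commute mp)
  then have "mexp X *v wv (-1) = ((2 * complex_of_real B / \<beta>) * \<alpha>) *s wv 1"
    by (simp only: p_def vec.scale_scale)
  ultimately show ?thesis using X by blast
qed

text \<open>The image condition only says that \<open>h 1\<close> goes to \<open>- t\<close> times
  itself for some t \<ge> 0. Conjugation preserves eigenvalues, and those of \<open>h 1\<close> are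
  among 1, -1 and 0 by \<open>cube\<close>, so t = 1.\<close>

lemma flip_h1:
  assumes inv: "a ** a' = mat 1" "a' ** a = mat 1"
    and img: "Ad (a, b) ` (dominant_chamber gC H es \<inter> A) = uminus ` (dominant_chamber gC H es \<inter> A)"
  shows "Ad (a, b) (W.h 1) = - W.h 1"
proof -
  have "1 *\<^sub>R W.h 1 \<in> (\<lambda>t. t *\<^sub>R W.h 1) ` {0..}" by (rule imageI) simp
  then have "W.h 1 \<in> dominant_chamber gC H es \<inter> A" unfolding chamber_A by simp
  then have "Ad (a, b) (W.h 1) \<in> uminus ` (dominant_chamber gC H es \<inter> A)" using img by blast
  then obtain t where t: "t \<ge> 0" "Ad (a, b) (W.h 1) = - (t *\<^sub>R W.h 1)" unfolding chamber_A by auto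
  have e: "a ** W.h 1 = - (t *\<^sub>R W.h 1) ** a" using Ad_eq_iff[OF inv] t(2) by blast
  define y where "y = a *v wv 1"
  have "a' *v y = wv 1" by (simp add: y_def matrix_vector_mul_assoc inv)
  then have y0: "y \<noteq> 0" using wv_nonzero one_WI by auto
  have "a *v (W.h 1 *v wv 1) = - (t *\<^sub>R W.h 1) *v y"
    by (simp add: y_def matrix_vector_mul_assoc e)
  then have y: "y = (- complex_of_real t) *s (W.h 1 *v y)"
    by (simp add: h1_wv y_def scaleR_cscale mv_simps)
  have cube: "W.h 1 *v (W.h 1 *v (W.h 1 *v x)) = W.h 1 *v x" for x
    using W.form[OF one_WI] W.form[OF one_WI(2,1)] W.form[OF one_WI(1,1)] W.form[OF one_WI(2,2)]
    by (simp add: h1_mult_vec bf_simps)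
  define s where "s = - complex_of_real t"
  have ys: "y = s *s (W.h 1 *v y)" using y by (simp add: s_def)
  have c1: "W.h 1 *v y = s *s (W.h 1 *v (W.h 1 *v y))"
    by (rule trans[OF arg_cong[OF ys, of "(*v) (W.h 1)"]]) (simp only: vector_scalar_commute)
  have c2: "W.h 1 *v (W.h 1 *v y) = s *s (W.h 1 *v y)"
    by (rule trans[OF arg_cong[OF c1, of "(*v) (W.h 1)"]]) (simp only: vector_scalar_commute cube)
  have "W.h 1 *v (W.h 1 *v y) = y" using c2 ys by (rule trans[OF _ sym])
  then have "y = s *s (s *s y)" using ys c1 by simp
  then have "1 *s y = (s * s) *s y" by (simp only: vec.scale_scale vec.scale_one)
  then have "s * s = 1" using y0 by (simp only: vec.scale_cancel_right) simp
  then have "complex_of_real (t * t) = 1" by (simp add: s_def)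
  then have "t * t = 1" by (simp only: of_real_eq_1_iff)
  then have "t = 1" using t(1) by (simp add: square_eq_1_iff)
  then show ?thesis using t(2) by simp
qed

text \<open>Reversing \<open>h 1\<close> exchanges its eigenlines for 1 and -1. The relation between
  the two scalars is the invariance of the pairing of \<open>v 1\<close> with
  \<open>v (-1)\<close>.\<close>

lemma flip_swaps:
  assumes orth: "\<And>x y. bf (a *v x) (a *v y) = bf x y" and e: "a ** W.h 1 = - W.h 1 ** a"
  obtains \<alpha> \<beta> where "a *v wv 1 = \<alpha> *s wv (-1)" "a *v wv (-1) = \<beta> *s wv 1" "\<alpha> * \<beta> = 1"
proof -
  have e': "W.h 1 *v (a *v x) = - (a *v (W.h 1 *v x))" for x
    using arg_cong[OF e, of "\<lambda>M. M *v x"] by (simp add: matrix_vector_mul_assoc[symmetric] mv_simps)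
  have 1: "a *v wv 1 = bf (wv 1) (a *v wv 1) *s wv (-1)"
    by (rule h1_eigen_m1) (simp add: e' h1_wv)
  have 2: "a *v wv (-1) = bf (wv (-1)) (a *v wv (-1)) *s wv 1"
    by (rule h1_eigen1) (simp add: e' h1_wv mv_simps)
  have "bf (a *v wv 1) (a *v wv (-1)) = 1" unfolding orth using W.form[OF one_WI] by simp
  then have "bf (wv 1) (a *v wv 1) * bf (wv (-1)) (a *v wv (-1)) = 1"
    using W.form[OF one_WI(2,1)] by (subst (asm) 1, subst (asm) 2) (simp add: bf_simps)
  from that[OF 1 2 this] show ?thesis .
qed

text \<open>Two elements that reverse \<open>h 1\<close> differ by one that fixes it, and A is the
  line of \<open>h 1\<close>; so all of them form a single coset of the centralizer.
  \<open>reflection_exists\<close> makes this coset nonempty, and \<open>flip_h1\<close> gives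
  uniqueness.\<close>

lemma longest_element_eq:
  assumes neg: "\<And>X. X \<in> so1n \<Longrightarrow> \<rho> (- X) = - \<rho> X"
  shows "longest_element so1n \<rho> A (dominant_chamber gC H es \<inter> A) = {x \<in> lie_group so1n \<rho>. Ad x (W.h 1) = - W.h 1}"
    (is "_ = ?F")
proof -
  let ?G = "lie_group so1n \<rho>" and ?P = "dominant_chamber gC H es \<inter> A"
  have inv: "\<exists>a' b'. (a', b') \<in> ?G \<and> a ** a' = mat 1 \<and> a' ** a = mat 1 \<and> b ** b' = mat 1 \<and> b' ** b = mat 1"
    if "(a, b) \<in> ?G" for a b
    by (rule lie_group_inverse[OF that]) (use neg subspace_neg[OF so1n_subspace] in auto)
  have Fimg: "Ad x ` ?P = uminus ` ?P" and FA: "Ad x ` A = A" if "x \<in> ?F" for x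
  proof -
    have "Ad x (t *\<^sub>R W.h 1) = - (t *\<^sub>R W.h 1)" for t using that by (simp add: Ad_scaleR)
    then show "Ad x ` ?P = uminus ` ?P" unfolding chamber_A image_image by simp
    have "Ad x ` A = range (\<lambda>t. (- t) *\<^sub>R W.h 1)"
      unfolding A_eq image_image using \<open>\<And>t. Ad x (t *\<^sub>R W.h 1) = - (t *\<^sub>R W.h 1)\<close> by simp
    also have "\<dots> = A"
      unfolding A_eq using image_image[of "\<lambda>t. t *\<^sub>R W.h 1" uminus "UNIV :: real set"] by (simp add: surj_uminus)
    finally show "Ad x ` A = A" .
  qed
  have coset: "gmult x ` group_centralizer so1n \<rho> A = ?F" if x: "x \<in> ?F" for x
  proof (intro equalityI subsetI)
    obtain a b where ab: "x = (a, b)" "(a, b) \<in> ?G" using x by (cases x) auto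
    obtain a' b' where ab': "(a', b') \<in> ?G" "a ** a' = mat 1" "a' ** a = mat 1" "b ** b' = mat 1" "b' ** b = mat 1"
      using inv[OF ab(2)] by blast
    fix y
    assume "y \<in> gmult x ` group_centralizer so1n \<rho> A"
    then obtain c d where cd: "(c, d) \<in> ?G" "\<forall>X\<in>A. Ad (c, d) X = X" "y = (a ** c, b ** d)"
      by (auto simp: gmult_def ab(1) group_centralizer_def)
    obtain c' d' where cd': "c ** c' = mat 1" "c' ** c = mat 1" using inv[OF cd(1)] by blast
    have "Ad y (W.h 1) = Ad x (Ad (c, d) (W.h 1))" unfolding cd(3) ab(1) by (rule Ad_mult[OF ab'(2,3) cd'])
    also have "\<dots> = - W.h 1" using cd(2) h1_A[of 1] x by simp
    finally show "y \<in> ?F" using lie_group_mult[OF ab(2) cd(1)] cd(3) by simp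
  next
    obtain a b where ab: "x = (a, b)" "(a, b) \<in> ?G" using x by (cases x) auto
    obtain a' b' where ab': "(a', b') \<in> ?G" "a ** a' = mat 1" "a' ** a = mat 1" "b ** b' = mat 1" "b' ** b = mat 1"
      using inv[OF ab(2)] by blast
    fix y assume y: "y \<in> ?F"
    obtain c d where cd: "y = (c, d)" "(c, d) \<in> ?G" using y by (cases y) auto
    obtain c' d' where cd': "c ** c' = mat 1" "c' ** c = mat 1" using inv[OF cd(2)] by blast
    have "a ** W.h 1 = - W.h 1 ** a" using x ab(1) Ad_eq_iff[OF ab'(2,3)] by blast
    then have "a' ** (- W.h 1 ** a) ** a' = a' ** (a ** W.h 1) ** a'" by simp
    moreover have "a' ** (- W.h 1 ** a) ** a' = a' ** (- W.h 1)"
      by (simp only: matrix_mul_assoc[symmetric] ab'(2) matrix_mul_rid)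
    moreover have "a' ** (a ** W.h 1) ** a' = W.h 1 ** a'"
      by (simp only: matrix_mul_assoc ab'(3) matrix_mul_lid)
    ultimately have "a' ** (- W.h 1) = W.h 1 ** a'" by simp
    then have e: "Ad (a', b') (- W.h 1) = W.h 1" using Ad_eq_iff[OF ab'(3,2)] by blast
    have "Ad (a' ** c, b' ** d) (W.h 1) = Ad (a', b') (Ad (c, d) (W.h 1))"
      by (rule Ad_mult[OF ab'(3,2) cd'])
    then have "Ad (a' ** c, b' ** d) (W.h 1) = W.h 1" using y cd(1) e by simp
    then have "(a' ** c, b' ** d) \<in> group_centralizer so1n \<rho> A"
      unfolding group_centralizer_def A_eq using lie_group_mult[OF ab'(1) cd(2)] by (auto simp: Ad_scaleR)
    moreover have "y = gmult x (a' ** c, b' ** d)"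
      using ab'(2,4) by (simp add: gmult_def ab(1) cd(1) matrix_mul_assoc)
    ultimately show "y \<in> gmult x ` group_centralizer so1n \<rho> A" by (rule image_eqI[rotated])
  qed
  obtain X \<alpha> \<beta> where X: "X \<in> so1n" "mexp X *v wv 1 = \<alpha> *s wv (-1)" "mexp X *v wv (-1) = \<beta> *s wv 1"
    using reflection_exists by blast
  define a where "a = mat 1 ** mexp X"
  define x0 where "x0 = (a, mat 1 ** mexp (\<rho> X))"
  have x0G: "x0 \<in> ?G" unfolding x0_def a_def by (intro lie_group.intros X(1))
  have orth: "bf (a *v x) (a *v y) = bf x y" for x y
    using lie_group_orthogonal[OF x0G[unfolded x0_def]] so1n_so by blast
  obtain a' where a': "a ** a' = mat 1" "a' ** a = mat 1" using inv[OF x0G[unfolded x0_def]] by blast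
  have av: "a *v wv 1 = \<alpha> *s wv (-1)" "a *v wv (-1) = \<beta> *s wv 1" using X by (simp_all add: a_def)
  have "bf (a *v wv 1) (a *v wv (-1)) = 1" unfolding orth using W.form[OF one_WI] by simp
  then have "\<alpha> * \<beta> = 1" using W.form[OF one_WI(2,1)] by (simp add: av bf_simps mult.commute)
  have "a ** W.h 1 = wedge (a *v wv 1) (a *v wv (-1)) ** a"
    unfolding W.h_def by (rule orthogonal_wedge[OF orth])
  also have "wedge (a *v wv 1) (a *v wv (-1)) = - W.h 1"
  proof -
    have ab: "\<alpha> * (\<beta> * z) = z" for z using \<open>\<alpha> * \<beta> = 1\<close> by (simp add: mult.assoc[symmetric])
    show ?thesis
      by (simp add: av W.h_def matrix_eq wedge_mult_vec mv_simps bf_simps) (simp add: vec_eq_iff algebra_simps ab)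
  qed
  finally have "Ad x0 (W.h 1) = - W.h 1" unfolding x0_def by (simp only: Ad_eq_iff[OF a'])
  then have x0F: "x0 \<in> ?F" using x0G by simp
  show ?thesis
    unfolding longest_element_def
  proof (rule the_equality)
    have "x0 \<in> group_normalizer so1n \<rho> A"
      unfolding group_normalizer_def using x0G FA[OF x0F] by simp
    then have "?F \<in> restricted_weyl_group so1n \<rho> A"
      unfolding restricted_weyl_group_def using coset[OF x0F] by (intro image_eqI[of _ _ x0]) simp_all
    then show "?F \<in> restricted_weyl_group so1n \<rho> A \<and> (\<forall>x\<in>?F. Ad x ` ?P = uminus ` ?P)"
      using Fimg by blast
  next
    fix w assume w: "w \<in> restricted_weyl_group so1n \<rho> A \<and> (\<forall>x\<in>w. Ad x ` ?P = uminus ` ?P)"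
    then obtain x where x: "x \<in> group_normalizer so1n \<rho> A" "w = gmult x ` group_centralizer so1n \<rho> A"
      unfolding restricted_weyl_group_def by blast
    have "matrix_inv (mat 1 :: complex^('n option)^('n option)) = mat 1" by (rule matrix_inv_eqI) simp_all
    then have "(mat 1, mat 1) \<in> group_centralizer so1n \<rho> A"
      by (simp add: group_centralizer_def Ad_def lie_group.one)
    then have "gmult x (mat 1, mat 1) \<in> w" unfolding x(2) by (rule imageI)
    then have "x \<in> w" by (simp add: gmult_def)
    then have img: "Ad x ` ?P = uminus ` ?P" using w by blast
    obtain a b where ab: "x = (a, b)" "(a, b) \<in> ?G" using x(1) by (cases x) (auto simp: group_normalizer_def)
    obtain a' where "a ** a' = mat 1" "a' ** a = mat 1" using inv[OF ab(2)] by blast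
    from flip_h1[OF this img[unfolded ab(1)]] have "x \<in> ?F" using ab by simp
    then show "w = ?F" using coset x(2) by simp
  qed
qed

end


section \<open>The action on the invariant vectors\<close>

lemma minus_one_power_eq_power_int:
  "even (l - int b) \<Longrightarrow> (-1) ^ b = ((-1) powi l :: complex)"
  by (cases "even b"; cases "even l") (auto simp: power_int_minus_left)

text \<open>For \<open>n = 3\<close> the coordinate \<open>\<lambda>\<^sub>2\<close> may be negative. Exchanging \<open>v\<^sub>2\<close> and \<open>v\<^sub>-\<^sub>2\<close> changes its sign and
  does not affect \<open>levi\<close>.\<close>

definition swap2 :: "int \<Rightarrow> int" where
  "swap2 k = (if \<bar>k\<bar> = 2 then - k else k)"

text \<open>In type D_2 the exchange interchanges the simple roots \<epsilon>_1 - \<epsilon>_2 and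
  \<epsilon>_1 + \<epsilon>_2, so \<open>v0\<close> remains a highest weight vector for the new
  basis.\<close>

lemma (in hw_rep) swap2_hw_rep:
  assumes r: "r = 2" "\<not> z"
  shows "hw_rep (\<lambda>k. v (swap2 k)) r z \<rho> v0 (L(2 := - L 2))"
proof -
  have swap: "swap2 k \<in> I \<longleftrightarrow> k \<in> I" "swap2 (- k) = - swap2 k" "swap2 (swap2 k) = k" for k
    by (auto simp: swap2_def I_def)
  have w: "witt (\<lambda>k. v (swap2 k)) r z"
  proof (unfold_locales, fold I_def)
    show "bf (v (swap2 k)) (v (swap2 m)) = (if k = - m then 1 else 0)" if "k \<in> I" "m \<in> I" for k m
    proof -
      have "swap2 k = - swap2 m \<longleftrightarrow> k = - m" by (metis swap(2,3))
      then show ?thesis using form[of "swap2 k" "swap2 m"] that by (simp add: swap)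
    qed
    show "x = (\<Sum>k\<in>I. bf (v (swap2 (- k))) x *s v (swap2 k))" for x
    proof -
      have "(\<Sum>k\<in>I. bf (v (swap2 (- k))) x *s v (swap2 k)) = (\<Sum>k\<in>I. bf (v (- k)) x *s v k)"
        by (rule sum.reindex_bij_witness[of _ swap2 swap2]) (simp_all add: swap)
      then show ?thesis using expansion[of x] by simp
    qed
  qed (rule rank)
  have I2: "k \<in> {-2, -1, 1, 2}" if "k \<in> I" for k
    using that r by (auto simp: I_def)
  show ?thesis
  proof (rule hw_rep.intro[OF w], unfold_locales, fold I_def)
    show "\<rho> (witt.h (\<lambda>k. v (swap2 k)) i) *v v0 = of_real ((L(2 := - L 2)) i) *s v0" if i: "1 \<le> i" "i \<le> r" for i
    proof (cases "i = 2")
      case True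
      have "witt.h (\<lambda>k. v (swap2 k)) 2 = - h 2"
        unfolding witt.h_def[OF w] h_def
        using wedge_anticommute[of "v 2" "v (-2)"] by (simp add: swap2_def wedge_anticommute[of "v (-2)"] cscale_def vec_eq_iff)
      moreover have "\<rho> (- h 2) = - \<rho> (h 2)" using rep_diff[of 0 "h 2"] by (simp add: so_closed h_so rep0)
      ultimately show ?thesis using hw[OF i] True by (simp add: mv_simps)
    next
      case False
      then have "i = 1" using i r by simp
      then have "witt.h (\<lambda>k. v (swap2 k)) i = h i" unfolding witt.h_def[OF w] h_def by (simp add: swap2_def)
      then show ?thesis using hw[OF i] False by simp
    qed
    show "\<rho> (wedge (v (swap2 k)) (v (swap2 m))) *v v0 = 0" if k: "k \<in> I" "m \<in> I" "ht k + ht m > 0" for k m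
    proof (cases "k = m")
      case True
      then show ?thesis by (simp add: rep0)
    next
      case False
      have hv: "ht 1 = 2" "ht 2 = 1" unfolding ht_def using r(1) by simp_all
      have "ht (swap2 k) + ht (swap2 m) > 0"
        using I2[OF k(1)] I2[OF k(2)] k(3) False by (auto simp: swap2_def hv)
      then show ?thesis using k(1,2) by (intro hw_raising) (simp_all add: swap)
    qed
  qed (rule irred, rule v0)
qed

text \<open>In every case the exponent b of the alternating factor differs from \<lambda>_1 by the
  even number 2 a, so \<open>(-1) ^ b\<close> is the claimed sign. In rank at least 2 the bound on
  \<lambda>_2 makes a nonnegative.\<close>

lemma (in hw_rep) invariant_sign:
  fixes l1 l2 :: int
  assumes l1: "L 1 = l1" and r1: "r = 1 \<Longrightarrow> l1 \<ge> 0"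
    and r2: "r \<ge> 2 \<Longrightarrow> L 2 = l2 \<and> even (l1 + l2) \<and> \<bar>l2\<bar> \<le> l1" "r \<ge> 2 \<Longrightarrow> l2 < 0 \<Longrightarrow> r = 2 \<and> \<not> z"
    and L0: "\<And>i. 3 \<le> i \<Longrightarrow> i \<le> r \<Longrightarrow> L i = 0"
  obtains u where "u \<in> invariants levi \<rho>" "u \<noteq> 0"
    "\<And>p q gR \<alpha> \<beta>. (p, q) \<in> lie_group gR \<rho> \<Longrightarrow> gR \<subseteq> g \<Longrightarrow> p *v v 1 = \<alpha> *s v (-1) \<Longrightarrow>
       p *v v (-1) = \<beta> *s v 1 \<Longrightarrow> \<alpha> * \<beta> = 1 \<Longrightarrow> q *v u = (-1) powi l1 *s u"
proof -
  consider "r = 1" | "r \<ge> 2" "l2 \<ge> 0" | "r \<ge> 2" "l2 < 0" using rank by fastforce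
  then show ?thesis
  proof cases
    case 1
    have T: "hw_tensor v r z \<rho> v0 L 0 (nat l1)"
      by (unfold_locales) (use l1 r1[OF 1] 1 in simp_all)
    have s: "(-1) ^ nat l1 = ((-1) powi l1 :: complex)"
      by (rule minus_one_power_eq_power_int) (use r1[OF 1] in simp)
    show ?thesis by (rule hw_tensor.invariant_exists[OF T, unfolded s], rule that)
  next
    case 2
    define a where "a = (l1 - l2) div 2"
    have a: "l1 = 2 * a + l2" "a \<ge> 0" using r2(1)[OF 2(1)] by (auto simp: a_def)
    have T: "hw_tensor v r z \<rho> v0 L (nat a) (nat l2)"
      by (unfold_locales) (use l1 a r2(1) L0 2 in simp_all)
    have s: "(-1) ^ nat l2 = ((-1) powi l1 :: complex)"
      by (rule minus_one_power_eq_power_int) (use 2 a in simp)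
    show ?thesis by (rule hw_tensor.invariant_exists[OF T, unfolded s], rule that)
  next
    case 3
    then have r: "r = 2" "\<not> z" using r2 by auto
    define a where "a = (l1 + l2) div 2"
    have a: "l1 = 2 * a - l2" "a \<ge> 0" using r2(1)[OF 3(1)] by (auto simp: a_def)
    note S = swap2_hw_rep[OF r]
    have T: "hw_tensor (\<lambda>k. v (swap2 k)) r z \<rho> v0 (L(2 := - L 2)) (nat a) (nat (- l2))"
      by (rule hw_tensor.intro[OF S], unfold_locales) (use l1 a r2(1) L0 3 in simp_all)
    have s: "(-1) ^ nat (- l2) = ((-1) powi l1 :: complex)"
      by (rule minus_one_power_eq_power_int) (use 3 a in simp)
    have lv: "witt.levi (\<lambda>k. v (swap2 k)) = levi"
      unfolding witt.levi_def[OF hw_rep.axioms(1)[OF S]] levi_def by (simp add: swap2_def)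
    have sw: "swap2 1 = 1" "swap2 (-1) = -1" by (simp_all add: swap2_def)
    show ?thesis by (rule hw_tensor.invariant_exists[OF T, unfolded s lv sw], rule that)
  qed
qed

section \<open>The condition on the weight and dominance in coordinates\<close>

context so1n_cartan
begin

lemma coords_unique:
  assumes "(\<Sum>i\<in>{1..rk}. x i *\<^sub>R \<epsilon> i) = (\<Sum>i\<in>{1..rk}. y i *\<^sub>R \<epsilon> i)" "i \<in> {1..rk}"
  shows "x i = y i"
proof -
  have j: "1 \<le> int i" "int i \<le> int rk" using assms(2) by auto
  have "complex_of_real (x i) = of_real (y i)"
    using kil_weight_h[OF refl j, of x] kil_weight_h[OF refl j, of y] assms(1) by simp
  then show ?thesis by simp
qed

lemma two_coords:
  assumes "rk \<ge> 2"
  shows "(\<Sum>i\<in>{1..rk}. (if i = 1 then a else if i = 2 then b else 0) *\<^sub>R \<epsilon> i) = a *\<^sub>R \<epsilon> 1 + b *\<^sub>R \<epsilon> 2"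
proof -
  have "(\<Sum>i\<in>{1..rk}. (if i = 1 then a else if i = 2 then b else 0) *\<^sub>R \<epsilon> i) =
      (\<Sum>i\<in>{1,2}. (if i = 1 then a else if i = 2 then b else 0) *\<^sub>R \<epsilon> i)"
    using assms by (intro sum.mono_neutral_right) auto
  then show ?thesis by simp
qed

lemma star_coords:
  assumes lam: "lam = (\<Sum>i\<in>{1..rk}. x i *\<^sub>R \<epsilon> i)"
  shows "star_condition n \<epsilon> lam l1 l2 \<longleftrightarrow>
    x 1 = l1 \<and> (rk \<ge> 2 \<longrightarrow> x 2 = l2 \<and> even (l1 + l2)) \<and> (\<forall>i. 3 \<le> i \<longrightarrow> i \<le> rk \<longrightarrow> x i = 0)"
proof (cases "rk \<ge> 2")
  case True
  then have n3: "n \<ge> 3" by (simp add: rk_def)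
  have "lam = of_int l1 *\<^sub>R \<epsilon> 1 + of_int l2 *\<^sub>R \<epsilon> 2 \<longleftrightarrow> x 1 = l1 \<and> x 2 = l2 \<and> (\<forall>i. 3 \<le> i \<longrightarrow> i \<le> rk \<longrightarrow> x i = 0)"
  proof
    assume "lam = of_int l1 *\<^sub>R \<epsilon> 1 + of_int l2 *\<^sub>R \<epsilon> 2"
    then have e: "i \<in> {1..rk} \<Longrightarrow> x i = (if i = 1 then of_int l1 else if i = 2 then of_int l2 else 0)" for i
      using coords_unique[of x "\<lambda>i. if i = 1 then of_int l1 else if i = 2 then of_int l2 else 0" i] lam
      unfolding two_coords[OF True] by simp
    show "x 1 = l1 \<and> x 2 = l2 \<and> (\<forall>i. 3 \<le> i \<longrightarrow> i \<le> rk \<longrightarrow> x i = 0)"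
      using e[of 1] e[of 2] e True by auto
  next
    assume r: "x 1 = l1 \<and> x 2 = l2 \<and> (\<forall>i. 3 \<le> i \<longrightarrow> i \<le> rk \<longrightarrow> x i = 0)"
    have "lam = (\<Sum>i\<in>{1..rk}. (if i = 1 then of_int l1 else if i = 2 then of_int l2 else 0) *\<^sub>R \<epsilon> i)"
      unfolding lam
    proof (rule sum.cong[OF refl])
      fix i assume "i \<in> {1..rk}"
      then have "i = 1 \<or> i = 2 \<or> 3 \<le> i \<and> i \<le> rk" by auto
      then show "x i *\<^sub>R \<epsilon> i = (if i = 1 then of_int l1 else if i = 2 then of_int l2 else 0) *\<^sub>R \<epsilon> i"
        using r by auto
    qed
    then show "lam = of_int l1 *\<^sub>R \<epsilon> 1 + of_int l2 *\<^sub>R \<epsilon> 2" unfolding two_coords[OF True] .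
  qed
  then show ?thesis using n3 True by (auto simp: star_condition_def cong_0_iff)
next
  case False
  then have rk: "rk = 1" using rk_pos by simp
  then have n3: "\<not> n \<ge> 3" by (simp add: rk_def)
  have "lam = x 1 *\<^sub>R \<epsilon> 1" unfolding lam rk by simp
  then have "lam = of_int l1 *\<^sub>R \<epsilon> 1 \<longleftrightarrow> x 1 = l1" using eps_independent(1)[of 1 1] rk by simp
  then show ?thesis using n3 rk by (auto simp: star_condition_def)
qed

lemma dominant_coords:
  assumes lam: "lam = (\<Sum>i\<in>{1..rk}. x i *\<^sub>R \<epsilon> i)" and dom: "lam \<in> dominant_chamber gC H es"
  shows "i \<in> {1..<rk} \<Longrightarrow> x (i + 1) \<le> x i" "even n \<Longrightarrow> x rk \<ge> 0" "odd n \<Longrightarrow> x (rk - 1) + x rk \<ge> 0"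
proof -
  have H: "lam \<in> H" using dom real_cartan_H by (auto simp: dominant_chamber_def)
  have c: "2 * (real n - 1) > 0" using card by simp
  have k: "kil (\<epsilon> i) lam = of_real (x i / (2 * (real n - 1)))" if i: "i \<in> {1..rk}" for i
  proof -
    have j: "1 \<le> int i" "int i \<le> int rk" using i by auto
    show ?thesis
      using kil_h[OF H j] kil_weight_h[OF lam j] n_minus_1 by (simp add: field_simps)
  qed
  have d: "Re (kil a lam) \<ge> 0" if "a \<in> simple_roots gC H es" for a
    using dom that by (simp add: dominant_chamber_def)
  show "x (i + 1) \<le> x i" if i: "i \<in> {1..<rk}"
  proof -
    have ii: "i \<in> {1..rk}" "i + 1 \<in> {1..rk}" using i by auto
    have "\<epsilon> i - \<epsilon> (i + 1) \<in> simple_roots gC H es" unfolding bourbaki_facts(5) using i by blast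
    from d[OF this] have "x i / (2 * (real n - 1)) - x (i + 1) / (2 * (real n - 1)) \<ge> 0"
      using k[OF ii(1)] k[OF ii(2)] eps_H[OF ii(1)] eps_H[OF ii(2)] H by (simp add: kil_simps)
    then have "(x i - x (i + 1)) / (2 * (real n - 1)) \<ge> 0" by (simp add: diff_divide_distrib)
    then show ?thesis using c by (simp add: zero_le_divide_iff)
  qed
  show "x rk \<ge> 0" if "even n"
  proof -
    have "rk \<in> {1..rk}" using rk_pos by simp
    moreover have "\<epsilon> rk \<in> simple_roots gC H es" unfolding bourbaki_facts(5) using that by simp
    ultimately have "x rk / (2 * (real n - 1)) \<ge> 0" using d[of "\<epsilon> rk"] k[of rk] by simp
    then show ?thesis using c by (simp add: zero_le_divide_iff)
  qed
  show "x (rk - 1) + x rk \<ge> 0" if odd: "odd n"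
  proof -
    have ii: "rk - 1 \<in> {1..rk}" "rk \<in> {1..rk}" using rk_odd[OF odd] by auto
    have "\<epsilon> (rk - 1) + \<epsilon> rk \<in> simple_roots gC H es" unfolding bourbaki_facts(5) using odd by simp
    from d[OF this] have "x (rk - 1) / (2 * (real n - 1)) + x rk / (2 * (real n - 1)) \<ge> 0"
      using k[OF ii(1)] k[OF ii(2)] eps_H[OF ii(1)] eps_H[OF ii(2)] H by (simp add: kil_simps)
    then have "(x (rk - 1) + x rk) / (2 * (real n - 1)) \<ge> 0" by (simp add: add_divide_distrib)
    then show ?thesis using c by (simp add: zero_le_divide_iff)
  qed
qed

end

lemma (in so1n_full) levi_invariants:
  assumes dom: "lam \<in> dominant_chamber gC H es"
    and irr: "irreducible_representation gC \<rho>" and hw: "has_highest_weight gC H es \<rho> lam"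
  shows "u \<in> invariants W.levi \<rho> \<Longrightarrow> u' \<in> invariants W.levi \<rho> \<Longrightarrow> u \<noteq> 0 \<Longrightarrow> \<exists>c. u' = c *s u"
    and "u \<in> invariants W.levi \<rho> \<Longrightarrow> u \<noteq> 0 \<Longrightarrow> \<exists>l1 l2. star_condition n \<epsilon> lam l1 l2"
    and "star_condition n \<epsilon> lam l1 l2 \<Longrightarrow> \<exists>u\<in>invariants W.levi \<rho>. u \<noteq> 0 \<and>
      (\<forall>x\<in>longest_element so1n \<rho> A (dominant_chamber gC H es \<inter> A). snd x *v u = (-1) powi l1 *s u)"
proof -
  have "lam \<in> real_cartan gC H" using dom by (simp add: dominant_chamber_def)
  then obtain x where lam: "lam = (\<Sum>i\<in>{1..rk}. x i *\<^sub>R \<epsilon> i)" using real_cartan_expand by blast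
  have rep: "representation_of gC \<rho>" using irr by (simp add: irreducible_representation_def)
  define L where "L i = x (nat i)" for i
  from highest_weight_vector[OF hw rep lam] obtain v0 where v0: "v0 \<noteq> 0" "\<forall>i. 1 \<le> i \<longrightarrow> i \<le> int rk \<longrightarrow> \<rho> (W.h i) *v v0 = of_real (x (nat i)) *s v0"
    "\<forall>k\<in>WI. \<forall>m\<in>WI. W.ht k + W.ht m > 0 \<longrightarrow> \<rho> (wedge (wv k) (wv m)) *v v0 = 0"
    by (elim exE conjE) (rule that)
  interpret R: hw_rep wv "int rk" "even n" WI \<rho> v0 L
  proof (unfold_locales)
    show "\<rho> (W.h i) *v v0 = of_real (L i) *s v0" if "1 \<le> i" "i \<le> int rk" for i
      using v0(2) that unfolding L_def by simp
    show "\<rho> (wedge (wv k) (wv m)) *v v0 = 0" if "k \<in> WI" "m \<in> WI" "W.ht k + W.ht m > 0" for k m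
      by (rule v0(3)[rule_format, OF that])
  qed (rule irr, rule v0(1))
  show "u \<in> invariants W.levi \<rho> \<Longrightarrow> u' \<in> invariants W.levi \<rho> \<Longrightarrow> u \<noteq> 0 \<Longrightarrow> \<exists>c. u' = c *s u"
    by (rule R.invariants_unique)
  note star = star_coords[OF lam]
  show "\<exists>l1 l2. star_condition n \<epsilon> lam l1 l2" if u: "u \<in> invariants W.levi \<rho>" "u \<noteq> 0"
  proof -
    have z: "x i = 0" if "3 \<le> i" "i \<le> rk" for i
      using R.invariants_weight(3)[OF u, of "int i"] that by (simp add: L_def)
    show ?thesis
    proof (cases "rk \<ge> 2")
      case True
      then have "int rk \<ge> 2" by simp
      from R.invariants_weight(2)[OF u this] obtain i j :: nat where "L 1 + L 2 = 2 * real i" "L 1 - L 2 = 2 * real j" by blast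
      then have "x 1 = of_int (int i + int j)" "x 2 = of_int (int i - int j)" by (simp_all add: L_def)
      moreover have "even ((int i + int j) + (int i - int j))" by simp
      ultimately have "star_condition n \<epsilon> lam (int i + int j) (int i - int j)" unfolding star using z by blast
      then show ?thesis by blast
    next
      case False
      then have "int rk = 1" using rk_pos by simp
      from R.invariants_weight(1)[OF u this] obtain k :: nat where "L 1 = k" by blast
      then have "star_condition n \<epsilon> lam (int k) 0" unfolding star using z False by (simp add: L_def)
      then show ?thesis by blast
    qed
  qed
  assume "star_condition n \<epsilon> lam l1 l2"
  note s = this[unfolded star]
  note dc = dominant_coords[OF lam dom]
  have r1: "l1 \<ge> 0" if "int rk = 1"
  proof -
    have "rk = 1" "even n" using that rank_cases by auto
    then show ?thesis using dc(2) s by simp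
  qed
  have r2: "\<bar>l2\<bar> \<le> l1" and r3: "l2 < 0 \<Longrightarrow> int rk = 2 \<and> odd n" if rk2: "int rk \<ge> 2"
  proof -
    have x12: "x 1 = l1" "x 2 = l2" using s rk2 by auto
    have le: "l2 \<le> l1" using dc(1)[of 1] rk2 x12 by (simp add: numeral_2_eq_2)
    \<comment> \<open>In rank at least 3 dominance gives \<open>x 2 \<ge> x 3 = 0\<close>. Only in
      type D_2 may \<open>x 2\<close> be negative, and there the last simple root bounds it from
      below.\<close>
    have "l2 \<ge> 0 \<or> (int rk = 2 \<and> odd n \<and> l1 + l2 \<ge> 0)"
    proof (cases "rk = 2")
      case True
      show ?thesis
      proof (cases "even n")
        case True
        then show ?thesis using dc(2) \<open>rk = 2\<close> x12 by simp
      next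
        case False
        have "x (2 - 1) + x 2 \<ge> 0" using dc(3)[OF False] unfolding True .
        then have "real_of_int (l1 + l2) \<ge> 0" using x12 by simp
        then show ?thesis using True False by (simp only: of_int_0_le_iff) simp
      qed
    next
      case False
      then have "x 3 = 0" "x 3 \<le> x 2" using s dc(1)[of 2] rk2 by auto
      then show ?thesis using x12 by simp
    qed
    then show "\<bar>l2\<bar> \<le> l1" "l2 < 0 \<Longrightarrow> int rk = 2 \<and> odd n" using le by auto
  qed
  obtain u where u: "u \<in> invariants W.levi \<rho>" "u \<noteq> 0"
    "\<And>p q gR \<alpha> \<beta>. (p, q) \<in> lie_group gR \<rho> \<Longrightarrow> gR \<subseteq> gC \<Longrightarrow> p *v wv 1 = \<alpha> *s wv (-1) \<Longrightarrow>
       p *v wv (-1) = \<beta> *s wv 1 \<Longrightarrow> \<alpha> * \<beta> = 1 \<Longrightarrow> q *v u = (-1) powi l1 *s u"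
  proof (rule R.invariant_sign[of l1 l2])
    show "L 1 = l1" using s by (simp add: L_def)
    show "L 2 = l2 \<and> even (l1 + l2) \<and> \<bar>l2\<bar> \<le> l1" if "2 \<le> int rk" using s that r2 by (simp add: L_def)
    show "L i = 0" if "3 \<le> i" "i \<le> int rk" for i
    proof -
      have "3 \<le> nat i" "nat i \<le> rk" using that by linarith+
      then show ?thesis using s unfolding L_def by blast
    qed
  qed (use r1 r3 in blast)+
  have neg: "\<rho> (- X) = - \<rho> X" if "X \<in> so1n" for X
    using R.rep_diff[of 0 X] so1n_so[OF that] by (simp add: so_closed R.rep0)
  have "snd y *v u = (-1) powi l1 *s u"
    if y: "y \<in> longest_element so1n \<rho> A (dominant_chamber gC H es \<inter> A)" for y
  proof -
    have "y \<in> {x \<in> lie_group so1n \<rho>. Ad x (W.h 1) = - W.h 1}" using y longest_element_eq[of \<rho>, OF neg] by simp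
    then obtain p q where pq: "y = (p, q)" "(p, q) \<in> lie_group so1n \<rho>" "Ad (p, q) (W.h 1) = - W.h 1" by (cases y) auto
    have sub: "so1n \<subseteq> gC" using so1n_so by blast
    obtain p' where "p ** p' = mat 1" "p' ** p = mat 1"
      using lie_group_inverse[OF pq(2) _ neg] subspace_neg[OF so1n_subspace] by blast
    then have e: "p ** W.h 1 = - W.h 1 ** p" using Ad_eq_iff pq(3) by blast
    obtain \<alpha> \<beta> where "p *v wv 1 = \<alpha> *s wv (-1)" "p *v wv (-1) = \<beta> *s wv 1" "\<alpha> * \<beta> = 1"
      by (rule flip_swaps[OF lie_group_orthogonal[OF pq(2) sub] e])
    from u(3)[OF pq(2) sub this] show ?thesis by (simp add: pq(1))
  qed
  then show "\<exists>u\<in>invariants W.levi \<rho>. u \<noteq> 0 \<and>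
      (\<forall>x\<in>longest_element so1n \<rho> A (dominant_chamber gC H es \<inter> A). snd x *v u = (-1) powi l1 *s u)"
    using u(1,2) by blast
qed

theorem theorem2p1:
  fixes n :: nat
    and A H :: "(complex^('n::finite option)^('n option)) set"
    and es :: "(complex^('n option)^('n option)) list"
    and \<epsilon> :: "nat \<Rightarrow> complex^('n option)^('n option)"
    and lam :: "complex^('n option)^('n option)"
    and \<rho> :: "complex^('n option)^('n option) \<Rightarrow> complex^('d::finite)^'d"
  defines "g \<equiv> so1n_complex :: (complex^('n option)^('n option)) set"
    and "gR \<equiv> so1n :: (complex^('n option)^('n option)) set"
  defines "l \<equiv> centralizer_in g (cmat.span A)"
    and "Aplus \<equiv> dominant_chamber g H es \<inter> A"
  assumes "n = CARD('n)" and "n \<ge> 2"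
    and "cartan_subspace gR A"
    and "cartan_subalgebra g H" and "cmat.span A \<subseteq> H"
    and "lex_order_first g H A es"
    and "bourbaki_basis H es \<epsilon>"
    and "lam \<in> weight_lattice g H \<inter> dominant_chamber g H es"
    and "irreducible_representation g \<rho>" and "has_highest_weight g H es \<rho> lam"
  shows "(invariants l \<rho> \<noteq> {0} \<longleftrightarrow> (\<exists>l1 l2. star_condition n \<epsilon> lam l1 l2)) \<and>
    ((\<exists>l1 l2. star_condition n \<epsilon> lam l1 l2) \<longrightarrow> vec.dim (invariants l \<rho>) = 1) \<and>
    (\<forall>l1 l2. star_condition n \<epsilon> lam l1 l2 \<longrightarrow>
       (\<forall>x\<in>longest_element gR \<rho> A Aplus. \<forall>v\<in>invariants l \<rho>. snd x *v v = (-1) powi l1 *s v))"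
proof -
  interpret F: so1n_full n H es \<epsilon> A
    by unfold_locales (use assms in \<open>simp_all add: lex_order_first_def g_def gR_def\<close>)
  have l: "l = F.W.levi" unfolding l_def g_def by (rule F.centralizer_levi)
  have dom: "lam \<in> dominant_chamber so1n_complex H es" using assms(12) by (simp add: g_def)
  note main = F.levi_invariants[OF dom assms(13,14)[unfolded g_def], folded l]
  have l0: "0 \<in> invariants l \<rho>" by (simp add: invariants_def)
  have span: "invariants l \<rho> = vec.span {u}" if u: "u \<in> invariants l \<rho>" "u \<noteq> 0" for u
  proof (intro equalityI subsetI)
    fix y assume "y \<in> invariants l \<rho>"
    then obtain c where "y = c *s u" using main(1)[OF u(1) _ u(2)] by blast
    then show "y \<in> vec.span {u}" by (simp add: vec.span_base vec.span_scale)
  next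
    fix y assume "y \<in> vec.span {u}"
    then obtain c where "y = c *s u" by (auto simp: vec.span_singleton)
    then show "y \<in> invariants l \<rho>" using u(1) by (simp add: invariants_def vector_scalar_commute)
  qed
  show ?thesis
  proof (intro conjI impI iffI allI ballI)
    assume "invariants l \<rho> \<noteq> {0}"
    then obtain u where "u \<in> invariants l \<rho>" "u \<noteq> 0" using l0 by blast
    then show "\<exists>l1 l2. star_condition n \<epsilon> lam l1 l2" by (rule main(2))
  next
    assume "\<exists>l1 l2. star_condition n \<epsilon> lam l1 l2"
    then show "invariants l \<rho> \<noteq> {0}" using main(3) by blast
  next
    assume "\<exists>l1 l2. star_condition n \<epsilon> lam l1 l2"
    then obtain u where "u \<in> invariants l \<rho>" "u \<noteq> 0" using main(3) by blast
    then show "vec.dim (invariants l \<rho>) = 1"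
      unfolding span[OF \<open>u \<in> invariants l \<rho>\<close> \<open>u \<noteq> 0\<close>] by (simp add: vec.dim_span)
  next
    fix l1 l2 x y
    assume s: "star_condition n \<epsilon> lam l1 l2" and x: "x \<in> longest_element gR \<rho> A Aplus" and y: "y \<in> invariants l \<rho>"
    obtain u where u: "u \<in> invariants l \<rho>" "u \<noteq> 0" "snd x *v u = (-1) powi l1 *s u"
      using main(3)[OF s] x unfolding gR_def Aplus_def g_def by blast
    obtain c where "y = c *s u" using main(1)[OF u(1) y u(2)] by blast
    then show "snd x *v y = (-1) powi l1 *s y" using u(3) by (simp add: vector_scalar_commute mult.commute)
  qed
qed

end
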